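(* Let $\theta=(\psi,\lambda)$, $\psi\in\mathbb{R}$, $\lambda\in\mathbb{R}^{p-1}$, be an orthogonal parametrization of the model. Let $\zeta>4$ be an integer, let $c_3,c_4\le 1$ and $0\le c_\infty\le1/2$ be constants, let $p=O(n^\alpha)$ with $\alpha<1/2-1/(2\zeta-2)$, and put $$e_{n,p}=\max\left\{\frac{p^2\log(n)^2}{n},\ \frac{p^{\zeta-1}\log(n)^{\zeta/2}}{n^{(\zeta-2)/2}},\ \frac{p\log(n)^{1/2}}{n^{3/2-c_3}}\right\}.$$ Suppose that: (a) the sequence of functions $\theta\mapsto g_n(\theta)$ on $\mathbb{R}^p$ satisfies the Laplace conditions (defined in the context) with constants $c_3,c_4,c_\infty,\zeta$ and rate $e_{n,p}$; (b) for every sequence $\psi=\psi_n$ with $|\psi-\hat\psi|=O(\log(n)^{1/2}/n^{1/2})$, the sequence of functions $\lambda\mapsto g_n(\psi,\lambda)$ on $\mathbb{R}^{p-1}$ satisfies the Laplace conditions with constants $c_3,c_4,c_\infty,\zeta$ and rate $e_{n,p}$; (c) with $\theta_0$ the data-generating parameter, $\|\hat\theta_n-\theta_0\|_2=O\{(p/n)^{1/2}\}$, and $\|\hat\theta_n-\hat\theta_\psi\|_2=O\{(p/n)^{1/2}\}$ for all $\psi$ with $|\psi-\hat\psi|=O(\log(n)^{1/2}/n^{1/2})$; furthermore $g^{(2)}_{\psi\lambda}(\theta_0)=O(n^{1/2})$ uniformly over the components of $\lambda$. Then, for all $\psi$ with $|\psi-\hat\psi|= O(\log(n)^{1/2}/n^{1/2})$,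 $$\frac{f(\psi|X_n)}{\hat f(\psi|X_n)}=1+O(e_{n,p}).$$
   Context: The asymptotics are as $n\to\infty$ with the dimension $p=p_n$ growing with $n$; $\gamma_n^2=p\log(n)/n$. The data $X_n$ are subsequences of a fixed infinite sequence of realizations. With prior $\pi$ and log-likelihood $l_n$, $g_n(\theta)=g_n(\theta;X_n)=\log\pi(\theta)+l_n(\theta;X_n)$ on $\mathbb{R}^p$; $\theta=(\psi,\lambda)$ with $\psi$ the scalar parameter of interest and $\lambda$ the nuisance parameter. $\hat\theta_n=(\hat\psi,\hat\lambda)$ is the maximizer of $g_n$; $\hat\lambda_\psi$ is the maximizer of $\lambda\mapsto g_n(\psi,\lambda)$ and $\hat\theta_\psi=(\psi,\hat\lambda_\psi)$. The parametrization is orthogonal: the expected information satisfies $\mathbb{E}[-\partial^2 l_n(\psi,\lambda)/\partial\psi\,\partial\lambda]=0$, and the prior for $\psi$ is independent of the prior for $\lambda$ (so that $\mathbb{E}[g^{(2)}_{\psi\lambda}(\theta)]=0$). The marginal posterior density of $\psi$ and its Laplace approximation are $$f(\psi|X_n)=\frac{\int_{\mathbb{R}^{p-1}}\exp\{g_n(\psi,\lambda)\}d\lambda}{\int_{\mathbb{R}^p}\exp\{g_n(\theta)\}d\theta},\qquad \hat f(\psi|X_n)=\frac{\det\{-g^{(2)}_n(\hat\theta_n)\}^{1/2}}{(2\pi)^{1/2}\det\{-g^{(2)}_{\lambda\lambda}(\hat\theta_\psi)\}^{1/2}}\exp\{g_n(\psi,\hat\lambda_\psi)-g_n(\hat\psi,\hat\lambda)\},$$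 where $g^{(2)}_{\lambda\lambda}$ is the block of the Hessian of $g_n$ for the nuisance parameters and $g^{(2)}_{\psi\lambda}$ is the vector of mixed second derivatives. Laplace conditions. A sequence of functions $h_n:\mathbb{R}^{q}\to\mathbb{R}$ ($q=q_n\in\{p,p-1\}$) with maximizer $\hat z_n$ satisfies the Laplace conditions with constants $c_3,c_4,c_\infty,\zeta$ and rate $e_{n,p}$ if there are constants $\delta,\eta_1,\eta_2>0$, $\eta_3,\dots,\eta_6\in\mathbb{R}$ and $B_k,C_k\in\mathbb{R}$, not depending on $n,p$, such that: (1) $e_{n,p}\to0$ and $(2\pi)^{-q/2}\det\{-h_n^{(2)}(\hat z_n)\}^{1/2}\int_{B^C_{\hat z_n}(\delta)}\exp\{h_n(z)-h_n(\hat z_n)\}dz=O(e_{n,p})$; (2) $0<\eta_1n\le\lambda_q[-h_n^{(2)}(z)]\le\lambda_1[-h_n^{(2)}(z)]\le\eta_2n$ for all $z\in B_{\hat z_n}(\delta)$, and $\|\{-h_n^{(2)}(\hat z_n)\}^{-1/2}\|_\infty=O(p^{c_\infty}n^{-1/2})$; (3) $\eta_3n^{c_3}\le\lambda_q[h^{(3)}_{\cdot\cdot l}(\hat z_n)]\le\lambda_1[h^{(3)}_{\cdot\cdot l}(\hat z_n)]\le\eta_4n^{c_3}$ for all $l=1,\dots,q$; (4) $\eta_5n^{c_4}\le\lambda_q[h^{(4)}_{\cdot\cdot lm}(z)]\le\lambda_1[h^{(4)}_{\cdot\cdot lm}(z)]\le\eta_6n^{c_4}$ for all $z\in B_{\hat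 z_n}(2^{1/2}\gamma_n)$ and all $l,m=1,\dots,q$; (5) for every integer $k$ with $4<k\le\zeta$, $B_kn\le\lambda_q[h^{(k)}_{\cdot\cdot j_1\cdots j_{k-2}}(z)]\le\lambda_1[h^{(k)}_{\cdot\cdot j_1\cdots j_{k-2}}(z)]\le C_kn$ for all $z\in B_{\hat z_n}(2^{1/2}\gamma_n)$ and $j_1,\dots,j_{k-2}\in\{1,\dots,q\}$. Here $h^{(k)}_{\cdot\cdot j_1\cdots j_{k-2}}$ is the $q\times q$ matrix whose $(a,b)$ entry is the $k$-th order partial derivative of $h_n$ in coordinates $a,b,j_1,\dots,j_{k-2}$ (existence of these derivatives is part of the conditions). Notation: $B_x(r)$ is the Euclidean ball with center $x$ and radius $r$, $S^C$ the complement of $S$; $\lambda_1(A)\ge\dots\ge\lambda_q(A)$ are the ordered eigenvalues of a real symmetric $q\times q$ matrix; $\|A\|_\infty=\max_j\sum_k|a_{jk}|$. A vector is $O(a_n)$ if its entries are $O(a_n)$ uniformly. *)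

theory Defs
  imports
    "HOL-Probability.Probability"
    "HOL-Library.Landau_Symbols"
    "Jordan_Normal_Form.Spectral_Radius"
begin

text \<open>The dimension depends on the sample size, so a point of \<open>q\<close>-dimensional Euclidean space is an
  extensional function on \<open>{..<q}\<close>, and \<open>leb q\<close> is Lebesgue measure there.
  Coordinate \<open>0\<close> of a full parameter is the interest parameter:
  \<open>\<psi>\<close> and a nuisance vector \<open>l\<close> form the parameter \<open>case_nat \<psi> l\<close>, that is, \<open>\<psi>, l 0, l 1, \<dots>\<close>;
  it is extensional on \<open>{..<q}\<close> exactly when \<open>l\<close> is extensional on \<open>{..<q - 1}\<close>
  (for positive \<open>q\<close>).\<close>

type_synonym point = "nat \<Rightarrow> real"

definition Rn :: "nat \<Rightarrow> point set" where
  "Rn q = {..<q} \<rightarrow>\<^sub>E UNIV"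

definition leb :: "nat \<Rightarrow> point measure" where
  "leb q = (\<Pi>\<^sub>M i\<in>{..<q}. lborel)"

definition edist :: "nat \<Rightarrow> point \<Rightarrow> point \<Rightarrow> real" where
  "edist q x y = L2_set (\<lambda>i. x i - y i) {..<q}"

definition eball :: "nat \<Rightarrow> point \<Rightarrow> real \<Rightarrow> point set" where
  "eball q x r = {z \<in> Rn q. edist q x z < r}"

definition partial :: "nat \<Rightarrow> (point \<Rightarrow> real) \<Rightarrow> point \<Rightarrow> real" where
  "partial a h z = deriv (\<lambda>t. h (z(a := t))) (z a)"

definition partials :: "nat list \<Rightarrow> (point \<Rightarrow> real) \<Rightarrow> point \<Rightarrow> real" where
  "partials js h = foldr partial js h"

definition differentiable_pt :: "nat \<Rightarrow> (point \<Rightarrow> real) \<Rightarrow> point \<Rightarrow> bool" where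
  "differentiable_pt q h z \<longleftrightarrow>
     (\<exists>D :: nat \<Rightarrow> real. \<forall>\<epsilon>>0. \<exists>r>0. \<forall>w\<in>eball q z r.
        \<bar>h w - h z - (\<Sum>i<q. D i * (w i - z i))\<bar> \<le> \<epsilon> * edist q z w)"

text \<open>\<open>k\<close>-fold (total) differentiability on a set that is open in \<open>Rn q\<close>: every partial derivative
  of order less than \<open>k\<close> is totally differentiable. All partial derivatives up to order \<open>k\<close> then
  exist and do not depend on the order of differentiation, so that the matrices
  \<open>deriv_mat\<close> below are symmetric.\<close>

definition times_differentiable_on :: "nat \<Rightarrow> nat \<Rightarrow> (point \<Rightarrow> real) \<Rightarrow> point set \<Rightarrow> bool" where
  "times_differentiable_on k q h S \<longleftrightarrow>
     (\<forall>js. set js \<subseteq> {..<q} \<and> length js < k \<longrightarrow> (\<forall>z\<in>S. differentiable_pt q (partials js h) z))"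

text \<open>The matrix with entries \<open>h\<^bsub>a b j\<^sub>1 \<dots> j\<^sub>m\<^esub>\<close>; for the empty index list this is the Hessian.\<close>

definition deriv_mat :: "nat \<Rightarrow> (point \<Rightarrow> real) \<Rightarrow> nat list \<Rightarrow> point \<Rightarrow> real mat" where
  "deriv_mat q h js z = mat q q (\<lambda>(a, b). partials (a # b # js) h z)"

abbreviation hessian :: "nat \<Rightarrow> (point \<Rightarrow> real) \<Rightarrow> point \<Rightarrow> real mat" where
  "hessian q h z \<equiv> deriv_mat q h [] z"

text \<open>The extreme eigenvalues of a symmetric matrix of positive dimension.\<close>

definition max_eig :: "real mat \<Rightarrow> real" where
  "max_eig A = Max (spectrum A)"

definition min_eig :: "real mat \<Rightarrow> real" where
  "min_eig A = Min (spectrum A)"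

definition eigs_within :: "real \<Rightarrow> real mat \<Rightarrow> real \<Rightarrow> bool" where
  "eigs_within lo A hi \<longleftrightarrow> lo \<le> min_eig A \<and> min_eig A \<le> max_eig A \<and> max_eig A \<le> hi"

definition mat_inf_norm :: "real mat \<Rightarrow> real" where
  "mat_inf_norm A = Max ((\<lambda>j. \<Sum>k<dim_col A. \<bar>A $$ (j, k)\<bar>) ` {..<dim_row A})"

text \<open>For symmetric positive definite \<open>A\<close>: the symmetric positive definite square root of the inverse
  of \<open>A\<close>.\<close>

definition inv_sqrt_mat :: "real mat \<Rightarrow> real mat" where
  "inv_sqrt_mat A = (THE S. S \<in> carrier_mat (dim_row A) (dim_row A) \<and> transpose_mat S = S \<and>
      (\<forall>e\<in>spectrum S. 0 < e) \<and> inverts_mat A (S * S))"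

definition gamma_rate :: "nat \<Rightarrow> nat \<Rightarrow> real" where
  "gamma_rate p n = sqrt (real p * ln (real n) / real n)"

definition laplace_conditions ::
  "(nat \<Rightarrow> nat) \<Rightarrow> (nat \<Rightarrow> nat) \<Rightarrow> (nat \<Rightarrow> point \<Rightarrow> real) \<Rightarrow> (nat \<Rightarrow> point) \<Rightarrow>
   real \<Rightarrow> real \<Rightarrow> real \<Rightarrow> nat \<Rightarrow> (nat \<Rightarrow> real) \<Rightarrow> bool" where
  "laplace_conditions p q h zhat c3 c4 cinf \<zeta> e \<longleftrightarrow>
    (\<forall>\<^sub>F n in sequentially. is_arg_max (h n) (\<lambda>z. z \<in> Rn (q n)) (zhat n)) \<and>
    (\<exists>\<delta> \<eta>1 \<eta>2 \<eta>3 \<eta>4 \<eta>5 \<eta>6 :: real. \<exists>B C :: nat \<Rightarrow> real. 0 < \<delta> \<and> 0 < \<eta>1 \<and> 0 < \<eta>2 \<and>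
      e \<longlonglongrightarrow> 0 \<and>
      (\<forall>\<^sub>F n in sequentially.
         set_integrable (leb (q n)) (Rn (q n) - eball (q n) (zhat n) \<delta>)
           (\<lambda>z. exp (h n z - h n (zhat n)))) \<and>
      (\<lambda>n. (2 * pi) powr (- real (q n) / 2)
           * sqrt (Determinant.det (- hessian (q n) (h n) (zhat n)))
           * (LINT z : Rn (q n) - eball (q n) (zhat n) \<delta> | leb (q n).
                exp (h n z - h n (zhat n)))) \<in> O(e) \<and>
      (\<forall>\<^sub>F n in sequentially.
         times_differentiable_on 2 (q n) (h n) (eball (q n) (zhat n) \<delta>) \<and>
         (\<forall>z\<in>eball (q n) (zhat n) \<delta>.
            eigs_within (\<eta>1 * real n) (- hessian (q n) (h n) z) (\<eta>2 * real n))) \<and>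
      (\<lambda>n. mat_inf_norm (inv_sqrt_mat (- hessian (q n) (h n) (zhat n))))
         \<in> O(\<lambda>n. real (p n) powr cinf / sqrt (real n)) \<and>
      (\<forall>\<^sub>F n in sequentially.
         times_differentiable_on \<zeta> (q n) (h n)
           (eball (q n) (zhat n) (sqrt 2 * gamma_rate (p n) n))) \<and>
      (\<forall>\<^sub>F n in sequentially. \<forall>l<q n.
         eigs_within (\<eta>3 * real n powr c3) (deriv_mat (q n) (h n) [l] (zhat n))
           (\<eta>4 * real n powr c3)) \<and>
      (\<forall>\<^sub>F n in sequentially. \<forall>z\<in>eball (q n) (zhat n) (sqrt 2 * gamma_rate (p n) n).
         \<forall>l<q n. \<forall>m<q n.
           eigs_within (\<eta>5 * real n powr c4) (deriv_mat (q n) (h n) [l, m] z)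
             (\<eta>6 * real n powr c4)) \<and>
      (\<forall>k. 4 < k \<and> k \<le> \<zeta> \<longrightarrow>
         (\<forall>\<^sub>F n in sequentially. \<forall>z\<in>eball (q n) (zhat n) (sqrt 2 * gamma_rate (p n) n).
            \<forall>js. length js = k - 2 \<and> set js \<subseteq> {..<q n} \<longrightarrow>
              eigs_within (B k * real n) (deriv_mat (q n) (h n) js z) (C k * real n))))"

text \<open>\<open>f \<theta> x\<close> is the density at the data point \<open>x\<close> of the sampling distribution with parameter
  \<open>\<theta>\<close>, with respect to the dominating measure \<open>\<mu>\<close>.\<close>

definition sampling_dist :: "'d measure \<Rightarrow> (point \<Rightarrow> 'd \<Rightarrow> real) \<Rightarrow> point \<Rightarrow> 'd measure" where
  "sampling_dist \<mu> f \<theta> = density \<mu> (\<lambda>x. ennreal (f \<theta> x))"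

definition dominated_model :: "nat \<Rightarrow> 'd measure \<Rightarrow> (point \<Rightarrow> 'd \<Rightarrow> real) \<Rightarrow> bool" where
  "dominated_model q \<mu> f \<longleftrightarrow>
     (\<forall>\<theta>\<in>Rn q. f \<theta> \<in> borel_measurable \<mu> \<and> (\<forall>x\<in>space \<mu>. 0 \<le> f \<theta> x) \<and>
        prob_space (sampling_dist \<mu> f \<theta>))"

definition log_lik :: "(point \<Rightarrow> 'd \<Rightarrow> real) \<Rightarrow> 'd \<Rightarrow> point \<Rightarrow> real" where
  "log_lik f x \<theta> = ln (f \<theta> x)"

text \<open>Existence of \<open>\<partial>\<^sup>2 h / \<partial>z\<^sub>a \<partial>z\<^sub>b\<close> at \<open>z\<close>.\<close>

definition has_second_partial :: "nat \<Rightarrow> nat \<Rightarrow> (point \<Rightarrow> real) \<Rightarrow> point \<Rightarrow> bool" where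
  "has_second_partial a b h z \<longleftrightarrow>
     (\<forall>\<^sub>F s in nhds (z a).
        (\<lambda>t. h ((z(a := s))(b := t))) field_differentiable at ((z(a := s)) b)) \<and>
     (\<lambda>s. partial b h (z(a := s))) field_differentiable at (z a)"

text \<open>The mixed entries of the expected information vanish at every parameter value, the expectation
  being taken under the same parameter value.\<close>

definition orthogonal_parametrization ::
  "nat \<Rightarrow> 'd measure \<Rightarrow> (point \<Rightarrow> 'd \<Rightarrow> real) \<Rightarrow> bool" where
  "orthogonal_parametrization q \<mu> f \<longleftrightarrow>
     (\<forall>\<theta>\<in>Rn q. \<forall>j\<in>{1..<q}.
        (AE x in sampling_dist \<mu> f \<theta>. has_second_partial 0 j (log_lik f x) \<theta>) \<and>
        integrable (sampling_dist \<mu> f \<theta>) (\<lambda>x. - partials [0, j] (log_lik f x) \<theta>) \<and>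
        (LINT x | sampling_dist \<mu> f \<theta>. - partials [0, j] (log_lik f x) \<theta>) = 0)"

text \<open>A prior density under which \<open>\<psi>\<close> and \<open>\<lambda>\<close> are independent. It is positive everywhere because its
  logarithm is a real function on the whole parameter space. It is not required to have total mass
  one, so improper priors are included.\<close>

definition independent_prior :: "nat \<Rightarrow> (point \<Rightarrow> real) \<Rightarrow> bool" where
  "independent_prior q \<pi> \<longleftrightarrow> (\<forall>\<theta>\<in>Rn q. 0 < \<pi> \<theta>) \<and>
     (\<exists>\<pi>1 \<pi>2. \<pi>1 \<in> borel_measurable lborel \<and> \<pi>2 \<in> borel_measurable (leb (q - 1)) \<and>
        (\<forall>\<psi>. \<forall>l\<in>Rn (q - 1). \<pi> (case_nat \<psi> l) = \<pi>1 \<psi> * \<pi>2 l))"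

definition log_post :: "(point \<Rightarrow> real) \<Rightarrow> (point \<Rightarrow> 'd \<Rightarrow> real) \<Rightarrow> 'd \<Rightarrow> point \<Rightarrow> real" where
  "log_post \<pi> f x \<theta> = ln (\<pi> \<theta>) + log_lik f x \<theta>"

definition marginal_post :: "nat \<Rightarrow> (point \<Rightarrow> real) \<Rightarrow> real \<Rightarrow> real" where
  "marginal_post q g \<psi> =
     (LINT l | leb (q - 1). exp (g (case_nat \<psi> l))) / (LINT \<theta> | leb q. exp (g \<theta>))"

definition nuisance_hessian :: "nat \<Rightarrow> (point \<Rightarrow> real) \<Rightarrow> point \<Rightarrow> real mat" where
  "nuisance_hessian q g \<theta> = mat (q - 1) (q - 1) (\<lambda>(a, b). partials [Suc a, Suc b] g \<theta>)"

text \<open>\<open>tmax\<close> is the maximizer of \<open>g\<close> and \<open>lmax\<close> the maximizer of \<open>g\<close> for fixed \<open>\<psi>\<close>.\<close>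

definition laplace_marginal_post ::
  "nat \<Rightarrow> (point \<Rightarrow> real) \<Rightarrow> point \<Rightarrow> point \<Rightarrow> real \<Rightarrow> real" where
  "laplace_marginal_post q g tmax lmax \<psi> =
     sqrt (Determinant.det (- hessian q g tmax))
       / (sqrt (2 * pi) * sqrt (Determinant.det (- nuisance_hessian q g (case_nat \<psi> lmax))))
       * exp (g (case_nat \<psi> lmax) - g tmax)"

definition error_rate :: "(nat \<Rightarrow> nat) \<Rightarrow> real \<Rightarrow> nat \<Rightarrow> nat \<Rightarrow> real" where
  "error_rate p c3 \<zeta> n = Max
     {real (p n) ^ 2 * ln (real n) ^ 2 / real n,
      real (p n) ^ (\<zeta> - 1) * ln (real n) powr (real \<zeta> / 2) / real n powr ((real \<zeta> - 2) / 2),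
      real (p n) * sqrt (ln (real n)) / real n powr (3 / 2 - c3)}"

definition near :: "(nat \<Rightarrow> real) \<Rightarrow> (nat \<Rightarrow> real) \<Rightarrow> bool" where
  "near \<psi>hat \<psi> \<longleftrightarrow> (\<lambda>n. \<bar>\<psi> n - \<psi>hat n\<bar>) \<in> O(\<lambda>n. sqrt (ln (real n)) / sqrt (real n))"

end

theory Submission
  imports Defs
begin

text \<open>Numerator and denominator of the marginal density are Laplace integrals of the same kind, so it
  suffices to approximate one of them with relative error \<open>O(p\<^sup>2 ln\<^sup>2 n / n)\<close>. On the ball of radius
  \<open>\<gamma>\<^sub>n\<close> write the integrand as \<open>exp (R x - x\<^sup>T H x / 2)\<close> and interpolate by \<open>exp (t R - x\<^sup>T H x / 2)\<close>. The
  second derivative in \<open>t\<close> of the logarithm of the integral is the variance of \<open>R\<close>; the interpolating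
  densities are strongly log-concave, so a Poincare inequality (proved from the Prekopa--Leindler
  inequality) bounds that variance by the gradient of \<open>R\<close>. Gaussian integration by parts turns the
  means of \<open>R\<close> and of its gradient at \<open>t = 0\<close> into contractions of the fourth and third derivatives
  with \<open>H\<^sup>-\<^sup>1\<close>, which are controlled by the eigenvalue conditions and symmetry. The Gaussian mass outside
  the ball is \<open>exp (- c p ln n)\<close> up to a factor exponential in \<open>p\<close>; it is negligible because the bound
  on the constrained maximizer forces \<open>p\<close> to grow at least like \<open>ln n\<close>.\<close>

subsection \<open>The Prekopa--Leindler inequality\<close>

text \<open>The obstacle: R is not small on the ball. Its supremum is only controlled by a multiple
  of \<epsilon> p ln n with \<epsilon> = p ln n / sqrt n, which may diverge although \<epsilon>
  tends to 0, so exp R cannot be expanded pointwise. What is small is the Hessian of R relative to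
  the Gaussian precision, a ratio of order \<epsilon>. Each application of the Poincare inequality
  trades a function for its gradient at the price 1 / \<kappa>; two of them, from R to its gradient
  and on to its Hessian, give a variance of order \<epsilon>^2, apart from the squared mean of the
  gradient. The eigenvalue conditions bound derivative tensors with all but two indices fixed, so
  indices are permuted until two rows of the inverse Hessian, or a row and a test vector, meet in
  one bilinear form; entrywise bounds would cost powers of p. Constants raised to the power p are
  tolerable only in the tail, where exp (- \<eta> p ln n / 4) compensates for them; the factor ln n
  in the squared radius serves this purpose.\<close>

lemma emeasure_lborel_shift:
  fixes A :: "real set"
  assumes "A \<in> sets borel"
  shows "emeasure lborel {x. x - b \<in> A} = emeasure lborel A"
proof -
  have [measurable]: "A \<in> sets borel" by fact
  have "emeasure lborel A = (\<integral>\<^sup>+x. indicator A x \<partial>lborel)" by simp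
  also have "\<dots> = ennreal \<bar>1\<bar> * (\<integral>\<^sup>+x. indicator A (- b + 1 * x) \<partial>lborel)"
    by (rule nn_integral_real_affine) auto
  also have "\<dots> = (\<integral>\<^sup>+x. indicator {x. x - b \<in> A} x \<partial>lborel)"
    by (auto intro!: nn_integral_cong simp: indicator_def)
  also have "\<dots> = emeasure lborel {x. x - b \<in> A}"
    by (rule nn_integral_indicator) measurable
  finally show ?thesis by simp
qed

lemma emeasure_lborel_double:
  fixes A :: "real set"
  assumes "A \<in> sets borel"
  shows "emeasure lborel {x. x / 2 \<in> A} = 2 * emeasure lborel A"
proof -
  have [measurable]: "A \<in> sets borel" by fact
  have "emeasure lborel {x. x / 2 \<in> A} = (\<integral>\<^sup>+x. indicator {x. x / 2 \<in> A} x \<partial>lborel)"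
    by (rule nn_integral_indicator[symmetric]) measurable
  also have "\<dots> = ennreal \<bar>2\<bar> * (\<integral>\<^sup>+x. indicator {x. x / 2 \<in> A} (0 + 2 * x) \<partial>lborel)"
    by (rule nn_integral_real_affine) auto
  also have "(\<integral>\<^sup>+x. indicator {x. x / 2 \<in> A} (0 + 2 * x) \<partial>lborel) = (\<integral>\<^sup>+x. indicator A x \<partial>lborel)"
    by (auto intro!: nn_integral_cong simp: indicator_def)
  finally show ?thesis by simp
qed

text \<open>Choose a near the top of A and b near the bottom of B. The translates A + b and B + a
  both lie in 2 C, and A + b ends about where B + a begins: they overlap only in an interval of
  length e around a + b.\<close>

lemma brunn_minkowski_real_bounded:
  fixes A B C :: "real set"
  assumes [measurable]: "A \<in> sets borel" "B \<in> sets borel" "C \<in> sets borel"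
    and ne: "A \<noteq> {}" "B \<noteq> {}" and bd: "bdd_above A" "bdd_below B"
    and mid: "\<And>x y. x \<in> A \<Longrightarrow> y \<in> B \<Longrightarrow> (x + y) / 2 \<in> C"
  shows "emeasure lborel A + emeasure lborel B \<le> 2 * emeasure lborel C"
proof (rule ennreal_le_epsilon)
  fix e :: real assume e: "0 < e"
  obtain a where a: "a \<in> A" "Sup A - e/2 < a"
    using less_cSup_iff[OF ne(1) bd(1), of "Sup A - e/2"] e by auto
  obtain b where b: "b \<in> B" "b < Inf B + e/2"
    using cInf_less_iff[OF ne(2) bd(2), of "Inf B + e/2"] e by auto
  let ?P = "{x. x - b \<in> A}" and ?Q = "{x. x - a \<in> B}" and ?I = "{a + b - e/2 .. a + b + e/2}"
  let ?D = "{x. x / 2 \<in> C}"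
  have mP[measurable]: "?P \<in> sets borel" "?Q \<in> sets borel" "?D \<in> sets borel" by measurable
  have disj: "?P \<inter> (?Q - ?I) = {}"
  proof -
    have "x \<in> ?I" if "x \<in> ?P" "x \<in> ?Q" for x
      using cSup_upper[of "x - b" A] cInf_lower[of "x - a" B] that bd a b by auto
    then show ?thesis by blast
  qed
  have sub: "?P \<union> (?Q - ?I) \<subseteq> ?D"
    using mid[OF _ b(1)] mid[OF a(1)] by force
  have "emeasure lborel A + emeasure lborel B = emeasure lborel ?P + emeasure lborel ?Q"
    by (simp add: emeasure_lborel_shift)
  also have "\<dots> \<le> emeasure lborel ?P + (emeasure lborel (?Q - ?I) + emeasure lborel ?I)"
  proof (rule add_left_mono)
    have "emeasure lborel ?Q \<le> emeasure lborel ((?Q - ?I) \<union> ?I)"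
      by (rule emeasure_mono) auto
    also have "\<dots> \<le> emeasure lborel (?Q - ?I) + emeasure lborel ?I"
      by (rule emeasure_subadditive) auto
    finally show "emeasure lborel ?Q \<le> \<dots>" .
  qed
  also have "\<dots> = (emeasure lborel ?P + emeasure lborel (?Q - ?I)) + ennreal e"
    using e by (simp add: add.assoc)
  also have "emeasure lborel ?P + emeasure lborel (?Q - ?I) = emeasure lborel (?P \<union> (?Q - ?I))"
    by (rule plus_emeasure) (use disj in auto)
  also have "\<dots> \<le> emeasure lborel ?D"
    by (rule emeasure_mono[OF sub]) auto
  also have "\<dots> = 2 * emeasure lborel C"
    by (rule emeasure_lborel_double) auto
  finally show "emeasure lborel A + emeasure lborel B \<le> 2 * emeasure lborel C + ennreal e"
    by (simp add: add_right_mono)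
qed

text \<open>The bounded case asks for a bound on one side of each set only, so A is cut off above
  and B below, and the cut-offs are released by continuity of the measure from below.\<close>

lemma brunn_minkowski_real:
  fixes A B C :: "real set"
  assumes [measurable]: "A \<in> sets borel" "B \<in> sets borel" "C \<in> sets borel"
    and ne: "A \<noteq> {}" "B \<noteq> {}"
    and mid: "\<And>x y. x \<in> A \<Longrightarrow> y \<in> B \<Longrightarrow> (x + y) / 2 \<in> C"
  shows "emeasure lborel A + emeasure lborel B \<le> 2 * emeasure lborel C"
proof -
  obtain a b where ab: "a \<in> A" "b \<in> B" using ne by auto
  let ?A = "\<lambda>n::nat. A \<inter> {..real n}" and ?B = "\<lambda>n::nat. B \<inter> {- real n..}"
  \<comment> \<open>From this index on the cut-off sets contain the chosen points a and b, hence are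
    nonempty.\<close>
  have 1: "emeasure lborel (?A n) + emeasure lborel (?B n) \<le> 2 * emeasure lborel C"
    if "n \<ge> nat \<lceil>\<bar>a\<bar>\<rceil> + nat \<lceil>\<bar>b\<bar>\<rceil>" for n
  proof (rule brunn_minkowski_real_bounded)
    have "\<bar>a\<bar> \<le> n" "\<bar>b\<bar> \<le> n" using that by linarith+
    then have "a \<in> ?A n" "b \<in> ?B n" using ab by auto
    then show "?A n \<noteq> {}" "?B n \<noteq> {}" by blast+
  qed (use mid in \<open>auto intro!: bdd_aboveI[of _ "real n"] bdd_belowI[of _ "- real n"]\<close>)
  have "(\<lambda>n. emeasure lborel (?A n)) \<longlonglongrightarrow> emeasure lborel (\<Union>n. ?A n)"
    by (rule Lim_emeasure_incseq) (auto simp: incseq_def)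
  moreover have "(\<Union>n. ?A n) = A" using real_arch_simple by auto
  moreover have "(\<lambda>n. emeasure lborel (?B n)) \<longlonglongrightarrow> emeasure lborel (\<Union>n. ?B n)"
    by (rule Lim_emeasure_incseq) (auto simp: incseq_def)
  moreover have "(\<Union>n. ?B n) = B"
  proof -
    have "\<exists>n. - real n \<le> x" for x using real_arch_simple[of "-x"] by (auto simp: minus_le_iff)
    then show ?thesis by auto
  qed
  ultimately have "(\<lambda>n. emeasure lborel (?A n) + emeasure lborel (?B n)) \<longlonglongrightarrow> emeasure lborel A + emeasure lborel B"
    by (intro tendsto_add) auto
  then show ?thesis
    by (rule LIMSEQ_le_const2) (use 1 in blast)
qed

lemma nn_integral_layer_cake:
  assumes [measurable]: "u \<in> borel_measurable M" and "sigma_finite_measure M"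
  shows "(\<integral>\<^sup>+x. u x \<partial>M) = (\<integral>\<^sup>+t. indicator {0<..} t * emeasure M {x \<in> space M. ennreal t < u x} \<partial>lborel)"
proof -
  interpret sigma_finite_measure M by fact
  interpret pair_sigma_finite lborel M ..
  have *: "u x = (\<integral>\<^sup>+t. indicator {0<..} t * indicator {x \<in> space M. ennreal t < u x} x \<partial>lborel)"
    if "x \<in> space M" for x
  proof (cases "u x")
    case (real r)
    have "(\<integral>\<^sup>+t. indicator {0<..} t * indicator {x \<in> space M. ennreal t < u x} x \<partial>lborel)
      = (\<integral>\<^sup>+t. indicator {0<..<r} t \<partial>lborel)"
      using that real by (intro nn_integral_cong) (auto simp: indicator_def ennreal_less_iff)
    also have "\<dots> = ennreal r" using real by simp
    finally show ?thesis using real by simp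
  next
    case top
    have "(\<integral>\<^sup>+t. indicator {0<..} t * indicator {x \<in> space M. ennreal t < u x} x \<partial>lborel)
      = (\<integral>\<^sup>+t. indicator {0<..} (t::real) \<partial>lborel)"
      using that top by (intro nn_integral_cong) (auto simp: indicator_def ennreal_less_top)
    also have "\<dots> = emeasure lborel {0::real<..}" by (rule nn_integral_indicator) simp
    also have "\<dots> = \<infinity>"
    proof (rule ccontr)
      assume "emeasure lborel {0::real<..} \<noteq> \<infinity>"
      then obtain k :: nat where k: "emeasure lborel {0::real<..} < of_nat k"
        using ennreal_Ex_less_of_nat by (auto simp: less_top)
      have "of_nat k = emeasure lborel {0<..<real k}" by (simp add: ennreal_of_nat_eq_real_of_nat)
      also have "\<dots> \<le> emeasure lborel {0::real<..}" by (rule emeasure_mono) auto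
      finally show False using k by simp
    qed
    finally show ?thesis using top by simp
  qed
  have "(\<integral>\<^sup>+x. u x \<partial>M) = (\<integral>\<^sup>+x. (\<integral>\<^sup>+t. indicator {0<..} t * indicator {x \<in> space M. ennreal t < u x} x \<partial>lborel) \<partial>M)"
    by (rule nn_integral_cong) (rule *)
  also have "\<dots> = (\<integral>\<^sup>+t. (\<integral>\<^sup>+x. indicator {0<..} t * indicator {x \<in> space M. ennreal t < u x} x \<partial>M) \<partial>lborel)"
    by (rule Fubini') measurable
  also have "\<dots> = (\<integral>\<^sup>+t. indicator {0<..} t * emeasure M {x \<in> space M. ennreal t < u x} \<partial>lborel)"
    by (intro nn_integral_cong) (simp add: nn_integral_cmult)
  finally show ?thesis .
qed

text \<open>Since c and d may be infinite, the comparison is made with finite values c' and d'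
  strictly in between, where real arithmetic applies.\<close>

lemma ennreal_mult_less_mono:
  fixes a b c d :: ennreal
  assumes "a < c" "b < d"
  shows "a * b < c * d"
proof -
  obtain c' where c': "a < c'" "c' < c" using dense[OF assms(1)] by auto
  obtain d' where d': "b < d'" "d' < d" using dense[OF assms(2)] by auto
  have "a < Orderings.top" "b < Orderings.top" "c' < Orderings.top" "d' < Orderings.top" using c' d' by (auto intro: less_le_trans)
  then obtain ra rb rc rd where r: "a = ennreal ra" "b = ennreal rb" "c' = ennreal rc" "d' = ennreal rd"
    "0 \<le> ra" "0 \<le> rb" "0 \<le> rc" "0 \<le> rd"
    by (metis less_top_ennreal)
  have "ra * rb < rc * rd"
    using r c' d' by (intro mult_strict_mono') (auto simp: ennreal_less_iff)
  then have "a * b < c' * d'" using r by (simp add: ennreal_less_iff flip: ennreal_mult)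
  also have "\<dots> \<le> c * d" using c' d' by (intro mult_mono) auto
  finally show ?thesis .
qed

lemma ennreal_am_gm: "4 * (x * y) \<le> (x + y)^2" for x y :: ennreal
proof (cases x; cases y)
  fix a b assume *: "x = ennreal a" "y = ennreal b" "0 \<le> a" "0 \<le> b"
  have "4 * (a * b) \<le> (a + b)^2" using sum_squares_bound[of a b] by (simp add: power2_sum)
  then have "ennreal (4 * (a * b)) \<le> ennreal ((a + b)^2)" by (rule ennreal_leI)
  then show ?thesis using * by (simp add: ennreal_mult ennreal_power flip: ennreal_plus)
qed (auto simp: ennreal_top_mult power2_eq_square)

text \<open>Equal suprema make the superlevel sets of u and v nonempty for the same levels, those
  below 1, so the one-dimensional Brunn--Minkowski inequality applies level by level; at levels from
  1 on both sets are empty. Integration over the levels yields a sum on the left, not yet a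
  product.\<close>

lemma prekopa_leindler_real_normalized:
  fixes u v w :: "real \<Rightarrow> ennreal"
  assumes [measurable]: "u \<in> borel_measurable borel" "v \<in> borel_measurable borel" "w \<in> borel_measurable borel"
    and sup: "(SUP x. u x) = 1" "(SUP x. v x) = 1"
    and mid: "\<And>x y. u x * v y \<le> (w ((x + y) / 2))^2"
  shows "(\<integral>\<^sup>+x. u x \<partial>lborel) + (\<integral>\<^sup>+x. v x \<partial>lborel) \<le> 2 * (\<integral>\<^sup>+x. w x \<partial>lborel)"
proof -
  let ?m = "\<lambda>u t. indicator {0<..} t * emeasure lborel {x \<in> space lborel. ennreal t < u x}"
  have mm: "(\<lambda>t. ?m u t) \<in> borel_measurable lborel" if [measurable]: "u \<in> borel_measurable borel" for u
  proof -
    have "(\<lambda>t. emeasure lborel {x \<in> space lborel. ennreal t < u x}) \<in> borel_measurable lborel"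
      by measurable
    then show ?thesis by measurable
  qed
  have le: "?m u t + ?m v t \<le> 2 * ?m w t" for t
  proof (cases "0 < t \<and> t < 1")
    case True
    then have t1: "ennreal t < 1" by (simp add: ennreal_less_one_iff)
    have "emeasure lborel {x. ennreal t < u x} + emeasure lborel {x. ennreal t < v x}
        \<le> 2 * emeasure lborel {x. ennreal t < w x}"
    proof (rule brunn_minkowski_real)
      show "{x. ennreal t < u x} \<noteq> {}" "{x. ennreal t < v x} \<noteq> {}"
        using sup t1 less_SUP_iff[of "ennreal t" u UNIV] less_SUP_iff[of "ennreal t" v UNIV] by auto
      fix x y assume "x \<in> {x. ennreal t < u x}" "y \<in> {x. ennreal t < v x}"
      then have "ennreal t < u x" "ennreal t < v y" by auto
      then have "ennreal t * ennreal t < u x * v y" by (rule ennreal_mult_less_mono)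
      also have "\<dots> \<le> (w ((x + y)/2))^2" by (rule mid)
      finally have "(ennreal t)^2 < (w ((x+y)/2))^2" by (simp add: power2_eq_square)
      then show "(x + y)/2 \<in> {x. ennreal t < w x}"
        by (auto simp: not_le[symmetric] dest: power_mono[of _ _ 2])
    qed auto
    then show ?thesis using True by simp
  next
    case False
    have "u x \<le> 1" "v x \<le> 1" for x using sup SUP_upper[of x UNIV u] SUP_upper[of x UNIV v] by auto
    moreover have "1 \<le> ennreal t" if "t \<ge> 1" using that by (simp add: ennreal_leI flip: ennreal_1)
    ultimately have "u x \<le> ennreal t" "v x \<le> ennreal t" if "t \<ge> 1" for x
      using that order.trans by blast+
    then have "t \<ge> 1 \<Longrightarrow> {x. ennreal t < u x} = {}" "t \<ge> 1 \<Longrightarrow> {x. ennreal t < v x} = {}"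
      by (auto simp: not_less)
    then show ?thesis using False by (auto simp: indicator_def)
  qed
  have "(\<integral>\<^sup>+x. u x \<partial>lborel) + (\<integral>\<^sup>+x. v x \<partial>lborel) = (\<integral>\<^sup>+t. ?m u t + ?m v t \<partial>lborel)"
    by (subst (1 2) nn_integral_layer_cake) (auto simp: nn_integral_add mm lborel.sigma_finite_measure_axioms)
  also have "\<dots> \<le> (\<integral>\<^sup>+t. 2 * ?m w t \<partial>lborel)"
    by (intro nn_integral_mono le)
  also have "\<dots> = 2 * (\<integral>\<^sup>+x. w x \<partial>lborel)"
    by (subst nn_integral_cmult) (auto simp: nn_integral_layer_cake[of w] mm lborel.sigma_finite_measure_axioms)
  finally show ?thesis .
qed

text \<open>Dividing u and v by their suprema, and w by the geometric mean of these, reaches the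
  normalized case; the arithmetic-geometric mean inequality then turns its sum into the
  product.\<close>

lemma prekopa_leindler_real_bounded:
  fixes u v w :: "real \<Rightarrow> ennreal"
  assumes [measurable]: "u \<in> borel_measurable borel" "v \<in> borel_measurable borel" "w \<in> borel_measurable borel"
    and bd: "\<And>x. u x \<le> of_nat j" "\<And>x. v x \<le> of_nat k"
    and mid: "\<And>x y. u x * v y \<le> (w ((x + y) / 2))^2"
  shows "(\<integral>\<^sup>+x. u x \<partial>lborel) * (\<integral>\<^sup>+x. v x \<partial>lborel) \<le> (\<integral>\<^sup>+x. w x \<partial>lborel)^2"
proof -
  define a b where "a = (SUP x. u x)" and "b = (SUP x. v x)"
  have le: "u x \<le> a" "v x \<le> b" for x by (auto simp: a_def b_def intro: SUP_upper)
  have "a \<le> of_nat j" "b \<le> of_nat k" by (auto simp: a_def b_def intro!: SUP_least bd)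
  then have "a < Orderings.top" "b < Orderings.top" using of_nat_less_top le_less_trans by blast+
  then obtain ra rb where r: "a = ennreal ra" "b = ennreal rb" "0 \<le> ra" "0 \<le> rb"
    by (metis less_top_ennreal)
  show ?thesis
  proof (cases "a = 0 \<or> b = 0")
    case True
    then have "(\<forall>x. u x = 0) \<or> (\<forall>x. v x = 0)" using le by (metis le_zero_eq)
    then show ?thesis by auto
  next
    case False
    then have pos: "0 < ra" "0 < rb" using r by (auto simp: less_le)
    define c where "c = sqrt (ra * rb)"
    have c: "0 < c" "c * c = ra * rb" using pos by (auto simp: c_def)
    let ?u = "\<lambda>x. ennreal (1/ra) * u x" and ?v = "\<lambda>x. ennreal (1/rb) * v x" and ?w = "\<lambda>x. ennreal (1/c) * w x"
    have "(\<integral>\<^sup>+x. ?u x \<partial>lborel) + (\<integral>\<^sup>+x. ?v x \<partial>lborel) \<le> 2 * (\<integral>\<^sup>+x. ?w x \<partial>lborel)"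
    proof (rule prekopa_leindler_real_normalized)
      show "(SUP x. ?u x) = 1" "(SUP x. ?v x) = 1"
        using pos r by (simp_all add: a_def[symmetric] b_def[symmetric] SUP_mult_left_ennreal[symmetric] ennreal_mult[symmetric])
      fix x y
      have "?u x * ?v y = ennreal (1/c)^2 * (u x * v y)"
        using pos c by (simp add: power2_eq_square ennreal_mult[symmetric] mult_ac)
      also have "\<dots> \<le> ennreal (1/c)^2 * (w ((x + y)/2))^2"
        by (intro mult_left_mono mid) simp
      finally show "?u x * ?v y \<le> (?w ((x + y)/2))^2" by (simp add: power_mult_distrib)
    qed measurable
    then have "((\<integral>\<^sup>+x. ?u x \<partial>lborel) + (\<integral>\<^sup>+x. ?v x \<partial>lborel))^2 \<le> (2 * (\<integral>\<^sup>+x. ?w x \<partial>lborel))^2"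
      by (rule power_mono) simp
    from order.trans[OF ennreal_am_gm this]
    have "4 * ((ennreal (1/ra) * integral\<^sup>N lborel u) * (ennreal (1/rb) * integral\<^sup>N lborel v))
      \<le> 4 * (ennreal (1/c) * integral\<^sup>N lborel w)^2"
      by (simp add: nn_integral_cmult power_mult_distrib)
    then have "ennreal (4 * c * c) * (ennreal (1/ra) * ennreal (1/rb)) * (integral\<^sup>N lborel u * integral\<^sup>N lborel v)
      \<le> ennreal (4 * c * c) * ennreal (1/c)^2 * (integral\<^sup>N lborel w)^2"
      using c by (auto simp: mult_ac power_mult_distrib ennreal_mult intro!: mult_left_mono)
    moreover have "ennreal (4 * c * c) * (ennreal (1/ra) * ennreal (1/rb)) = 4" "ennreal (4 * c * c) * ennreal (1/c)^2 = 4"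
      using c pos by (simp_all add: ennreal_mult[symmetric] power2_eq_square mult.assoc)
    ultimately have "4 * (integral\<^sup>N lborel u * integral\<^sup>N lborel v) \<le> 4 * (integral\<^sup>N lborel w)^2" by simp
    then show ?thesis by (simp add: ennreal_mult_le_mult_iff)
  qed
qed

lemma nn_integral_SUP_truncate:
  assumes [measurable]: "u \<in> borel_measurable M"
  shows "(SUP k. \<integral>\<^sup>+x. min (u x) (of_nat k) \<partial>M) = (\<integral>\<^sup>+x. u x \<partial>M)"
proof -
  have "(SUP k. min (u x) (of_nat k)) = u x" for x
  proof -
    have "(SUP k. min (u x) (of_nat k)) = min (u x) (SUP k. of_nat k)"
      by (simp add: inf_min[symmetric] inf_SUP)
    then show ?thesis by (simp add: ennreal_SUP_of_nat_eq_top)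
  qed
  moreover have "(\<integral>\<^sup>+x. (SUP k. min (u x) (of_nat k)) \<partial>M) = (SUP k. \<integral>\<^sup>+x. min (u x) (of_nat k) \<partial>M)"
    by (rule nn_integral_monotone_convergence_SUP)
      (auto simp: incseq_def le_fun_def min_le_iff_disj intro!: min.boundedI min.coboundedI2)
  ultimately show ?thesis by simp
qed

theorem prekopa_leindler_real:
  fixes u v w :: "real \<Rightarrow> ennreal"
  assumes [measurable]: "u \<in> borel_measurable borel" "v \<in> borel_measurable borel" "w \<in> borel_measurable borel"
    and mid: "\<And>x y. u x * v y \<le> (w ((x + y) / 2))^2"
  shows "(\<integral>\<^sup>+x. u x \<partial>lborel) * (\<integral>\<^sup>+x. v x \<partial>lborel) \<le> (\<integral>\<^sup>+x. w x \<partial>lborel)^2"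
proof -
  have "(\<integral>\<^sup>+x. min (u x) (of_nat j) \<partial>lborel) * (\<integral>\<^sup>+x. min (v x) (of_nat k) \<partial>lborel) \<le> (\<integral>\<^sup>+x. w x \<partial>lborel)^2" for j k
    by (rule prekopa_leindler_real_bounded[where j = j and k = k])
      (auto intro!: order.trans[OF _ mid] mult_mono)
  then have "(SUP j. (SUP k. (\<integral>\<^sup>+x. min (u x) (of_nat j) \<partial>lborel) * (\<integral>\<^sup>+x. min (v x) (of_nat k) \<partial>lborel))) \<le> (\<integral>\<^sup>+x. w x \<partial>lborel)^2"
    by (intro SUP_least) auto
  then show ?thesis
    by (simp add: SUP_mult_left_ennreal[symmetric] SUP_mult_right_ennreal[symmetric] nn_integral_SUP_truncate)
qed

definition midpt :: "nat \<Rightarrow> point \<Rightarrow> point \<Rightarrow> point" where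
  "midpt q x y = (\<lambda>i\<in>{..<q}. (x i + y i) / 2)"

lemma Rn_fun_upd: "x \<in> Rn q \<Longrightarrow> x(q := t) \<in> Rn (Suc q)"
  by (auto simp: Rn_def PiE_def extensional_def)

lemma space_leb: "space (leb q) = Rn q"
  by (simp add: leb_def Rn_def space_PiM)

interpretation lborel_prod: product_sigma_finite "\<lambda>_::nat. lborel :: real measure"
  by standard

text \<open>Tensorization: for fixed last coordinates s and t the slices of u, v and w satisfy the
  hypothesis in one dimension less, so the induction hypothesis says that the marginals in the last
  coordinate satisfy the hypothesis of the real case.\<close>

theorem prekopa_leindler:
  fixes u v w :: "point \<Rightarrow> ennreal"
  assumes "u \<in> borel_measurable (leb q)" "v \<in> borel_measurable (leb q)" "w \<in> borel_measurable (leb q)"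
    and "\<And>x y. x \<in> Rn q \<Longrightarrow> y \<in> Rn q \<Longrightarrow> u x * v y \<le> (w (midpt q x y))^2"
  shows "(\<integral>\<^sup>+x. u x \<partial>leb q) * (\<integral>\<^sup>+x. v x \<partial>leb q) \<le> (\<integral>\<^sup>+x. w x \<partial>leb q)^2"
  using assms
proof (induction q arbitrary: u v w)
  case 0
  have "(\<lambda>_. undefined) \<in> Rn 0" by (simp add: Rn_def)
  moreover have "midpt 0 (\<lambda>_. undefined) (\<lambda>_. undefined) = (\<lambda>_. undefined)" by (auto simp: midpt_def)
  ultimately show ?case using 0(4) by (metis (no_types, lifting) leb_def lborel_prod.nn_integral_empty lessThan_0 zero_le)
next
  case (Suc q)
  have meas: "(\<lambda>(t, x). u (x(q := t))) \<in> borel_measurable (borel \<Otimes>\<^sub>M leb q)"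
    if "u \<in> borel_measurable (leb (Suc q))" for u :: "point \<Rightarrow> ennreal"
  proof -
    have [measurable]: "u \<in> borel_measurable (Pi\<^sub>M (insert q {..<q}) (\<lambda>_. lborel))"
      using that by (simp add: leb_def lessThan_Suc)
    have "(\<lambda>(t, x). x(q := t)) \<in> measurable (lborel \<Otimes>\<^sub>M leb q) (Pi\<^sub>M (insert q {..<q}) (\<lambda>_. lborel))"
      unfolding leb_def by measurable
    from measurable_compose[OF this, of u] show ?thesis
      by (simp add: split_def cong: measurable_cong_sets)
  qed
  have red: "(\<integral>\<^sup>+x. u x \<partial>leb (Suc q)) = (\<integral>\<^sup>+t. (\<integral>\<^sup>+x. u (x(q := t)) \<partial>leb q) \<partial>lborel)"
    if "u \<in> borel_measurable (leb (Suc q))" for u :: "point \<Rightarrow> ennreal"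
    using that unfolding leb_def lessThan_Suc by (intro lborel_prod.product_nn_integral_insert_rev) auto
  interpret sigma_finite_measure "leb q"
    unfolding leb_def by (rule lborel_prod.sigma_finite) simp
  have m1: "(\<lambda>t. \<integral>\<^sup>+x. u (x(q := t)) \<partial>leb q) \<in> borel_measurable borel"
    if "u \<in> borel_measurable (leb (Suc q))" for u :: "point \<Rightarrow> ennreal"
    using meas[OF that] by (rule borel_measurable_nn_integral)
  have m2: "(\<lambda>x. u (x(q := t))) \<in> borel_measurable (leb q)"
    if "u \<in> borel_measurable (leb (Suc q))" for u :: "point \<Rightarrow> ennreal" and t
    using measurable_compose[OF measurable_Pair1' meas[OF that], of t] by simp
  have "(\<integral>\<^sup>+t. (\<integral>\<^sup>+x. u (x(q := t)) \<partial>leb q) \<partial>lborel) * (\<integral>\<^sup>+t. (\<integral>\<^sup>+x. v (x(q := t)) \<partial>leb q) \<partial>lborel)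
     \<le> (\<integral>\<^sup>+t. (\<integral>\<^sup>+x. w (x(q := t)) \<partial>leb q) \<partial>lborel)^2"
  proof (rule prekopa_leindler_real)
    fix s t
    show "(\<integral>\<^sup>+x. u (x(q := s)) \<partial>leb q) * (\<integral>\<^sup>+x. v (x(q := t)) \<partial>leb q) \<le> (\<integral>\<^sup>+x. w (x(q := (s + t)/2)) \<partial>leb q)^2"
    proof (rule Suc.IH)
      fix x y assume xy: "x \<in> Rn q" "y \<in> Rn q"
      have "midpt (Suc q) (x(q := s)) (y(q := t)) = (midpt q x y)(q := (s + t)/2)"
        by (auto simp: midpt_def fun_eq_iff less_Suc_eq)
      then show "u (x(q := s)) * v (y(q := t)) \<le> (w ((midpt q x y)(q := (s + t)/2)))^2"
        using Suc.prems(4)[OF Rn_fun_upd[OF xy(1)] Rn_fun_upd[OF xy(2)], of s t] by (simp del: fun_upd_apply)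
    qed (fact m2[OF Suc.prems(1)] m2[OF Suc.prems(2)] m2[OF Suc.prems(3)])+
  qed (use Suc.prems in \<open>auto intro: m1\<close>)
  then show ?case using Suc.prems by (simp add: red)
qed

subsection \<open>The Poincare inequality for strongly log-concave densities\<close>

lemma exp_lower_cubic:
  fixes a :: real assumes "\<bar>a\<bar> \<le> 1"
  shows "1 + a + a^2/2 - \<bar>a\<bar>^3 \<le> exp a"
proof -
  obtain t where t: "\<bar>t\<bar> \<le> \<bar>a\<bar>" "exp a = (\<Sum>m<3. (a ^ m) / fact m) + (exp t / fact 3) * a ^ 3"
    using Maclaurin_exp_le[of a 3] by blast
  have "exp t \<le> exp 1" using t assms by auto
  also have "exp 1 \<le> (3::real)" by (rule exp_le)
  finally have "exp t / 6 \<le> 1" by simp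
  then have "abs ((exp t / 6) * a^3) \<le> 1 * \<bar>a\<bar>^3"
    unfolding abs_mult power_abs by (intro mult_right_mono) auto
  then have "(exp t / 6) * a^3 \<ge> - (\<bar>a\<bar>^3)" by linarith
  moreover have "exp a = 1 + a + a^2/2 + (exp t / 6) * a^3"
    using t(2) by (simp add: eval_nat_numeral)
  ultimately show ?thesis by linarith
qed

lemma ip_le_norms:
  fixes x y :: "nat \<Rightarrow> real"
  shows "\<bar>\<Sum>i<q. x i * y i\<bar> \<le> L2_set x {..<q} * L2_set y {..<q}"
proof -
  have "\<bar>\<Sum>i<q. x i * y i\<bar> \<le> (\<Sum>i<q. \<bar>x i\<bar> * \<bar>y i\<bar>)"
    by (rule order.trans[OF sum_abs]) (simp add: abs_mult)
  also have "\<dots> \<le> L2_set x {..<q} * L2_set y {..<q}" by (rule L2_set_mult_ineq)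
  finally show ?thesis .
qed

lemma L2_set_sq: "(L2_set x {..<q})^2 = (\<Sum>i<q. (x i)^2)"
  by (simp add: L2_set_def sum_nonneg)

text \<open>The factor exp (\<kappa> |x - y|^2 / 4) gained from strong log-concavity absorbs
  \<epsilon> (\<phi> x - \<phi> y) up to a cost of order \<epsilon>^2, which is subtracted in the
  first exponent. Only an upper bound on \<phi> x - \<phi> y occurs, hence semiconvexity of \<phi>
  suffices.\<close>

lemma poincare_PL_step:
  fixes \<rho> \<phi> :: "point \<Rightarrow> real" and \<Gamma> :: "nat \<Rightarrow> point \<Rightarrow> real"
  assumes [measurable]: "\<rho> \<in> borel_measurable (leb q)" "\<phi> \<in> borel_measurable (leb q)"
    "\<And>i. i < q \<Longrightarrow> \<Gamma> i \<in> borel_measurable (leb q)"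
    and \<rho>: "\<And>x. 0 \<le> \<rho> x"
    and lc: "\<And>x y. x \<in> Rn q \<Longrightarrow> y \<in> Rn q \<Longrightarrow>
      \<rho> x * \<rho> y * exp (\<kappa> * (edist q x y)^2 / 4) \<le> (\<rho> (midpt q x y))^2"
    and taylor: "\<And>x y. x \<in> Rn q \<Longrightarrow> y \<in> Rn q \<Longrightarrow> 0 < \<rho> x \<Longrightarrow> 0 < \<rho> y \<Longrightarrow>
      \<phi> x + (\<Sum>i<q. \<Gamma> i x * (y i - x i)) - L / 2 * (edist q x y)^2 \<le> \<phi> y"
    and pos: "0 < \<kappa>" "0 \<le> \<epsilon>" "\<epsilon> * L \<le> \<kappa> / 4"
  shows "(\<integral>\<^sup>+x. ennreal (\<rho> x * exp (\<epsilon> * \<phi> x - \<epsilon>^2 * (2 / \<kappa> * (\<Sum>i<q. (\<Gamma> i x)^2)))) \<partial>leb q) *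
     (\<integral>\<^sup>+x. ennreal (\<rho> x * exp (- \<epsilon> * \<phi> x)) \<partial>leb q) \<le> (\<integral>\<^sup>+x. ennreal (\<rho> x) \<partial>leb q)^2"
proof (rule prekopa_leindler)
  fix x y assume xy: "x \<in> Rn q" "y \<in> Rn q"
  let ?G = "2 / \<kappa> * (\<Sum>i<q. (\<Gamma> i x)^2)" and ?d = "edist q x y"
  show "ennreal (\<rho> x * exp (\<epsilon> * \<phi> x - \<epsilon>^2 * ?G)) * ennreal (\<rho> y * exp (- \<epsilon> * \<phi> y)) \<le> (ennreal (\<rho> (midpt q x y)))^2"
  proof (cases "0 < \<rho> x \<and> 0 < \<rho> y")
    case False
    then have "\<rho> x = 0 \<or> \<rho> y = 0" using \<rho>[of x] \<rho>[of y] by linarith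
    then show ?thesis by auto
  next
    case True
    have d: "?d = L2_set (\<lambda>i. y i - x i) {..<q}"
      by (auto simp: edist_def L2_set_def power2_commute)
    define g where "g = L2_set (\<lambda>i. \<Gamma> i x) {..<q}"
    have "- (\<Sum>i<q. \<Gamma> i x * (y i - x i)) \<le> g * ?d"
      using ip_le_norms[where x = "\<lambda>i. \<Gamma> i x" and y = "\<lambda>i. y i - x i" and q = q] by (simp add: d g_def)
    with taylor[OF xy] True have "\<phi> x - \<phi> y \<le> g * ?d + L/2 * ?d^2" by auto
    then have "\<epsilon> * (\<phi> x - \<phi> y) \<le> \<epsilon> * (g * ?d + L/2 * ?d^2)" using pos by (intro mult_left_mono) auto
    also have "\<dots> = (\<epsilon> * g) * ?d + (\<epsilon> * L) / 2 * ?d^2" by (simp add: algebra_simps)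
    also have "\<dots> \<le> (\<epsilon> * g) * ?d + (\<kappa>/4) / 2 * ?d^2"
      using pos by (intro add_left_mono mult_right_mono divide_right_mono) auto
    \<comment> \<open>Half of \<kappa> d^2 / 4 pays for the Taylor error, the other half for the
      linear term by completing the square. The even split is the origin of 2 / \<kappa> in place of
      the sharp constant 1 / \<kappa>.\<close>
    also have "\<dots> \<le> 2 / \<kappa> * (\<epsilon> * g)^2 + \<kappa> / 8 * ?d^2 + \<kappa> / 8 * ?d^2"
    proof -
      have "0 \<le> 2 / \<kappa> * (\<epsilon> * g - \<kappa> / 4 * ?d)^2" using pos by simp
      also have "\<dots> = 2 / \<kappa> * (\<epsilon> * g)^2 + \<kappa> / 8 * ?d^2 - (\<epsilon> * g) * ?d"
        using pos by (simp add: power2_eq_square field_simps)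
      finally show ?thesis by simp
    qed
    also have "2 / \<kappa> * (\<epsilon> * g)^2 = \<epsilon>^2 * ?G"
      unfolding power_mult_distrib g_def L2_set_sq by simp
    finally have "\<epsilon> * \<phi> x - \<epsilon>^2 * ?G - \<epsilon> * \<phi> y \<le> \<kappa> * ?d^2 / 4" by (simp add: algebra_simps)
    then have "\<rho> x * \<rho> y * exp (\<epsilon> * \<phi> x - \<epsilon>^2 * ?G - \<epsilon> * \<phi> y) \<le> \<rho> x * \<rho> y * exp (\<kappa> * ?d^2 / 4)"
      using \<rho> by (intro mult_left_mono) auto
    also have "\<dots> \<le> (\<rho> (midpt q x y))^2" by (rule lc[OF xy])
    finally have "(\<rho> x * exp (\<epsilon> * \<phi> x - \<epsilon>^2 * ?G)) * (\<rho> y * exp (- \<epsilon> * \<phi> y)) \<le> (\<rho> (midpt q x y))^2"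
      by (simp add: exp_diff exp_minus mult_ac divide_inverse)
    then show ?thesis
      using \<rho> by (simp add: ennreal_mult[symmetric] ennreal_power ennreal_leI)
  qed
qed auto

text \<open>The Prekopa--Leindler inequality is applied to the density perturbed by \<open>exp (\<epsilon> \<phi>)\<close> and
  \<open>exp (- \<epsilon> \<phi>)\<close>; the claim is the coefficient of \<open>\<epsilon>\<^sup>2\<close>.\<close>

theorem poincare_strongly_log_concave:
  fixes \<rho> \<phi> :: "point \<Rightarrow> real" and \<Gamma> :: "nat \<Rightarrow> point \<Rightarrow> real"
  assumes int: "integrable (leb q) \<rho>" "(\<integral>x. \<rho> x \<partial>leb q) = 1"
    and meas: "\<phi> \<in> borel_measurable (leb q)" "\<And>i. i < q \<Longrightarrow> \<Gamma> i \<in> borel_measurable (leb q)"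
    and \<rho>: "\<And>x. 0 \<le> \<rho> x"
    and lc: "\<And>x y. x \<in> Rn q \<Longrightarrow> y \<in> Rn q \<Longrightarrow>
      \<rho> x * \<rho> y * exp (\<kappa> * (edist q x y)^2 / 4) \<le> (\<rho> (midpt q x y))^2"
    and taylor: "\<And>x y. x \<in> Rn q \<Longrightarrow> y \<in> Rn q \<Longrightarrow> 0 < \<rho> x \<Longrightarrow> 0 < \<rho> y \<Longrightarrow>
      \<phi> x + (\<Sum>i<q. \<Gamma> i x * (y i - x i)) - L / 2 * (edist q x y)^2 \<le> \<phi> y"
    and bounds: "\<And>x. \<bar>\<phi> x\<bar> \<le> K" "\<And>x i. i < q \<Longrightarrow> \<bar>\<Gamma> i x\<bar> \<le> K"
    and pos: "0 < \<kappa>"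
  shows "(\<integral>x. \<rho> x * (\<phi> x)^2 \<partial>leb q) - (\<integral>x. \<rho> x * \<phi> x \<partial>leb q)^2
    \<le> 2 / \<kappa> * (\<integral>x. \<rho> x * (\<Sum>i<q. (\<Gamma> i x)^2) \<partial>leb q)"
proof -
  note [measurable] = borel_measurable_integrable[OF int(1)] meas
  define G where "G x = 2 / \<kappa> * (\<Sum>i<q. (\<Gamma> i x)^2)" for x
  have Gm[measurable]: "G \<in> borel_measurable (leb q)" unfolding G_def by measurable
  have K0: "0 \<le> K" using bounds(1)[of undefined] by linarith
  \<comment> \<open>A common bound for \<phi> and \<open>G\<close>; J >= 1 lets J^2 be replaced by
    J^3 in the cubic error.\<close>
  define J where "J = max 1 (max K (2 / \<kappa> * (q * K^2)))"
  have J1: "1 \<le> J" "K \<le> J" by (auto simp: J_def)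
  have G0: "0 \<le> G x" for x using pos unfolding G_def by (intro mult_nonneg_nonneg sum_nonneg) auto
  have GJ: "G x \<le> J" for x
  proof -
    have "(\<Sum>i<q. (\<Gamma> i x)^2) \<le> (\<Sum>i<q. K^2)"
      using bounds(2) K0 by (intro sum_mono) (metis abs_le_square_iff abs_of_nonneg lessThan_iff)
    then have "G x \<le> 2 / \<kappa> * (q * K^2)"
      unfolding G_def using pos by (intro mult_left_mono) auto
    then show ?thesis by (simp add: J_def)
  qed
  have \<phi>J: "\<bar>\<phi> x\<bar> \<le> J" for x using bounds(1)[of x] J1 by linarith
  have ib: "integrable (leb q) (\<lambda>x. \<rho> x * f x)"
    if [measurable]: "f \<in> borel_measurable (leb q)" and b: "\<And>x. \<bar>f x\<bar> \<le> c" for f and c :: real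
  proof (rule Bochner_Integration.integrable_bound)
    show "integrable (leb q) (\<lambda>x. c * \<rho> x)" using int(1) by simp
    show "AE x in leb q. norm (\<rho> x * f x) \<le> norm (c * \<rho> x)"
    proof (rule AE_I2)
      fix x have "\<bar>f x\<bar> * \<rho> x \<le> \<bar>c\<bar> * \<rho> x" using b[of x] \<rho> by (intro mult_right_mono) auto
      then show "norm (\<rho> x * f x) \<le> norm (c * \<rho> x)" using \<rho>[of x] by (simp add: abs_mult mult.commute)
    qed
  qed measurable
  define m s g where "m = (\<integral>x. \<rho> x * \<phi> x \<partial>leb q)" and "s = (\<integral>x. \<rho> x * (\<phi> x)^2 \<partial>leb q)"
    and "g = (\<integral>x. \<rho> x * G x \<partial>leb q)"
  have J2: "\<bar>(\<phi> x)^2\<bar> \<le> J^2" for x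
    using \<phi>J[of x] J1 abs_le_square_iff[of "\<phi> x" J] by simp
  have i1: "integrable (leb q) (\<lambda>x. \<rho> x * \<phi> x)" by (rule ib[OF _ \<phi>J]) measurable
  have i2: "integrable (leb q) (\<lambda>x. \<rho> x * (\<phi> x)^2)" by (rule ib[OF _ J2]) measurable
  have i3: "integrable (leb q) (\<lambda>x. \<rho> x * G x)" by (rule ib[where c = J]) (use G0 GJ in \<open>auto\<close>)
  \<comment> \<open>Second-order lower bounds for the two perturbed integrals. Of the cubic error, 8
    J^3 comes from |a|^3 with |a| \<le> 2 \<epsilon> J, and one more J^3 from the cross term in a^2
    / 2.\<close>
  define A B where "A \<epsilon> = 1 + \<epsilon> * m + \<epsilon>^2 * (s/2 - g) - 9 * J^3 * \<epsilon>^3"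
    and "B \<epsilon> = 1 - \<epsilon> * m + \<epsilon>^2 * (s/2) - 9 * J^3 * \<epsilon>^3" for \<epsilon>
  have main: "A \<epsilon> * B \<epsilon> \<le> 1" if \<epsilon>: "0 < \<epsilon>" "\<epsilon> * L \<le> \<kappa> / 4" "\<epsilon> \<le> 1 / (2 * J)" "0 \<le> A \<epsilon>" "0 \<le> B \<epsilon>" for \<epsilon>
  proof -
    have \<epsilon>J: "\<epsilon> * J \<le> 1/2" using \<epsilon> J1 by (simp add: field_simps)
    moreover have "\<epsilon> \<le> \<epsilon> * J" using \<epsilon>(1) J1(1) by simp
    ultimately have \<epsilon>1: "\<epsilon> \<le> 1" by linarith
    have J0: "0 \<le> J" using J1 by simp
    have \<epsilon>32: "\<epsilon>^4 * J^2 \<ge> 0" by simp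
    have J23: "J^2 \<le> J^3" using J1(1) by (intro power_increasing) auto
    have low: "1 + \<epsilon> * \<phi> x + \<epsilon>^2 * ((\<phi> x)^2/2 - H) - 9 * J^3 * \<epsilon>^3 \<le> exp (\<epsilon> * \<phi> x - \<epsilon>^2 * H)"
      if H: "0 \<le> H" "H \<le> J" "\<bar>\<phi> x\<bar> \<le> J" for x H and \<phi> :: "point \<Rightarrow> real"
    proof -
      let ?a = "\<epsilon> * \<phi> x - \<epsilon>^2 * H"
      have "\<bar>?a\<bar> \<le> \<epsilon> * \<bar>\<phi> x\<bar> + \<epsilon>^2 * H" using H \<epsilon> by (intro order.trans[OF abs_triangle_ineq4]) (auto simp: abs_mult)
      also have "\<dots> \<le> \<epsilon> * J + \<epsilon> * J"
      proof (rule add_mono)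
        show "\<epsilon> * \<bar>\<phi> x\<bar> \<le> \<epsilon> * J" using H \<epsilon> by (intro mult_left_mono) auto
        have "\<epsilon>^2 \<le> \<epsilon>" using \<epsilon> \<epsilon>1 by (simp add: power2_eq_square)
        then show "\<epsilon>^2 * H \<le> \<epsilon> * J" using H \<epsilon> by (intro mult_mono) auto
      qed
      finally have a: "\<bar>?a\<bar> \<le> 2 * \<epsilon> * J" by (simp add: mult_ac)
      then have a1: "\<bar>?a\<bar> \<le> 1" using \<epsilon>J by linarith
      have "\<bar>?a\<bar>^3 \<le> (2 * \<epsilon> * J)^3" using a by (intro power_mono) auto
      then have 1: "\<bar>?a\<bar>^3 \<le> 8 * J^3 * \<epsilon>^3" by (simp add: power_mult_distrib mult_ac)
      have "\<phi> x * H \<le> J * J" using H by (intro mult_mono) auto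
      then have "\<epsilon>^3 * (\<phi> x * H) \<le> \<epsilon>^3 * J^3"
        using J23 \<epsilon> by (intro mult_left_mono) (auto simp: power2_eq_square)
      moreover have "?a^2/2 = \<epsilon>^2 * (\<phi> x)^2/2 - \<epsilon>^3 * (\<phi> x * H) + \<epsilon>^4 * H^2/2"
        by (simp add: power2_eq_square eval_nat_numeral field_simps)
      moreover have "0 \<le> \<epsilon>^4 * H^2/2" by simp
      ultimately have 2: "?a^2/2 \<ge> \<epsilon>^2 * (\<phi> x)^2/2 - J^3 * \<epsilon>^3"
        unfolding mult.commute[of "J^3"] by linarith
      show ?thesis using exp_lower_cubic[OF a1] 1 2 by (simp add: algebra_simps)
    qed
    let ?I = "\<lambda>f. \<integral>x. \<rho> x * f x \<partial>leb q"
    define E1 E2 where "E1 x = exp (\<epsilon> * \<phi> x - \<epsilon>^2 * G x)" and "E2 x = exp (- \<epsilon> * \<phi> x)" for x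
    have [measurable]: "E1 \<in> borel_measurable (leb q)" "E2 \<in> borel_measurable (leb q)"
      unfolding E1_def E2_def by measurable
    have "\<epsilon> * \<phi> x - \<epsilon>^2 * G x \<le> \<epsilon> * J" "- \<epsilon> * \<phi> x \<le> \<epsilon> * J" for x
    proof -
      have "\<epsilon> * \<bar>\<phi> x\<bar> \<le> \<epsilon> * J" using \<phi>J \<epsilon> by (intro mult_left_mono) auto
      moreover have "\<epsilon> * \<phi> x \<le> \<epsilon> * \<bar>\<phi> x\<bar>" "- \<epsilon> * \<phi> x \<le> \<epsilon> * \<bar>\<phi> x\<bar>" "0 \<le> \<epsilon>^2 * G x"
        using \<epsilon> G0[of x] by (auto simp: abs_if)
      ultimately show "\<epsilon> * \<phi> x - \<epsilon>^2 * G x \<le> \<epsilon> * J" "- \<epsilon> * \<phi> x \<le> \<epsilon> * J" by linarith+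
    qed
    then have Eb: "\<bar>E1 x\<bar> \<le> exp (\<epsilon> * J)" "\<bar>E2 x\<bar> \<le> exp (\<epsilon> * J)" for x
      by (auto simp: E1_def E2_def)
    have iE: "integrable (leb q) (\<lambda>x. \<rho> x * E1 x)" "integrable (leb q) (\<lambda>x. \<rho> x * E2 x)"
      by (rule ib[OF _ Eb(1)], measurable) (rule ib[OF _ Eb(2)], measurable)
    have "ennreal (?I E1) * ennreal (?I E2) \<le> (ennreal 1)^2"
    proof -
      have "ennreal (?I E1) = (\<integral>\<^sup>+x. ennreal (\<rho> x * E1 x) \<partial>leb q)"
        using iE \<rho> by (intro nn_integral_eq_integral[symmetric]) (auto simp: E1_def)
      moreover have "ennreal (?I E2) = (\<integral>\<^sup>+x. ennreal (\<rho> x * E2 x) \<partial>leb q)"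
        using iE \<rho> by (intro nn_integral_eq_integral[symmetric]) (auto simp: E2_def)
      moreover have "ennreal 1 = (\<integral>\<^sup>+x. ennreal (\<rho> x) \<partial>leb q)"
        using int \<rho> by (subst nn_integral_eq_integral) auto
      moreover have "(\<integral>\<^sup>+x. ennreal (\<rho> x * E1 x) \<partial>leb q) * (\<integral>\<^sup>+x. ennreal (\<rho> x * E2 x) \<partial>leb q)
          \<le> (\<integral>\<^sup>+x. ennreal (\<rho> x) \<partial>leb q)^2"
        unfolding E1_def E2_def G_def
        by (rule poincare_PL_step[OF borel_measurable_integrable[OF int(1)] meas(1) meas(2) \<rho> lc taylor
            pos less_imp_le[OF \<epsilon>(1)] \<epsilon>(2)])
      ultimately show ?thesis by (simp only:)
    qed
    moreover have "0 \<le> ?I E1" "0 \<le> ?I E2" using \<rho> by (auto intro!: integral_nonneg_AE simp: E1_def E2_def)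
    ultimately have EE: "?I E1 * ?I E2 \<le> 1"
      by (simp add: ennreal_mult[symmetric])
    have "A \<epsilon> = (\<integral>x. \<rho> x + \<epsilon> * (\<rho> x * \<phi> x) + \<epsilon>^2 * ((\<rho> x * (\<phi> x)^2)/2 - \<rho> x * G x) - 9 * J^3 * \<epsilon>^3 * \<rho> x \<partial>leb q)"
      unfolding A_def m_def s_def g_def using i1 i2 i3 int by simp
    also have "\<dots> \<le> ?I E1"
    proof (rule integral_mono)
      fix x
      have "\<rho> x * (1 + \<epsilon> * \<phi> x + \<epsilon>^2 * ((\<phi> x)^2/2 - G x) - 9 * J^3 * \<epsilon>^3) \<le> \<rho> x * E1 x"
        unfolding E1_def using \<rho> low[of "G x" \<phi> x] G0 GJ \<phi>J by (intro mult_left_mono) auto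
      then show "\<rho> x + \<epsilon> * (\<rho> x * \<phi> x) + \<epsilon>^2 * ((\<rho> x * (\<phi> x)^2)/2 - \<rho> x * G x) - 9 * J^3 * \<epsilon>^3 * \<rho> x \<le> \<rho> x * E1 x"
        by (simp add: algebra_simps)
    qed (use i1 i2 i3 int iE in auto)
    finally have AE: "A \<epsilon> \<le> ?I E1" .
    have "B \<epsilon> = (\<integral>x. \<rho> x - \<epsilon> * (\<rho> x * \<phi> x) + \<epsilon>^2 * ((\<rho> x * (\<phi> x)^2)/2) - 9 * J^3 * \<epsilon>^3 * \<rho> x \<partial>leb q)"
      unfolding B_def m_def s_def using i1 i2 int by simp
    also have "\<dots> \<le> ?I E2"
    proof (rule integral_mono)
      fix x
      have "\<rho> x * (1 - \<epsilon> * \<phi> x + \<epsilon>^2 * ((\<phi> x)^2/2) - 9 * J^3 * \<epsilon>^3) \<le> \<rho> x * E2 x"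
        unfolding E2_def using \<rho> low[of 0 "\<lambda>x. - \<phi> x" x] \<phi>J J0 by (intro mult_left_mono) auto
      then show "\<rho> x - \<epsilon> * (\<rho> x * \<phi> x) + \<epsilon>^2 * ((\<rho> x * (\<phi> x)^2)/2) - 9 * J^3 * \<epsilon>^3 * \<rho> x \<le> \<rho> x * E2 x"
        by (simp add: algebra_simps)
    qed (use i1 i2 int iE in auto)
    finally have BE: "B \<epsilon> \<le> ?I E2" .
    have "A \<epsilon> * B \<epsilon> \<le> ?I E1 * ?I E2" using AE BE \<epsilon> by (intro mult_mono) auto
    with EE show ?thesis by linarith
  qed
  define u v where "u \<epsilon> = s/2 - g - 9 * J^3 * \<epsilon>" and "v \<epsilon> = s/2 - 9 * J^3 * \<epsilon>" for \<epsilon> :: real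
  \<comment> \<open>The linear terms of \<open>A\<close> and \<open>B\<close> cancel in the product,
    so that A B \<le> 1 becomes P \<le> 0 for small \<epsilon>; the limit \<open>P 0\<close> is s -
    m^2 - g.\<close>
  define P where "P \<epsilon> = u \<epsilon> + v \<epsilon> - m^2 + \<epsilon> * m * (v \<epsilon> - u \<epsilon>) + \<epsilon>^2 * (u \<epsilon> * v \<epsilon>)" for \<epsilon>
  have AB: "A \<epsilon> = 1 + \<epsilon> * m + \<epsilon>^2 * u \<epsilon>" "B \<epsilon> = 1 - \<epsilon> * m + \<epsilon>^2 * v \<epsilon>" for \<epsilon>
    by (simp_all add: A_def B_def u_def v_def algebra_simps power2_eq_square power3_eq_cube)
  have P: "A \<epsilon> * B \<epsilon> = 1 + \<epsilon>^2 * P \<epsilon>" for \<epsilon>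
    by (simp add: P_def AB algebra_simps power2_eq_square)
  have lim: "(P \<longlongrightarrow> P 0) (at_right 0)" "(A \<longlongrightarrow> A 0) (at_right 0)" "(B \<longlongrightarrow> B 0) (at_right 0)"
    unfolding P_def A_def B_def u_def v_def by (auto intro!: tendsto_eq_intros)
  have e1: "eventually (\<lambda>\<epsilon>. 0 < A \<epsilon>) (at_right 0)" "eventually (\<lambda>\<epsilon>. 0 < B \<epsilon>) (at_right 0)"
    using order_tendstoD(1)[OF lim(2), of 0] order_tendstoD(1)[OF lim(3), of 0] by (auto simp: A_def B_def)
  have e2: "eventually (\<lambda>\<epsilon>. \<epsilon> * L < \<kappa> / 4) (at_right 0)"
    by (rule order_tendstoD(2)[of _ "0 * L"]) (auto intro!: tendsto_mult_left_zero tendsto_ident_at simp: pos)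
  have e3: "eventually (\<lambda>\<epsilon>. \<epsilon> < 1 / (2 * J)) (at_right (0::real))"
    by (rule order_tendstoD(2)[of _ 0]) (use J1 in \<open>auto intro!: tendsto_intros\<close>)
  have "eventually (\<lambda>\<epsilon>. P \<epsilon> \<le> 0) (at_right 0)"
    using e1 e2 e3 eventually_at_right_less[of 0]
  proof eventually_elim
    case (elim \<epsilon>)
    then have "\<epsilon>^2 * P \<epsilon> \<le> 0" using main[of \<epsilon>] P[of \<epsilon>] by simp
    then show ?case using elim by (simp add: mult_le_0_iff)
  qed
  then have "P 0 \<le> 0" by (rule tendsto_upperbound[OF lim(1)]) simp
  then have "s - m^2 \<le> g" by (simp add: P_def u_def v_def)
  moreover have "g = 2 / \<kappa> * (\<integral>x. \<rho> x * (\<Sum>i<q. (\<Gamma> i x)^2) \<partial>leb q)"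
    unfolding g_def G_def by (simp only: mult.left_commute[of _ "2/\<kappa>"] integral_mult_right_zero)
  ultimately show ?thesis by (simp add: s_def m_def)
qed

subsection \<open>Log-partition functions of exponential families\<close>

text \<open>By the mean value theorem the difference quotients are bounded by K, and a constant is a
  dominating function because the measure is finite.\<close>

lemma has_real_derivative_integral:
  fixes f f' :: "'a \<Rightarrow> real \<Rightarrow> real"
  assumes fin: "finite_measure M" and t: "a < t" "t < b"
    and int: "\<And>s. a < s \<Longrightarrow> s < b \<Longrightarrow> integrable M (\<lambda>x. f x s)"
    and der: "\<And>x s. x \<in> space M \<Longrightarrow> a < s \<Longrightarrow> s < b \<Longrightarrow> (f x has_real_derivative f' x s) (at s)"
    and bd: "\<And>x s. x \<in> space M \<Longrightarrow> a < s \<Longrightarrow> s < b \<Longrightarrow> \<bar>f' x s\<bar> \<le> K"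
    and meas: "(\<lambda>x. f' x t) \<in> borel_measurable M"
  shows "((\<lambda>s. \<integral>x. f x s \<partial>M) has_real_derivative (\<integral>x. f' x t \<partial>M)) (at t)"
proof -
  interpret finite_measure M by fact
  define d where "d = min (t - a) (b - t)"
  have d: "0 < d" using t by (simp add: d_def)
  have inside: "a < t + h \<and> t + h < b" if "\<bar>h\<bar> < d" for h
    using that by (auto simp: d_def)
  let ?q = "\<lambda>x h. (f x (t + h) - f x t) / h"
  have qb: "\<bar>?q x h\<bar> \<le> K" if "x \<in> space M" "\<bar>h\<bar> < d" "h \<noteq> 0" for x h
  proof -
    have "\<exists>\<xi>. a < \<xi> \<and> \<xi> < b \<and> f x (t + h) - f x t = h * f' x \<xi>"
    proof (cases "h > 0")
      case True
      have "\<exists>z>t. z < t + h \<and> f x (t + h) - f x t = (t + h - t) * f' x z"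
        by (rule MVT2) (use True inside[of h] that t in \<open>auto intro!: der\<close>)
      then obtain z where "t < z" "z < t + h" "f x (t + h) - f x t = (t + h - t) * f' x z" by auto
      then show ?thesis using inside[of h] that t by (intro exI[of _ z]) auto
    next
      case False
      then have "\<exists>z>t + h. z < t \<and> f x t - f x (t + h) = (t - (t + h)) * f' x z"
        by (intro MVT2) (use inside[of h] that t in \<open>auto intro!: der\<close>)
      then obtain z where "t + h < z" "z < t" "f x t - f x (t + h) = (t - (t + h)) * f' x z" by auto
      then show ?thesis using inside[of h] that t by (intro exI[of _ z]) auto
    qed
    then obtain \<xi> where "a < \<xi>" "\<xi> < b" "f x (t + h) - f x t = h * f' x \<xi>" by auto
    then show ?thesis using bd[of x \<xi>] that by simp
  qed
  have "((\<lambda>h. ((\<integral>x. f x (t + h) \<partial>M) - (\<integral>x. f x t \<partial>M)) / h) \<longlongrightarrow> (\<integral>x. f' x t \<partial>M)) (at 0)"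
    unfolding tendsto_at_iff_sequentially comp_def
  proof (intro allI impI)
    fix X :: "nat \<Rightarrow> real" assume X: "\<forall>i. X i \<in> UNIV - {0}" "X \<longlonglongrightarrow> 0"
    have "eventually (\<lambda>i. \<bar>X i\<bar> < d) sequentially"
      using order_tendstoD(2)[OF tendsto_rabs[OF X(2)], of d] d by simp
    then obtain n0 where n0: "\<And>i. i \<ge> n0 \<Longrightarrow> \<bar>X i\<bar> < d" by (auto simp: eventually_sequentially)
    let ?Y = "\<lambda>i. X (i + n0)"
    have Y: "\<bar>?Y i\<bar> < d" "?Y i \<noteq> 0" for i using n0 X(1) by auto
    have Y0: "?Y \<longlonglongrightarrow> 0" using X(2) by (rule LIMSEQ_ignore_initial_segment)
    have "(\<lambda>i. \<integral>x. ?q x (?Y i) \<partial>M) \<longlonglongrightarrow> (\<integral>x. f' x t \<partial>M)"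
    proof (rule integral_dominated_convergence[where w = "\<lambda>_. K"])
      show "AE x in M. (\<lambda>i. ?q x (?Y i)) \<longlonglongrightarrow> f' x t"
      proof (rule AE_I2)
        fix x assume "x \<in> space M"
        from der[OF this t] have "((\<lambda>h. ?q x h) \<longlongrightarrow> f' x t) (at 0)" by (simp add: DERIV_def)
        then show "(\<lambda>i. ?q x (?Y i)) \<longlonglongrightarrow> f' x t"
          using Y Y0 unfolding tendsto_at_iff_sequentially comp_def by auto
      qed
      show "AE x in M. norm (?q x (?Y i)) \<le> K" for i
        using qb Y[of i] by (intro AE_I2) auto
      show "(\<lambda>x. ?q x (?Y i)) \<in> borel_measurable M" for i
        using borel_measurable_integrable[OF int[of "t + ?Y i"]] borel_measurable_integrable[OF int[OF t]] inside[OF Y(1)[of i]]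
        by (auto intro!: borel_measurable_divide borel_measurable_diff)
    qed (use meas in auto)
    moreover have "(\<integral>x. ?q x (?Y i) \<partial>M) = ((\<integral>x. f x (t + ?Y i) \<partial>M) - (\<integral>x. f x t \<partial>M)) / ?Y i" for i
      using int[of "t + ?Y i"] int[OF t] inside[OF Y(1)[of i]]
      by (simp only: Bochner_Integration.integral_diff integral_divide_zero)
    ultimately have "(\<lambda>i. ((\<integral>x. f x (t + ?Y i) \<partial>M) - (\<integral>x. f x t \<partial>M)) / ?Y i) \<longlonglongrightarrow> (\<integral>x. f' x t \<partial>M)" by (simp only:)
    then show "(\<lambda>i. ((\<integral>x. f x (t + X i) \<partial>M) - (\<integral>x. f x t \<partial>M)) / X i) \<longlonglongrightarrow> (\<integral>x. f' x t \<partial>M)"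
      by (rule LIMSEQ_offset)
  qed
  then show ?thesis by (simp add: DERIV_def)
qed

text \<open>The discriminant criterion, with the sign of C left to be derived. It provides two
  Cauchy--Schwarz arguments: for covariances, and for the semidefinite form at a maximizer of the
  Rayleigh quotient.\<close>

lemma quadratic_form_nonneg_imp:
  fixes A B C :: real
  assumes "\<And>l. 0 \<le> A + 2 * l * B + l^2 * C"
  shows "B^2 \<le> A * C"
proof (cases "C = 0")
  case True
  have "B = 0"
  proof (rule ccontr)
    assume "B \<noteq> 0"
    then have "A + 2 * (- (A + 1) / (2 * B)) * B = - 1" by (simp add: field_simps)
    then show False using assms[of "- (A + 1) / (2 * B)"] True by simp
  qed
  then show ?thesis using True by simp
next
  case False
  have "C > 0"
  proof (rule ccontr)
    assume "\<not> 0 < C"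
    with False have C: "C < 0" by simp
    \<comment> \<open>Large enough that l |C| dominates 1 + |A| + 2 |B| while l >= 1; a negative C
      then makes the quadratic negative at l.\<close>
    define l where "l = (1 + \<bar>A\<bar> + 2 * \<bar>B\<bar>) / \<bar>C\<bar> + 1"
    have l: "l \<ge> 1" unfolding l_def by (simp add: add_nonneg_nonneg)
    have "\<bar>C\<bar> * l \<ge> 1 + \<bar>A\<bar> + 2 * \<bar>B\<bar>" using C by (simp add: l_def field_simps)
    then have "l * (\<bar>C\<bar> * l) \<ge> l * (1 + \<bar>A\<bar> + 2 * \<bar>B\<bar>)" using l by (intro mult_left_mono) auto
    moreover have "l * \<bar>A\<bar> \<ge> \<bar>A\<bar>" using l by (simp add: mult_le_cancel_right1)
    moreover have "l * \<bar>B\<bar> \<ge> l * B" using l by (intro mult_left_mono) auto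
    moreover have "l^2 * C = - (l * (\<bar>C\<bar> * l))" "2 * l * B = 2 * (l * B)"
      "l * (1 + \<bar>A\<bar> + 2 * \<bar>B\<bar>) = l + l * \<bar>A\<bar> + 2 * (l * \<bar>B\<bar>)"
      using C by (simp_all add: power2_eq_square algebra_simps)
    ultimately have "A + 2 * l * B + l^2 * C < 0" using l by linarith
    then show False using assms[of l] by simp
  qed
  then have "0 \<le> C * (A + 2 * (- B / C) * B + (- B / C)^2 * C)" using assms[of "- B/C"] by simp
  also have "\<dots> = A * C - B^2" using \<open>C > 0\<close> by (simp add: field_simps power2_eq_square)
  finally show ?thesis by simp
qed

text \<open>The exponential family of a bounded statistic R over a finite base measure:
  \<open>W\<close> is the unnormalized and \<open>E\<close> the normalized mean under the weight exp
  (t R). With observables bounded everywhere (\<open>bm\<close>) all differentiations under the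
  integral are dominated by constants.\<close>

locale exp_family = finite_measure M for M :: "'a measure" +
  fixes R :: "'a \<Rightarrow> real" and K :: real
  assumes mass: "measure M (space M) > 0"
    and R_meas[measurable]: "R \<in> borel_measurable M" and R_bd: "\<And>x. \<bar>R x\<bar> \<le> K"
begin

definition W :: "('a \<Rightarrow> real) \<Rightarrow> real \<Rightarrow> real" where
  "W \<phi> t = (\<integral>x. \<phi> x * exp (t * R x) \<partial>M)"

definition Z :: "real \<Rightarrow> real" where
  "Z t = W (\<lambda>_. 1) t"

definition E :: "('a \<Rightarrow> real) \<Rightarrow> real \<Rightarrow> real" where
  "E \<phi> t = W \<phi> t / Z t"

definition bm :: "('a \<Rightarrow> real) \<Rightarrow> bool" where
  "bm \<phi> \<longleftrightarrow> \<phi> \<in> borel_measurable M \<and> (\<exists>c. \<forall>x. \<bar>\<phi> x\<bar> \<le> c)"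

lemma bm_const[simp, intro]: "bm (\<lambda>_. c)" by (auto simp: bm_def)
lemma bm_R[simp, intro]: "bm R" using R_bd by (auto simp: bm_def)
lemma bm_mult[intro]: "bm \<phi> \<Longrightarrow> bm \<psi> \<Longrightarrow> bm (\<lambda>x. \<phi> x * \<psi> x)"
  unfolding bm_def
proof (elim conjE exE, intro conjI)
  fix c d assume "\<forall>x. \<bar>\<phi> x\<bar> \<le> c" "\<forall>x. \<bar>\<psi> x\<bar> \<le> d"
  then have "\<forall>x. \<bar>\<phi> x * \<psi> x\<bar> \<le> c * d" unfolding abs_mult using order.trans[OF abs_ge_zero] by (blast intro: mult_mono)
  then show "\<exists>c. \<forall>x. \<bar>\<phi> x * \<psi> x\<bar> \<le> c" by blast
qed auto
lemma bm_add[intro]: "bm \<phi> \<Longrightarrow> bm \<psi> \<Longrightarrow> bm (\<lambda>x. \<phi> x + \<psi> x)"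
  unfolding bm_def
proof (elim conjE exE, intro conjI)
  fix c d assume "\<forall>x. \<bar>\<phi> x\<bar> \<le> c" "\<forall>x. \<bar>\<psi> x\<bar> \<le> d"
  then have "\<forall>x. \<bar>\<phi> x + \<psi> x\<bar> \<le> c + d" by (meson abs_triangle_ineq add_mono order_trans)
  then show "\<exists>c. \<forall>x. \<bar>\<phi> x + \<psi> x\<bar> \<le> c" by blast
qed auto
lemma bm_power2[intro]: "bm \<phi> \<Longrightarrow> bm (\<lambda>x. (\<phi> x)^2)"
  using bm_mult[of \<phi> \<phi>] by (simp add: power2_eq_square)
lemma bm_cmult[intro]: "bm \<phi> \<Longrightarrow> bm (\<lambda>x. c * \<phi> x)"
  by (rule bm_mult) simp_all
lemma bm_sum[intro]: "(\<And>i. i \<in> I \<Longrightarrow> bm (\<phi> i)) \<Longrightarrow> bm (\<lambda>x. \<Sum>i\<in>I. \<phi> i x)"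
  by (induction I rule: infinite_finite_induct) auto

lemma integrable_W: assumes "bm \<phi>" shows "integrable M (\<lambda>x. \<phi> x * exp (t * R x))"
proof -
  obtain c where c: "\<phi> \<in> borel_measurable M" "\<And>x. \<bar>\<phi> x\<bar> \<le> c" using assms by (auto simp: bm_def)
  note [measurable] = c(1)
  have "\<bar>\<phi> x * exp (t * R x)\<bar> \<le> c * exp (\<bar>t\<bar> * K)" for x
  proof -
    have "t * R x \<le> \<bar>t\<bar> * \<bar>R x\<bar>" by (metis abs_ge_self abs_mult)
    also have "\<dots> \<le> \<bar>t\<bar> * K" using R_bd by (intro mult_left_mono) auto
    finally show ?thesis unfolding abs_mult using c(2) order.trans[OF abs_ge_zero c(2)] by (intro mult_mono) auto
  qed
  then show ?thesis by (intro integrable_const_bound[where B = "c * exp (\<bar>t\<bar> * K)"]) auto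
qed

lemma W_add: "bm \<phi> \<Longrightarrow> bm \<psi> \<Longrightarrow> W (\<lambda>x. \<phi> x + \<psi> x) t = W \<phi> t + W \<psi> t"
  unfolding W_def using integrable_W by (simp add: distrib_right)
lemma W_cmult: "W (\<lambda>x. c * \<phi> x) t = c * W \<phi> t"
  unfolding W_def by (simp add: mult.assoc)

lemma W_deriv: assumes "bm \<phi>" shows "(W \<phi> has_real_derivative W (\<lambda>x. \<phi> x * R x) t) (at t)"
proof -
  obtain c where c: "\<phi> \<in> borel_measurable M" "\<And>x. \<bar>\<phi> x\<bar> \<le> c" using assms by (auto simp: bm_def)
  note [measurable] = c(1)
  have K0: "0 \<le> K" "0 \<le> c" using R_bd c(2) order.trans[OF abs_ge_zero] by blast+
  show ?thesis unfolding W_def[abs_def]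
  proof (rule has_real_derivative_integral[where a = "t - 1" and b = "t + 1" and K = "c * K * exp ((\<bar>t\<bar> + 1) * K)"])
    show "finite_measure M" by unfold_locales
    show "((\<lambda>s. \<phi> x * exp (s * R x)) has_real_derivative \<phi> x * R x * exp (s * R x)) (at s)" for x s
      by (auto intro!: derivative_eq_intros)
    fix x s assume s: "t - 1 < s" "s < t + 1"
    have "s * R x \<le> \<bar>s\<bar> * \<bar>R x\<bar>" by (metis abs_ge_self abs_mult)
    also have "\<dots> \<le> (\<bar>t\<bar> + 1) * K" using R_bd s K0 by (intro mult_mono) auto
    finally show "\<bar>\<phi> x * R x * exp (s * R x)\<bar> \<le> c * K * exp ((\<bar>t\<bar> + 1) * K)"
      unfolding abs_mult using c(2) R_bd K0 by (intro mult_mono) auto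
  qed (use integrable_W[OF assms] in auto)
qed

lemma Z_pos: "0 < Z t"
proof -
  have "0 < measure M (space M) * exp (- (\<bar>t\<bar> * K))" using mass by simp
  also have "\<dots> = (\<integral>x. exp (- (\<bar>t\<bar> * K)) \<partial>M)" by simp
  also have "\<dots> \<le> (\<integral>x. 1 * exp (t * R x) \<partial>M)"
  proof (rule integral_mono)
    fix x
    have "- (t * R x) \<le> \<bar>t\<bar> * \<bar>R x\<bar>" by (metis abs_ge_minus_self abs_mult)
    also have "\<dots> \<le> \<bar>t\<bar> * K" using R_bd by (intro mult_left_mono) auto
    finally show "exp (- (\<bar>t\<bar> * K)) \<le> 1 * exp (t * R x)" by simp
  qed (use integrable_W[of "\<lambda>_. 1"] in auto)
  finally show ?thesis by (simp add: Z_def W_def)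
qed

lemma Z_deriv: "(Z has_real_derivative W R t) (at t)"
  using W_deriv[of "\<lambda>_. 1" t] unfolding Z_def[abs_def] by simp

lemma E_add: "bm \<phi> \<Longrightarrow> bm \<psi> \<Longrightarrow> E (\<lambda>x. \<phi> x + \<psi> x) t = E \<phi> t + E \<psi> t"
  unfolding E_def by (simp add: W_add add_divide_distrib)
lemma E_cmult: "E (\<lambda>x. c * \<phi> x) t = c * E \<phi> t"
  unfolding E_def by (simp add: W_cmult)
lemma E_const: "E (\<lambda>x. c) t = c"
  using E_cmult[of c "\<lambda>_. 1" t] Z_pos[of t] by (simp add: E_def Z_def)
lemma E_sum: "finite I \<Longrightarrow> (\<And>i. i \<in> I \<Longrightarrow> bm (\<phi> i)) \<Longrightarrow> E (\<lambda>x. \<Sum>i\<in>I. \<phi> i x) t = (\<Sum>i\<in>I. E (\<phi> i) t)"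
proof (induction I rule: finite_induct)
  case (insert i I)
  then have "E (\<lambda>x. \<phi> i x + (\<Sum>i\<in>I. \<phi> i x)) t = E (\<phi> i) t + E (\<lambda>x. (\<Sum>i\<in>I. \<phi> i x)) t"
    by (intro E_add) auto
  then show ?case using insert by simp
qed (simp add: E_const)
lemma E_nonneg: "(\<And>x. 0 \<le> \<phi> x) \<Longrightarrow> 0 \<le> E \<phi> t"
  unfolding E_def W_def using Z_pos[of t] by (intro divide_nonneg_pos integral_nonneg_AE) auto
lemma E_mono: assumes "bm \<phi>" "bm \<psi>" "\<And>x. \<phi> x \<le> \<psi> x" shows "E \<phi> t \<le> E \<psi> t"
proof -
  have "0 \<le> E (\<lambda>x. \<psi> x + (-1) * \<phi> x) t" using assms(3) by (intro E_nonneg) simp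
  also have "\<dots> = E \<psi> t + (-1) * E \<phi> t"
    unfolding E_add[OF assms(2) bm_cmult[OF assms(1)]] E_cmult ..
  finally show ?thesis by simp
qed

text \<open>Quotient rule. The right-hand side is the covariance with R under the tilted law; for
  \<phi> = R it is the variance, hence the second derivative of ln Z.\<close>

lemma E_deriv: assumes "bm \<phi>"
  shows "(E \<phi> has_real_derivative (E (\<lambda>x. \<phi> x * R x) t - E \<phi> t * E R t)) (at t)"
  unfolding E_def[abs_def] using Z_pos[of t]
  by (auto intro!: derivative_eq_intros W_deriv[OF assms] Z_deriv simp: field_simps)

definition Var :: "('a \<Rightarrow> real) \<Rightarrow> real \<Rightarrow> real" where
  "Var \<phi> t = E (\<lambda>x. (\<phi> x)^2) t - (E \<phi> t)^2"

lemma Var_nonneg: assumes "bm \<phi>" shows "0 \<le> Var \<phi> t"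
proof -
  have "0 \<le> E (\<lambda>x. (\<phi> x - E \<phi> t)^2) t" by (intro E_nonneg) simp
  also have "(\<lambda>x. (\<phi> x - E \<phi> t)^2) = (\<lambda>x. (\<phi> x)^2 + ((- 2 * E \<phi> t) * \<phi> x + (E \<phi> t)^2))"
    by (simp add: fun_eq_iff power2_diff algebra_simps)
  also have "E \<dots> t = E (\<lambda>x. (\<phi> x)^2) t + ((- 2 * E \<phi> t) * E \<phi> t + (E \<phi> t)^2)"
    unfolding E_add[OF bm_power2[OF assms] bm_add[OF bm_cmult[OF assms] bm_const]]
      E_add[OF bm_cmult[OF assms] bm_const] E_cmult E_const ..
  finally show ?thesis by (simp add: Var_def power2_eq_square)
qed

text \<open>The variance of \<phi> + l R is a nonnegative quadratic polynomial in l.\<close>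

lemma cov_sq_le: assumes "bm \<phi>" shows "(E (\<lambda>x. \<phi> x * R x) t - E \<phi> t * E R t)^2 \<le> Var \<phi> t * Var R t"
proof (rule quadratic_form_nonneg_imp)
  fix l
  have "0 \<le> Var (\<lambda>x. \<phi> x + l * R x) t" by (intro Var_nonneg bm_add bm_cmult bm_R assms)
  also have "\<dots> = Var \<phi> t + 2 * l * (E (\<lambda>x. \<phi> x * R x) t - E \<phi> t * E R t) + l^2 * Var R t"
  proof -
    have "(\<lambda>x. (\<phi> x + l * R x)^2) = (\<lambda>x. (\<phi> x)^2 + ((2 * l) * (\<phi> x * R x) + l^2 * (R x)^2))"
      by (simp add: fun_eq_iff power2_sum algebra_simps power_mult_distrib)
    then have "E (\<lambda>x. (\<phi> x + l * R x)^2) t = E (\<lambda>x. (\<phi> x)^2) t + ((2 * l) * E (\<lambda>x. \<phi> x * R x) t + l^2 * E (\<lambda>x. (R x)^2) t)"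
      by (simp only: E_cmult
        E_add[OF bm_power2[OF assms] bm_add[OF bm_cmult[OF bm_mult[OF assms bm_R]] bm_cmult[OF bm_power2[OF bm_R]]]]
        E_add[OF bm_cmult[OF bm_mult[OF assms bm_R]] bm_cmult[OF bm_power2[OF bm_R]]])
    moreover have "E (\<lambda>x. \<phi> x + l * R x) t = E \<phi> t + l * E R t"
      by (simp only: E_add[OF assms bm_cmult[OF bm_R]] E_cmult)
    ultimately show ?thesis by (simp add: Var_def power2_eq_square algebra_simps)
  qed
  finally show "0 \<le> Var \<phi> t + 2 * l * (E (\<lambda>x. \<phi> x * R x) t - E \<phi> t * E R t) + l^2 * Var R t" .
qed

text \<open>The means of the gradient components \<open>\<phi> i\<close> have derivative \<open>Cov (\<phi> i) R\<close> in \<open>t\<close>, so they are bounded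
  in terms of the supremum of \<open>Var R\<close>, which the Poincare bound \<open>1\<close> then bounds in terms of itself.\<close>

theorem log_partition_bounds:
  fixes \<phi> :: "nat \<Rightarrow> 'a \<Rightarrow> real"
  assumes bm: "\<And>i. i < q \<Longrightarrow> bm (\<phi> i)" and c: "0 \<le> c" "0 \<le> M0" "0 \<le> b" "4 * c * b \<le> 1"
    and 1: "\<And>t. 0 \<le> t \<Longrightarrow> t \<le> 1 \<Longrightarrow> Var R t \<le> c * E (\<lambda>x. \<Sum>i<q. (\<phi> i x)^2) t"
    and 2: "\<And>t. 0 \<le> t \<Longrightarrow> t \<le> 1 \<Longrightarrow> (\<Sum>i<q. Var (\<phi> i) t) \<le> D"
    and 3: "\<And>t w. 0 \<le> t \<Longrightarrow> t \<le> 1 \<Longrightarrow> (\<Sum>i<q. (w i)^2) = 1 \<Longrightarrow> Var (\<lambda>x. \<Sum>i<q. w i * \<phi> i x) t \<le> b"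
    and 4: "\<And>w. (\<Sum>i<q. (w i)^2) = 1 \<Longrightarrow> E (\<lambda>x. \<Sum>i<q. w i * \<phi> i x) 0 \<le> M0"
  shows "exp (E R 0) \<le> Z 1 / Z 0" "Z 1 / Z 0 \<le> exp (E R 0 + (2 * c * D + 4 * c * M0^2))"
proof -
  have VK: "Var R t \<le> K^2" for t
  proof -
    have "(R x)^2 \<le> K^2" for x using R_bd[of x] abs_le_square_iff[of "R x" K] by (auto simp: abs_of_nonneg[OF order.trans[OF abs_ge_zero R_bd[of x]]])
    then have "E (\<lambda>x. (R x)^2) t \<le> E (\<lambda>x. K^2) t" by (intro E_mono) auto
    then show ?thesis unfolding Var_def E_const by (smt (verit) zero_le_power2)
  qed
  define V where "V = (SUP t\<in>{0..1}. Var R t)"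
  have bdd: "bdd_above (Var R ` {0..1})" using VK by (auto intro!: bdd_aboveI2)
  have VV: "Var R t \<le> V" if "0 \<le> t" "t \<le> 1" for t
    unfolding V_def using bdd that by (intro cSUP_upper) auto
  have V0: "0 \<le> V" using VV[of 0] Var_nonneg[of R 0] by auto
  have key: "Var R t \<le> c * D + 2 * c * M0^2 + V / 2" if t: "0 \<le> t" "t \<le> 1" for t
  proof -
    define m where "m = sqrt (\<Sum>i<q. (E (\<phi> i) t)^2)"
    have m2: "m^2 = (\<Sum>i<q. (E (\<phi> i) t)^2)" by (simp add: m_def sum_nonneg)
    have m0: "0 \<le> m" by (simp add: m_def sum_nonneg)
    have mle: "m \<le> M0 + sqrt (b * V)"
    proof (cases "m = 0")
      case True then show ?thesis using c V0 by simp
    next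
      case False
      \<comment> \<open>The direction of the mean gradient: the mean of \<psi> in this direction is
        the whole norm m, so a bound on one directional variance controls m.\<close>
      define w where "w i = E (\<phi> i) t / m" for i
      have w: "(\<Sum>i<q. (w i)^2) = 1"
        using False m2 by (simp add: w_def power_divide sum_divide_distrib[symmetric]) (metis divide_self power_eq_0_iff)
      define \<psi> where "\<psi> x = (\<Sum>i<q. w i * \<phi> i x)" for x
      have b\<psi>: "bm \<psi>" unfolding \<psi>_def using bm by (intro bm_sum bm_mult) auto
      have "E \<psi> t = (\<Sum>i<q. w i * E (\<phi> i) t)"
        unfolding \<psi>_def using bm by (subst E_sum) (auto simp: E_cmult)
      also have "\<dots> = (\<Sum>i<q. (E (\<phi> i) t)^2) / m" by (simp add: w_def sum_divide_distrib[symmetric] power2_eq_square)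
      also have "\<dots> = m" unfolding m2[symmetric] using False by (simp add: power2_eq_square)
      finally have Em: "E \<psi> t = m" .
      have E0: "E \<psi> 0 \<le> M0" using 4[OF w] by (simp add: \<psi>_def[abs_def])
      show ?thesis
      proof (cases "t = 0")
        case True then show ?thesis using Em E0 c V0 by (simp add: add_increasing2)
      next
        case False
        then have "\<exists>s>0. s < t \<and> E \<psi> t - E \<psi> 0 = (t - 0) * (E (\<lambda>x. \<psi> x * R x) s - E \<psi> s * E R s)"
          using t by (intro MVT2 E_deriv b\<psi>) auto
        then obtain s where s: "0 < s" "s < t" "E \<psi> t - E \<psi> 0 = t * (E (\<lambda>x. \<psi> x * R x) s - E \<psi> s * E R s)" by auto
        let ?C = "E (\<lambda>x. \<psi> x * R x) s - E \<psi> s * E R s"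
        have "?C^2 \<le> Var \<psi> s * Var R s" by (rule cov_sq_le[OF b\<psi>])
        also have "\<dots> \<le> b * V" using 3[OF _ _ w, of s] VV[of s] s t c Var_nonneg[of R s]
          by (intro mult_mono) (auto simp: \<psi>_def[abs_def])
        finally have "\<bar>?C\<bar> \<le> sqrt (b * V)" using real_le_rsqrt[of "\<bar>?C\<bar>" "b * V"] by simp
        moreover have "t * ?C \<le> 1 * \<bar>?C\<bar>" using t by (intro order.trans[OF mult_left_mono[of ?C "\<bar>?C\<bar>" t]] mult_right_mono) auto
        ultimately show ?thesis using s(3) Em E0 by simp
      qed
    qed
    have "m^2 \<le> (M0 + sqrt (b * V))^2" using mle m0 by (intro power_mono)
    also have "\<dots> \<le> 2 * M0^2 + 2 * (b * V)"
      using sum_squares_bound[of M0 "sqrt (b * V)"] c V0 by (simp add: power2_sum mult.commute[of V b])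
    finally have m3: "m^2 \<le> 2 * M0^2 + 2 * (b * V)" .
    have "E (\<lambda>x. \<Sum>i<q. (\<phi> i x)^2) t = (\<Sum>i<q. E (\<lambda>x. (\<phi> i x)^2) t)"
      using bm by (intro E_sum) auto
    also have "\<dots> = (\<Sum>i<q. Var (\<phi> i) t) + m^2" by (simp add: Var_def m2 sum_subtractf)
    also have "\<dots> \<le> D + (2 * M0^2 + 2 * (b * V))" using 2[OF t] m3 by (intro add_mono)
    finally have "c * E (\<lambda>x. \<Sum>i<q. (\<phi> i x)^2) t \<le> c * (D + (2 * M0^2 + 2 * (b * V)))"
      using c by (intro mult_left_mono)
    also have "\<dots> = c * D + 2 * c * M0^2 + (4 * c * b) * V / 2" by (simp add: algebra_simps)
    \<comment> \<open>Here 4 c b \<le> 1 is spent: at most half of V returns on the right, so the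
      inequality can be solved for V.\<close>
    also have "\<dots> \<le> c * D + 2 * c * M0^2 + V / 2" using mult_right_mono[OF c(4) V0] by (simp add: mult_ac)
    finally show ?thesis using 1[OF t] by linarith
  qed
  have "V \<le> c * D + 2 * c * M0^2 + V / 2" unfolding V_def
    by (rule cSUP_least) (use key in \<open>auto simp: V_def\<close>)
  then have V: "V \<le> 2 * c * D + 4 * c * M0^2" by linarith
  \<comment> \<open>ln Z has derivative E R, whose derivative is Var R. As the variance lies between
    0 and V, ln (Z 1 / Z 0) lies between E R 0 (Jensen) and E R 0 + V.\<close>
  have "((\<lambda>t. ln (Z t)) has_real_derivative E R t) (at t)" for t
    using Z_pos[of t] by (auto intro!: derivative_eq_intros Z_deriv simp: E_def)
  then have "\<exists>s>0. s < 1 \<and> ln (Z 1) - ln (Z 0) = (1 - 0) * E R s" by (intro MVT2) auto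
  then obtain s where s: "0 < s" "s < 1" "ln (Z 1) - ln (Z 0) = E R s" by auto
  have "\<exists>r>0. r < s \<and> E R s - E R 0 = (s - 0) * (E (\<lambda>x. R x * R x) r - E R r * E R r)"
    using s by (intro MVT2 E_deriv) auto
  then obtain r where r: "0 < r" "r < s" "E R s - E R 0 = s * Var R r" by (auto simp: Var_def power2_eq_square)
  have "0 \<le> s * Var R r" using s Var_nonneg[of R r] by simp
  moreover have "s * Var R r \<le> 1 * V"
    using s r Var_nonneg[of R r] VV[of r] by (intro mult_mono) auto
  ultimately have *: "E R 0 \<le> ln (Z 1 / Z 0)" "ln (Z 1 / Z 0) \<le> E R 0 + (2 * c * D + 4 * c * M0^2)"
    using r s V Z_pos[of 1] Z_pos[of 0] by (auto simp: ln_div)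
  have "0 < Z 1 / Z 0" using Z_pos by simp
  with * show "exp (E R 0) \<le> Z 1 / Z 0" "Z 1 / Z 0 \<le> exp (E R 0 + (2 * c * D + 4 * c * M0^2))"
    by (metis exp_le_cancel_iff exp_ln)+
qed

end

subsection \<open>Differential calculus on Euclidean balls\<close>

abbreviation nrm :: "nat \<Rightarrow> point \<Rightarrow> real" where
  "nrm q x \<equiv> L2_set x {..<q}"

lemma nrm_scale: "nrm q (\<lambda>i. s * x i) = \<bar>s\<bar> * nrm q x"
  by (simp add: L2_set_def power_mult_distrib sum_distrib_left[symmetric] real_sqrt_mult)

lemma nrm_zero: "nrm q (\<lambda>i. 0) = 0" by (simp add: L2_set_def)

lemma nrm_add: "nrm q (\<lambda>i. x i + y i) \<le> nrm q x + nrm q y"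
  by (rule L2_set_triangle_ineq)

lemma nrm_minus_commute: "nrm q (\<lambda>i. x i - y i) = nrm q (\<lambda>i. y i - x i)"
  by (auto simp: L2_set_def power2_commute)

lemma abs_coord_le_nrm: "i < q \<Longrightarrow> \<bar>x i\<bar> \<le> nrm q x"
  using member_le_L2_set[of "{..<q}" i "\<lambda>i. \<bar>x i\<bar>"] by (simp add: L2_set_def)

lemma nrm_segment_le:
  assumes "nrm q x \<le> \<rho>" "nrm q y \<le> \<rho>" "0 \<le> s" "s \<le> 1"
  shows "nrm q (\<lambda>i. x i + s * (y i - x i)) \<le> \<rho>"
proof -
  have "nrm q (\<lambda>i. x i + s * (y i - x i)) = nrm q (\<lambda>i. (1 - s) * x i + s * y i)"
    by (simp add: algebra_simps)
  also have "\<dots> \<le> (1 - s) * nrm q x + s * nrm q y"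
    using nrm_add[where q = q and x = "\<lambda>i. (1 - s) * x i" and y = "\<lambda>i. s * y i"] assms by (simp add: nrm_scale)
  also have "\<dots> \<le> \<rho>" using assms by (intro convex_bound_le) auto
  finally show ?thesis .
qed

lemma sum_abs_le_nrm: "(\<Sum>i<q. \<bar>x i\<bar>) \<le> sqrt (real q) * nrm q x"
proof -
  have "\<bar>\<Sum>i<q. 1 * \<bar>x i\<bar>\<bar> \<le> nrm q (\<lambda>_. 1) * nrm q (\<lambda>i. \<bar>x i\<bar>)" by (rule ip_le_norms)
  then show ?thesis by (simp add: L2_set_def)
qed

text \<open>Here and in \<open>has_grad\<close> points are arbitrary functions, and the seminorm
  sees only the first q coordinates. The definitions therefore also force \<phi> to ignore the other
  coordinates, at least inside the ball; \<open>has_grad\<close> is Frechet differentiability in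
  this sense.\<close>

definition cts_ball :: "nat \<Rightarrow> real \<Rightarrow> (point \<Rightarrow> real) \<Rightarrow> bool" where
  "cts_ball q \<rho> \<phi> \<longleftrightarrow> (\<forall>x. nrm q x < \<rho> \<longrightarrow>
     (\<forall>\<epsilon>>0. \<exists>d>0. \<forall>y. nrm q (\<lambda>i. y i - x i) < d \<longrightarrow> \<bar>\<phi> y - \<phi> x\<bar> < \<epsilon>))"

definition has_grad :: "nat \<Rightarrow> real \<Rightarrow> (point \<Rightarrow> real) \<Rightarrow> (nat \<Rightarrow> point \<Rightarrow> real) \<Rightarrow> bool" where
  "has_grad q \<rho> \<phi> \<Gamma> \<longleftrightarrow> (\<forall>x. nrm q x < \<rho> \<longrightarrow>
     (\<forall>\<epsilon>>0. \<exists>d>0. \<forall>y. nrm q (\<lambda>i. y i - x i) < d \<longrightarrow>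
        \<bar>\<phi> y - \<phi> x - (\<Sum>i<q. \<Gamma> i x * (y i - x i))\<bar> \<le> \<epsilon> * nrm q (\<lambda>i. y i - x i)))"

lemma has_gradD:
  assumes "has_grad q \<rho> \<phi> \<Gamma>" "nrm q x < \<rho>" "0 < \<epsilon>"
  obtains d where "0 < d" "\<And>y. nrm q (\<lambda>i. y i - x i) < d \<Longrightarrow>
        \<bar>\<phi> y - \<phi> x - (\<Sum>i<q. \<Gamma> i x * (y i - x i))\<bar> \<le> \<epsilon> * nrm q (\<lambda>i. y i - x i)"
  using assms unfolding has_grad_def by blast

lemma has_grad_imp_cts:
  assumes g: "has_grad q \<rho> \<phi> \<Gamma>"
  shows "cts_ball q \<rho> \<phi>"
  unfolding cts_ball_def
proof (intro allI impI)
  fix x and \<epsilon> :: real assume x: "nrm q x < \<rho>" and e: "0 < \<epsilon>"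
  let ?G = "nrm q (\<lambda>i. \<Gamma> i x)"
  have G0: "0 \<le> ?G" by (rule L2_set_nonneg)
  obtain d where d: "0 < d" "\<And>y. nrm q (\<lambda>i. y i - x i) < d \<Longrightarrow>
        \<bar>\<phi> y - \<phi> x - (\<Sum>i<q. \<Gamma> i x * (y i - x i))\<bar> \<le> 1 * nrm q (\<lambda>i. y i - x i)"
    using has_gradD[OF g x, of 1] by auto
  show "\<exists>d>0. \<forall>y. nrm q (\<lambda>i. y i - x i) < d \<longrightarrow> \<bar>\<phi> y - \<phi> x\<bar> < \<epsilon>"
  proof (intro exI[of _ "min d (\<epsilon> / (?G + 2))"] conjI allI impI)
    show "0 < min d (\<epsilon> / (?G + 2))" using d e G0 by (auto intro!: divide_pos_pos add_nonneg_pos)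
    fix y assume y: "nrm q (\<lambda>i. y i - x i) < min d (\<epsilon> / (?G + 2))"
    let ?n = "nrm q (\<lambda>i. y i - x i)"
    have "\<bar>\<phi> y - \<phi> x\<bar> \<le> \<bar>\<phi> y - \<phi> x - (\<Sum>i<q. \<Gamma> i x * (y i - x i))\<bar> + \<bar>\<Sum>i<q. \<Gamma> i x * (y i - x i)\<bar>" by linarith
    also have "\<dots> \<le> 1 * ?n + ?G * ?n" using d(2)[of y] y by (intro add_mono ip_le_norms) auto
    also have "\<dots> = ?n * (?G + 1)" by (simp add: algebra_simps)
    also have "\<dots> \<le> ?n * (?G + 2)" by (intro mult_left_mono L2_set_nonneg) auto
    also have "\<dots> < \<epsilon>" using y G0 by (simp add: pos_less_divide_eq)
    finally show "\<bar>\<phi> y - \<phi> x\<bar> < \<epsilon>" .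
  qed
qed

text \<open>The chain rule along a line, through which multivariate Taylor arguments are reduced to
  one real variable.\<close>

lemma has_grad_line:
  assumes g: "has_grad q \<rho> \<phi> \<Gamma>" and x: "nrm q (\<lambda>i. x i + t * v i) < \<rho>"
  shows "((\<lambda>s. \<phi> (\<lambda>i. x i + s * v i)) has_real_derivative (\<Sum>i<q. \<Gamma> i (\<lambda>i. x i + t * v i) * v i)) (at t)"
  unfolding has_field_derivative_def has_derivative_at_alt
proof (intro conjI allI impI)
  let ?x = "\<lambda>i. x i + t * v i"
  let ?D = "\<Sum>i<q. \<Gamma> i ?x * v i"
  show "bounded_linear ((*) ?D)" by (rule bounded_linear_mult_right)
  fix e :: real assume e: "0 < e"
  let ?n = "nrm q v"
  have n0: "0 \<le> ?n" by (rule L2_set_nonneg)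
  obtain d where d: "0 < d" "\<And>y. nrm q (\<lambda>i. y i - ?x i) < d \<Longrightarrow>
        \<bar>\<phi> y - \<phi> ?x - (\<Sum>i<q. \<Gamma> i ?x * (y i - ?x i))\<bar> \<le> e / (?n + 1) * nrm q (\<lambda>i. y i - ?x i)"
    using has_gradD[OF g x divide_pos_pos[OF e, of "?n + 1"]] n0 by (auto simp: add_nonneg_pos)
  show "\<exists>d>0. \<forall>y. norm (y - t) < d \<longrightarrow>
     norm (\<phi> (\<lambda>i. x i + y * v i) - \<phi> ?x - ?D * (y - t)) \<le> e * norm (y - t)"
  proof (intro exI[of _ "d / (?n + 1)"] conjI allI impI)
    show "0 < d / (?n + 1)" using d n0 by (intro divide_pos_pos add_nonneg_pos) auto
    fix y assume y: "norm (y - t) < d / (?n + 1)"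
    let ?y = "\<lambda>i. x i + y * v i"
    have df: "(\<lambda>i. ?y i - ?x i) = (\<lambda>i. (y - t) * v i)" by (auto simp: algebra_simps)
    have nn: "nrm q (\<lambda>i. ?y i - ?x i) = \<bar>y - t\<bar> * ?n" unfolding df nrm_scale ..
    have "\<bar>y - t\<bar> * ?n \<le> \<bar>y - t\<bar> * (?n + 1)" by (intro mult_left_mono) auto
    also have "\<dots> < d" using y n0 by (simp add: pos_less_divide_eq)
    finally have "\<bar>\<phi> ?y - \<phi> ?x - (\<Sum>i<q. \<Gamma> i ?x * (?y i - ?x i))\<bar> \<le> e / (?n + 1) * (\<bar>y - t\<bar> * ?n)"
      using d(2)[of ?y] unfolding nn by simp
    also have "\<dots> = e * \<bar>y - t\<bar> * (?n / (?n + 1))" by simp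
    also have "\<dots> \<le> e * \<bar>y - t\<bar> * 1" 
    proof (intro mult_left_mono)
      have "0 < ?n + 1" using n0 by linarith
      then show "?n / (?n + 1) \<le> 1" by (subst pos_divide_le_eq) auto
    qed (use e in auto)
    also have "(\<Sum>i<q. \<Gamma> i ?x * (?y i - ?x i)) = ?D * (y - t)"
      unfolding sum_distrib_right by (intro sum.cong) (auto simp: algebra_simps)
    finally show "norm (\<phi> ?y - \<phi> ?x - ?D * (y - t)) \<le> e * norm (y - t)" by simp
  qed
qed

lemma has_grad_add:
  assumes "has_grad q \<rho> \<phi> \<Gamma>" "has_grad q \<rho> \<psi> \<Delta>"
  shows "has_grad q \<rho> (\<lambda>x. \<phi> x + \<psi> x) (\<lambda>i x. \<Gamma> i x + \<Delta> i x)"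
  unfolding has_grad_def
proof (intro allI impI)
  fix x and \<epsilon> :: real assume x: "nrm q x < \<rho>" and e: "0 < \<epsilon>"
  obtain d1 where d1: "0 < d1" "\<And>y. nrm q (\<lambda>i. y i - x i) < d1 \<Longrightarrow>
        \<bar>\<phi> y - \<phi> x - (\<Sum>i<q. \<Gamma> i x * (y i - x i))\<bar> \<le> \<epsilon>/2 * nrm q (\<lambda>i. y i - x i)"
    using has_gradD[OF assms(1) x, of "\<epsilon>/2"] e by auto
  obtain d2 where d2: "0 < d2" "\<And>y. nrm q (\<lambda>i. y i - x i) < d2 \<Longrightarrow>
        \<bar>\<psi> y - \<psi> x - (\<Sum>i<q. \<Delta> i x * (y i - x i))\<bar> \<le> \<epsilon>/2 * nrm q (\<lambda>i. y i - x i)"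
    using has_gradD[OF assms(2) x, of "\<epsilon>/2"] e by auto
  show "\<exists>d>0. \<forall>y. nrm q (\<lambda>i. y i - x i) < d \<longrightarrow>
      \<bar>\<phi> y + \<psi> y - (\<phi> x + \<psi> x) - (\<Sum>i<q. (\<Gamma> i x + \<Delta> i x) * (y i - x i))\<bar> \<le> \<epsilon> * nrm q (\<lambda>i. y i - x i)"
  proof (intro exI[of _ "min d1 d2"] conjI allI impI)
    fix y assume y: "nrm q (\<lambda>i. y i - x i) < min d1 d2"
    have "(\<Sum>i<q. (\<Gamma> i x + \<Delta> i x) * (y i - x i)) = (\<Sum>i<q. \<Gamma> i x * (y i - x i)) + (\<Sum>i<q. \<Delta> i x * (y i - x i))"
      by (simp add: distrib_right sum.distrib)
    moreover have "\<epsilon> * nrm q (\<lambda>i. y i - x i) = \<epsilon>/2 * nrm q (\<lambda>i. y i - x i) + \<epsilon>/2 * nrm q (\<lambda>i. y i - x i)" by simp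
    ultimately show "\<bar>\<phi> y + \<psi> y - (\<phi> x + \<psi> x) - (\<Sum>i<q. (\<Gamma> i x + \<Delta> i x) * (y i - x i))\<bar> \<le> \<epsilon> * nrm q (\<lambda>i. y i - x i)"
      using d1(2)[of y] d2(2)[of y] y by linarith
  qed (use d1 d2 in auto)
qed

lemma has_grad_const: "has_grad q \<rho> (\<lambda>x. c) (\<lambda>i x. 0)"
  unfolding has_grad_def by (auto intro!: exI[of _ 1] mult_nonneg_nonneg L2_set_nonneg)

lemma has_grad_cmult:
  assumes "has_grad q \<rho> \<phi> \<Gamma>"
  shows "has_grad q \<rho> (\<lambda>x. c * \<phi> x) (\<lambda>i x. c * \<Gamma> i x)"
  unfolding has_grad_def
proof (intro allI impI)
  fix x and \<epsilon> :: real assume x: "nrm q x < \<rho>" and e: "0 < \<epsilon>"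
  obtain d where d: "0 < d" "\<And>y. nrm q (\<lambda>i. y i - x i) < d \<Longrightarrow>
        \<bar>\<phi> y - \<phi> x - (\<Sum>i<q. \<Gamma> i x * (y i - x i))\<bar> \<le> \<epsilon> / (\<bar>c\<bar> + 1) * nrm q (\<lambda>i. y i - x i)"
    using has_gradD[OF assms(1) x divide_pos_pos[OF e, of "\<bar>c\<bar> + 1"]] by (auto simp: add_nonneg_pos)
  show "\<exists>d>0. \<forall>y. nrm q (\<lambda>i. y i - x i) < d \<longrightarrow>
      \<bar>c * \<phi> y - c * \<phi> x - (\<Sum>i<q. c * \<Gamma> i x * (y i - x i))\<bar> \<le> \<epsilon> * nrm q (\<lambda>i. y i - x i)"
  proof (intro exI[of _ d] conjI allI impI)
    fix y assume y: "nrm q (\<lambda>i. y i - x i) < d"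
    let ?n = "nrm q (\<lambda>i. y i - x i)"
    have "c * \<phi> y - c * \<phi> x - (\<Sum>i<q. c * \<Gamma> i x * (y i - x i)) = c * (\<phi> y - \<phi> x - (\<Sum>i<q. \<Gamma> i x * (y i - x i)))"
      by (simp add: right_diff_distrib sum_distrib_left mult.assoc)
    then have "\<bar>c * \<phi> y - c * \<phi> x - (\<Sum>i<q. c * \<Gamma> i x * (y i - x i))\<bar> \<le> \<bar>c\<bar> * (\<epsilon> / (\<bar>c\<bar> + 1) * ?n)"
      using d(2)[OF y] by (simp only: abs_mult mult_left_mono abs_ge_zero)
    also have "\<dots> = \<epsilon> * ?n * (\<bar>c\<bar> / (\<bar>c\<bar> + 1))" by simp
    also have "\<dots> \<le> \<epsilon> * ?n * 1" using e by (intro mult_left_mono) (auto intro: mult_nonneg_nonneg L2_set_nonneg)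
    finally show "\<bar>c * \<phi> y - c * \<phi> x - (\<Sum>i<q. c * \<Gamma> i x * (y i - x i))\<bar> \<le> \<epsilon> * ?n" by simp
  qed (use d in auto)
qed

lemma has_grad_sum:
  assumes "finite I" "\<And>a. a \<in> I \<Longrightarrow> has_grad q \<rho> (\<phi> a) (\<Gamma> a)"
  shows "has_grad q \<rho> (\<lambda>x. \<Sum>a\<in>I. \<phi> a x) (\<lambda>i x. \<Sum>a\<in>I. \<Gamma> a i x)"
  using assms
proof (induction I rule: finite_induct)
  case empty then show ?case using has_grad_const[of q \<rho> 0] by simp
next
  case (insert a I)
  then show ?case using has_grad_add[of q \<rho> "\<phi> a" "\<Gamma> a" "\<lambda>x. \<Sum>a\<in>I. \<phi> a x"] by simp
qed

lemma has_grad_scale: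
  assumes g: "has_grad q \<rho> \<phi> \<Gamma>" and s: "\<bar>s\<bar> \<le> 1"
  shows "has_grad q \<rho> (\<lambda>x. \<phi> (\<lambda>i. s * x i)) (\<lambda>i x. s * \<Gamma> i (\<lambda>i. s * x i))"
  unfolding has_grad_def
proof (intro allI impI)
  fix x and \<epsilon> :: real assume x: "nrm q x < \<rho>" and e: "0 < \<epsilon>"
  have le: "\<bar>s\<bar> * nrm q z \<le> nrm q z" for z
    using mult_right_mono[OF s L2_set_nonneg[of z "{..<q}"]] by simp
  have "nrm q (\<lambda>i. s * x i) < \<rho>" using x le[of x] by (simp add: nrm_scale)
  from has_gradD[OF g this e] obtain d where d: "0 < d" "\<And>y. nrm q (\<lambda>i. y i - s * x i) < d \<Longrightarrow>
        \<bar>\<phi> y - \<phi> (\<lambda>i. s * x i) - (\<Sum>i<q. \<Gamma> i (\<lambda>i. s * x i) * (y i - s * x i))\<bar> \<le> \<epsilon> * nrm q (\<lambda>i. y i - s * x i)"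
    by auto
  show "\<exists>d>0. \<forall>y. nrm q (\<lambda>i. y i - x i) < d \<longrightarrow>
     \<bar>\<phi> (\<lambda>i. s * y i) - \<phi> (\<lambda>i. s * x i) - (\<Sum>i<q. s * \<Gamma> i (\<lambda>i. s * x i) * (y i - x i))\<bar> \<le> \<epsilon> * nrm q (\<lambda>i. y i - x i)"
  proof (intro exI[of _ d] conjI allI impI)
    fix y assume y: "nrm q (\<lambda>i. y i - x i) < d"
    have n: "nrm q (\<lambda>i. s * y i - s * x i) = \<bar>s\<bar> * nrm q (\<lambda>i. y i - x i)"
      by (simp add: right_diff_distrib[symmetric] nrm_scale)
    have "\<bar>\<phi> (\<lambda>i. s * y i) - \<phi> (\<lambda>i. s * x i) - (\<Sum>i<q. \<Gamma> i (\<lambda>i. s * x i) * (s * y i - s * x i))\<bar>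
       \<le> \<epsilon> * (\<bar>s\<bar> * nrm q (\<lambda>i. y i - x i))"
      using d(2)[of "\<lambda>i. s * y i"] y le[of "\<lambda>i. y i - x i"] unfolding n by linarith
    also have "\<dots> \<le> \<epsilon> * nrm q (\<lambda>i. y i - x i)" using e by (intro mult_left_mono le) auto
    also have "(\<Sum>i<q. \<Gamma> i (\<lambda>i. s * x i) * (s * y i - s * x i)) = (\<Sum>i<q. s * \<Gamma> i (\<lambda>i. s * x i) * (y i - x i))"
      by (intro sum.cong) (auto simp: algebra_simps)
    finally show "\<bar>\<phi> (\<lambda>i. s * y i) - \<phi> (\<lambda>i. s * x i) - (\<Sum>i<q. s * \<Gamma> i (\<lambda>i. s * x i) * (y i - x i))\<bar> \<le> \<epsilon> * nrm q (\<lambda>i. y i - x i)" .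
  qed (use d in auto)
qed

lemma has_grad_linear: "has_grad q \<rho> (\<lambda>x. \<Sum>i<q. a i * x i) (\<lambda>i x. a i)"
  unfolding has_grad_def
  by (auto intro!: exI[of _ 1] mult_nonneg_nonneg L2_set_nonneg simp: right_diff_distrib sum_subtractf)

lemma has_grad_quadratic:
  assumes sym: "\<And>i j. i < q \<Longrightarrow> j < q \<Longrightarrow> H i j = H j i"
    and bd: "\<And>v. \<bar>\<Sum>i<q. \<Sum>j<q. H i j * v i * v j\<bar> \<le> c * (nrm q v)^2"
  shows "has_grad q \<rho> (\<lambda>x. (\<Sum>i<q. \<Sum>j<q. H i j * x i * x j) / 2) (\<lambda>i x. \<Sum>j<q. H i j * x j)"
  unfolding has_grad_def
proof (intro allI impI)
  fix x and \<epsilon> :: real assume x: "nrm q x < \<rho>" and e: "0 < \<epsilon>"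
  let ?Q = "\<lambda>u v. \<Sum>i<q. \<Sum>j<q. H i j * u i * v j"
  show "\<exists>d>0. \<forall>y. nrm q (\<lambda>i. y i - x i) < d \<longrightarrow>
      \<bar>?Q y y / 2 - ?Q x x / 2 - (\<Sum>i<q. (\<Sum>j<q. H i j * x j) * (y i - x i))\<bar> \<le> \<epsilon> * nrm q (\<lambda>i. y i - x i)"
  proof (intro exI[of _ "\<epsilon> / (\<bar>c\<bar> + 1)"] conjI allI impI)
    show "0 < \<epsilon> / (\<bar>c\<bar> + 1)" using e by (simp add: add_nonneg_pos)
    fix y assume y: "nrm q (\<lambda>i. y i - x i) < \<epsilon> / (\<bar>c\<bar> + 1)"
    let ?v = "\<lambda>i. y i - x i"
    let ?n = "nrm q ?v"
    have Qs: "?Q u v = ?Q v u" for u v :: point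
      by (subst sum.swap) (auto intro!: sum.cong simp: sym)
    have "?Q y y = ?Q x x + ?Q x ?v + ?Q ?v x + ?Q ?v ?v"
      by (simp add: sum.distrib[symmetric] algebra_simps)
    moreover have "(\<Sum>i<q. (\<Sum>j<q. H i j * x j) * (y i - x i)) = ?Q ?v x"
      by (simp add: sum_distrib_right sum_distrib_left mult_ac)
    ultimately have "?Q y y / 2 - ?Q x x / 2 - (\<Sum>i<q. (\<Sum>j<q. H i j * x j) * (y i - x i)) = ?Q ?v ?v / 2"
      using Qs[of x ?v] by (simp add: field_simps)
    then have "\<bar>?Q y y / 2 - ?Q x x / 2 - (\<Sum>i<q. (\<Sum>j<q. H i j * x j) * (y i - x i))\<bar> \<le> c * ?n^2 / 2"
      using bd[of ?v] by (simp only: abs_divide)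
    also have "\<dots> \<le> (\<bar>c\<bar> + 1) * ?n * ?n"
    proof -
      have "c * ?n^2 \<le> \<bar>c\<bar> * ?n^2" by (intro mult_right_mono) auto
      moreover have "0 \<le> ?n^2" "0 \<le> \<bar>c\<bar> * ?n^2" by auto
      moreover have "(\<bar>c\<bar> + 1) * ?n * ?n = \<bar>c\<bar> * ?n^2 + ?n^2" by (simp add: power2_eq_square algebra_simps)
      ultimately show ?thesis by linarith
    qed
    also have "\<dots> \<le> \<epsilon> * ?n"
      using y by (intro mult_right_mono L2_set_nonneg) (simp add: pos_less_divide_eq add_nonneg_pos mult.commute)
    finally show "\<bar>?Q y y / 2 - ?Q x x / 2 - (\<Sum>i<q. (\<Sum>j<q. H i j * x j) * (y i - x i))\<bar> \<le> \<epsilon> * ?n" .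
  qed
qed

section \<open>Measurability, translation invariance and Taylor formulas along rays\<close>

lemma nrm_measurable[measurable]: "(\<lambda>x. nrm q x) \<in> borel_measurable (leb q)"
  unfolding L2_set_def leb_def by measurable

lemma coord_measurable: "i < q \<Longrightarrow> (\<lambda>x. x i) \<in> borel_measurable (leb q)"
  unfolding leb_def by measurable

text \<open>Continuity lives on the space of all functions with the product topology,
  \<open>leb q\<close> on the product over the first q indices. The map \<open>E\<close>, which sets
  the remaining coordinates to 0, is measurable between them, and \<phi> does not distinguish x from
  E x inside the ball.\<close>

lemma cts_ball_measurable:
  assumes c: "cts_ball q \<rho> \<phi>"
  shows "(\<lambda>x. indicator {x. nrm q x < \<rho>} x * \<phi> x) \<in> borel_measurable (leb q)"
proof -
  let ?U = "{x::point. nrm q x < \<rho>}"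
  have cn: "continuous_on UNIV (\<lambda>x::point. nrm q x)"
    unfolding L2_set_def by (intro continuous_intros continuous_on_product_coordinates)
  have cd: "open {y::point. nrm q (\<lambda>i. y i - x i) < d}" for x d
  proof -
    have "continuous_on UNIV (\<lambda>y::point. nrm q (\<lambda>i. y i - x i))"
      unfolding L2_set_def by (intro continuous_intros continuous_on_product_coordinates)
    then show ?thesis by (intro open_Collect_less) auto
  qed
  have oU: "open ?U" using cn by (intro open_Collect_less) auto
  have "continuous_on ?U \<phi>"
    unfolding continuous_on_topological
  proof (intro ballI allI impI)
    fix x B assume x: "x \<in> ?U" and B: "open B" "\<phi> x \<in> B"
    then obtain e where e: "0 < e" "ball (\<phi> x) e \<subseteq> B" using openE by blast
    from c x e obtain d where d: "0 < d" "\<And>y. nrm q (\<lambda>i. y i - x i) < d \<Longrightarrow> \<bar>\<phi> y - \<phi> x\<bar> < e"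
      unfolding cts_ball_def by blast
    show "\<exists>A. open A \<and> x \<in> A \<and> (\<forall>y\<in>?U. y \<in> A \<longrightarrow> \<phi> y \<in> B)"
      by (rule exI[of _ "{y. nrm q (\<lambda>i. y i - x i) < d}"])
        (use cd d e in \<open>auto simp: nrm_zero dist_real_def abs_minus_commute subset_iff\<close>)
  qed
  then have m1: "(\<lambda>x. indicator ?U x *\<^sub>R \<phi> x) \<in> borel_measurable borel"
    using oU by (intro borel_measurable_continuous_on_indicator) auto
  define E where "E x = (\<lambda>i. if i < q then x i else 0)" for x :: point
  have "E \<in> measurable (leb q) (Pi\<^sub>M UNIV (\<lambda>_. borel))"
    unfolding E_def
  proof (rule measurable_PiM_single')
    fix i show "(\<lambda>x. if i < q then x i else 0) \<in> measurable (leb q) borel"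
      using coord_measurable[of i q] by (cases "i < q") auto
  qed auto
  then have "E \<in> measurable (leb q) borel"
    by (simp add: sets_PiM_equal_borel cong: measurable_cong_sets)
  from measurable_compose[OF this m1]
  have "(\<lambda>x. indicator ?U (E x) *\<^sub>R \<phi> (E x)) \<in> borel_measurable (leb q)" .
  moreover have "indicator ?U (E x) *\<^sub>R \<phi> (E x) = indicator ?U x * \<phi> x" for x
  proof -
    have n: "nrm q (E x) = nrm q x" by (auto simp: E_def L2_set_def)
    show ?thesis
    proof (cases "nrm q x < \<rho>")
      case True
      have "\<bar>\<phi> (E x) - \<phi> x\<bar> < e" if e: "0 < e" for e
      proof -
        from c True e obtain d where d: "0 < d" "\<And>y. nrm q (\<lambda>i. y i - x i) < d \<Longrightarrow> \<bar>\<phi> y - \<phi> x\<bar> < e"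
          unfolding cts_ball_def by blast
        show ?thesis using d by (auto simp: E_def L2_set_def)
      qed
      then have "\<phi> (E x) = \<phi> x" by (metis abs_ge_zero eq_iff_diff_eq_0 less_irrefl zero_less_abs_iff)
      then show ?thesis using n True by simp
    qed (use n in auto)
  qed
  ultimately show ?thesis by simp
qed

lemma cts_ball_measurable_closed:
  assumes c: "cts_ball q \<rho> \<phi>" and r: "r < \<rho>"
  shows "(\<lambda>x. indicator {x. nrm q x \<le> r} x * \<phi> x) \<in> borel_measurable (leb q)"
proof -
  note [measurable] = cts_ball_measurable[OF c]
  have "(\<lambda>x. indicator {x. nrm q x \<le> r} x * \<phi> x) = (\<lambda>x. (if nrm q x \<le> r then 1 else 0) * (indicator {x. nrm q x < \<rho>} x * \<phi> x))"
    using r by (auto simp: indicator_def)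
  also have "\<dots> \<in> borel_measurable (leb q)" by measurable
  finally show ?thesis .
qed

lemma nn_integral_leb_translateanslate:
  assumes [measurable]: "f \<in> borel_measurable (leb q)"
  shows "(\<integral>\<^sup>+x. f (\<lambda>i\<in>{..<q}. c i + x i) \<partial>leb q) = (\<integral>\<^sup>+x. f x \<partial>leb q)"
    "leb q = distr (leb q) (leb q) (\<lambda>x. \<lambda>i\<in>{..<q}. c i + x i)"
proof -
  let ?T = "\<lambda>x. \<lambda>i\<in>{..<q}. c i + x i"
  have T[measurable]: "?T \<in> measurable (leb q) (leb q)"
    unfolding leb_def by measurable
  show eq: "leb q = distr (leb q) (leb q) ?T"
    unfolding leb_def
  proof (rule lborel_prod.PiM_eqI[symmetric])
    fix A assume A: "\<And>i. i \<in> {..<q} \<Longrightarrow> A i \<in> sets (lborel :: real measure)"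
    have "?T -` (Pi\<^sub>E {..<q} A) \<inter> space (Pi\<^sub>M {..<q} (\<lambda>_. lborel)) = Pi\<^sub>E {..<q} (\<lambda>i. {x. c i + x \<in> A i})"
    proof (rule Set.set_eqI)
      fix x show "x \<in> ?T -` (Pi\<^sub>E {..<q} A) \<inter> space (Pi\<^sub>M {..<q} (\<lambda>_. lborel)) \<longleftrightarrow> x \<in> Pi\<^sub>E {..<q} (\<lambda>i. {x. c i + x \<in> A i})"
        unfolding Int_iff vimage_eq PiE_iff space_PiM by auto
    qed
    then have "emeasure (distr (Pi\<^sub>M {..<q} (\<lambda>_. lborel)) (Pi\<^sub>M {..<q} (\<lambda>_. lborel)) ?T) (Pi\<^sub>E {..<q} A)
      = emeasure (Pi\<^sub>M {..<q} (\<lambda>_. lborel)) (Pi\<^sub>E {..<q} (\<lambda>i. {x. c i + x \<in> A i}))"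
      using T A by (subst emeasure_distr) (auto simp: leb_def intro!: sets_PiM_I_finite)
    also have "\<dots> = (\<Prod>i<q. emeasure lborel {x. c i + x \<in> A i})"
    proof (rule lborel_prod.emeasure_PiM)
      fix i assume "i \<in> {..<q}"
      then have [measurable]: "A i \<in> sets borel" using A by simp
      show "{x. c i + x \<in> A i} \<in> sets lborel" by measurable
    qed simp
    also have "\<dots> = (\<Prod>i<q. emeasure lborel (A i))"
    proof (intro prod.cong refl)
      fix i assume "i \<in> {..<q}"
      then show "emeasure lborel {x. c i + x \<in> A i} = emeasure lborel (A i)"
        using emeasure_lborel_shift[of "A i" "- c i"] A by (simp add: add.commute)
    qed
    finally show "emeasure (distr (Pi\<^sub>M {..<q} (\<lambda>_. lborel)) (Pi\<^sub>M {..<q} (\<lambda>_. lborel)) ?T) (Pi\<^sub>E {..<q} A)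
       = (\<Prod>i\<in>{..<q}. emeasure lborel (A i))" .
  qed auto
  show "(\<integral>\<^sup>+x. f (?T x) \<partial>leb q) = (\<integral>\<^sup>+x. f x \<partial>leb q)"
    by (subst (2) eq) (simp add: nn_integral_distr)
qed

lemma has_grad_ray:
  assumes "has_grad q \<rho> \<phi> \<Gamma>" "nrm q (\<lambda>i. t * x i) < \<rho>"
  shows "((\<lambda>s. \<phi> (\<lambda>i. s * x i)) has_real_derivative (\<Sum>i<q. \<Gamma> i (\<lambda>i. t * x i) * x i)) (at t)"
  using has_grad_line[OF assms(1), of "\<lambda>_. 0" t x] assms(2) by simp

lemma has_grad_ray1:
  assumes g: "has_grad q \<rho> \<phi> \<Gamma>" and x: "nrm q x < \<rho>"
  obtains \<xi> where "0 < \<xi>" "\<xi> < 1" "\<phi> x = \<phi> (\<lambda>_. 0) + (\<Sum>i<q. \<Gamma> i (\<lambda>i. \<xi> * x i) * x i)"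
proof -
  have "nrm q (\<lambda>i. t * x i) < \<rho>" if "0 \<le> t" "t \<le> 1" for t
    using that x mult_left_le_one_le[OF L2_set_nonneg[of x "{..<q}"], of t] by (simp add: nrm_scale)
  then have "\<exists>z>0. z < 1 \<and> \<phi> (\<lambda>i. 1 * x i) - \<phi> (\<lambda>i. 0 * x i) = (1 - 0) * (\<Sum>i<q. \<Gamma> i (\<lambda>i. z * x i) * x i)"
    by (intro MVT2 has_grad_ray[OF g]) auto
  then obtain \<xi> where "0 < \<xi>" "\<xi> < 1" "\<phi> x - \<phi> (\<lambda>_. 0) = (\<Sum>i<q. \<Gamma> i (\<lambda>i. \<xi> * x i) * x i)" by auto
  then show ?thesis by (intro that[of \<xi>]) auto
qed

lemma taylor2_unit:
  fixes f f' f'' :: "real \<Rightarrow> real"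
  assumes "\<And>t. 0 \<le> t \<Longrightarrow> t \<le> 1 \<Longrightarrow> (f has_real_derivative f' t) (at t)"
    "\<And>t. 0 \<le> t \<Longrightarrow> t \<le> 1 \<Longrightarrow> (f' has_real_derivative f'' t) (at t)"
  obtains \<xi> where "0 < \<xi>" "\<xi> < 1" "f 1 = f 0 + f' 0 + f'' \<xi> / 2"
proof -
  let ?d = "\<lambda>m::nat. if m = 0 then f else if m = 1 then f' else f''"
  have "\<exists>t>0. t < 1 \<and> f 1 = (\<Sum>m<2. (?d m 0 / fact m) * 1 ^ m) + (?d 2 t / fact 2) * 1 ^ 2"
  proof (rule Maclaurin)
    show "\<forall>m t. m < 2 \<and> 0 \<le> t \<and> t \<le> 1 \<longrightarrow> DERIV (?d m) t :> ?d (Suc m) t"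
      using assms by (auto simp: less_Suc_eq numeral_2_eq_2)
  qed auto
  then show ?thesis using that by (auto simp: numeral_2_eq_2)
qed

text \<open>The expansion is made for a function of one variable, so a single intermediate point
  \<xi> serves all index pairs. Contracted tensors can thus be bounded as forms instead of entry by
  entry.\<close>

lemma has_grad_ray2:
  assumes g: "has_grad q \<rho> \<phi> \<Gamma>" and g2: "\<And>i. i < q \<Longrightarrow> has_grad q \<rho> (\<Gamma> i) (\<Delta> i)"
    and x: "nrm q x < \<rho>"
  obtains \<xi> where "0 < \<xi>" "\<xi> < 1"
    "\<phi> x = \<phi> (\<lambda>_. 0) + (\<Sum>i<q. \<Gamma> i (\<lambda>_. 0) * x i) + (\<Sum>i<q. (\<Sum>j<q. \<Delta> i j (\<lambda>i. \<xi> * x i) * x j) * x i) / 2"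
proof -
  have n: "nrm q (\<lambda>i. t * x i) < \<rho>" if "0 \<le> t" "t \<le> 1" for t
    using that x mult_left_le_one_le[OF L2_set_nonneg[of x "{..<q}"], of t] by (simp add: nrm_scale)
  let ?f = "\<lambda>s. \<phi> (\<lambda>i. s * x i)" and ?f' = "\<lambda>s. \<Sum>i<q. \<Gamma> i (\<lambda>i. s * x i) * x i"
    and ?f'' = "\<lambda>s. \<Sum>i<q. (\<Sum>j<q. \<Delta> i j (\<lambda>i. s * x i) * x j) * x i"
  obtain \<xi> where "0 < \<xi>" "\<xi> < 1" "?f 1 = ?f 0 + ?f' 0 + ?f'' \<xi> / 2"
  proof (rule taylor2_unit[of ?f ?f' ?f''])
    fix t :: real assume t: "0 \<le> t" "t \<le> 1"
    show "(?f has_real_derivative ?f' t) (at t)" by (rule has_grad_ray[OF g n[OF t]])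
    show "(?f' has_real_derivative ?f'' t) (at t)"
      by (intro DERIV_sum DERIV_cmult_right has_grad_ray[OF g2 n[OF t]]) auto
  qed
  then show ?thesis by (intro that[of \<xi>]) auto
qed

subsection \<open>Derivative bounds for the remainder\<close>

lemma sum_rot3:
  fixes F :: "nat \<Rightarrow> nat \<Rightarrow> nat \<Rightarrow> real"
  shows "(\<Sum>a<q. \<Sum>b<q. \<Sum>c<q. F a b c) = (\<Sum>c<q. \<Sum>a<q. \<Sum>b<q. F a b c)"
proof -
  have "(\<Sum>a<q. \<Sum>b<q. \<Sum>c<q. F a b c) = (\<Sum>a<q. \<Sum>c<q. \<Sum>b<q. F a b c)"
    by (rule sum.cong[OF refl]) (rule sum.swap)
  also have "\<dots> = (\<Sum>c<q. \<Sum>a<q. \<Sum>b<q. F a b c)" by (rule sum.swap)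
  finally show ?thesis .
qed

lemma abs_sum_mult_le:
  fixes g w :: "nat \<Rightarrow> real"
  assumes "\<And>c. c < q \<Longrightarrow> \<bar>g c\<bar> \<le> K"
  shows "\<bar>\<Sum>c<q. g c * w c\<bar> \<le> K * (\<Sum>c<q. \<bar>w c\<bar>)"
proof -
  have "\<bar>\<Sum>c<q. g c * w c\<bar> \<le> (\<Sum>c<q. K * \<bar>w c\<bar>)"
    using assms by (intro order.trans[OF sum_abs] sum_mono) (auto simp: abs_mult intro!: mult_right_mono)
  then show ?thesis by (simp add: sum_distrib_left)
qed

text \<open>\<open>R\<close> is the remainder of a function after removal of its quadratic part \<open>- x\<^sup>T H x / 2\<close>, with
  derivatives \<open>R1\<close> to \<open>R4\<close>; \<open>S\<close> is the inverse of \<open>H\<close>. The integrals are taken over the ball of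
  radius \<open>r\<close>, the derivatives exist on the larger ball of radius \<open>\<rho>\<close>.\<close>

locale ball_fn =
  fixes q :: nat and r \<rho> \<kappa> \<kappa>2 C :: real and H S :: "nat \<Rightarrow> nat \<Rightarrow> real"
    and R :: "point \<Rightarrow> real" and R1 :: "nat \<Rightarrow> point \<Rightarrow> real" and R2 :: "nat \<Rightarrow> nat \<Rightarrow> point \<Rightarrow> real"
    and R3 :: "nat \<Rightarrow> nat \<Rightarrow> nat \<Rightarrow> point \<Rightarrow> real"
    and R4 :: "nat \<Rightarrow> nat \<Rightarrow> nat \<Rightarrow> nat \<Rightarrow> point \<Rightarrow> real"
  assumes q: "0 < q" and r: "0 < r" "r < \<rho>" and \<kappa>: "0 < \<kappa>" and C: "0 \<le> C"
    and H_sym: "\<And>i j. i < q \<Longrightarrow> j < q \<Longrightarrow> H i j = H j i"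
    and H_low: "\<And>v. \<kappa> * (nrm q v)^2 \<le> (\<Sum>i<q. \<Sum>j<q. H i j * v i * v j)"
    and H_up: "\<And>v. (\<Sum>i<q. \<Sum>j<q. H i j * v i * v j) \<le> \<kappa>2 * (nrm q v)^2"
    and S_sym: "\<And>i j. i < q \<Longrightarrow> j < q \<Longrightarrow> S i j = S j i"
    and HS: "\<And>i k. i < q \<Longrightarrow> k < q \<Longrightarrow> (\<Sum>j<q. H i j * S j k) = (if i = k then 1 else 0)"
    and gR: "has_grad q \<rho> R R1" "\<And>a. a < q \<Longrightarrow> has_grad q \<rho> (R1 a) (R2 a)"
      "\<And>a b. a < q \<Longrightarrow> b < q \<Longrightarrow> has_grad q \<rho> (R2 a b) (R3 a b)"
      "\<And>a b c. a < q \<Longrightarrow> b < q \<Longrightarrow> c < q \<Longrightarrow> has_grad q \<rho> (R3 a b c) (R4 a b c)"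
      "\<And>a b c d. a < q \<Longrightarrow> b < q \<Longrightarrow> c < q \<Longrightarrow> d < q \<Longrightarrow> cts_ball q \<rho> (R4 a b c d)"
    and R0: "R (\<lambda>_. 0) = 0" "\<And>a. a < q \<Longrightarrow> R1 a (\<lambda>_. 0) = 0"
      "\<And>a b. a < q \<Longrightarrow> b < q \<Longrightarrow> R2 a b (\<lambda>_. 0) = 0"
    and R2_sym: "\<And>a b x. a < q \<Longrightarrow> b < q \<Longrightarrow> nrm q x < \<rho> \<Longrightarrow> R2 a b x = R2 b a x"
    and R3_sym: "\<And>a b c x. a < q \<Longrightarrow> b < q \<Longrightarrow> c < q \<Longrightarrow> nrm q x < \<rho> \<Longrightarrow>
        R3 a b c x = R3 b a c x \<and> R3 a b c x = R3 a c b x"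
    and R4_sym: "\<And>a b c d x. a < q \<Longrightarrow> b < q \<Longrightarrow> c < q \<Longrightarrow> d < q \<Longrightarrow> nrm q x < \<rho> \<Longrightarrow>
        R4 a b c d x = R4 b a c d x \<and> R4 a b c d x = R4 a c b d x \<and> R4 a b c d x = R4 a b d c x"
    and T3: "\<And>c u v. c < q \<Longrightarrow> \<bar>\<Sum>a<q. \<Sum>b<q. R3 a b c (\<lambda>_. 0) * u a * v b\<bar> \<le> C * nrm q u * nrm q v"
    and T4: "\<And>c d x u v. c < q \<Longrightarrow> d < q \<Longrightarrow> nrm q x < \<rho> \<Longrightarrow>
        \<bar>\<Sum>a<q. \<Sum>b<q. R4 a b c d x * u a * v b\<bar> \<le> C * nrm q u * nrm q v"
    and conv: "\<And>x v. nrm q x < \<rho> \<Longrightarrow> \<kappa> * (nrm q v)^2 \<le> (\<Sum>a<q. \<Sum>b<q. (H a b - R2 a b x) * v a * v b)"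
begin

text \<open>Compositions of adjacent transpositions that bring a prescribed index into the slot that
  \<open>T3\<close> keeps fixed; the next lemma does the same for \<open>T4\<close>.\<close>

lemma R3_perm:
  assumes "a < q" "b < q" "c < q" "nrm q x < \<rho>"
  shows "R3 a b c x = R3 b c a x" "R3 a b c x = R3 c b a x"
proof -
  have "R3 a b c x = R3 b a c x" "R3 b a c x = R3 b c a x" "R3 b c a x = R3 c b a x"
    using R3_sym assms by blast+
  then show "R3 a b c x = R3 b c a x" "R3 a b c x = R3 c b a x" by simp_all
qed

lemma R4_perm:
  assumes "a < q" "b < q" "c < q" "d < q" "nrm q x < \<rho>"
  shows "R4 a b c d x = R4 c b a d x" "R4 a b c d x = R4 b c a d x" "R4 a b c d x = R4 b d a c x"
proof -
  have "R4 a b c d x = R4 b a c d x" "R4 b a c d x = R4 b c a d x" "R4 b c a d x = R4 c b a d x"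
    "R4 b a c d x = R4 b a d c x" "R4 b a d c x = R4 b d a c x"
    using R4_sym assms by blast+
  then show "R4 a b c d x = R4 c b a d x" "R4 a b c d x = R4 b c a d x" "R4 a b c d x = R4 b d a c x"
    by simp_all
qed

abbreviation "B \<equiv> {x::point. nrm q x \<le> r}"

lemma B_in: "nrm q x \<le> r \<Longrightarrow> nrm q x < \<rho>" using r by simp

lemma B_scale: "nrm q x \<le> r \<Longrightarrow> 0 \<le> s \<Longrightarrow> s \<le> 1 \<Longrightarrow> nrm q (\<lambda>i. s * x i) \<le> r"
  using mult_left_le_one_le[OF L2_set_nonneg[of x "{..<q}"], of s] by (simp add: nrm_scale)

lemma zero_in: "nrm q (\<lambda>_. 0) < \<rho>" using r by (simp add: nrm_zero)

lemma sum_abs_B: "nrm q x \<le> r \<Longrightarrow> (\<Sum>c<q. \<bar>x c\<bar>) \<le> sqrt (real q) * r"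
  by (rule order.trans[OF sum_abs_le_nrm]) (auto intro: mult_left_mono)

text \<open>Bounds on the Hessian \<open>R2\<close> over the ball, from its second-order expansion
  at 0, where it vanishes: \<beta> for the operator norm and \<open>\<gamma>1\<close> for the norm
  of one row. A single row saves a factor sqrt q.\<close>

definition \<beta> :: real where "\<beta> = C * (sqrt (real q) * r + real q * r^2 / 2)"
definition \<gamma>1 :: real where "\<gamma>1 = C * (r + sqrt (real q) * r^2 / 2)"

lemma \<beta>_nonneg: "0 \<le> \<beta>" using C r by (simp add: \<beta>_def)

text \<open>\<open>T3\<close> and \<open>T4\<close> control forms in the first two indices, which
  are taken by u and v. Every further index is contracted with x through the l1 norm of x, each time
  at the cost of a factor sqrt q r.\<close>

lemma R2_bilinear_bound:
  assumes x: "nrm q x \<le> r"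
  shows "\<bar>\<Sum>a<q. \<Sum>b<q. u a * v b * R2 a b x\<bar> \<le> \<beta> * nrm q u * nrm q v"
proof -
  let ?F = "\<lambda>x. \<Sum>a<q. \<Sum>b<q. u a * v b * R2 a b x"
  have g1: "has_grad q \<rho> ?F (\<lambda>c x. \<Sum>a<q. \<Sum>b<q. u a * v b * R3 a b c x)"
    by (intro has_grad_sum has_grad_cmult gR) auto
  have g2: "has_grad q \<rho> (\<lambda>x. \<Sum>a<q. \<Sum>b<q. u a * v b * R3 a b c x) (\<lambda>d x. \<Sum>a<q. \<Sum>b<q. u a * v b * R4 a b c d x)"
    if "c < q" for c using that by (intro has_grad_sum has_grad_cmult gR) auto
  obtain \<xi> where \<xi>: "0 < \<xi>" "\<xi> < 1" "?F x = ?F (\<lambda>_. 0) + (\<Sum>c<q. (\<Sum>a<q. \<Sum>b<q. u a * v b * R3 a b c (\<lambda>_. 0)) * x c)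
     + (\<Sum>c<q. (\<Sum>d<q. (\<Sum>a<q. \<Sum>b<q. u a * v b * R4 a b c d (\<lambda>i. \<xi> * x i)) * x d) * x c) / 2"
    by (rule has_grad_ray2[OF g1 g2 B_in[OF x]])
  let ?K = "C * nrm q u * nrm q v" and ?s = "\<Sum>c<q. \<bar>x c\<bar>"
  have K0: "0 \<le> ?K" using C by (intro mult_nonneg_nonneg L2_set_nonneg)
  have s0: "0 \<le> ?s" by (intro sum_nonneg) auto
  have xr: "nrm q (\<lambda>i. \<xi> * x i) < \<rho>" using B_in[OF B_scale[OF x]] \<xi> by simp
  have 1: "\<bar>\<Sum>c<q. (\<Sum>a<q. \<Sum>b<q. u a * v b * R3 a b c (\<lambda>_. 0)) * x c\<bar> \<le> ?K * ?s"
    using T3[of _ u v] by (intro abs_sum_mult_le) (simp add: mult_ac)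
  have 2: "\<bar>\<Sum>c<q. (\<Sum>d<q. (\<Sum>a<q. \<Sum>b<q. u a * v b * R4 a b c d (\<lambda>i. \<xi> * x i)) * x d) * x c\<bar> \<le> ?K * ?s * ?s"
    using T4[OF _ _ xr, of _ _ u v] by (intro abs_sum_mult_le) (simp add: mult_ac)
  have 0: "?F (\<lambda>_. 0) = 0" by (intro sum.neutral ballI) (simp add: R0)
  have "\<bar>?F x\<bar> \<le> ?K * ?s + ?K * ?s * ?s / 2" using \<xi>(3) 0 1 2 by (simp add: abs_le_iff)
  also have "\<dots> \<le> ?K * (sqrt q * r) + ?K * (sqrt q * r) * (sqrt q * r) / 2"
  proof -
    have "?K * ?s \<le> ?K * (sqrt q * r)" by (intro mult_left_mono sum_abs_B x K0)
    moreover have "?K * ?s * ?s \<le> ?K * (sqrt q * r) * (sqrt q * r)"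
    proof (intro mult_mono[OF calculation sum_abs_B[OF x]])
      show "0 \<le> ?K * (sqrt q * r)" using r by (intro mult_nonneg_nonneg[OF K0]) simp
    qed (use s0 in auto)
    ultimately show ?thesis by linarith
  qed
  also have "\<dots> = \<beta> * nrm q u * nrm q v"
    by (simp add: \<beta>_def algebra_simps power2_eq_square)
  finally show ?thesis .
qed

text \<open>With the row index a moved to a fixed slot, x and v enter the bilinear form together;
  only the fourth derivative still has an index to be summed in absolute value.\<close>

lemma R2_row_bound:
  assumes x: "nrm q x \<le> r" and a: "a < q"
  shows "\<bar>\<Sum>b<q. v b * R2 a b x\<bar> \<le> \<gamma>1 * nrm q v"
proof -
  let ?F = "\<lambda>x. \<Sum>b<q. v b * R2 a b x"
  have g1: "has_grad q \<rho> ?F (\<lambda>c x. \<Sum>b<q. v b * R3 a b c x)"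
    using a by (intro has_grad_sum has_grad_cmult gR) auto
  have g2: "has_grad q \<rho> (\<lambda>x. \<Sum>b<q. v b * R3 a b c x) (\<lambda>d x. \<Sum>b<q. v b * R4 a b c d x)"
    if "c < q" for c using that a by (intro has_grad_sum has_grad_cmult gR) auto
  obtain \<xi> where \<xi>: "0 < \<xi>" "\<xi> < 1" "?F x = ?F (\<lambda>_. 0) + (\<Sum>c<q. (\<Sum>b<q. v b * R3 a b c (\<lambda>_. 0)) * x c)
     + (\<Sum>c<q. (\<Sum>d<q. (\<Sum>b<q. v b * R4 a b c d (\<lambda>i. \<xi> * x i)) * x d) * x c) / 2"
    by (rule has_grad_ray2[OF g1 g2 B_in[OF x]])
  let ?y = "\<lambda>i. \<xi> * x i"
  have xr: "nrm q ?y < \<rho>" using B_in[OF B_scale[OF x]] \<xi> by simp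
  have "(\<Sum>c<q. (\<Sum>b<q. v b * R3 a b c (\<lambda>_. 0)) * x c) = (\<Sum>c<q. \<Sum>b<q. R3 c b a (\<lambda>_. 0) * x c * v b)"
    unfolding sum_distrib_right
  proof (intro sum.cong refl)
    fix c b assume "c \<in> {..<q}" "b \<in> {..<q}"
    then have "R3 a b c (\<lambda>_. 0) = R3 c b a (\<lambda>_. 0)" using R3_perm(2)[OF _ _ _ zero_in] a by simp
    then show "v b * R3 a b c (\<lambda>_. 0) * x c = R3 c b a (\<lambda>_. 0) * x c * v b" by simp
  qed
  also have "\<bar>\<dots>\<bar> \<le> C * nrm q x * nrm q v" by (rule T3[OF a])
  also have "\<dots> \<le> C * r * nrm q v" using x C r by (intro mult_mono) (auto intro: L2_set_nonneg mult_nonneg_nonneg)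
  finally have 1: "\<bar>\<Sum>c<q. (\<Sum>b<q. v b * R3 a b c (\<lambda>_. 0)) * x c\<bar> \<le> C * r * nrm q v" .
  have "(\<Sum>c<q. (\<Sum>d<q. (\<Sum>b<q. v b * R4 a b c d ?y) * x d) * x c) = (\<Sum>d<q. (\<Sum>c<q. \<Sum>b<q. R4 c b a d ?y * x c * v b) * x d)"
  proof -
    have "(\<Sum>c<q. (\<Sum>d<q. (\<Sum>b<q. v b * R4 a b c d ?y) * x d) * x c) = (\<Sum>c<q. \<Sum>d<q. \<Sum>b<q. R4 c b a d ?y * x c * v b * x d)"
      unfolding sum_distrib_right
    proof (intro sum.cong refl)
      fix c d b assume "c \<in> {..<q}" "d \<in> {..<q}" "b \<in> {..<q}"
      then have "R4 a b c d ?y = R4 c b a d ?y"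
        using R4_perm(1)[OF _ _ _ _ xr] a by simp
      then show "v b * R4 a b c d ?y * x d * x c = R4 c b a d ?y * x c * v b * x d" by simp
    qed
    also have "\<dots> = (\<Sum>d<q. \<Sum>c<q. \<Sum>b<q. R4 c b a d ?y * x c * v b * x d)" by (rule sum.swap)
    finally show ?thesis by (simp add: sum_distrib_right)
  qed
  also have "\<bar>\<dots>\<bar> \<le> (C * nrm q x * nrm q v) * (\<Sum>d<q. \<bar>x d\<bar>)"
    using T4[OF a _ xr] by (intro abs_sum_mult_le) auto
  also have "\<dots> \<le> (C * r * nrm q v) * (sqrt q * r)"
    using x C r by (intro mult_mono sum_abs_B) (auto intro!: L2_set_nonneg mult_nonneg_nonneg sum_nonneg)
  finally have 2: "\<bar>\<Sum>c<q. (\<Sum>d<q. (\<Sum>b<q. v b * R4 a b c d ?y) * x d) * x c\<bar> \<le> (C * r * nrm q v) * (sqrt q * r)" .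
  have 0: "?F (\<lambda>_. 0) = 0" by (intro sum.neutral ballI) (simp add: R0 a)
  have "\<bar>?F x\<bar> \<le> C * r * nrm q v + (C * r * nrm q v) * (sqrt q * r) / 2" using \<xi>(3) 0 1 2 by (simp add: abs_le_iff)
  also have "\<dots> = \<gamma>1 * nrm q v" by (simp add: \<gamma>1_def algebra_simps power2_eq_square)
  finally show ?thesis .
qed

text \<open>Duality of the Euclidean norm with itself: test with v = f.\<close>

lemma self_bound:
  fixes f :: "nat \<Rightarrow> real"
  assumes "\<And>v. \<bar>\<Sum>b<q. v b * f b\<bar> \<le> K * nrm q v"
  shows "(\<Sum>b<q. (f b)^2) \<le> K^2"
proof -
  have K0: "0 \<le> K"
  proof -
    have "nrm q (\<lambda>_. 1) > 0" using q by (simp add: L2_set_def)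
    moreover have "0 \<le> K * nrm q (\<lambda>_. 1)" using assms[of "\<lambda>_. 1"] by linarith
    ultimately show ?thesis by (simp add: zero_le_mult_iff)
  qed
  have "(nrm q f)^2 \<le> K * nrm q f" using assms[of f] by (simp add: L2_set_sq power2_eq_square[symmetric] sum_nonneg)
  then have "nrm q f \<le> K" using K0 L2_set_nonneg[of f "{..<q}"]
    by (cases "nrm q f = 0") (auto simp: power2_eq_square)
  then have "(nrm q f)^2 \<le> K^2" by (intro power_mono L2_set_nonneg)
  then show ?thesis by (simp add: L2_set_sq)
qed

lemma R2_frobenius:
  assumes x: "nrm q x \<le> r"
  shows "(\<Sum>a<q. \<Sum>b<q. (R2 a b x)^2) \<le> real q * \<gamma>1^2"
proof -
  have "(\<Sum>a<q. \<Sum>b<q. (R2 a b x)^2) \<le> (\<Sum>a<q. \<gamma>1^2)"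
    using R2_row_bound[OF x] by (intro sum_mono self_bound) auto
  then show ?thesis by simp
qed

lemma R2_image_bound:
  assumes x: "nrm q x \<le> r" and w: "(\<Sum>i<q. (w i)^2) = 1"
  shows "(\<Sum>b<q. (\<Sum>a<q. w a * R2 a b x)^2) \<le> \<beta>^2"
proof (rule self_bound)
  fix v
  have n: "nrm q w = 1" using w by (simp add: L2_set_def)
  have "(\<Sum>b<q. v b * (\<Sum>a<q. w a * R2 a b x)) = (\<Sum>a<q. \<Sum>b<q. w a * v b * R2 a b x)"
    by (subst sum.swap) (simp add: sum_distrib_left mult_ac)
  then show "\<bar>\<Sum>b<q. v b * (\<Sum>a<q. w a * R2 a b x)\<bar> \<le> \<beta> * nrm q v"
    using R2_bilinear_bound[OF x, of w v] n by simp
qed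

text \<open>Insert row a of S into the lower bound on H: because H S is the identity, the form takes
  the value S a a, which is at most the norm of the row.\<close>

lemma S_row: assumes a: "a < q" shows "nrm q (S a) \<le> 1 / \<kappa>"
proof -
  let ?n = "nrm q (S a)"
  have "\<kappa> * ?n^2 \<le> (\<Sum>i<q. \<Sum>j<q. H i j * S a i * S a j)" by (rule H_low)
  also have "\<dots> = (\<Sum>i<q. S a i * (\<Sum>j<q. H i j * S j a))"
    using a S_sym by (auto simp: sum_distrib_left mult_ac intro!: sum.cong)
  also have "\<dots> = (\<Sum>i<q. if i = a then S a i else 0)"
    using a by (intro sum.cong) (auto simp: HS)
  also have "\<dots> = S a a" using a by simp
  also have "\<dots> \<le> ?n" using abs_coord_le_nrm[OF a, of "S a"] by simp
  finally have "\<kappa> * ?n * ?n \<le> 1 * ?n" by (simp add: power2_eq_square)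
  then have "\<kappa> * ?n \<le> 1" using L2_set_nonneg[of "S a" "{..<q}"] by (cases "?n = 0") auto
  then show ?thesis using \<kappa> by (simp add: field_simps)
qed

lemma S_rows_sum: "(\<Sum>a<q. nrm q (S a)) \<le> real q / \<kappa>"
proof -
  have "(\<Sum>a<q. nrm q (S a)) \<le> (\<Sum>a<q. 1/\<kappa>)" using S_row by (intro sum_mono) auto
  then show ?thesis by simp
qed

lemma S_abs_sum: "(\<Sum>a<q. \<Sum>b<q. \<bar>S a b\<bar>) \<le> sqrt q * (q / \<kappa>)"
proof -
  have "(\<Sum>a<q. \<Sum>b<q. \<bar>S a b\<bar>) \<le> (\<Sum>a<q. sqrt q * nrm q (S a))"
    by (intro sum_mono sum_abs_le_nrm)
  also have "\<dots> \<le> sqrt q * (q / \<kappa>)" unfolding sum_distrib_left[symmetric]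
    using S_rows_sum by (intro mult_left_mono) auto
  finally show ?thesis .
qed

text \<open>For fixed a and c the sum over b and d is the form with fixed indices a and c, evaluated
  at rows a and c of S. Only the q row norms enter, twice.\<close>

lemma R4_contract:
  assumes x: "nrm q x < \<rho>"
  shows "\<bar>\<Sum>a<q. \<Sum>b<q. \<Sum>c<q. \<Sum>d<q. S a b * S c d * R4 a b c d x\<bar> \<le> C * (q / \<kappa>)^2"
proof -
  have eq: "(\<Sum>a<q. \<Sum>b<q. \<Sum>c<q. \<Sum>d<q. S a b * S c d * R4 a b c d x)
     = (\<Sum>a<q. \<Sum>c<q. \<Sum>b<q. \<Sum>d<q. R4 b d a c x * S a b * S c d)"
  proof (rule sum.cong[OF refl])
    fix a assume a: "a \<in> {..<q}"
    have "(\<Sum>b<q. \<Sum>c<q. \<Sum>d<q. S a b * S c d * R4 a b c d x) = (\<Sum>c<q. \<Sum>b<q. \<Sum>d<q. S a b * S c d * R4 a b c d x)"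
      by (rule sum.swap)
    also have "\<dots> = (\<Sum>c<q. \<Sum>b<q. \<Sum>d<q. R4 b d a c x * S a b * S c d)"
    proof (intro sum.cong refl)
      fix b c d assume "c \<in> {..<q}" "d \<in> {..<q}" "b \<in> {..<q}"
      then have "R4 a b c d x = R4 b d a c x"
        using R4_perm(3)[OF _ _ _ _ x] a by simp
      then show "S a b * S c d * R4 a b c d x = R4 b d a c x * S a b * S c d" by simp
    qed
    finally show "(\<Sum>b<q. \<Sum>c<q. \<Sum>d<q. S a b * S c d * R4 a b c d x) = (\<Sum>c<q. \<Sum>b<q. \<Sum>d<q. R4 b d a c x * S a b * S c d)" .
  qed
  have "\<bar>\<Sum>a<q. \<Sum>c<q. \<Sum>b<q. \<Sum>d<q. R4 b d a c x * S a b * S c d\<bar> \<le> (\<Sum>a<q. \<Sum>c<q. C * nrm q (S a) * nrm q (S c))"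
    by (rule order.trans[OF sum_abs], rule sum_mono, rule order.trans[OF sum_abs], rule sum_mono) (use T4[OF _ _ x] in auto)
  also have "\<dots> = C * ((\<Sum>a<q. nrm q (S a)) * (\<Sum>a<q. nrm q (S a)))"
    by (simp add: sum_product sum_distrib_left mult_ac)
  also have "\<dots> \<le> C * ((q / \<kappa>) * (q / \<kappa>))"
    using S_rows_sum C \<kappa> by (intro mult_left_mono mult_mono) (auto intro: sum_nonneg L2_set_nonneg)
  finally show ?thesis using eq by (simp add: power2_eq_square)
qed

text \<open>Bounds the norm of the vector obtained by contracting two indices of the third
  derivative with S: the summand 1 accounts for its value at 0, sqrt q r for the variation through
  the fourth derivative. This vector governs the Gaussian mean of the gradient of R.\<close>

definition \<tau> :: real where "\<tau> = C * (q / \<kappa>) * (1 + sqrt q * r)"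

lemma R3_contract:
  assumes x: "nrm q x \<le> r"
  shows "\<bar>\<Sum>c<q. (\<Sum>a<q. \<Sum>b<q. S a b * R3 a b c x) * w c\<bar> \<le> \<tau> * nrm q w"
proof -
  let ?F = "\<lambda>x. \<Sum>c<q. w c * (\<Sum>a<q. \<Sum>b<q. S a b * R3 a b c x)"
  have g1: "has_grad q \<rho> ?F (\<lambda>d x. \<Sum>c<q. w c * (\<Sum>a<q. \<Sum>b<q. S a b * R4 a b c d x))"
    by (intro has_grad_sum has_grad_cmult gR) auto
  obtain \<xi> where \<xi>: "0 < \<xi>" "\<xi> < 1" "?F x = ?F (\<lambda>_. 0) + (\<Sum>d<q. (\<Sum>c<q. w c * (\<Sum>a<q. \<Sum>b<q. S a b * R4 a b c d (\<lambda>i. \<xi> * x i))) * x d)"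
    by (rule has_grad_ray1[OF g1 B_in[OF x]])
  let ?y = "\<lambda>i. \<xi> * x i"
  have xr: "nrm q ?y < \<rho>" using B_in[OF B_scale[OF x]] \<xi> by simp
  have nw: "0 \<le> nrm q w" by (rule L2_set_nonneg)
  have "?F (\<lambda>_. 0) = (\<Sum>a<q. \<Sum>b<q. \<Sum>c<q. R3 b c a (\<lambda>_. 0) * S a b * w c)"
  proof -
    have "?F (\<lambda>_. 0) = (\<Sum>c<q. \<Sum>a<q. \<Sum>b<q. R3 b c a (\<lambda>_. 0) * S a b * w c)"
      unfolding sum_distrib_left
    proof (intro sum.cong refl)
      fix c a b assume "c \<in> {..<q}" "a \<in> {..<q}" "b \<in> {..<q}"
      then have "R3 a b c (\<lambda>_. 0) = R3 b c a (\<lambda>_. 0)"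
        using R3_perm(1)[OF _ _ _ zero_in] by simp
      then show "w c * (S a b * R3 a b c (\<lambda>_. 0)) = R3 b c a (\<lambda>_. 0) * S a b * w c" by simp
    qed
    then show ?thesis by (rule trans[OF _ sum_rot3[symmetric]])
  qed
  also have "\<bar>\<dots>\<bar> \<le> (\<Sum>a<q. C * nrm q (S a) * nrm q w)"
    by (rule order.trans[OF sum_abs], rule sum_mono) (use T3 in auto)
  also have "\<dots> = C * (\<Sum>a<q. nrm q (S a)) * nrm q w"
    by (simp add: sum_distrib_left sum_distrib_right)
  also have "\<dots> \<le> C * (q / \<kappa>) * nrm q w"
    using S_rows_sum C nw by (intro mult_left_mono mult_right_mono) auto
  finally have 1: "\<bar>?F (\<lambda>_. 0)\<bar> \<le> C * (q / \<kappa>) * nrm q w" .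
  have "\<bar>\<Sum>d<q. (\<Sum>c<q. w c * (\<Sum>a<q. \<Sum>b<q. S a b * R4 a b c d ?y)) * x d\<bar> \<le> (C * (q / \<kappa>) * nrm q w) * (\<Sum>d<q. \<bar>x d\<bar>)"
  proof (rule abs_sum_mult_le)
    fix d assume d: "d < q"
    have "(\<Sum>c<q. w c * (\<Sum>a<q. \<Sum>b<q. S a b * R4 a b c d ?y)) = (\<Sum>a<q. \<Sum>b<q. \<Sum>c<q. R4 b c a d ?y * S a b * w c)"
    proof -
      have "(\<Sum>c<q. w c * (\<Sum>a<q. \<Sum>b<q. S a b * R4 a b c d ?y)) = (\<Sum>c<q. \<Sum>a<q. \<Sum>b<q. R4 b c a d ?y * S a b * w c)"
        unfolding sum_distrib_left
      proof (intro sum.cong refl)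
        fix c a b assume "c \<in> {..<q}" "a \<in> {..<q}" "b \<in> {..<q}"
        then have "R4 a b c d ?y = R4 b c a d ?y"
          using R4_perm(2)[OF _ _ _ _ xr] d by simp
        then show "w c * (S a b * R4 a b c d ?y) = R4 b c a d ?y * S a b * w c" by simp
      qed
      then show ?thesis by (rule trans[OF _ sum_rot3[symmetric]])
    qed
    also have "\<bar>\<dots>\<bar> \<le> (\<Sum>a<q. C * nrm q (S a) * nrm q w)"
      by (rule order.trans[OF sum_abs], rule sum_mono) (use T4[OF _ d xr] in auto)
    also have "\<dots> = C * (\<Sum>a<q. nrm q (S a)) * nrm q w"
      by (simp add: sum_distrib_left sum_distrib_right)
    also have "\<dots> \<le> C * (q / \<kappa>) * nrm q w"
      using S_rows_sum C nw by (intro mult_left_mono mult_right_mono) auto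
    finally show "\<bar>\<Sum>c<q. w c * (\<Sum>a<q. \<Sum>b<q. S a b * R4 a b c d ?y)\<bar> \<le> C * (q / \<kappa>) * nrm q w" .
  qed
  also have "\<dots> \<le> (C * (q / \<kappa>) * nrm q w) * (sqrt q * r)"
    using C \<kappa> nw by (intro mult_left_mono sum_abs_B x) auto
  finally have "\<bar>?F x\<bar> \<le> C * (q / \<kappa>) * nrm q w + (C * (q / \<kappa>) * nrm q w) * (sqrt q * r)"
    using 1 \<xi>(3) by (simp add: abs_le_iff)
  also have "\<dots> = \<tau> * nrm q w" by (simp add: \<tau>_def algebra_simps)
  finally show ?thesis by (simp add: mult.commute)
qed

text \<open>Supplies a semiconvexity constant for directional derivatives of R. The Poincare
  inequality asks for some such constant L, which does not occur in its conclusion, so a crude bound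
  is enough.\<close>

lemma R3_dir_bound:
  assumes x: "nrm q x < \<rho>" and w: "(\<Sum>i<q. (w i)^2) = 1"
  shows "\<bar>\<Sum>b<q. \<Sum>c<q. (\<Sum>a<q. w a * R3 a b c x) * v b * v c\<bar> \<le> C * (sqrt q + q * \<rho>) * (nrm q v)^2"
proof -
  let ?F = "\<lambda>x. \<Sum>a<q. w a * (\<Sum>b<q. \<Sum>c<q. v b * v c * R3 a b c x)"
  have g1: "has_grad q \<rho> ?F (\<lambda>d x. \<Sum>a<q. w a * (\<Sum>b<q. \<Sum>c<q. v b * v c * R4 a b c d x))"
    by (intro has_grad_sum has_grad_cmult gR) auto
  obtain \<xi> where \<xi>: "0 < \<xi>" "\<xi> < 1" "?F x = ?F (\<lambda>_. 0) + (\<Sum>d<q. (\<Sum>a<q. w a * (\<Sum>b<q. \<Sum>c<q. v b * v c * R4 a b c d (\<lambda>i. \<xi> * x i))) * x d)"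
    by (rule has_grad_ray1[OF g1 x])
  let ?y = "\<lambda>i. \<xi> * x i" and ?n = "nrm q v"
  have xr: "nrm q ?y < \<rho>"
    using \<xi> x mult_left_le_one_le[OF L2_set_nonneg[of x "{..<q}"], of \<xi>] by (simp add: nrm_scale)
  have n0: "0 \<le> C * ?n * ?n" using C by (simp add: L2_set_nonneg)
  have nw: "nrm q w = 1" using w by (simp add: L2_set_def)
  have aw: "(\<Sum>a<q. \<bar>w a\<bar>) \<le> sqrt q" using sum_abs_le_nrm[where x = w and q = q] nw by simp
  have "\<bar>?F (\<lambda>_. 0)\<bar> = \<bar>\<Sum>a<q. (\<Sum>b<q. \<Sum>c<q. R3 b c a (\<lambda>_. 0) * v b * v c) * w a\<bar>"
  proof -
    have "?F (\<lambda>_. 0) = (\<Sum>a<q. (\<Sum>b<q. \<Sum>c<q. R3 b c a (\<lambda>_. 0) * v b * v c) * w a)"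
      unfolding sum_distrib_left sum_distrib_right
    proof (intro sum.cong refl)
      fix c a b assume "c \<in> {..<q}" "a \<in> {..<q}" "b \<in> {..<q}"
      then have "R3 a b c (\<lambda>_. 0) = R3 b c a (\<lambda>_. 0)"
        using R3_perm(1)[OF _ _ _ zero_in] by simp
      then show "w a * (v b * v c * R3 a b c (\<lambda>_. 0)) = R3 b c a (\<lambda>_. 0) * v b * v c * w a" by simp
    qed
    then show ?thesis by simp
  qed
  also have "\<dots> \<le> (C * ?n * ?n) * (\<Sum>a<q. \<bar>w a\<bar>)"
    using T3[of _ v v] by (intro abs_sum_mult_le)
  also have "\<dots> \<le> (C * ?n * ?n) * sqrt q" using aw n0 by (intro mult_left_mono)
  finally have 1: "\<bar>?F (\<lambda>_. 0)\<bar> \<le> (C * ?n * ?n) * sqrt q" .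
  have "\<bar>\<Sum>d<q. (\<Sum>a<q. w a * (\<Sum>b<q. \<Sum>c<q. v b * v c * R4 a b c d ?y)) * x d\<bar> \<le> (C * ?n * ?n) * sqrt q * (\<Sum>d<q. \<bar>x d\<bar>)"
  proof (rule abs_sum_mult_le)
    fix d assume d: "d < q"
    have "(\<Sum>a<q. w a * (\<Sum>b<q. \<Sum>c<q. v b * v c * R4 a b c d ?y)) = (\<Sum>a<q. (\<Sum>b<q. \<Sum>c<q. R4 b c a d ?y * v b * v c) * w a)"
      unfolding sum_distrib_left sum_distrib_right
    proof (intro sum.cong refl)
      fix c a b assume "c \<in> {..<q}" "a \<in> {..<q}" "b \<in> {..<q}"
      then have "R4 a b c d ?y = R4 b c a d ?y"
        using R4_perm(2)[OF _ _ _ _ xr] d by simp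
      then show "w a * (v b * v c * R4 a b c d ?y) = R4 b c a d ?y * v b * v c * w a" by simp
    qed
    also have "\<bar>\<dots>\<bar> \<le> (C * ?n * ?n) * (\<Sum>a<q. \<bar>w a\<bar>)"
      using T4[OF _ d xr, of _ v v] by (intro abs_sum_mult_le)
    also have "\<dots> \<le> (C * ?n * ?n) * sqrt q" using aw n0 by (intro mult_left_mono)
    finally show "\<bar>\<Sum>a<q. w a * (\<Sum>b<q. \<Sum>c<q. v b * v c * R4 a b c d ?y)\<bar> \<le> (C * ?n * ?n) * sqrt q" .
  qed
  also have "\<dots> \<le> (C * ?n * ?n) * sqrt q * (sqrt q * \<rho>)"
  proof (intro mult_left_mono)
    show "(\<Sum>d<q. \<bar>x d\<bar>) \<le> sqrt q * \<rho>"
      using x by (intro order.trans[OF sum_abs_le_nrm] mult_left_mono) auto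
    show "0 \<le> (C * ?n * ?n) * sqrt q" using n0 by simp
  qed
  finally have "\<bar>?F x\<bar> \<le> (C * ?n * ?n) * sqrt q + (C * ?n * ?n) * sqrt q * (sqrt q * \<rho>)"
    using 1 \<xi>(3) by (simp add: abs_le_iff)
  also have "\<dots> = C * (sqrt q + q * \<rho>) * ?n^2"
    by (simp add: algebra_simps power2_eq_square)
  also have "?F x = (\<Sum>b<q. \<Sum>c<q. (\<Sum>a<q. w a * R3 a b c x) * v b * v c)"
    unfolding sum_distrib_left sum_distrib_right
    by (subst sum_rot3[symmetric]) (auto intro!: sum.cong simp: mult_ac)
  finally show ?thesis .
qed

lemma R_bound:
  assumes x: "nrm q x \<le> r"
  shows "\<bar>R x\<bar> \<le> \<beta> * r^2 / 2"
proof -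
  obtain \<xi> where \<xi>: "0 < \<xi>" "\<xi> < 1" "R x = R (\<lambda>_. 0) + (\<Sum>i<q. R1 i (\<lambda>_. 0) * x i) + (\<Sum>i<q. (\<Sum>j<q. R2 i j (\<lambda>i. \<xi> * x i) * x j) * x i) / 2"
    by (rule has_grad_ray2[OF gR(1) gR(2) B_in[OF x]])
  have "(\<Sum>i<q. (\<Sum>j<q. R2 i j (\<lambda>i. \<xi> * x i) * x j) * x i) = (\<Sum>i<q. \<Sum>j<q. x i * x j * R2 i j (\<lambda>i. \<xi> * x i))"
    unfolding sum_distrib_right by (intro sum.cong refl) (simp add: mult_ac)
  also have "\<bar>\<dots>\<bar> \<le> \<beta> * nrm q x * nrm q x" using \<xi> by (intro R2_bilinear_bound B_scale x) auto
  also have "\<dots> \<le> \<beta> * r * r" using x r \<beta>_nonneg by (intro mult_mono) (auto intro: L2_set_nonneg mult_nonneg_nonneg)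
  finally show ?thesis using \<xi>(3) R0 by (simp add: power2_eq_square mult.assoc)
qed

lemma R1_dir_bound:
  assumes x: "nrm q x \<le> r"
  shows "\<bar>\<Sum>a<q. w a * R1 a x\<bar> \<le> \<beta> * r * nrm q w"
proof -
  let ?F = "\<lambda>x. \<Sum>a<q. w a * R1 a x"
  have g1: "has_grad q \<rho> ?F (\<lambda>b x. \<Sum>a<q. w a * R2 a b x)"
    by (intro has_grad_sum has_grad_cmult gR) auto
  obtain \<xi> where \<xi>: "0 < \<xi>" "\<xi> < 1" "?F x = ?F (\<lambda>_. 0) + (\<Sum>b<q. (\<Sum>a<q. w a * R2 a b (\<lambda>i. \<xi> * x i)) * x b)"
    by (rule has_grad_ray1[OF g1 B_in[OF x]])
  have "(\<Sum>b<q. (\<Sum>a<q. w a * R2 a b (\<lambda>i. \<xi> * x i)) * x b) = (\<Sum>a<q. \<Sum>b<q. w a * x b * R2 a b (\<lambda>i. \<xi> * x i))"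
    unfolding sum_distrib_right by (subst sum.swap, intro sum.cong refl) (simp add: mult_ac)
  also have "\<bar>\<dots>\<bar> \<le> \<beta> * nrm q w * nrm q x" using \<xi> by (intro R2_bilinear_bound B_scale x) auto
  also have "\<dots> \<le> \<beta> * nrm q w * r" using x \<beta>_nonneg by (intro mult_left_mono) (auto intro: L2_set_nonneg mult_nonneg_nonneg)
  finally show ?thesis using \<xi>(3) R0 by (simp add: mult_ac)
qed

end

subsection \<open>The interpolating family on the ball\<close>

text \<open>The difference quotient estimate at seminorm distance 0. It connects
  \<open>midpt\<close>, which is extensional, with points of a segment, which are not.\<close>

lemma has_grad_cong_pt:
  assumes g: "has_grad q \<rho> \<phi> \<Gamma>" and x: "nrm q x < \<rho>" and eq: "\<And>i. i < q \<Longrightarrow> y i = x i"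
  shows "\<phi> y = \<phi> x"
proof -
  have n: "nrm q (\<lambda>i. y i - x i) = 0" using eq by (simp add: L2_set_def)
  obtain d where "0 < d" "\<And>y. nrm q (\<lambda>i. y i - x i) < d \<Longrightarrow>
        \<bar>\<phi> y - \<phi> x - (\<Sum>i<q. \<Gamma> i x * (y i - x i))\<bar> \<le> 1 * nrm q (\<lambda>i. y i - x i)"
    using has_gradD[OF g x, of 1] by auto
  from this(2)[of y] this(1) n eq show ?thesis by simp
qed

text \<open>Taylor expansion from the midpoint to both ends: the first-order terms cancel on
  averaging, and each second-order term is at least (1/2)^2 k / 2 = k / 8.\<close>

lemma midpoint_strong_convex:
  fixes f f' f'' :: "real \<Rightarrow> real"
  assumes "\<And>t. 0 \<le> t \<Longrightarrow> t \<le> 1 \<Longrightarrow> (f has_real_derivative f' t) (at t)"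
    "\<And>t. 0 \<le> t \<Longrightarrow> t \<le> 1 \<Longrightarrow> (f' has_real_derivative f'' t) (at t)"
    and k: "\<And>t. 0 \<le> t \<Longrightarrow> t \<le> 1 \<Longrightarrow> k \<le> f'' t"
  shows "f (1/2) \<le> (f 0 + f 1) / 2 - k / 8"
proof -
  have d: "((\<lambda>s. f (1/2 + c * s)) has_real_derivative f' (1/2 + c * t) * c) (at t)"
    "((\<lambda>s. f' (1/2 + c * s) * c) has_real_derivative f'' (1/2 + c * t) * c * c) (at t)"
    if "c = 1/2 \<or> c = -1/2" "0 \<le> t" "t \<le> 1" for c t
  proof -
    have "0 \<le> 1/2 + c * t \<and> 1/2 + c * t \<le> 1"
      using that(1)
    proof
      assume c: "c = 1/2" show ?thesis unfolding c using that(2,3) by simp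
    next
      assume c: "c = -1/2" show ?thesis unfolding c using that(2,3) by simp
    qed
    then have 1: "(f has_real_derivative f' (1/2 + c * t)) (at (1/2 + c * t))"
      "(f' has_real_derivative f'' (1/2 + c * t)) (at (1/2 + c * t))" using assms by blast+
    have 2: "((\<lambda>s. 1/2 + c * s) has_real_derivative c) (at t)" by (auto intro!: derivative_eq_intros)
    show "((\<lambda>s. f (1/2 + c * s)) has_real_derivative f' (1/2 + c * t) * c) (at t)"
      by (rule DERIV_chain2[OF 1(1) 2])
    show "((\<lambda>s. f' (1/2 + c * s) * c) has_real_derivative f'' (1/2 + c * t) * c * c) (at t)"
      by (rule DERIV_cmult_right[OF DERIV_chain2[OF 1(2) 2]])
  qed
  obtain \<xi> where x1: "0 < \<xi>" "\<xi> < 1" "f (1/2 + 1/2 * 1) = f (1/2 + 1/2 * 0) + f' (1/2 + 1/2 * 0) * (1/2) + f'' (1/2 + 1/2 * \<xi>) * (1/2) * (1/2) / 2"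
    by (rule taylor2_unit[OF d(1)[of "1/2"] d(2)[of "1/2"]]) auto
  obtain \<eta> where x2: "0 < \<eta>" "\<eta> < 1" "f (1/2 + (-1/2) * 1) = f (1/2 + (-1/2) * 0) + f' (1/2 + (-1/2) * 0) * (-1/2) + f'' (1/2 + (-1/2) * \<eta>) * (-1/2) * (-1/2) / 2"
    by (rule taylor2_unit[OF d(1)[of "-1/2"] d(2)[of "-1/2"]]) auto
  have "k \<le> f'' (1/2 + 1/2 * \<xi>)" "k \<le> f'' (1/2 + (-1/2) * \<eta>)" using x1 x2 by (auto intro!: k)
  with x1(3) x2(3) show ?thesis by (simp add: field_simps)
qed

lemma ball_emeasure_finite: "emeasure (leb q) {x \<in> space (leb q). nrm q x \<le> r} < \<infinity>"
proof -
  have "{x \<in> space (leb q). nrm q x \<le> r} \<subseteq> Pi\<^sub>E {..<q} (\<lambda>_. {-r..r})"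
  proof
    fix x assume x: "x \<in> {x \<in> space (leb q). nrm q x \<le> r}"
    then have "\<bar>x i\<bar> \<le> r" if "i < q" for i using abs_coord_le_nrm[OF that, of x] by simp
    then have "x i \<in> {-r..r}" if "i < q" for i using that by (auto simp: abs_le_iff minus_le_iff)
    then show "x \<in> Pi\<^sub>E {..<q} (\<lambda>_. {-r..r})" using x by (auto simp: space_leb Rn_def PiE_iff)
  qed
  then have "emeasure (leb q) {x \<in> space (leb q). nrm q x \<le> r} \<le> emeasure (leb q) (Pi\<^sub>E {..<q} (\<lambda>_. {-r..r}))"
    by (rule emeasure_mono) (auto simp: leb_def intro!: sets_PiM_I_finite)
  also have "\<dots> = (\<Prod>i<q. emeasure lborel {-r..r})"
    unfolding leb_def by (rule lborel_prod.emeasure_PiM) auto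
  also have "(\<Prod>i<q. emeasure lborel {-r..r}) < \<infinity>"
    by (auto simp: power_less_top_ennreal emeasure_lborel_Icc_eq)
  finally show ?thesis .
qed

lemma integrable_on_ball:
  fixes f :: "point \<Rightarrow> real"
  assumes m: "(\<lambda>x. indicator {x. nrm q x \<le> r} x * f x) \<in> borel_measurable (leb q)"
    and b: "\<And>x. nrm q x \<le> r \<Longrightarrow> \<bar>f x\<bar> \<le> K"
  shows "integrable (leb q) (\<lambda>x. indicator {x. nrm q x \<le> r} x * f x)"
proof (rule Bochner_Integration.integrable_bound)
  show "integrable (leb q) (\<lambda>x. K * indicator {x \<in> space (leb q). nrm q x \<le> r} x)"
    using ball_emeasure_finite[of q r] by (intro integrable_mult_right integrable_real_indicator) auto
  show "AE x in leb q. norm (indicator {x. nrm q x \<le> r} x * f x) \<le> norm (K * indicator {x \<in> space (leb q). nrm q x \<le> r} x)"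
    using order.trans[OF b abs_ge_self] by (intro AE_I2) (auto simp: indicator_def)
qed (rule m)

context ball_fn
begin

text \<open>Potentials, that is, minus the logarithms of the Gaussian weight and of the
  interpolating weight.\<close>

definition Qf :: "point \<Rightarrow> real" where "Qf x = (\<Sum>i<q. \<Sum>j<q. H i j * x i * x j) / 2"
definition U :: "real \<Rightarrow> point \<Rightarrow> real" where "U t x = Qf x + (- t) * R x"

lemma Qf_low: "\<kappa> / 2 * (nrm q x)^2 \<le> Qf x" using H_low[of x] by (simp add: Qf_def)
lemma Qf_up: "Qf x \<le> \<kappa>2 / 2 * (nrm q x)^2" using H_up[of x] by (simp add: Qf_def)
lemma Qf_nonneg: "0 \<le> Qf x" using Qf_low[of x] \<kappa> by (smt (verit) divide_pos_pos mult_nonneg_nonneg zero_le_power2)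

lemma Qf_grad: "has_grad q \<rho>' Qf (\<lambda>i x. \<Sum>j<q. H i j * x j)"
  unfolding Qf_def[abs_def]
proof (rule has_grad_quadratic[OF H_sym])
  fix v show "\<bar>\<Sum>i<q. \<Sum>j<q. H i j * v i * v j\<bar> \<le> \<kappa>2 * (nrm q v)^2"
    using H_up[of v] Qf_nonneg[of v] by (simp add: Qf_def)
qed

lemma U_grad: "has_grad q \<rho> (U t) (\<lambda>i x. (\<Sum>j<q. H i j * x j) + (- t) * R1 i x)"
  unfolding U_def[abs_def] by (intro has_grad_add Qf_grad has_grad_cmult gR)

lemma U_grad2: "i < q \<Longrightarrow> has_grad q \<rho> (\<lambda>x. (\<Sum>j<q. H i j * x j) + (- t) * R1 i x) (\<lambda>j x. H i j + (- t) * R2 i j x)"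
  by (intro has_grad_add has_grad_linear has_grad_cmult gR)

text \<open>The Hessian H - t R2 is a convex combination of H and H - R2, and \<kappa> bounds both
  from below. The whole interpolation thus keeps the same log-concavity constant.\<close>

lemma U_hess_low:
  assumes x: "nrm q x < \<rho>" and t: "0 \<le> t" "t \<le> 1"
  shows "\<kappa> * (nrm q v)^2 \<le> (\<Sum>i<q. (\<Sum>j<q. (H i j + (- t) * R2 i j x) * v j) * v i)"
proof -
  let ?A = "\<Sum>i<q. \<Sum>j<q. H i j * v i * v j" and ?B = "\<Sum>i<q. \<Sum>j<q. (H i j - R2 i j x) * v i * v j"
  have "(1 - t) * (\<kappa> * (nrm q v)^2) + t * (\<kappa> * (nrm q v)^2) \<le> (1 - t) * ?A + t * ?B"
    using H_low[of v] conv[OF x, of v] t by (intro add_mono mult_left_mono) auto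
  also have "\<dots> = (\<Sum>i<q. \<Sum>j<q. (1 - t) * (H i j * v i * v j) + t * ((H i j - R2 i j x) * v i * v j))"
    by (simp add: sum_distrib_left sum.distrib)
  also have "\<dots> = (\<Sum>i<q. (\<Sum>j<q. (H i j + (- t) * R2 i j x) * v j) * v i)"
    unfolding sum_distrib_right by (intro sum.cong refl) (simp add: algebra_simps)
  finally show ?thesis by (simp add: algebra_simps)
qed

text \<open>Doubled and exponentiated, this is the log-concavity hypothesis of the Poincare
  inequality, with exponent \<kappa> |x - y|^2 / 4.\<close>

lemma U_midpoint:
  assumes x: "nrm q x \<le> r" and y: "nrm q y \<le> r" and t: "0 \<le> t" "t \<le> 1"
  shows "U t (midpt q x y) \<le> (U t x + U t y) / 2 - \<kappa> * (edist q x y)^2 / 8"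
proof -
  let ?v = "\<lambda>i. y i - x i"
  let ?z = "\<lambda>s i. x i + s * ?v i"
  have z: "nrm q (?z s) < \<rho>" if "0 \<le> s" "s \<le> 1" for s
    using nrm_segment_le[OF x y that] r by simp
  let ?f = "\<lambda>s. U t (?z s)" and ?f' = "\<lambda>s. \<Sum>i<q. ((\<Sum>j<q. H i j * ?z s j) + (- t) * R1 i (?z s)) * ?v i"
    and ?f'' = "\<lambda>s. \<Sum>i<q. (\<Sum>j<q. (H i j + (- t) * R2 i j (?z s)) * ?v j) * ?v i"
  have "?f (1/2) \<le> (?f 0 + ?f 1) / 2 - \<kappa> * (nrm q ?v)^2 / 8"
  proof (rule midpoint_strong_convex[of ?f ?f' ?f''])
    fix s :: real assume s: "0 \<le> s" "s \<le> 1"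
    show "(?f has_real_derivative ?f' s) (at s)" by (rule has_grad_line[OF U_grad z[OF s]])
    show "(?f' has_real_derivative ?f'' s) (at s)"
      by (intro DERIV_sum DERIV_cmult_right) (rule has_grad_line[OF U_grad2 z[OF s]], simp)
    show "\<kappa> * (nrm q ?v)^2 \<le> ?f'' s" by (rule U_hess_low[OF z[OF s] t])
  qed
  moreover have "U t (midpt q x y) = ?f (1/2)"
    by (rule has_grad_cong_pt[OF U_grad z]) (auto simp: midpt_def field_simps)
  moreover have "nrm q ?v = edist q x y" unfolding edist_def by (rule nrm_minus_commute)
  ultimately show ?thesis by simp
qed

lemma meas_ball: "has_grad q \<rho> \<phi> \<Gamma> \<Longrightarrow> (\<lambda>x. indicator B x * \<phi> x) \<in> borel_measurable (leb q)"
  by (rule cts_ball_measurable_closed[OF has_grad_imp_cts r(2)])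

lemma meas_weight[measurable]: "(\<lambda>x. indicator B x * exp (- U t x)) \<in> borel_measurable (leb q)"
proof -
  note [measurable] = meas_ball[OF U_grad]
  have "(\<lambda>x. indicator B x * exp (- U t x)) = (\<lambda>x. (if nrm q x \<le> r then 1 else 0) * exp (- (indicator B x * U t x)))"
    by (auto simp: indicator_def)
  also have "\<dots> \<in> borel_measurable (leb q)" by measurable
  finally show ?thesis .
qed

definition KU :: real where "KU = \<kappa>2 / 2 * r^2 + \<beta> * r^2 / 2"

lemma \<kappa>2_pos: "\<kappa> \<le> \<kappa>2"
proof -
  have "\<kappa> * (nrm q (\<lambda>_. 1))^2 \<le> \<kappa>2 * (nrm q (\<lambda>_. 1))^2" using H_low H_up order.trans by blast
  moreover have "(nrm q (\<lambda>_. 1))^2 > 0" using q by (simp add: L2_set_def)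
  ultimately show ?thesis by simp
qed

lemma U_bound: assumes x: "nrm q x \<le> r" and t: "0 \<le> t" "t \<le> 1" shows "\<bar>U t x\<bar> \<le> KU"
proof -
  have "(nrm q x)^2 \<le> r^2" using x by (intro power_mono) (auto simp: L2_set_nonneg)
  then have "\<kappa>2 / 2 * (nrm q x)^2 \<le> \<kappa>2 / 2 * r^2" using \<kappa>2_pos \<kappa> by (intro mult_left_mono) auto
  then have "\<bar>Qf x\<bar> \<le> \<kappa>2 / 2 * r^2" using Qf_up[of x] Qf_nonneg[of x] by linarith
  moreover have "\<bar>t * R x\<bar> \<le> 1 * (\<beta> * r^2 / 2)" unfolding abs_mult using t R_bound[OF x] by (intro mult_mono) auto
  ultimately show ?thesis unfolding U_def KU_def by linarith
qed

definition Zw :: "real \<Rightarrow> real" where "Zw t = (\<integral>x. indicator B x * exp (- U t x) \<partial>leb q)"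

lemma weight_integrable:
  assumes m: "(\<lambda>x. indicator B x * \<phi> x) \<in> borel_measurable (leb q)"
    and b: "\<And>x. nrm q x \<le> r \<Longrightarrow> \<bar>\<phi> x\<bar> \<le> K" and t: "0 \<le> t" "t \<le> 1"
  shows "integrable (leb q) (\<lambda>x. indicator B x * (exp (- U t x) * \<phi> x))"
proof (rule integrable_on_ball)
  note [measurable] = m
  have "(\<lambda>x. indicator B x * (exp (- U t x) * \<phi> x)) = (\<lambda>x. (indicator B x * exp (- U t x)) * (indicator B x * \<phi> x))"
    by (auto simp: indicator_def)
  also have "\<dots> \<in> borel_measurable (leb q)" by measurable
  finally show "(\<lambda>x. indicator B x * (exp (- U t x) * \<phi> x)) \<in> borel_measurable (leb q)" .
  fix x assume x: "nrm q x \<le> r"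
  have "exp (- U t x) \<le> exp KU" using U_bound[OF x t] by simp
  then show "\<bar>exp (- U t x) * \<phi> x\<bar> \<le> exp KU * K"
    unfolding abs_mult using b[OF x] by (intro mult_mono) auto
qed

lemma Zw_pos: assumes t: "0 \<le> t" "t \<le> 1" shows "0 < Zw t"
proof -
  have int: "integrable (leb q) (\<lambda>x. indicator B x * (exp (- U t x) * 1))"
    by (rule weight_integrable[OF _ _ t, where K = 1])
      (use cts_ball_measurable_closed[OF has_grad_imp_cts[OF has_grad_const] r(2), of 1] in auto)
  \<comment> \<open>A cube of half side r / q lies in the ball, as the Euclidean norm is at most the
    l1 norm; its volume is explicit and positive.\<close>
  define Q where "Q = Pi\<^sub>E {..<q} (\<lambda>_. {- (r / q) .. r / q})"
  have Qm: "Q \<in> sets (leb q)" unfolding Q_def leb_def by (intro sets_PiM_I_finite) auto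
  have eQ: "emeasure (leb q) Q = ennreal ((2 * (r/q))^q)"
  proof -
    have "emeasure (leb q) Q = (\<Prod>i<q. emeasure lborel {- (r/q)..r/q})"
      unfolding leb_def Q_def by (rule lborel_prod.emeasure_PiM) auto
    then show ?thesis using r q by (simp add: ennreal_power)
  qed
  have QB: "x \<in> B" if "x \<in> Q" for x
  proof -
    have "\<bar>x i\<bar> \<le> r / q" if "i < q" for i
    proof -
      have "- (r / q) \<le> x i" "x i \<le> r / q" using \<open>x \<in> Q\<close> that by (auto simp: Q_def PiE_iff)
      then show ?thesis by linarith
    qed
    then have "(\<Sum>i<q. \<bar>x i\<bar>) \<le> (\<Sum>i<q. r / q)" by (intro sum_mono) auto
    then have "(\<Sum>i<q. \<bar>x i\<bar>) \<le> r" using q by simp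
    moreover have "nrm q x \<le> (\<Sum>i<q. \<bar>x i\<bar>)" by (rule L2_set_le_sum_abs)
    ultimately show ?thesis by simp
  qed
  have iQ: "integrable (leb q) (\<lambda>x. exp (- KU) * indicator Q x)"
    using Qm eQ by (intro integrable_mult_right integrable_real_indicator) auto
  have "0 < exp (- KU) * measure (leb q) Q" using eQ r q by (simp add: measure_def)
  also have "\<dots> = (\<integral>x. exp (- KU) * indicator Q x \<partial>leb q)"
    using Qm sets.sets_into_space[OF Qm] by (simp add: Int_absorb1 Int_absorb2)
  also have "\<dots> \<le> (\<integral>x. indicator B x * (exp (- U t x) * 1) \<partial>leb q)"
  proof (rule integral_mono[OF iQ int])
    fix x show "exp (- KU) * indicator Q x \<le> indicator B x * (exp (- U t x) * 1)"
      using QB[of x] U_bound[of x, OF _ t] by (auto simp: indicator_def abs_le_iff)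
  qed
  finally show ?thesis by (simp add: Zw_def)
qed

text \<open>Cutting the density off at the ball preserves the midpoint inequality because the ball
  is convex. The Taylor hypothesis concerns only points of positive density, so \<phi> and its
  gradient may be cut off as well, which makes them globally bounded.\<close>

lemma ball_poincare:
  assumes t: "0 \<le> t" "t \<le> 1" and g: "has_grad q \<rho> \<phi> \<Gamma>"
    and g2: "\<And>i. i < q \<Longrightarrow> has_grad q \<rho> (\<Gamma> i) (\<Delta> i)"
    and L: "\<And>x v. nrm q x \<le> r \<Longrightarrow> - (L * (nrm q v)^2) \<le> (\<Sum>i<q. (\<Sum>j<q. \<Delta> i j x * v j) * v i)"
    and K: "\<And>x. nrm q x \<le> r \<Longrightarrow> \<bar>\<phi> x\<bar> \<le> K" "\<And>x i. i < q \<Longrightarrow> nrm q x \<le> r \<Longrightarrow> \<bar>\<Gamma> i x\<bar> \<le> K"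
  shows "(\<integral>x. indicator B x * (exp (- U t x) * (\<phi> x)^2) \<partial>leb q) / Zw t
     - ((\<integral>x. indicator B x * (exp (- U t x) * \<phi> x) \<partial>leb q) / Zw t)^2
    \<le> 2 / \<kappa> * ((\<integral>x. indicator B x * (exp (- U t x) * (\<Sum>i<q. (\<Gamma> i x)^2)) \<partial>leb q) / Zw t)"
proof -
  let ?\<rho> = "\<lambda>x. indicator B x * exp (- U t x) / Zw t"
  let ?\<phi> = "\<lambda>x. indicator B x * \<phi> x" and ?\<Gamma> = "\<lambda>i x. indicator B x * \<Gamma> i x"
  note Z = Zw_pos[OF t]
  have K0: "0 \<le> K" using K(1)[of "\<lambda>_. 0"] r by (simp add: nrm_zero)
  have m1: "(\<lambda>x. indicator B x * (1::real)) \<in> borel_measurable (leb q)"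
    by (rule meas_ball[OF has_grad_const])
  have "(\<integral>x. ?\<rho> x * (?\<phi> x)^2 \<partial>leb q) - (\<integral>x. ?\<rho> x * ?\<phi> x \<partial>leb q)^2
    \<le> 2 / \<kappa> * (\<integral>x. ?\<rho> x * (\<Sum>i<q. (?\<Gamma> i x)^2) \<partial>leb q)"
  proof (rule poincare_strongly_log_concave[where L = L and K = K])
    show "integrable (leb q) ?\<rho>"
      using weight_integrable[OF m1 _ t, of 1] by simp
    show "(\<integral>x. ?\<rho> x \<partial>leb q) = 1" using Z by (simp add: Zw_def)
    show "?\<phi> \<in> borel_measurable (leb q)" by (rule meas_ball[OF g])
    show "?\<Gamma> i \<in> borel_measurable (leb q)" if "i < q" for i by (rule meas_ball[OF g2[OF that]])
    show "0 \<le> ?\<rho> x" for x using Z by simp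
    show "\<bar>?\<phi> x\<bar> \<le> K" for x using K(1)[of x] K0 by (auto simp: indicator_def)
    show "\<bar>?\<Gamma> i x\<bar> \<le> K" if "i < q" for i x using K(2)[OF that, of x] K0 by (auto simp: indicator_def)
    show "0 < \<kappa>" by (rule \<kappa>)
    fix x y
    show "?\<rho> x * ?\<rho> y * exp (\<kappa> * (edist q x y)^2 / 4) \<le> (?\<rho> (midpt q x y))^2"
    proof (cases "nrm q x \<le> r \<and> nrm q y \<le> r")
      case True
      then have x: "nrm q x \<le> r" and y: "nrm q y \<le> r" by auto
      have "nrm q (midpt q x y) = nrm q (\<lambda>i. x i + (1/2) * (y i - x i))"
        by (auto simp: L2_set_def midpt_def field_simps)
      also have "\<dots> \<le> r" by (rule nrm_segment_le[OF x y]) auto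
      finally have mid: "nrm q (midpt q x y) \<le> r" .
      have "- U t x + (- U t y) + \<kappa> * (edist q x y)^2 / 4 \<le> - U t (midpt q x y) + (- U t (midpt q x y))"
        using U_midpoint[OF x y t] by (simp add: field_simps)
      then have "exp (- U t x) * exp (- U t y) * exp (\<kappa> * (edist q x y)^2 / 4) \<le> exp (- U t (midpt q x y)) * exp (- U t (midpt q x y))"
        unfolding exp_add[symmetric] by simp
      then show ?thesis using x y mid Z by (simp add: power2_eq_square divide_right_mono)
    qed auto
    assume "0 < ?\<rho> x" "0 < ?\<rho> y"
    then have x: "nrm q x \<le> r" and y: "nrm q y \<le> r"
      by (cases "nrm q x \<le> r"; cases "nrm q y \<le> r"; simp)+
    let ?v = "\<lambda>i. y i - x i"
    let ?z = "\<lambda>s i. x i + s * ?v i"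
    have z: "nrm q (?z s) \<le> r" if "0 \<le> s" "s \<le> 1" for s
      using nrm_segment_le[OF x y that] .
    obtain \<xi> where \<xi>: "0 < \<xi>" "\<xi> < 1" "\<phi> (?z 1) = \<phi> (?z 0) + (\<Sum>i<q. \<Gamma> i (?z 0) * ?v i)
        + (\<Sum>i<q. (\<Sum>j<q. \<Delta> i j (?z \<xi>) * ?v j) * ?v i) / 2"
    proof (rule taylor2_unit[of "\<lambda>s. \<phi> (?z s)" "\<lambda>s. \<Sum>i<q. \<Gamma> i (?z s) * ?v i" "\<lambda>s. \<Sum>i<q. (\<Sum>j<q. \<Delta> i j (?z s) * ?v j) * ?v i"])
      fix s :: real assume s: "0 \<le> s" "s \<le> 1"
      show "((\<lambda>s. \<phi> (?z s)) has_real_derivative (\<Sum>i<q. \<Gamma> i (?z s) * ?v i)) (at s)"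
        by (rule has_grad_line[OF g B_in[OF z[OF s]]])
      show "((\<lambda>s. \<Sum>i<q. \<Gamma> i (?z s) * ?v i) has_real_derivative (\<Sum>i<q. (\<Sum>j<q. \<Delta> i j (?z s) * ?v j) * ?v i)) (at s)"
        by (intro DERIV_sum DERIV_cmult_right) (rule has_grad_line[OF g2 B_in[OF z[OF s]]], simp)
    qed
    have "- (L * (nrm q ?v)^2) \<le> (\<Sum>i<q. (\<Sum>j<q. \<Delta> i j (?z \<xi>) * ?v j) * ?v i)"
      using \<xi> by (intro L z) auto
    moreover have "nrm q ?v = edist q x y" unfolding edist_def by (rule nrm_minus_commute)
    ultimately have "\<phi> x + (\<Sum>i<q. \<Gamma> i x * ?v i) - L / 2 * (edist q x y)^2 \<le> \<phi> y"
      using \<xi>(3) by simp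
    then show "?\<phi> x + (\<Sum>i<q. ?\<Gamma> i x * (y i - x i)) - L / 2 * (edist q x y)^2 \<le> ?\<phi> y"
      using x y by simp
  qed
  moreover have "(\<integral>x. ?\<rho> x * (?\<phi> x)^2 \<partial>leb q) = (\<integral>x. indicator B x * (exp (- U t x) * (\<phi> x)^2) \<partial>leb q) / Zw t"
    by (subst integral_divide_zero[symmetric]) (auto intro!: Bochner_Integration.integral_cong simp: indicator_def)
  moreover have "(\<integral>x. ?\<rho> x * ?\<phi> x \<partial>leb q) = (\<integral>x. indicator B x * (exp (- U t x) * \<phi> x) \<partial>leb q) / Zw t"
    by (subst integral_divide_zero[symmetric]) (auto intro!: Bochner_Integration.integral_cong simp: indicator_def)
  moreover have "(\<integral>x. ?\<rho> x * (\<Sum>i<q. (?\<Gamma> i x)^2) \<partial>leb q) = (\<integral>x. indicator B x * (exp (- U t x) * (\<Sum>i<q. (\<Gamma> i x)^2)) \<partial>leb q) / Zw t"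
    by (subst integral_divide_zero[symmetric]) (auto intro!: Bochner_Integration.integral_cong simp: indicator_def)
  ultimately show ?thesis by (simp only:)
qed

text \<open>The unnormalized Gaussian on the ball, of total mass \<open>Zw 0\<close>.
  \<open>Rb\<close> is cut off because \<open>exp_family\<close> demands a global bound; outside the
  ball \<open>GM\<close> has no mass.\<close>

definition GM :: "point measure" where
  "GM = density (leb q) (\<lambda>x. ennreal (indicator B x * exp (- Qf x)))"
definition Rb :: "point \<Rightarrow> real" where "Rb x = indicator B x * R x"

lemma Qf_U0: "Qf x = U 0 x" by (simp add: U_def)

lemma meas_Q[measurable]: "(\<lambda>x. indicator B x * exp (- Qf x)) \<in> borel_measurable (leb q)"
  unfolding Qf_U0 by (rule meas_weight)

lemma int_Q: "integrable (leb q) (\<lambda>x. indicator B x * exp (- Qf x))"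
  using weight_integrable[OF meas_ball[OF has_grad_const], of 1 1 0] by (simp add: U_def)

lemma GM_space[simp]: "space GM = Rn q" by (simp add: GM_def space_leb)

lemma emeasure_GM: "emeasure GM (space GM) = ennreal (Zw 0)"
proof -
  have "emeasure GM (space GM) = (\<integral>\<^sup>+x. ennreal (indicator B x * exp (- Qf x)) * indicator (space (leb q)) x \<partial>leb q)"
    unfolding GM_def by (subst emeasure_density) auto
  also have "\<dots> = (\<integral>\<^sup>+x. ennreal (indicator B x * exp (- Qf x)) \<partial>leb q)"
    by (intro nn_integral_cong) auto
  also have "\<dots> = ennreal (\<integral>x. indicator B x * exp (- Qf x) \<partial>leb q)"
    by (rule nn_integral_eq_integral[OF int_Q]) auto
  finally show ?thesis by (simp add: Zw_def U_def)
qed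

lemma Rb_meas: "Rb \<in> borel_measurable (leb q)"
  unfolding Rb_def[abs_def] by (rule meas_ball[OF gR(1)])

lemma Rb_bound: "\<bar>Rb x\<bar> \<le> \<beta> * r^2 / 2"
  using R_bound[of x] \<beta>_nonneg by (auto simp: Rb_def indicator_def)

sublocale EF: exp_family GM Rb "\<beta> * r^2 / 2"
proof -
  interpret finite_measure GM by (rule finite_measureI) (simp add: emeasure_GM del: GM_space)
  show "exp_family GM Rb (\<beta> * r^2 / 2)"
  proof
  show "measure GM (space GM) > 0" unfolding measure_def emeasure_GM using Zw_pos[of 0] by simp
  show "Rb \<in> borel_measurable GM" using Rb_meas by (simp add: GM_def)
  qed (rule Rb_bound)
qed

lemma Rb_eq: "(\<lambda>x. indicator B x * R x) = Rb" by (simp add: Rb_def fun_eq_iff)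

lemma EF_W: assumes m: "\<phi> \<in> borel_measurable (leb q)"
  shows "EF.W \<phi> t = (\<integral>x. indicator B x * (exp (- U t x) * \<phi> x) \<partial>leb q)"
proof -
  note [measurable] = m Rb_meas
  have "EF.W \<phi> t = (\<integral>x. \<phi> x * exp (t * Rb x) \<partial>GM)" by (rule EF.W_def)
  also have "\<dots> = (\<integral>x. indicator B x * exp (- Qf x) * (\<phi> x * exp (t * Rb x)) \<partial>leb q)"
    unfolding GM_def by (subst integral_density) auto
  also have "\<dots> = (\<integral>x. indicator B x * (exp (- U t x) * \<phi> x) \<partial>leb q)"
    by (intro Bochner_Integration.integral_cong) (auto simp: indicator_def U_def Rb_def exp_diff exp_minus divide_inverse mult_ac exp_add)
  finally show ?thesis .
qed

lemma EF_Z: "EF.Z t = Zw t"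
  unfolding EF.Z_def Zw_def by (subst EF_W) auto

lemma EF_E: "\<phi> \<in> borel_measurable (leb q) \<Longrightarrow> EF.E \<phi> t = (\<integral>x. indicator B x * (exp (- U t x) * \<phi> x) \<partial>leb q) / Zw t"
  unfolding EF.E_def EF_Z by (simp add: EF_W)

lemma EF_bm: "(\<lambda>x. indicator B x * \<phi> x) \<in> borel_measurable (leb q) \<Longrightarrow> (\<And>x. nrm q x \<le> r \<Longrightarrow> \<bar>\<phi> x\<bar> \<le> K) \<Longrightarrow> EF.bm (\<lambda>x. indicator B x * \<phi> x)"
proof -
  assume m: "(\<lambda>x. indicator B x * \<phi> x) \<in> borel_measurable (leb q)" and b: "\<And>x. nrm q x \<le> r \<Longrightarrow> \<bar>\<phi> x\<bar> \<le> K"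
  have "(\<lambda>x. indicator B x * \<phi> x) \<in> borel_measurable GM" using m by (simp add: GM_def)
  moreover have "\<bar>indicator B x * \<phi> x\<bar> \<le> \<bar>K\<bar>" for x
    using order.trans[OF b abs_ge_self] by (auto simp: indicator_def)
  ultimately show ?thesis unfolding EF.bm_def by blast
qed

lemma EF_Var_le:
  assumes t: "0 \<le> t" "t \<le> 1" and g: "has_grad q \<rho> \<phi> \<Gamma>"
    and g2: "\<And>i. i < q \<Longrightarrow> has_grad q \<rho> (\<Gamma> i) (\<Delta> i)"
    and L: "\<And>x v. nrm q x \<le> r \<Longrightarrow> - (L * (nrm q v)^2) \<le> (\<Sum>i<q. (\<Sum>j<q. \<Delta> i j x * v j) * v i)"
    and K: "\<And>x. nrm q x \<le> r \<Longrightarrow> \<bar>\<phi> x\<bar> \<le> K" "\<And>x i. i < q \<Longrightarrow> nrm q x \<le> r \<Longrightarrow> \<bar>\<Gamma> i x\<bar> \<le> K"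
  shows "EF.Var (\<lambda>x. indicator B x * \<phi> x) t \<le> 2 / \<kappa> * EF.E (\<lambda>x. \<Sum>i<q. (indicator B x * \<Gamma> i x)^2) t"
proof -
  note [measurable] = meas_ball[OF g] meas_ball[OF g2]
  have "EF.E (\<lambda>x. (indicator B x * \<phi> x)^2) t = (\<integral>x. indicator B x * (exp (- U t x) * (\<phi> x)^2) \<partial>leb q) / Zw t"
    by (subst EF_E, measurable) (auto intro!: arg_cong2[where f = "(/)"] Bochner_Integration.integral_cong simp: indicator_def)
  moreover have "EF.E (\<lambda>x. indicator B x * \<phi> x) t = (\<integral>x. indicator B x * (exp (- U t x) * \<phi> x) \<partial>leb q) / Zw t"
    by (subst EF_E, measurable) (auto intro!: arg_cong2[where f = "(/)"] Bochner_Integration.integral_cong simp: indicator_def)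
  moreover have "EF.E (\<lambda>x. \<Sum>i<q. (indicator B x * \<Gamma> i x)^2) t = (\<integral>x. indicator B x * (exp (- U t x) * (\<Sum>i<q. (\<Gamma> i x)^2)) \<partial>leb q) / Zw t"
    by (subst EF_E, measurable) (auto intro!: arg_cong2[where f = "(/)"] Bochner_Integration.integral_cong simp: indicator_def)
  ultimately show ?thesis unfolding EF.Var_def using ball_poincare[OF assms] by simp
qed

text \<open>The Poincare inequality is applied three times: to R, to each partial derivative, where
  the sum produces the Frobenius norm of the Hessian, and to each directional derivative, where the
  operator norm \<beta> appears. With c = 2 / \<kappa> and b = 2 \<beta>^2 / \<kappa> the smallness
  assumption is 4 c b \<le> 1.\<close>

theorem Zw_ratio_bounds:
  assumes small: "16 * \<beta>^2 \<le> \<kappa>^2" and M0: "0 \<le> M0"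
    and grad0: "\<And>w. (\<Sum>i<q. (w i)^2) = 1 \<Longrightarrow> EF.E (\<lambda>x. indicator B x * (\<Sum>i<q. w i * R1 i x)) 0 \<le> M0"
  shows "exp (EF.E Rb 0) \<le> Zw 1 / Zw 0"
    "Zw 1 / Zw 0 \<le> exp (EF.E Rb 0 + (8 / \<kappa>^2 * (real q * \<gamma>1^2) + 8 / \<kappa> * M0^2))"
proof -
  let ?c = "2 / \<kappa>" and ?b = "2 / \<kappa> * \<beta>^2" and ?D = "2 / \<kappa> * (real q * \<gamma>1^2)"
  let ?\<phi> = "\<lambda>i x. indicator B x * R1 i x"
  have R1b: "\<bar>R1 i x\<bar> \<le> \<beta> * r" if "i < q" "nrm q x \<le> r" for i x
  proof -
    have "(\<Sum>a<q. (if a = i then 1 else 0) * R1 a x) = R1 i x"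
      using that by (simp add: if_distrib[of "\<lambda>u. u * _"] cong: if_cong)
    moreover have "nrm q (\<lambda>a. if a = i then 1 else 0) = 1"
      using that by (simp add: L2_set_def if_distrib[of "\<lambda>u. u^2"] cong: if_cong)
    ultimately show ?thesis using R1_dir_bound[OF that(2), of "\<lambda>a. if a = i then 1 else 0"] by simp
  qed
  have R2b: "\<bar>R2 i j x\<bar> \<le> \<gamma>1" if "i < q" "j < q" "nrm q x \<le> r" for i j x
  proof -
    have "(\<Sum>b<q. (if b = j then 1 else 0) * R2 i b x) = R2 i j x"
      using that by (simp add: if_distrib[of "\<lambda>u. u * _"] cong: if_cong)
    moreover have "nrm q (\<lambda>b. if b = j then 1 else 0) = 1"
      using that by (simp add: L2_set_def if_distrib[of "\<lambda>u. u^2"] cong: if_cong)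
    ultimately show ?thesis using R2_row_bound[OF that(3,1), of "\<lambda>b. if b = j then 1 else 0"] by simp
  qed
  have bm: "EF.bm (?\<phi> i)" if "i < q" for i
    by (rule EF_bm[OF meas_ball[OF gR(2)] R1b]) (use that in auto)
  have bm2: "EF.bm (\<lambda>x. indicator B x * R2 i j x)" if "i < q" "j < q" for i j
    by (rule EF_bm[OF meas_ball[OF gR(3)] R2b]) (use that in auto)
  have dist: "(\<lambda>x. \<Sum>i<q. w i * ?\<phi> i x) = (\<lambda>x. indicator B x * (\<Sum>i<q. w i * R1 i x))" for w :: "nat \<Rightarrow> real"
    by (auto simp: indicator_def)
  have 1: "EF.Var (\<lambda>x. indicator B x * R x) t \<le> ?c * EF.E (\<lambda>x. \<Sum>i<q. (?\<phi> i x)^2) t" if "0 \<le> t" "t \<le> 1" for t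
  proof (rule EF_Var_le[OF that gR(1) gR(2), where L = \<beta> and K = "max (\<beta> * r^2 / 2) (\<beta> * r)"])
    fix x v assume x: "nrm q x \<le> r"
    have "(\<Sum>i<q. (\<Sum>j<q. R2 i j x * v j) * v i) = (\<Sum>i<q. \<Sum>j<q. v i * v j * R2 i j x)"
      unfolding sum_distrib_right by (intro sum.cong refl) (simp add: mult_ac)
    then show "- (\<beta> * (nrm q v)^2) \<le> (\<Sum>i<q. (\<Sum>j<q. R2 i j x * v j) * v i)"
      using R2_bilinear_bound[OF x, of v v] by (simp add: abs_le_iff power2_eq_square)
  qed (use R_bound R1b in \<open>auto simp: le_max_iff_disj\<close>)
  have vdir: "EF.Var (\<lambda>x. indicator B x * (\<Sum>i<q. w i * R1 i x)) t
      \<le> ?c * EF.E (\<lambda>x. \<Sum>j<q. (indicator B x * (\<Sum>i<q. w i * R2 i j x))^2) t"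
    if t: "0 \<le> t" "t \<le> 1" and w: "(\<Sum>i<q. (w i)^2) = 1" for t w
  proof -
    have n: "nrm q w = 1" using w by (simp add: L2_set_def)
    have g1: "has_grad q \<rho> (\<lambda>x. \<Sum>i<q. w i * R1 i x) (\<lambda>j x. \<Sum>i<q. w i * R2 i j x)"
      by (intro has_grad_sum has_grad_cmult gR) auto
    have g2: "has_grad q \<rho> (\<lambda>x. \<Sum>i<q. w i * R2 i j x) (\<lambda>k x. \<Sum>i<q. w i * R3 i j k x)" if "j < q" for j
      using that by (intro has_grad_sum has_grad_cmult gR) auto
    show ?thesis
    proof (rule EF_Var_le[OF t g1 g2, where L = "C * (sqrt q + q * \<rho>)" and K = "max (\<beta> * r) \<beta>"])
      fix x v assume x: "nrm q x \<le> r"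
      have "(\<Sum>i<q. (\<Sum>j<q. (\<Sum>a<q. w a * R3 a i j x) * v j) * v i) = (\<Sum>i<q. \<Sum>j<q. (\<Sum>a<q. w a * R3 a i j x) * v i * v j)"
        by (rule sum.cong[OF refl], subst sum_distrib_right, rule sum.cong[OF refl]) (simp only: mult_ac)
      then show "- (C * (sqrt q + q * \<rho>) * (nrm q v)^2) \<le> (\<Sum>i<q. (\<Sum>j<q. (\<Sum>a<q. w a * R3 a i j x) * v j) * v i)"
        using R3_dir_bound[OF B_in[OF x] w, of v] by (simp add: abs_le_iff)
    next
      fix x assume x: "nrm q x \<le> r"
      show "\<bar>\<Sum>i<q. w i * R1 i x\<bar> \<le> max (\<beta> * r) \<beta>" using R1_dir_bound[OF x, of w] n by simp
      fix j assume j: "j < q"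
      have "(\<Sum>i<q. w i * R2 i j x)^2 \<le> (\<Sum>b<q. (\<Sum>a<q. w a * R2 a b x)^2)"
        using j by (intro member_le_sum) auto
      also have "\<dots> \<le> \<beta>^2" by (rule R2_image_bound[OF x w])
      finally have "\<bar>\<Sum>i<q. w i * R2 i j x\<bar> \<le> \<beta>" using \<beta>_nonneg abs_le_square_iff[of "\<Sum>i<q. w i * R2 i j x" \<beta>] by simp
      then show "\<bar>\<Sum>i<q. w i * R2 i j x\<bar> \<le> max (\<beta> * r) \<beta>" by simp
    qed
  qed
  have 3: "EF.Var (\<lambda>x. \<Sum>i<q. w i * ?\<phi> i x) t \<le> ?b" if t: "0 \<le> t" "t \<le> 1" and w: "(\<Sum>i<q. (w i)^2) = 1" for t w
  proof -
    have bmj: "EF.bm (\<lambda>x. indicator B x * (\<Sum>i<q. w i * R2 i j x))" if "j < q" for j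
    proof -
      have "EF.bm (\<lambda>x. \<Sum>i<q. w i * (indicator B x * R2 i j x))"
        using that by (intro EF.bm_sum EF.bm_cmult bm2) auto
      then show ?thesis by (simp add: sum_distrib_left mult_ac)
    qed
    have "EF.E (\<lambda>x. \<Sum>j<q. (indicator B x * (\<Sum>i<q. w i * R2 i j x))^2) t \<le> EF.E (\<lambda>x. \<beta>^2) t"
    proof (rule EF.E_mono)
      show "EF.bm (\<lambda>x. \<Sum>j<q. (indicator B x * (\<Sum>i<q. w i * R2 i j x))^2)"
        using bmj by (intro EF.bm_sum EF.bm_power2) auto
      show "(\<Sum>j<q. (indicator B x * (\<Sum>i<q. w i * R2 i j x))^2) \<le> \<beta>^2" for x
        using R2_image_bound[OF _ w, of x] by (auto simp: indicator_def)
    qed simp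
    then have "?c * EF.E (\<lambda>x. \<Sum>j<q. (indicator B x * (\<Sum>i<q. w i * R2 i j x))^2) t \<le> ?c * \<beta>^2"
      using \<kappa> by (intro mult_left_mono) (auto simp: EF.E_const)
    then show ?thesis unfolding dist using vdir[OF t w] by linarith
  qed
  have 2: "(\<Sum>i<q. EF.Var (?\<phi> i) t) \<le> ?D" if t: "0 \<le> t" "t \<le> 1" for t
  proof -
    have "(\<Sum>i<q. EF.Var (?\<phi> i) t) \<le> (\<Sum>i<q. ?c * EF.E (\<lambda>x. \<Sum>j<q. (indicator B x * R2 i j x)^2) t)"
    proof (rule sum_mono)
      fix i assume "i \<in> {..<q}"
      then have i: "i < q" by simp
      let ?w = "\<lambda>a. if a = i then 1 else (0::real)"
      have s: "(\<Sum>a<q. ?w a * f a) = f i" for f :: "nat \<Rightarrow> real"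
        using i by (simp add: if_distrib[of "\<lambda>u. u * _"] cong: if_cong)
      have w: "(\<Sum>a<q. (?w a)^2) = 1" using i by (simp add: if_distrib[of "\<lambda>u. u^2"] cong: if_cong)
      show "EF.Var (?\<phi> i) t \<le> ?c * EF.E (\<lambda>x. \<Sum>j<q. (indicator B x * R2 i j x)^2) t"
        using vdir[OF t w] unfolding s .
    qed
    also have "\<dots> = ?c * EF.E (\<lambda>x. \<Sum>i<q. \<Sum>j<q. (indicator B x * R2 i j x)^2) t"
    proof -
      have "EF.E (\<lambda>x. \<Sum>i<q. \<Sum>j<q. (indicator B x * R2 i j x)^2) t = (\<Sum>i<q. EF.E (\<lambda>x. \<Sum>j<q. (indicator B x * R2 i j x)^2) t)"
        using bm2 by (intro EF.E_sum EF.bm_sum EF.bm_power2) auto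
      then show ?thesis by (simp add: sum_distrib_left)
    qed
    also have "\<dots> \<le> ?c * (real q * \<gamma>1^2)"
    proof (rule mult_left_mono)
      have "EF.E (\<lambda>x. \<Sum>i<q. \<Sum>j<q. (indicator B x * R2 i j x)^2) t \<le> EF.E (\<lambda>x. real q * \<gamma>1^2) t"
      proof (rule EF.E_mono)
        show "EF.bm (\<lambda>x. \<Sum>i<q. \<Sum>j<q. (indicator B x * R2 i j x)^2)"
          using bm2 by (intro EF.bm_sum EF.bm_power2) auto
        show "(\<Sum>i<q. \<Sum>j<q. (indicator B x * R2 i j x)^2) \<le> real q * \<gamma>1^2" for x
          using R2_frobenius[of x] by (auto simp: indicator_def)
      qed simp
      then show "EF.E (\<lambda>x. \<Sum>i<q. \<Sum>j<q. (indicator B x * R2 i j x)^2) t \<le> real q * \<gamma>1^2" by (simp add: EF.E_const)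
    qed (use \<kappa> in auto)
    finally show ?thesis .
  qed
  have 4: "EF.E (\<lambda>x. \<Sum>i<q. w i * ?\<phi> i x) 0 \<le> M0" if "(\<Sum>i<q. (w i)^2) = 1" for w
    unfolding dist by (rule grad0[OF that])
  have c: "0 \<le> ?c" "0 \<le> ?b" "4 * ?c * ?b \<le> 1"
    using \<kappa> small by (auto simp: field_simps power2_eq_square)
  have eq: "2 * ?c * ?D + 4 * ?c * M0^2 = 8 / \<kappa>^2 * (real q * \<gamma>1^2) + 8 / \<kappa> * M0^2"
    by (simp add: power2_eq_square)
  note bnd = EF.log_partition_bounds[of q ?\<phi> ?c M0 ?b ?D, OF bm c(1) M0 c(2,3) 1[unfolded Rb_eq] 2 3 4]
  show "exp (EF.E Rb 0) \<le> Zw 1 / Zw 0" using bnd(1) unfolding EF_Z .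
  show "Zw 1 / Zw 0 \<le> exp (EF.E Rb 0 + (8 / \<kappa>^2 * (real q * \<gamma>1^2) + 8 / \<kappa> * M0^2))"
    using bnd(2) unfolding EF_Z eq .
qed

end

subsection \<open>Gaussian integration by parts\<close>

lemma integral_gaussian_real:
  assumes "0 < (c::real)"
  shows "integrable lborel (\<lambda>x. exp (- (c * x^2)))" "(\<integral>x. exp (- (c * x^2)) \<partial>lborel) = sqrt (pi / c)"
proof -
  define \<sigma> where "\<sigma> = sqrt (1 / (2 * c))"
  have \<sigma>: "0 < \<sigma>" "\<sigma>^2 = 1 / (2 * c)" using assms by (auto simp: \<sigma>_def)
  have eq: "exp (- (c * x^2)) = sqrt (pi / c) * normal_density 0 \<sigma> x" for x
  proof -
    have "normal_density 0 \<sigma> x = 1 / sqrt (pi / c) * exp (- (c * x^2))"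
      unfolding normal_density_def \<sigma>(2) using assms by (simp add: field_simps)
    then show ?thesis using assms by simp
  qed
  show "integrable lborel (\<lambda>x. exp (- (c * x^2)))"
    unfolding eq by (intro integrable_mult_right integrable_normal_density \<sigma>)
  show "(\<integral>x. exp (- (c * x^2)) \<partial>lborel) = sqrt (pi / c)"
    unfolding eq by (simp add: integral_normal_density \<sigma>)
qed

text \<open>If f is not integrable, its Bochner integral is 0 by convention and the bound follows
  from g >= 0. Slice integrals can therefore be estimated without establishing their integrability
  separately.\<close>

lemma abs_integral_le_of_AE:
  fixes f g :: "'a \<Rightarrow> real"
  assumes g: "integrable M g" and le: "AE x in M. \<bar>f x\<bar> \<le> g x"
  shows "\<bar>\<integral>x. f x \<partial>M\<bar> \<le> (\<integral>x. g x \<partial>M)"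
proof (cases "integrable M f")
  case True
  have "\<bar>\<integral>x. f x \<partial>M\<bar> \<le> (\<integral>x. \<bar>f x\<bar> \<partial>M)" by (rule integral_abs_bound)
  also have "\<dots> \<le> (\<integral>x. g x \<partial>M)" using True g le by (intro integral_mono_AE) auto
  finally show ?thesis .
next
  case False
  have "0 \<le> (\<integral>x. g x \<partial>M)" using le by (intro integral_nonneg_AE) (auto elim: eventually_mono)
  then show ?thesis using False by (simp add: not_integrable_integral_eq)
qed

lemma integral_gaussian_iso:
  fixes I :: "nat set"
  assumes I: "finite I" and c: "0 < (c::real)"
  shows "integrable (Pi\<^sub>M I (\<lambda>_. lborel)) (\<lambda>x. exp (- (c * (\<Sum>j\<in>I. (x j)^2))))"
    "(\<integral>x. exp (- (c * (\<Sum>j\<in>I. (x j)^2))) \<partial>Pi\<^sub>M I (\<lambda>_. lborel)) = sqrt (pi / c) ^ card I"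
proof -
  have eq: "exp (- (c * (\<Sum>j\<in>I. (x j)^2))) = (\<Prod>j\<in>I. exp (- (c * (x j)^2)))" for x :: point
    using I by (simp add: exp_sum[symmetric] sum_negf[symmetric] sum_distrib_left)
  show "integrable (Pi\<^sub>M I (\<lambda>_. lborel)) (\<lambda>x. exp (- (c * (\<Sum>j\<in>I. (x j)^2))))"
    unfolding eq by (intro lborel_prod.product_integrable_prod I integral_gaussian_real c)
  show "(\<integral>x. exp (- (c * (\<Sum>j\<in>I. (x j)^2))) \<partial>Pi\<^sub>M I (\<lambda>_. lborel)) = sqrt (pi / c) ^ card I"
    unfolding eq by (subst lborel_prod.product_integral_prod) (auto simp: I c integral_gaussian_real)
qed

lemma cts_ball_line:
  assumes c: "cts_ball q \<rho> \<phi>" and x: "nrm q (\<lambda>i. x i + t * v i) < \<rho>"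
  shows "isCont (\<lambda>s. \<phi> (\<lambda>i. x i + s * v i)) t"
  unfolding continuous_at_eps_delta
proof (intro allI impI)
  fix e :: real assume "0 < e"
  with c x obtain d where d: "0 < d" "\<And>y. nrm q (\<lambda>i. y i - (x i + t * v i)) < d \<Longrightarrow> \<bar>\<phi> y - \<phi> (\<lambda>i. x i + t * v i)\<bar> < e"
    unfolding cts_ball_def by blast
  let ?n = "nrm q v"
  have n0: "0 \<le> ?n" by (rule L2_set_nonneg)
  show "\<exists>d>0. \<forall>s. dist s t < d \<longrightarrow> dist (\<phi> (\<lambda>i. x i + s * v i)) (\<phi> (\<lambda>i. x i + t * v i)) < e"
  proof (intro exI[of _ "d / (?n + 1)"] conjI allI impI)
    show "0 < d / (?n + 1)" using d n0 by (intro divide_pos_pos add_nonneg_pos) auto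
    fix s assume s: "dist s t < d / (?n + 1)"
    have df: "(\<lambda>i. (x i + s * v i) - (x i + t * v i)) = (\<lambda>i. (s - t) * v i)" by (auto simp: algebra_simps)
    have "\<bar>s - t\<bar> * ?n \<le> \<bar>s - t\<bar> * (?n + 1)" by (intro mult_left_mono) auto
    also have "\<dots> < d" using s n0 by (simp add: pos_less_divide_eq dist_real_def)
    finally have "nrm q (\<lambda>i. (x i + s * v i) - (x i + t * v i)) < d" unfolding df nrm_scale .
    then show "dist (\<phi> (\<lambda>i. x i + s * v i)) (\<phi> (\<lambda>i. x i + t * v i)) < e"
      using d(2) by (simp add: dist_real_def)
  qed
qed

lemma cts_ball_const: "cts_ball q \<rho> (\<lambda>x. c)"
  by (rule has_grad_imp_cts[OF has_grad_const])

lemma cts_ball_add: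
  assumes "cts_ball q \<rho> \<phi>" "cts_ball q \<rho> \<psi>"
  shows "cts_ball q \<rho> (\<lambda>x. \<phi> x + \<psi> x)"
  unfolding cts_ball_def
proof (intro allI impI)
  fix x and e :: real assume x: "nrm q x < \<rho>" and e: "0 < e"
  then have e2: "0 < e/2" by simp
  obtain d1 where d1: "0 < d1" "\<And>y. nrm q (\<lambda>i. y i - x i) < d1 \<Longrightarrow> \<bar>\<phi> y - \<phi> x\<bar> < e/2"
    using assms(1) x e2 unfolding cts_ball_def by blast
  obtain d2 where d2: "0 < d2" "\<And>y. nrm q (\<lambda>i. y i - x i) < d2 \<Longrightarrow> \<bar>\<psi> y - \<psi> x\<bar> < e/2"
    using assms(2) x e2 unfolding cts_ball_def by blast
  show "\<exists>d>0. \<forall>y. nrm q (\<lambda>i. y i - x i) < d \<longrightarrow> \<bar>\<phi> y + \<psi> y - (\<phi> x + \<psi> x)\<bar> < e"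
  proof (intro exI[of _ "min d1 d2"] conjI allI impI)
    fix y assume "nrm q (\<lambda>i. y i - x i) < min d1 d2"
    then have "\<bar>\<phi> y - \<phi> x\<bar> < e/2" "\<bar>\<psi> y - \<psi> x\<bar> < e/2" using d1 d2 by auto
    then show "\<bar>\<phi> y + \<psi> y - (\<phi> x + \<psi> x)\<bar> < e" by linarith
  qed (use d1 d2 in auto)
qed

lemma cts_ball_mult:
  assumes c: "cts_ball q \<rho> \<phi>" shows "cts_ball q \<rho> (\<lambda>x. c * \<phi> x)"
  unfolding cts_ball_def
proof (intro allI impI)
  fix x and e :: real assume x: "nrm q x < \<rho>" and e: "0 < e"
  have "0 < e / (\<bar>c\<bar> + 1)" using e by (intro divide_pos_pos add_nonneg_pos) auto
  then obtain d where d: "0 < d" "\<And>y. nrm q (\<lambda>i. y i - x i) < d \<Longrightarrow> \<bar>\<phi> y - \<phi> x\<bar> < e / (\<bar>c\<bar> + 1)"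
    using c x unfolding cts_ball_def by blast
  show "\<exists>d>0. \<forall>y. nrm q (\<lambda>i. y i - x i) < d \<longrightarrow> \<bar>c * \<phi> y - c * \<phi> x\<bar> < e"
  proof (intro exI[of _ d] conjI allI impI)
    fix y assume "nrm q (\<lambda>i. y i - x i) < d"
    from d(2)[OF this] have "\<bar>\<phi> y - \<phi> x\<bar> * (\<bar>c\<bar> + 1) < e" by (simp add: pos_less_divide_eq add_nonneg_pos)
    moreover have "\<bar>c * \<phi> y - c * \<phi> x\<bar> = \<bar>\<phi> y - \<phi> x\<bar> * \<bar>c\<bar>"
      by (simp add: right_diff_distrib[symmetric] abs_mult)
    moreover have "\<bar>\<phi> y - \<phi> x\<bar> * \<bar>c\<bar> \<le> \<bar>\<phi> y - \<phi> x\<bar> * (\<bar>c\<bar> + 1)" by (intro mult_left_mono) auto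
    ultimately show "\<bar>c * \<phi> y - c * \<phi> x\<bar> < e" by linarith
  qed (rule d(1))
qed

lemma cts_ball_sum:
  "finite I \<Longrightarrow> (\<And>a. a \<in> I \<Longrightarrow> cts_ball q \<rho> (f a)) \<Longrightarrow> cts_ball q \<rho> (\<lambda>x. \<Sum>a\<in>I. f a x)"
  by (induction I rule: finite_induct) (auto intro: cts_ball_add cts_ball_const)

context ball_fn
begin

text \<open>A pointwise bound on the boundary term, integrated over the q - 1 other coordinates: a
  constant times the Gaussian integral of exp (- \<kappa> |x|^2 / 4).\<close>

definition bdry :: real where "bdry = exp (- (\<kappa> * r^2 / 4)) * sqrt (4 * pi / \<kappa>) ^ (q - 1)"

lemma coord_grad: "i < q \<Longrightarrow> has_grad q \<rho>' (\<lambda>x. x i) (\<lambda>a x. if a = i then 1 else 0)"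
proof -
  assume i: "i < q"
  have "(\<lambda>x. \<Sum>a<q. (if a = i then 1 else 0) * x a) = (\<lambda>x::point. x i)"
    using i by (simp add: if_distrib[of "\<lambda>u. u * _"] cong: if_cong)
  then show ?thesis using has_grad_linear[of q \<rho>' "\<lambda>a. if a = i then 1 else 0"] by simp
qed

lemma HX_bound: assumes i: "i < q" and x: "nrm q x \<le> r" shows "\<bar>\<Sum>j<q. H i j * x j\<bar> \<le> nrm q (H i) * r"
  by (rule order.trans[OF ip_le_norms]) (use x in \<open>auto intro: mult_left_mono L2_set_nonneg\<close>)

text \<open>In direction i the ball is cut in a chord [-l, l], on which \<open>F\<close> is the
  derivative of - \<psi> exp (- Qf). The endpoints lie on the sphere, where Qf is at least \<kappa>
  r^2 / 2, so each chord contributes at most 2 K exp (- \<kappa> r^2 / 2).\<close>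

lemma ibp:
  assumes i: "i < q" and g: "has_grad q \<rho> \<psi> \<Gamma>" and cg: "cts_ball q \<rho> (\<Gamma> i)"
    and K: "\<And>x. nrm q x \<le> r \<Longrightarrow> \<bar>\<psi> x\<bar> \<le> K" and K': "\<And>x. nrm q x \<le> r \<Longrightarrow> \<bar>\<Gamma> i x\<bar> \<le> K'"
  shows "\<bar>(\<integral>x. indicator B x * (exp (- Qf x) * ((\<Sum>j<q. H i j * x j) * \<psi> x)) \<partial>leb q)
     - (\<integral>x. indicator B x * (exp (- Qf x) * \<Gamma> i x) \<partial>leb q)\<bar> \<le> 2 * K * bdry"
proof -
  define F where "F x = exp (- Qf x) * ((\<Sum>j<q. H i j * x j) * \<psi> x - \<Gamma> i x)" for x
  define I where "I = {..<q} - {i}"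
  have I: "finite I" "i \<notin> I" "insert i I = {..<q}" "card I = q - 1" using i by (auto simp: I_def)
  note [measurable] = meas_ball[OF g] cts_ball_measurable_closed[OF cg r(2)] coord_measurable
  have K0: "0 \<le> K" using K[of "\<lambda>_. 0"] r by (simp add: nrm_zero)
  have mH: "(\<lambda>x. indicator B x * (\<Sum>j<q. H i j * x j)) \<in> borel_measurable (leb q)"
    by (rule meas_ball[OF has_grad_linear])
  have m1: "(\<lambda>x. indicator B x * ((\<Sum>j<q. H i j * x j) * \<psi> x)) \<in> borel_measurable (leb q)"
  proof -
    note [measurable] = mH
    have "(\<lambda>x. indicator B x * ((\<Sum>j<q. H i j * x j) * \<psi> x)) = (\<lambda>x. (indicator B x * (\<Sum>j<q. H i j * x j)) * (indicator B x * \<psi> x))"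
      by (auto simp: indicator_def)
    also have "\<dots> \<in> borel_measurable (leb q)" by measurable
    finally show ?thesis .
  qed
  have b1: "\<bar>(\<Sum>j<q. H i j * x j) * \<psi> x\<bar> \<le> nrm q (H i) * r * K" if "nrm q x \<le> r" for x
    unfolding abs_mult using HX_bound[OF i that] K[OF that] by (intro mult_mono) (auto simp: L2_set_nonneg r less_imp_le)
  have i1: "integrable (leb q) (\<lambda>x. indicator B x * (exp (- Qf x) * ((\<Sum>j<q. H i j * x j) * \<psi> x)))"
    using weight_integrable[OF m1 b1, of 0] by (simp add: U_def)
  have i2: "integrable (leb q) (\<lambda>x. indicator B x * (exp (- Qf x) * \<Gamma> i x))"
    using weight_integrable[OF cts_ball_measurable_closed[OF cg r(2)] K', of 0] by (simp add: U_def)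
  have iF: "integrable (leb q) (\<lambda>x. indicator B x * F x)"
    using Bochner_Integration.integrable_diff[OF i1 i2] by (simp add: F_def algebra_simps)
  have "(\<integral>x. indicator B x * (exp (- Qf x) * ((\<Sum>j<q. H i j * x j) * \<psi> x)) \<partial>leb q)
     - (\<integral>x. indicator B x * (exp (- Qf x) * \<Gamma> i x) \<partial>leb q) = (\<integral>x. indicator B x * F x \<partial>leb q)"
    unfolding Bochner_Integration.integral_diff[OF i1 i2, symmetric] by (simp add: F_def algebra_simps)
  also have "\<dots> = (\<integral>x. (\<integral>y. indicator B (x(i := y)) * F (x(i := y)) \<partial>lborel) \<partial>Pi\<^sub>M I (\<lambda>_. lborel))"
    using iF unfolding leb_def I(3)[symmetric] by (intro lborel_prod.product_integral_insert I) auto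
  also have "\<bar>\<dots>\<bar> \<le> (\<integral>x. 2 * K * exp (- (\<kappa> * r^2 / 4)) * exp (- ((\<kappa>/4) * (\<Sum>j\<in>I. (x j)^2))) \<partial>Pi\<^sub>M I (\<lambda>_. lborel))"
  proof (rule abs_integral_le_of_AE)
    show "integrable (Pi\<^sub>M I (\<lambda>_. lborel)) (\<lambda>x. 2 * K * exp (- (\<kappa> * r^2 / 4)) * exp (- ((\<kappa>/4) * (\<Sum>j\<in>I. (x j)^2))))"
      using \<kappa> by (intro integrable_mult_right integral_gaussian_iso I) auto
    show "AE x in Pi\<^sub>M I (\<lambda>_. lborel). \<bar>\<integral>y. indicator B (x(i := y)) * F (x(i := y)) \<partial>lborel\<bar>
       \<le> 2 * K * exp (- (\<kappa> * r^2 / 4)) * exp (- ((\<kappa>/4) * (\<Sum>j\<in>I. (x j)^2)))"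
    proof (rule AE_I2)
      fix x :: point
      let ?x = "x(i := 0)" and ?v = "\<lambda>j. if j = i then 1 else (0::real)" and ?s = "\<Sum>j\<in>I. (x j)^2"
      have upd: "x(i := y) = (\<lambda>j. ?x j + y * ?v j)" for y by auto
      have n2: "(nrm q (x(i := y)))^2 = y^2 + ?s" for y
      proof -
        have c: "(\<Sum>j\<in>I. ((x(i := y)) j)^2) = ?s" by (rule sum.cong) (use I(2) in auto)
        show ?thesis unfolding L2_set_sq unfolding I(3)[symmetric] by (simp only: sum.insert[OF I(1,2)] fun_upd_same c)
      qed
      have nle: "nrm q (x(i := y)) \<le> r \<longleftrightarrow> y^2 + ?s \<le> r^2" for y
        unfolding n2[symmetric] using r L2_set_nonneg[of "x(i := y)" "{..<q}"] abs_le_square_iff[of "nrm q (x(i := y))" r]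
        by (simp del: fun_upd_apply)
      show "\<bar>\<integral>y. indicator B (x(i := y)) * F (x(i := y)) \<partial>lborel\<bar>
        \<le> 2 * K * exp (- (\<kappa> * r^2 / 4)) * exp (- ((\<kappa>/4) * ?s))"
      proof (cases "?s \<le> r^2")
        case False
        have "\<not> nrm q (x(i := y)) \<le> r" for y unfolding nle using False zero_le_power2[of y] by linarith
        then show ?thesis using K0 by simp
      next
        case True
        define l where "l = sqrt (r^2 - ?s)"
        have l: "0 \<le> l" "l^2 = r^2 - ?s" using True by (auto simp: l_def)
        have nl: "nrm q (x(i := y)) \<le> r \<longleftrightarrow> y \<in> {-l..l}" for y
        proof -
          have "y^2 + ?s \<le> r^2 \<longleftrightarrow> y^2 \<le> l^2" using l by auto
          also have "\<dots> \<longleftrightarrow> \<bar>y\<bar> \<le> \<bar>l\<bar>" by (simp add: abs_le_square_iff)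
          finally show ?thesis unfolding nle using l by auto
        qed
        let ?G = "\<lambda>y. - (\<psi> (x(i := y)) * exp (- Qf (x(i := y))))"
        have "(\<integral>y. indicator B (x(i := y)) * F (x(i := y)) \<partial>lborel) = (\<integral>y. F (x(i := y)) * indicator {-l..l} y \<partial>lborel)"
          using nl by (intro Bochner_Integration.integral_cong) (auto simp: indicator_def)
        also have "\<dots> = ?G l - ?G (-l)"
        proof (rule integral_FTC_Icc_real)
          show "-l \<le> l" using l by simp
          fix y assume "-l \<le> y" "y \<le> l"
          then have yB: "nrm q (x(i := y)) \<le> r" using nl by auto
          then have y\<rho>: "nrm q (\<lambda>j. ?x j + y * ?v j) < \<rho>" unfolding upd[symmetric] by (rule B_in)
          have s1: "(\<Sum>a<q. f a * ?v a) = f i" for f :: "nat \<Rightarrow> real" using i by (simp add: if_distrib[of "\<lambda>u. _ * u"] cong: if_cong)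
          have d1: "((\<lambda>s. \<psi> (x(i := s))) has_real_derivative \<Gamma> i (x(i := y))) (at y)"
            using has_grad_line[OF g y\<rho>] unfolding s1 upd[symmetric] .
          have d2: "((\<lambda>s. Qf (x(i := s))) has_real_derivative (\<Sum>j<q. H i j * (x(i := y)) j)) (at y)"
          proof -
            have "((\<lambda>s. Qf (x(i := s))) has_real_derivative (\<Sum>j<q. H i j * (?x j + y * ?v j))) (at y)"
              using has_grad_line[OF Qf_grad y\<rho>] unfolding s1 upd[symmetric] .
            then show ?thesis by (rule DERIV_cong) (auto intro!: sum.cong)
          qed
          show "(?G has_real_derivative F (x(i := y))) (at y)"
            unfolding F_def by (rule derivative_eq_intros d1 d2 refl)+ (simp add: algebra_simps)
          have c1: "isCont (\<lambda>s. \<Gamma> i (x(i := s))) y" using cts_ball_line[OF cg y\<rho>] unfolding upd[symmetric] .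
          have c2: "isCont (\<lambda>s. \<psi> (x(i := s))) y" by (rule DERIV_isCont[OF d1])
          have c3: "isCont (\<lambda>s. Qf (x(i := s))) y" by (rule DERIV_isCont[OF d2])
          have c4: "isCont (\<lambda>s. \<Sum>j<q. H i j * (x(i := s)) j) y"
          proof -
            have "isCont (\<lambda>s. (x(i := s)) j) y" for j by (cases "j = i") auto
            then show ?thesis by (intro continuous_intros)
          qed
          show "isCont (\<lambda>y. F (x(i := y))) y" unfolding F_def by (intro isCont_mult isCont_diff isCont_minus isCont_exp' c1 c2 c3 c4)
        qed
        also have "\<bar>\<dots>\<bar> \<le> K * exp (- (\<kappa> * r^2 / 2)) + K * exp (- (\<kappa> * r^2 / 2))"
        proof -
          have e: "\<bar>\<psi> (x(i := y)) * exp (- Qf (x(i := y)))\<bar> \<le> K * exp (- (\<kappa> * r^2 / 2))" if "y = l \<or> y = -l" for y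
          proof -
            have y2: "y^2 = l^2" using that by auto
            then have yB: "nrm q (x(i := y)) \<le> r" unfolding nle using l by simp
            have "(nrm q (x(i := y)))^2 = r^2" unfolding n2 y2 using l by simp
            then have "\<kappa> * r^2 / 2 \<le> Qf (x(i := y))" using Qf_low[of "x(i := y)"] by simp
            then have "exp (- Qf (x(i := y))) \<le> exp (- (\<kappa> * r^2 / 2))" by simp
            then show ?thesis unfolding abs_mult using K[OF yB] K0 by (intro mult_mono) auto
          qed
          show ?thesis using e[of l] e[of "-l"] by linarith
        qed
        also have "\<dots> = 2 * K * exp (- (\<kappa> * r^2 / 4)) * exp (- (\<kappa> * r^2 / 4))"
          by (simp add: mult.assoc exp_add[symmetric])
        \<comment> \<open>One half of the exponent stays constant. The other is weakened to a
          Gaussian in the remaining coordinates, whose squared norm is at most r^2 here, so that the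
          bound becomes integrable over all of them.\<close>
        also have "\<dots> \<le> 2 * K * exp (- (\<kappa> * r^2 / 4)) * exp (- ((\<kappa>/4) * ?s))"
        proof (rule mult_left_mono)
          have "\<kappa> / 4 * ?s \<le> \<kappa> / 4 * r^2" using True \<kappa> by (intro mult_left_mono) auto
          then show "exp (- (\<kappa> * r^2 / 4)) \<le> exp (- ((\<kappa>/4) * ?s))" by simp
        qed (use K0 in simp)
        finally show ?thesis .
      qed
    qed
  qed
  also have "\<dots> = 2 * K * exp (- (\<kappa> * r^2 / 4)) * sqrt (pi / (\<kappa>/4)) ^ (q - 1)"
    using integral_gaussian_iso(2)[OF I(1), of "\<kappa>/4"] \<kappa> unfolding I(4) integral_mult_right_zero by simp
  also have "\<dots> = 2 * K * bdry" by (simp add: bdry_def mult_ac)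
  finally show ?thesis .
qed

text \<open>The mean under the normalized Gaussian on the ball. In contrast to \<open>EF.E\<close>
  it takes functions that are not cut off, as needed for rescaled arguments; for continuous
  functions the two agree at parameter 0.\<close>

definition E0 :: "(point \<Rightarrow> real) \<Rightarrow> real" where
  "E0 f = (\<integral>x. indicator B x * (exp (- Qf x) * f x) \<partial>leb q) / Zw 0"

lemma Zw0: "0 < Zw 0" by (rule Zw_pos) auto

lemma weight0_integrable:
  assumes "cts_ball q \<rho> f" "\<And>x. nrm q x \<le> r \<Longrightarrow> \<bar>f x\<bar> \<le> K"
  shows "integrable (leb q) (\<lambda>x. indicator B x * (exp (- Qf x) * f x))"
  using weight_integrable[OF cts_ball_measurable_closed[OF assms(1) r(2)] assms(2), of 0] by (simp add: U_def)

lemma E0_EF: "cts_ball q \<rho> f \<Longrightarrow> E0 f = EF.E (\<lambda>x. indicator B x * f x) 0"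
proof -
  assume c: "cts_ball q \<rho> f"
  note [measurable] = cts_ball_measurable_closed[OF c r(2)]
  show ?thesis unfolding E0_def
    by (subst EF_E, measurable) (auto intro!: arg_cong2[where f = "(/)"] Bochner_Integration.integral_cong simp: indicator_def U_def)
qed

lemma ibp_E0:
  assumes "i < q" "has_grad q \<rho> \<psi> \<Gamma>" "cts_ball q \<rho> (\<Gamma> i)"
    "\<And>x. nrm q x \<le> r \<Longrightarrow> \<bar>\<psi> x\<bar> \<le> K" "\<And>x. nrm q x \<le> r \<Longrightarrow> \<bar>\<Gamma> i x\<bar> \<le> K'"
  shows "\<bar>E0 (\<lambda>x. (\<Sum>j<q. H i j * x j) * \<psi> x) - E0 (\<Gamma> i)\<bar> \<le> 2 * K * (bdry / Zw 0)"
  using divide_right_mono[OF ibp[OF assms], of "Zw 0"] Zw0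
  unfolding E0_def by (simp add: diff_divide_distrib[symmetric] abs_divide)

text \<open>By symmetry of H and S the right inverse in \<open>HS\<close> is a left inverse
  too.\<close>

lemma SH: assumes "a < q" shows "(\<Sum>b<q. S a b * (\<Sum>j<q. H b j * x j)) = x a"
proof -
  have "(\<Sum>b<q. S a b * (\<Sum>j<q. H b j * x j)) = (\<Sum>b<q. \<Sum>j<q. H j b * S b a * x j)"
    unfolding sum_distrib_left using assms by (intro sum.cong refl) (simp add: H_sym[of _ a] S_sym[of a] H_sym mult_ac)
  also have "\<dots> = (\<Sum>j<q. (\<Sum>b<q. H j b * S b a) * x j)"
    by (subst sum.swap) (simp add: sum_distrib_right)
  also have "\<dots> = (\<Sum>j<q. (if j = a then x j else 0))"
    using assms by (intro sum.cong refl) (simp add: HS)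
  finally show ?thesis using assms by simp
qed

lemma E0_sum:
  assumes "finite I" "\<And>a. a \<in> I \<Longrightarrow> integrable (leb q) (\<lambda>x. indicator B x * (exp (- Qf x) * f a x))"
  shows "E0 (\<lambda>x. \<Sum>a\<in>I. c a * f a x) = (\<Sum>a\<in>I. c a * E0 (f a))"
proof -
  have "(\<integral>x. indicator B x * (exp (- Qf x) * (\<Sum>a\<in>I. c a * f a x)) \<partial>leb q)
     = (\<integral>x. (\<Sum>a\<in>I. c a * (indicator B x * (exp (- Qf x) * f a x))) \<partial>leb q)"
    by (intro Bochner_Integration.integral_cong) (auto simp: sum_distrib_left mult_ac)
  also have "\<dots> = (\<Sum>a\<in>I. c a * (\<integral>x. indicator B x * (exp (- Qf x) * f a x) \<partial>leb q))"
    using assms by (subst Bochner_Integration.integral_sum) auto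
  finally show ?thesis by (simp add: E0_def sum_divide_distrib)
qed

lemma cts_ball_scale:
  assumes c: "cts_ball q \<rho> \<phi>" and s: "\<bar>s\<bar> \<le> 1"
  shows "cts_ball q \<rho> (\<lambda>x. \<phi> (\<lambda>i. s * x i))"
  unfolding cts_ball_def
proof (intro allI impI)
  fix x and e :: real assume x: "nrm q x < \<rho>" and e: "0 < e"
  have le: "\<bar>s\<bar> * nrm q z \<le> nrm q z" for z
    using mult_right_mono[OF s L2_set_nonneg[of z "{..<q}"]] by simp
  have "nrm q (\<lambda>i. s * x i) < \<rho>" using x le[of x] by (simp add: nrm_scale)
  with c e obtain d where d: "0 < d" "\<And>y. nrm q (\<lambda>i. y i - s * x i) < d \<Longrightarrow> \<bar>\<phi> y - \<phi> (\<lambda>i. s * x i)\<bar> < e"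
    unfolding cts_ball_def by blast
  show "\<exists>d>0. \<forall>y. nrm q (\<lambda>i. y i - x i) < d \<longrightarrow> \<bar>\<phi> (\<lambda>i. s * y i) - \<phi> (\<lambda>i. s * x i)\<bar> < e"
  proof (intro exI[of _ d] conjI allI impI)
    fix y assume y: "nrm q (\<lambda>i. y i - x i) < d"
    have n: "nrm q (\<lambda>i. s * y i - s * x i) = \<bar>s\<bar> * nrm q (\<lambda>i. y i - x i)"
      by (simp add: right_diff_distrib[symmetric] nrm_scale)
    show "\<bar>\<phi> (\<lambda>i. s * y i) - \<phi> (\<lambda>i. s * x i)\<bar> < e"
      using d(2)[of "\<lambda>i. s * y i"] le[of "\<lambda>i. y i - x i"] y unfolding n by linarith
  qed (rule d(1))
qed

text \<open>The boundary terms of integration by parts, summed with the weights |S a b|. Multiplied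
  by a bound on the partial derivatives of a function, this is the boundary error of its
  mean.\<close>

definition err :: real where "err = 2 * (bdry / Zw 0) * (sqrt q * (q / \<kappa>))"

lemma bdry_nonneg: "0 \<le> bdry" unfolding bdry_def using \<kappa> by (intro mult_nonneg_nonneg) auto

lemma err_nonneg: "0 \<le> err"
  unfolding err_def using Zw0 \<kappa> by (intro mult_nonneg_nonneg divide_nonneg_pos) (auto simp: bdry_nonneg)

text \<open>The heat-flow argument: \<open>E0 (\<phi> (s x))\<close> interpolates between \<open>\<phi> 0\<close> and \<open>E0 \<phi>\<close>, and Gaussian integration by
  parts turns its derivative in \<open>s\<close> into the contraction of the second derivative with the covariance \<open>S\<close>.\<close>

lemma heat:
  assumes g: "has_grad q \<rho> \<phi> \<Gamma>" and g2: "\<And>a. a < q \<Longrightarrow> has_grad q \<rho> (\<Gamma> a) (\<Delta> a)"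
    and c2: "\<And>a b. a < q \<Longrightarrow> b < q \<Longrightarrow> cts_ball q \<rho> (\<Delta> a b)"
    and K\<phi>: "\<And>x. nrm q x \<le> r \<Longrightarrow> \<bar>\<phi> x\<bar> \<le> K\<phi>"
    and K: "\<And>x a. a < q \<Longrightarrow> nrm q x \<le> r \<Longrightarrow> \<bar>\<Gamma> a x\<bar> \<le> K"
    and K2: "\<And>x a b. a < q \<Longrightarrow> b < q \<Longrightarrow> nrm q x \<le> r \<Longrightarrow> \<bar>\<Delta> a b x\<bar> \<le> K2"
    and A: "\<And>s. 0 < s \<Longrightarrow> s < 1 \<Longrightarrow> \<bar>E0 (\<lambda>x. \<Sum>a<q. \<Sum>b<q. S a b * \<Delta> a b (\<lambda>i. s * x i))\<bar> \<le> A"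
  shows "\<bar>E0 \<phi> - \<phi> (\<lambda>_. 0)\<bar> \<le> A + K * err"
proof -
  let ?f = "\<lambda>s. E0 (\<lambda>x. \<phi> (\<lambda>i. s * x i))"
  let ?d = "\<lambda>s x. \<Sum>a<q. \<Gamma> a (\<lambda>i. s * x i) * x a"
  have K0: "0 \<le> K" using K[OF q, of "\<lambda>_. 0"] r by (simp add: nrm_zero)
  let ?L = "K * (sqrt q * r)"
  have L0: "0 \<le> ?L" using K0 r by simp
  have dL: "\<bar>?d s x\<bar> \<le> ?L" if s: "0 \<le> s" "s \<le> 1" and x: "nrm q x \<le> r" for s x
  proof -
    have "\<bar>?d s x\<bar> \<le> K * (\<Sum>c<q. \<bar>x c\<bar>)"
      using K[OF _ B_scale[OF x s]] by (intro abs_sum_mult_le)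
    also have "\<dots> \<le> ?L" by (intro mult_left_mono sum_abs_B x K0)
    finally show ?thesis .
  qed
  have der: "((\<lambda>s. \<phi> (\<lambda>i. s * x i)) has_real_derivative ?d s x) (at s)"
    if s: "0 \<le> s" "s \<le> 1" and x: "nrm q x \<le> r" for s x
    by (rule has_grad_ray[OF g B_in[OF B_scale[OF x s]]])
  have cs: "cts_ball q \<rho> (\<lambda>x. \<phi> (\<lambda>i. s * x i))" if "0 \<le> s" "s \<le> 1" for s
    using that by (intro cts_ball_scale has_grad_imp_cts[OF g]) auto
  have ints: "integrable (leb q) (\<lambda>x. indicator B x * (exp (- Qf x) * \<phi> (\<lambda>i. s * x i)))" if "0 \<le> s" "s \<le> 1" for s
    by (rule weight0_integrable[OF cs[OF that] K\<phi>[OF B_scale]]) (use that in auto)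
  have gd: "has_grad q \<rho> (\<lambda>x. \<Gamma> a (\<lambda>i. s * x i)) (\<lambda>b x. s * \<Delta> a b (\<lambda>i. s * x i))" if "0 \<le> s" "s \<le> 1" "a < q" for s a
    using that by (intro has_grad_scale g2) auto
  have lip: "\<bar>\<phi> (\<lambda>i. s * x i) - \<phi> (\<lambda>i. t * x i)\<bar> \<le> ?L * \<bar>s - t\<bar>"
    if "0 \<le> s" "s \<le> 1" "0 \<le> t" "t \<le> 1" "nrm q x \<le> r" for s t x
  proof -
    have *: "\<bar>\<phi> (\<lambda>i. s * x i) - \<phi> (\<lambda>i. t * x i)\<bar> \<le> ?L * \<bar>s - t\<bar>"
      if st: "0 \<le> s" "s < t" "t \<le> 1" for s t
    proof -
      have "\<exists>z>s. z < t \<and> \<phi> (\<lambda>i. t * x i) - \<phi> (\<lambda>i. s * x i) = (t - s) * ?d z x"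
        using st \<open>nrm q x \<le> r\<close> by (intro MVT2 der) auto
      then obtain z where z: "s < z" "z < t" "\<phi> (\<lambda>i. t * x i) - \<phi> (\<lambda>i. s * x i) = (t - s) * ?d z x" by auto
      have "\<bar>\<phi> (\<lambda>i. s * x i) - \<phi> (\<lambda>i. t * x i)\<bar> = \<bar>s - t\<bar> * \<bar>?d z x\<bar>"
        using z(3) by (metis abs_minus_commute abs_mult)
      also have "\<dots> \<le> \<bar>s - t\<bar> * ?L" using z st \<open>nrm q x \<le> r\<close> by (intro mult_left_mono dL) auto
      finally show ?thesis by (simp only: mult.commute)
    qed
    show ?thesis using *[of s t] *[of t s] that
      by (cases s t rule: linorder_cases) (auto simp: abs_minus_commute)
  qed
  \<comment> \<open>The differentiation lemma dominates by constants and needs a finite measure, so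
    the weight is moved from the integrand into the measure.\<close>
  have fin: "finite_measure GM" by unfold_locales
  have GMi: "(\<integral>x. indicator B x * f x \<partial>GM) = (\<integral>x. indicator B x * (exp (- Qf x) * f x) \<partial>leb q)"
    if [measurable]: "(\<lambda>x. indicator B x * f x) \<in> borel_measurable (leb q)" for f :: "point \<Rightarrow> real"
    unfolding GM_def
    by (subst integral_density, measurable) (auto intro!: Bochner_Integration.integral_cong simp: indicator_def)
  have fd: "(?f has_real_derivative E0 (?d s)) (at s)" if s: "0 < s" "s < 1" for s
  proof -
    have md: "(\<lambda>x. indicator B x * ?d s x) \<in> borel_measurable (leb q)"
    proof -
      have "(\<lambda>x. indicator B x * ?d s x) = (\<lambda>x. \<Sum>a<q. (indicator B x * \<Gamma> a (\<lambda>i. s * x i)) * (indicator B x * x a))"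
        by (auto simp: indicator_def)
      also have "\<dots> \<in> borel_measurable (leb q)"
        using s by (intro borel_measurable_sum borel_measurable_times meas_ball[OF gd] meas_ball[OF coord_grad]) auto
      finally show ?thesis .
    qed
    have "((\<lambda>s. \<integral>x. indicator B x * \<phi> (\<lambda>i. s * x i) \<partial>GM) has_real_derivative (\<integral>x. indicator B x * ?d s x \<partial>GM)) (at s)"
    proof (rule has_real_derivative_integral[OF fin s, where K = ?L])
      fix x t assume t: "0 < t" "t < (1::real)"
      show "((\<lambda>s. indicator B x * \<phi> (\<lambda>i. s * x i)) has_real_derivative indicator B x * ?d t x) (at t)"
      proof (cases "nrm q x \<le> r")
        case True
        then show ?thesis using der[of t x] t by simp
      qed simp
      show "\<bar>indicator B x * ?d t x\<bar> \<le> ?L" using dL[of t x] L0 t by (auto simp: indicator_def)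
    next
      fix t :: real assume t: "0 < t" "t < 1"
      have [measurable]: "(\<lambda>x. indicator B x * \<phi> (\<lambda>i. t * x i)) \<in> borel_measurable (leb q)"
        using t by (intro cts_ball_measurable_closed[OF cs r(2)]) auto
      have "\<bar>indicator B x * \<phi> (\<lambda>i. t * x i)\<bar> \<le> \<bar>K\<phi>\<bar>" for x
        using order.trans[OF K\<phi>[OF B_scale] abs_ge_self] t by (auto simp: indicator_def)
      then show "integrable GM (\<lambda>x. indicator B x * \<phi> (\<lambda>i. t * x i))"
        by (intro EF.integrable_const_bound[where B = "\<bar>K\<phi>\<bar>"]) (auto simp: GM_def)
    qed (use md in \<open>simp add: GM_def\<close>)
    then have "((\<lambda>s. (\<integral>x. indicator B x * \<phi> (\<lambda>i. s * x i) \<partial>GM) / Zw 0) has_real_derivative (\<integral>x. indicator B x * ?d s x \<partial>GM) / Zw 0) (at s)"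
      by (rule DERIV_cdivide)
    then have D: "((\<lambda>s. (\<integral>x. indicator B x * \<phi> (\<lambda>i. s * x i) \<partial>GM) / Zw 0) has_real_derivative E0 (?d s)) (at s)"
      unfolding E0_def GMi[OF md] .
    show ?thesis
    proof (rule has_field_derivative_transform_within_open[OF D, of "{0<..<1}"])
      fix t assume t: "t \<in> {0<..<(1::real)}"
      then show "(\<integral>x. indicator B x * \<phi> (\<lambda>i. t * x i) \<partial>GM) / Zw 0 = ?f t"
        unfolding E0_def by (subst GMi) (auto intro!: cts_ball_measurable_closed[OF cs r(2)])
    qed (use s in auto)
  qed
  \<comment> \<open>The derivative is available for 0 < s < 1 only; the Lipschitz bound gives the
    continuity up to both ends that the mean value theorem requires.\<close>
  have fl: "\<bar>?f s - ?f t\<bar> \<le> ?L * \<bar>s - t\<bar>" if s: "0 \<le> s" "s \<le> 1" and t: "0 \<le> t" "t \<le> 1" for s t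
  proof -
    have iw: "integrable (leb q) (\<lambda>x. indicator B x * (exp (- Qf x) * (?L * \<bar>s - t\<bar>)))"
      by (rule weight0_integrable[OF has_grad_imp_cts[OF has_grad_const], where K = "\<bar>?L * \<bar>s - t\<bar>\<bar>"]) simp
    have "\<bar>(\<integral>x. indicator B x * (exp (- Qf x) * \<phi> (\<lambda>i. s * x i)) \<partial>leb q) - (\<integral>x. indicator B x * (exp (- Qf x) * \<phi> (\<lambda>i. t * x i)) \<partial>leb q)\<bar>
      = \<bar>\<integral>x. indicator B x * (exp (- Qf x) * \<phi> (\<lambda>i. s * x i)) - indicator B x * (exp (- Qf x) * \<phi> (\<lambda>i. t * x i)) \<partial>leb q\<bar>"
      using ints[OF s] ints[OF t] by simp
    also have "\<dots> \<le> (\<integral>x. indicator B x * (exp (- Qf x) * (?L * \<bar>s - t\<bar>)) \<partial>leb q)"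
    proof (rule abs_integral_le_of_AE[OF iw], rule AE_I2)
      fix x
      show "\<bar>indicator B x * (exp (- Qf x) * \<phi> (\<lambda>i. s * x i)) - indicator B x * (exp (- Qf x) * \<phi> (\<lambda>i. t * x i))\<bar>
        \<le> indicator B x * (exp (- Qf x) * (?L * \<bar>s - t\<bar>))"
      proof (cases "nrm q x \<le> r")
        case True
        have "\<bar>exp (- Qf x) * (\<phi> (\<lambda>i. s * x i) - \<phi> (\<lambda>i. t * x i))\<bar> \<le> exp (- Qf x) * (?L * \<bar>s - t\<bar>)"
          unfolding abs_mult using lip[OF s t True] by (intro mult_mono) auto
        then show ?thesis using True by (simp add: right_diff_distrib)
      qed simp
    qed
    also have "\<dots> = ?L * \<bar>s - t\<bar> * Zw 0"
      unfolding Zw_def by (simp add: U_def mult_ac flip: integral_mult_right_zero)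
    finally have "\<bar>?f s - ?f t\<bar> * Zw 0 \<le> ?L * \<bar>s - t\<bar> * Zw 0"
      using Zw0 unfolding E0_def diff_divide_distrib[symmetric] abs_divide by simp
    then show ?thesis using Zw0 by simp
  qed
  have cont: "continuous_on {0..1} ?f"
    unfolding continuous_on_iff
  proof (intro ballI allI impI)
    fix t e :: real assume t: "t \<in> {0..1}" and e: "0 < e"
    have L1: "0 < ?L + 1" using L0 by linarith
    show "\<exists>d>0. \<forall>s\<in>{0..1}. dist s t < d \<longrightarrow> dist (?f s) (?f t) < e"
    proof (intro exI[of _ "e / (?L + 1)"] conjI ballI impI)
      show "0 < e / (?L + 1)" using e L1 by simp
      fix s :: real assume s: "s \<in> {0..1}" "dist s t < e / (?L + 1)"
      have "\<bar>?f s - ?f t\<bar> \<le> ?L * \<bar>s - t\<bar>" using fl s t by auto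
      also have "\<dots> \<le> (?L + 1) * \<bar>s - t\<bar>" by (intro mult_right_mono) auto
      also have "\<dots> < e" using s(2) L1 by (simp add: dist_real_def pos_less_divide_eq mult.commute)
      finally show "dist (?f s) (?f t) < e" by (simp add: dist_real_def)
    qed
  qed
  obtain l z where z: "0 < z" "z < 1" "(?f has_real_derivative l) (at z)" "?f 1 - ?f 0 = (1 - 0) * l"
    using MVT[of 0 1 ?f] cont fd by (force simp: real_differentiable_def)
  have lz: "l = E0 (?d z)" using DERIV_unique[OF z(3) fd[OF z(1,2)]] .
  let ?HX = "\<lambda>b x. (\<Sum>j<q. H b j * x j)"
  have iHG: "integrable (leb q) (\<lambda>x. indicator B x * (exp (- Qf x) * (?HX b x * \<Gamma> a (\<lambda>i. z * x i))))" if "a < q" "b < q" for a b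
  proof -
    have m: "(\<lambda>x. indicator B x * (?HX b x * \<Gamma> a (\<lambda>i. z * x i))) \<in> borel_measurable (leb q)"
    proof -
      have "(\<lambda>x. indicator B x * (?HX b x * \<Gamma> a (\<lambda>i. z * x i))) = (\<lambda>x. (indicator B x * ?HX b x) * (indicator B x * \<Gamma> a (\<lambda>i. z * x i)))"
        by (auto simp: indicator_def)
      also have "\<dots> \<in> borel_measurable (leb q)"
        using that z by (intro borel_measurable_times meas_ball[OF gd] meas_ball[OF has_grad_linear]) auto
      finally show ?thesis .
    qed
    have b: "\<bar>?HX b x * \<Gamma> a (\<lambda>i. z * x i)\<bar> \<le> nrm q (H b) * r * K" if "nrm q x \<le> r" for x
      unfolding abs_mult using HX_bound[OF \<open>b < q\<close> that] K[OF \<open>a < q\<close> B_scale[OF that, of z]] z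
      by (intro mult_mono) (auto simp: L2_set_nonneg r less_imp_le)
    have "integrable (leb q) (\<lambda>x. indicator B x * (exp (- U 0 x) * (?HX b x * \<Gamma> a (\<lambda>i. z * x i))))"
      by (rule weight_integrable[OF m b]) auto
    then show ?thesis unfolding Qf_U0 .
  qed
  \<comment> \<open>Writing x as S (H x) creates the factors (H x) b, which integration by parts
    turns into derivatives of the gradient.\<close>
  have "E0 (?d z) = E0 (\<lambda>x. \<Sum>(a, b)\<in>{..<q} \<times> {..<q}. S a b * (?HX b x * \<Gamma> a (\<lambda>i. z * x i)))"
  proof -
    have "?d z x = (\<Sum>(a, b)\<in>{..<q} \<times> {..<q}. S a b * (?HX b x * \<Gamma> a (\<lambda>i. z * x i)))" for x
    proof -
      have "?d z x = (\<Sum>a<q. \<Gamma> a (\<lambda>i. z * x i) * (\<Sum>b<q. S a b * ?HX b x))"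
        by (intro sum.cong refl) (simp add: SH)
      also have "\<dots> = (\<Sum>a<q. \<Sum>b<q. S a b * (?HX b x * \<Gamma> a (\<lambda>i. z * x i)))"
        by (rule sum.cong[OF refl], subst sum_distrib_left, rule sum.cong[OF refl]) (simp only: mult_ac)
      finally show ?thesis unfolding sum.cartesian_product .
    qed
    then show ?thesis by simp
  qed
  also have "\<dots> = (\<Sum>(a, b)\<in>{..<q} \<times> {..<q}. S a b * E0 (\<lambda>x. ?HX b x * \<Gamma> a (\<lambda>i. z * x i)))"
    unfolding split_def by (rule E0_sum) (auto intro: iHG)
  finally have e1: "E0 (?d z) = (\<Sum>(a, b)\<in>{..<q} \<times> {..<q}. S a b * E0 (\<lambda>x. ?HX b x * \<Gamma> a (\<lambda>i. z * x i)))" .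
  \<comment> \<open>The factor z comes from differentiating the gradient at the rescaled point z x;
    being less than 1, it is dropped in the final estimate.\<close>
  have cD: "cts_ball q \<rho> (\<lambda>x. z * \<Delta> a b (\<lambda>i. z * x i))" if "a < q" "b < q" for a b
    using z by (intro cts_ball_mult cts_ball_scale[OF c2[OF that]]) auto
  have iD: "integrable (leb q) (\<lambda>x. indicator B x * (exp (- Qf x) * \<Delta> a b (\<lambda>i. z * x i)))" if "a < q" "b < q" for a b
    by (rule weight0_integrable[OF cts_ball_scale[OF c2[OF that]] K2[OF that B_scale]]) (use z in auto)
  have "E0 (\<lambda>x. \<Sum>a<q. \<Sum>b<q. S a b * \<Delta> a b (\<lambda>i. z * x i)) = (\<Sum>(a, b)\<in>{..<q} \<times> {..<q}. S a b * E0 (\<lambda>x. \<Delta> a b (\<lambda>i. z * x i)))"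
    unfolding sum.cartesian_product split_def by (rule E0_sum) (auto intro: iD)
  then have e2: "z * E0 (\<lambda>x. \<Sum>a<q. \<Sum>b<q. S a b * \<Delta> a b (\<lambda>i. z * x i)) = (\<Sum>(a, b)\<in>{..<q} \<times> {..<q}. S a b * E0 (\<lambda>x. z * \<Delta> a b (\<lambda>i. z * x i)))"
  proof -
    have "E0 (\<lambda>x. z * f x) = z * E0 f" for f
      unfolding E0_def by (simp add: mult_ac flip: integral_mult_right_zero)
    then show ?thesis using \<open>E0 (\<lambda>x. \<Sum>a<q. \<Sum>b<q. S a b * \<Delta> a b (\<lambda>i. z * x i)) = _\<close>
      by (simp add: sum_distrib_left split_def mult_ac)
  qed
  have "\<bar>E0 (?d z) - z * E0 (\<lambda>x. \<Sum>a<q. \<Sum>b<q. S a b * \<Delta> a b (\<lambda>i. z * x i))\<bar>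
     \<le> (\<Sum>(a, b)\<in>{..<q} \<times> {..<q}. \<bar>S a b\<bar> * (2 * K * (bdry / Zw 0)))"
    unfolding e1 e2 sum_subtractf[symmetric]
  proof (rule order.trans[OF sum_abs], rule sum_mono)
    fix ab assume "ab \<in> {..<q} \<times> {..<q}"
    then obtain a b where ab: "ab = (a, b)" "a < q" "b < q" by auto
    have "\<bar>E0 (\<lambda>x. ?HX b x * \<Gamma> a (\<lambda>i. z * x i)) - E0 (\<lambda>x. z * \<Delta> a b (\<lambda>i. z * x i))\<bar> \<le> 2 * K * (bdry / Zw 0)"
    proof (rule ibp_E0[OF ab(3) gd cD[OF ab(2,3)], where K' = K2])
      fix x assume x: "nrm q x \<le> r"
      show "\<bar>\<Gamma> a (\<lambda>i. z * x i)\<bar> \<le> K" using z by (intro K ab B_scale x) auto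
      have "\<bar>z * \<Delta> a b (\<lambda>i. z * x i)\<bar> \<le> 1 * K2"
        unfolding abs_mult using z by (intro mult_mono K2 ab B_scale x) auto
      then show "\<bar>z * \<Delta> a b (\<lambda>i. z * x i)\<bar> \<le> K2" by simp
    qed (use z ab in auto)
    then have "\<bar>S a b\<bar> * \<bar>E0 (\<lambda>x. ?HX b x * \<Gamma> a (\<lambda>i. z * x i)) - E0 (\<lambda>x. z * \<Delta> a b (\<lambda>i. z * x i))\<bar> \<le> \<bar>S a b\<bar> * (2 * K * (bdry / Zw 0))"
      by (intro mult_left_mono) auto
    then show "\<bar>(case ab of (a, b) \<Rightarrow> S a b * E0 (\<lambda>x. ?HX b x * \<Gamma> a (\<lambda>i. z * x i))) - (case ab of (a, b) \<Rightarrow> S a b * E0 (\<lambda>x. z * \<Delta> a b (\<lambda>i. z * x i)))\<bar>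
       \<le> (case ab of (a, b) \<Rightarrow> \<bar>S a b\<bar> * (2 * K * (bdry / Zw 0)))"
      unfolding ab by (simp add: right_diff_distrib[symmetric] abs_mult)
  qed
  also have "\<dots> = (\<Sum>a<q. \<Sum>b<q. \<bar>S a b\<bar>) * (2 * K * (bdry / Zw 0))"
    by (simp only: sum.cartesian_product[symmetric] sum_distrib_right)
  also have "\<dots> \<le> (sqrt q * (q / \<kappa>)) * (2 * K * (bdry / Zw 0))"
    using K0 bdry_nonneg Zw0 by (intro mult_right_mono S_abs_sum) auto
  also have "\<dots> = K * err" by (simp add: err_def mult_ac)
  finally have "\<bar>E0 (?d z)\<bar> \<le> \<bar>z * E0 (\<lambda>x. \<Sum>a<q. \<Sum>b<q. S a b * \<Delta> a b (\<lambda>i. z * x i))\<bar> + K * err" by linarith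
  also have "\<bar>z * E0 (\<lambda>x. \<Sum>a<q. \<Sum>b<q. S a b * \<Delta> a b (\<lambda>i. z * x i))\<bar> \<le> 1 * A"
    unfolding abs_mult using z A[of z] by (intro mult_mono) auto
  finally have "\<bar>l\<bar> \<le> A + K * err" using lz by simp
  moreover have "?f 1 = E0 \<phi>" by simp
  moreover have "?f 0 = \<phi> (\<lambda>_. 0)"
    using Zw0 unfolding E0_def Zw_def by (simp add: U_def mult.assoc[symmetric])
  ultimately show ?thesis using z(4) by simp
qed

section \<open>Means of the remainder and of its gradient under the Gaussian on the ball\<close>

lemma entry_bound:
  assumes T: "\<And>u v. \<bar>\<Sum>a<q. \<Sum>b<q. M a b * u a * v b\<bar> \<le> K * nrm q u * nrm q v" and "a < q" "b < q"
  shows "\<bar>M a b\<bar> \<le> K"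
proof -
  let ?e = "\<lambda>i j. if j = i then 1 else (0::real)"
  have n: "nrm q (?e i) = 1" if "i < q" for i
    using that by (simp add: L2_set_def if_distrib[of "\<lambda>u. u^2"] cong: if_cong)
  have "(\<Sum>a'<q. \<Sum>b'<q. M a' b' * ?e a a' * ?e b b') = (\<Sum>a'<q. if a' = a then M a b else 0)"
    using assms(3) by (intro sum.cong refl) (simp add: if_distrib[of "\<lambda>u. _ * u"] cong: if_cong)
  also have "\<dots> = M a b" using assms(2) by simp
  finally show ?thesis using T[of "?e a" "?e b"] n assms by simp
qed

lemma R4_entry: "a < q \<Longrightarrow> b < q \<Longrightarrow> c < q \<Longrightarrow> d < q \<Longrightarrow> nrm q x < \<rho> \<Longrightarrow> \<bar>R4 a b c d x\<bar> \<le> C"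
  using entry_bound[where M = "\<lambda>a b. R4 a b c d x" and K = C, OF T4] by blast

text \<open>Entrywise size is enough here: it enters \<open>heat\<close> as the bound on second
  derivatives, which secures integrability and does not appear in the conclusion.\<close>

lemma R3_entry:
  assumes "a < q" "b < q" "c < q" "nrm q x \<le> r" shows "\<bar>R3 a b c x\<bar> \<le> C * (1 + sqrt q * r)"
proof -
  obtain \<xi> where \<xi>: "0 < \<xi>" "\<xi> < 1" "R3 a b c x = R3 a b c (\<lambda>_. 0) + (\<Sum>d<q. R4 a b c d (\<lambda>i. \<xi> * x i) * x d)"
    by (rule has_grad_ray1[OF gR(4)[OF assms(1-3)] B_in[OF assms(4)]])
  have "\<bar>\<Sum>d<q. R4 a b c d (\<lambda>i. \<xi> * x i) * x d\<bar> \<le> C * (\<Sum>d<q. \<bar>x d\<bar>)"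
    using assms \<xi> by (intro abs_sum_mult_le R4_entry B_in B_scale) auto
  also have "\<dots> \<le> C * (sqrt q * r)" using C by (intro mult_left_mono sum_abs_B assms)
  moreover have "\<bar>R3 a b c (\<lambda>_. 0)\<bar> \<le> C"
    using entry_bound[where M = "\<lambda>a b. R3 a b c (\<lambda>_. 0)" and K = C, OF T3] assms by blast
  ultimately show ?thesis using \<xi>(3) by (simp add: algebra_simps)
qed

lemma R2_entry: "a < q \<Longrightarrow> b < q \<Longrightarrow> nrm q x \<le> r \<Longrightarrow> \<bar>R2 a b x\<bar> \<le> \<beta>"
  using entry_bound[where M = "\<lambda>a b. R2 a b x" and K = \<beta>] R2_bilinear_bound[of x] by (simp add: mult_ac)

lemma R1_entry:
  assumes i: "i < q" "nrm q x \<le> r" shows "\<bar>R1 i x\<bar> \<le> \<beta> * r"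
proof -
  have "(\<Sum>a<q. (if a = i then 1 else 0) * R1 a x) = R1 i x"
    using i by (simp add: if_distrib[of "\<lambda>u. u * _"] cong: if_cong)
  moreover have "nrm q (\<lambda>a. if a = i then 1 else 0) = 1"
    using i by (simp add: L2_set_def if_distrib[of "\<lambda>u. u^2"] cong: if_cong)
  ultimately show ?thesis using R1_dir_bound[OF i(2), of "\<lambda>a. if a = i then 1 else 0"] by simp
qed

lemma R3_contract_coord:
  assumes x: "nrm q x \<le> r" and c: "c < q"
  shows "\<bar>\<Sum>a<q. \<Sum>b<q. S a b * R3 a b c x\<bar> \<le> \<tau>"
proof -
  have "(\<Sum>c'<q. (\<Sum>a<q. \<Sum>b<q. S a b * R3 a b c' x) * (if c' = c then 1 else 0)) = (\<Sum>a<q. \<Sum>b<q. S a b * R3 a b c x)"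
    using c by (simp add: if_distrib[of "\<lambda>u. _ * u"] cong: if_cong)
  moreover have "nrm q (\<lambda>a. if a = c then 1 else 0) = 1"
    using c by (simp add: L2_set_def if_distrib[of "\<lambda>u. u^2"] cong: if_cong)
  ultimately show ?thesis using R3_contract[OF x, of "\<lambda>a. if a = c then 1 else 0"] by simp
qed

lemma abs_E0_le:
  assumes c: "cts_ball q \<rho> f" and b: "\<And>x. nrm q x \<le> r \<Longrightarrow> \<bar>f x\<bar> \<le> K"
  shows "\<bar>E0 f\<bar> \<le> K"
proof -
  have iK: "integrable (leb q) (\<lambda>x. indicator B x * (exp (- Qf x) * K))"
    by (rule weight0_integrable[OF has_grad_imp_cts[OF has_grad_const], where K = "\<bar>K\<bar>"]) simp
  have "\<bar>\<integral>x. indicator B x * (exp (- Qf x) * f x) \<partial>leb q\<bar> \<le> (\<integral>x. indicator B x * (exp (- Qf x) * K) \<partial>leb q)"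
    using b by (intro abs_integral_le_of_AE[OF iK] AE_I2) (auto simp: indicator_def abs_mult)
  also have "\<dots> = K * Zw 0" unfolding Zw_def by (simp add: U_def mult_ac flip: integral_mult_right_zero)
  finally show ?thesis using Zw0 unfolding E0_def abs_divide by (simp add: pos_divide_le_eq)
qed

text \<open>\<open>heat\<close> for a directional derivative of R, which vanishes at 0. Its Hessian
  contracted with S is the contracted third derivative tested against w, bounded by \<tau>; its
  gradient is bounded by \<beta>.\<close>

lemma E0_R1_bound:
  assumes w: "(\<Sum>i<q. (w i)^2) = 1"
  shows "\<bar>E0 (\<lambda>x. \<Sum>a<q. w a * R1 a x)\<bar> \<le> \<tau> + \<beta> * err"
proof -
  have n: "nrm q w = 1" using w by (simp add: L2_set_def)
  have g1: "has_grad q \<rho> (\<lambda>x. \<Sum>i<q. w i * R1 i x) (\<lambda>j x. \<Sum>i<q. w i * R2 i j x)"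
    by (intro has_grad_sum has_grad_cmult gR) auto
  have g2: "has_grad q \<rho> (\<lambda>x. \<Sum>i<q. w i * R2 i j x) (\<lambda>k x. \<Sum>i<q. w i * R3 i j k x)" if "j < q" for j
    using that by (intro has_grad_sum has_grad_cmult gR) auto
  have g3: "has_grad q \<rho> (\<lambda>x. \<Sum>i<q. w i * R3 i j k x) (\<lambda>l x. \<Sum>i<q. w i * R4 i j k l x)" if "j < q" "k < q" for j k
    using that by (intro has_grad_sum has_grad_cmult gR) auto
  have "\<bar>E0 (\<lambda>x. \<Sum>a<q. w a * R1 a x) - (\<Sum>a<q. w a * R1 a (\<lambda>_. 0))\<bar> \<le> \<tau> + \<beta> * err"
  proof (rule heat[OF g1 g2 has_grad_imp_cts[OF g3]])
    fix x assume x: "nrm q x \<le> r"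
    show "\<bar>\<Sum>i<q. w i * R1 i x\<bar> \<le> \<beta> * r" using R1_dir_bound[OF x, of w] n by simp
    fix j assume j: "j < q"
    have "(\<Sum>i<q. w i * R2 i j x)^2 \<le> (\<Sum>b<q. (\<Sum>a<q. w a * R2 a b x)^2)"
      using j by (intro member_le_sum) auto
    also have "\<dots> \<le> \<beta>^2" by (rule R2_image_bound[OF x w])
    finally show "\<bar>\<Sum>i<q. w i * R2 i j x\<bar> \<le> \<beta>"
      using \<beta>_nonneg abs_le_square_iff[of "\<Sum>i<q. w i * R2 i j x" \<beta>] by simp
    fix k assume k: "k < q"
    have "\<bar>\<Sum>i<q. R3 i j k x * w i\<bar> \<le> C * (1 + sqrt q * r) * (\<Sum>i<q. \<bar>w i\<bar>)"
      using R3_entry j k x by (intro abs_sum_mult_le) auto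
    then show "\<bar>\<Sum>i<q. w i * R3 i j k x\<bar> \<le> C * (1 + sqrt q * r) * (\<Sum>i<q. \<bar>w i\<bar>)" by (simp only: mult.commute)
  next
    fix s :: real assume s: "0 < s" "s < 1"
    show "\<bar>E0 (\<lambda>x. \<Sum>a<q. \<Sum>b<q. S a b * (\<Sum>i<q. w i * R3 i a b (\<lambda>i. s * x i)))\<bar> \<le> \<tau>"
    proof (rule abs_E0_le)
      have "has_grad q \<rho> (\<lambda>x. \<Sum>a<q. \<Sum>b<q. S a b * (\<Sum>i<q. w i * R3 i a b (\<lambda>i. s * x i)))
        (\<lambda>l x. \<Sum>a<q. \<Sum>b<q. S a b * (\<Sum>i<q. w i * (s * R4 i a b l (\<lambda>i. s * x i))))"
        using s by (intro has_grad_sum has_grad_cmult has_grad_scale gR) auto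
      then show "cts_ball q \<rho> (\<lambda>x. \<Sum>a<q. \<Sum>b<q. S a b * (\<Sum>i<q. w i * R3 i a b (\<lambda>i. s * x i)))"
        by (rule has_grad_imp_cts)
      fix x assume x: "nrm q x \<le> r"
      let ?y = "\<lambda>i. s * x i"
      have y: "nrm q ?y \<le> r" using B_scale[OF x] s by simp
      have "(\<Sum>a<q. \<Sum>b<q. S a b * (\<Sum>i<q. w i * R3 i a b ?y)) = (\<Sum>a<q. \<Sum>b<q. \<Sum>i<q. S a b * R3 a b i ?y * w i)"
        unfolding sum_distrib_left
      proof (intro sum.cong refl)
        fix a b i assume "a \<in> {..<q}" "b \<in> {..<q}" "i \<in> {..<q}"
        then have "R3 i a b ?y = R3 a b i ?y" using R3_perm(1)[OF _ _ _ B_in[OF y]] by simp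
        then show "S a b * (w i * R3 i a b ?y) = S a b * R3 a b i ?y * w i" by simp
      qed
      also have "\<dots> = (\<Sum>i<q. (\<Sum>a<q. \<Sum>b<q. S a b * R3 a b i ?y) * w i)"
        unfolding sum_distrib_right by (rule sum_rot3)
      finally show "\<bar>\<Sum>a<q. \<Sum>b<q. S a b * (\<Sum>i<q. w i * R3 i a b ?y)\<bar> \<le> \<tau>"
        using R3_contract[OF y, of w] n by simp
    qed
  qed
  moreover have "(\<Sum>a<q. w a * R1 a (\<lambda>_. 0)) = 0" by (intro sum.neutral ballI) (simp add: R0)
  ultimately show ?thesis by simp
qed

text \<open>\<open>heat\<close> is nested. The outer use replaces R by its Hessian contracted with S
  at a rescaled point; this function vanishes at 0 again, and the inner use replaces it by the
  fourth derivative contracted with S twice.\<close>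

lemma E0_R_bound: "\<bar>E0 R\<bar> \<le> C * (q / \<kappa>)^2 + (\<tau> + \<beta> * r) * err"
proof -
  have "\<bar>E0 R - R (\<lambda>_. 0)\<bar> \<le> (C * (q / \<kappa>)^2 + \<tau> * err) + \<beta> * r * err"
  proof (rule heat[OF gR(1) gR(2) has_grad_imp_cts[OF gR(3)]])
    fix s :: real assume s: "0 < s" "s < 1"
    let ?\<phi> = "\<lambda>x. \<Sum>a<q. \<Sum>b<q. S a b * R2 a b (\<lambda>i. s * x i)"
    let ?\<Gamma> = "\<lambda>c x. \<Sum>a<q. \<Sum>b<q. S a b * (s * R3 a b c (\<lambda>i. s * x i))"
    let ?\<Delta> = "\<lambda>c d x. \<Sum>a<q. \<Sum>b<q. S a b * (s * (s * R4 a b c d (\<lambda>i. s * x i)))"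
    have g1: "has_grad q \<rho> ?\<phi> ?\<Gamma>"
      using s by (intro has_grad_sum has_grad_cmult has_grad_scale gR) auto
    have g2: "has_grad q \<rho> (?\<Gamma> c) (?\<Delta> c)" if "c < q" for c
      using s that by (intro has_grad_sum has_grad_cmult has_grad_scale gR) auto
    have \<tau>0: "0 \<le> \<tau>" unfolding \<tau>_def using C \<kappa> r by (intro mult_nonneg_nonneg) auto
    have "\<bar>E0 ?\<phi> - ?\<phi> (\<lambda>_. 0)\<bar> \<le> C * (q / \<kappa>)^2 + \<tau> * err"
    proof (rule heat[OF g1 g2])
      show "cts_ball q \<rho> (?\<Delta> c d)" if "c < q" "d < q" for c d
        using that s by (intro cts_ball_sum cts_ball_mult cts_ball_mult cts_ball_scale gR) auto
      fix x assume x: "nrm q x \<le> r"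
      let ?y = "\<lambda>i. s * x i"
      have y: "nrm q ?y \<le> r" using B_scale[OF x] s by simp
      have "\<bar>\<Sum>a<q. \<Sum>b<q. S a b * R2 a b ?y\<bar> \<le> (\<Sum>a<q. \<Sum>b<q. \<bar>S a b\<bar> * \<beta>)"
        using R2_entry[OF _ _ y] by (intro order.trans[OF sum_abs sum_mono] order.trans[OF sum_abs sum_mono]) (auto simp: abs_mult intro!: mult_left_mono)
      then show "\<bar>\<Sum>a<q. \<Sum>b<q. S a b * R2 a b ?y\<bar> \<le> (\<Sum>a<q. \<Sum>b<q. \<bar>S a b\<bar> * \<beta>)" .
      fix c assume c: "c < q"
      have "?\<Gamma> c x = s * (\<Sum>a<q. \<Sum>b<q. S a b * R3 a b c ?y)"
        by (simp add: sum_distrib_left mult_ac)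
      also have "\<bar>\<dots>\<bar> \<le> 1 * \<tau>"
        unfolding abs_mult using s R3_contract_coord[OF y c] by (intro mult_mono) auto
      finally show "\<bar>?\<Gamma> c x\<bar> \<le> \<tau>" by simp
      fix d assume d: "d < q"
      show "\<bar>?\<Delta> c d x\<bar> \<le> (\<Sum>a<q. \<Sum>b<q. \<bar>S a b\<bar> * C)"
      proof (intro order.trans[OF sum_abs sum_mono] order.trans[OF sum_abs sum_mono])
        fix a b assume ab: "a \<in> {..<q}" "b \<in> {..<q}"
        have "\<bar>s * (s * R4 a b c d ?y)\<bar> \<le> 1 * (1 * C)"
          unfolding abs_mult using s R4_entry[OF _ _ c d B_in[OF y], of a b] ab by (intro mult_mono) auto
        then show "\<bar>S a b * (s * (s * R4 a b c d ?y))\<bar> \<le> \<bar>S a b\<bar> * C"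
          unfolding abs_mult[of "S a b"] by (intro mult_left_mono) auto
      qed
    next
      fix s' :: real assume s': "0 < s'" "s' < 1"
      show "\<bar>E0 (\<lambda>x. \<Sum>c<q. \<Sum>d<q. S c d * ?\<Delta> c d (\<lambda>i. s' * x i))\<bar> \<le> C * (q / \<kappa>)^2"
      proof (rule abs_E0_le)
        show "cts_ball q \<rho> (\<lambda>x. \<Sum>c<q. \<Sum>d<q. S c d * ?\<Delta> c d (\<lambda>i. s' * x i))"
        proof (rule cts_ball_sum[OF finite_lessThan], rule cts_ball_sum[OF finite_lessThan], rule cts_ball_mult)
          fix c d assume cd: "c \<in> {..<q}" "d \<in> {..<q}"
          have "cts_ball q \<rho> (?\<Delta> c d)"
            using cd s by (intro cts_ball_sum cts_ball_mult cts_ball_mult cts_ball_scale gR) auto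
          then show "cts_ball q \<rho> (\<lambda>x. ?\<Delta> c d (\<lambda>i. s' * x i))"
            using s' by (intro cts_ball_scale[where \<phi> = "?\<Delta> c d"]) auto
        qed
        fix x assume x: "nrm q x \<le> r"
        let ?y = "\<lambda>i. s * (s' * x i)"
        have y: "nrm q ?y \<le> r" using B_scale[OF B_scale[OF x, of s'], of s] s s' by simp
        have "(\<Sum>c<q. \<Sum>d<q. S c d * ?\<Delta> c d (\<lambda>i. s' * x i)) = (s * s) * (\<Sum>c<q. \<Sum>d<q. \<Sum>a<q. \<Sum>b<q. S c d * S a b * R4 c d a b ?y)"
          unfolding sum_distrib_left
        proof (intro sum.cong refl)
          fix c d a b assume "a \<in> {..<q}" "b \<in> {..<q}" "c \<in> {..<q}" "d \<in> {..<q}"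
          then have "R4 a b c d ?y = R4 c d a b ?y"
            using R4_perm(3)[OF _ _ _ _ B_in[OF y]] R4_perm(2)[OF _ _ _ _ B_in[OF y]] R4_perm(1)[OF _ _ _ _ B_in[OF y]]
              R4_sym[OF _ _ _ _ B_in[OF y]] by (metis lessThan_iff)
          then show "S c d * (S a b * (s * (s * R4 a b c d ?y))) = s * s * (S c d * S a b * R4 c d a b ?y)" by simp
        qed
        also have "\<bar>\<dots>\<bar> \<le> 1 * (C * (q / \<kappa>)^2)"
          unfolding abs_mult[of "s * s"] using s R4_contract[OF B_in[OF y]]
          by (intro mult_mono) (auto intro: mult_le_one simp: abs_mult)
        finally show "\<bar>\<Sum>c<q. \<Sum>d<q. S c d * ?\<Delta> c d (\<lambda>i. s' * x i)\<bar> \<le> C * (q / \<kappa>)^2" by simp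
      qed
    qed
    moreover have "?\<phi> (\<lambda>_. 0) = 0" by (intro sum.neutral ballI) (simp add: R0)
    ultimately show "\<bar>E0 ?\<phi>\<bar> \<le> C * (q / \<kappa>)^2 + \<tau> * err" by simp
  next
    show "\<bar>R x\<bar> \<le> \<beta> * r^2 / 2" if "nrm q x \<le> r" for x by (rule R_bound[OF that])
    show "\<bar>R1 a x\<bar> \<le> \<beta> * r" if "a < q" "nrm q x \<le> r" for a x by (rule R1_entry[OF that])
    show "\<bar>R2 a b x\<bar> \<le> \<beta>" if "a < q" "b < q" "nrm q x \<le> r" for a b x by (rule R2_entry[OF that])
  qed auto
  then show ?thesis by (simp add: R0 algebra_simps)
qed

text \<open>The mean of R at t = 0 accounts for the first two terms of the bound, the variance of R
  along the interpolation for the other two.\<close>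

theorem Zw_ratio:
  assumes small: "16 * \<beta>^2 \<le> \<kappa>^2"
  shows "\<bar>ln (Zw 1 / Zw 0)\<bar> \<le> C * (q / \<kappa>)^2 + (\<tau> + \<beta> * r) * err
     + 8 / \<kappa>^2 * (real q * \<gamma>1^2) + 8 / \<kappa> * (\<tau> + \<beta> * err)^2"
proof -
  have \<tau>0: "0 \<le> \<tau>" unfolding \<tau>_def using C \<kappa> r by (intro mult_nonneg_nonneg) auto
  have M0: "0 \<le> \<tau> + \<beta> * err" using \<tau>0 \<beta>_nonneg err_nonneg by simp
  have "EF.E (\<lambda>x. indicator B x * (\<Sum>i<q. w i * R1 i x)) 0 \<le> \<tau> + \<beta> * err" if w: "(\<Sum>i<q. (w i)^2) = 1" for w
  proof -
    have "has_grad q \<rho> (\<lambda>x. \<Sum>i<q. w i * R1 i x) (\<lambda>j x. \<Sum>i<q. w i * R2 i j x)"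
      by (intro has_grad_sum has_grad_cmult gR) auto
    from E0_EF[OF has_grad_imp_cts[OF this]] E0_R1_bound[OF w] show ?thesis by simp
  qed
  note bnd = Zw_ratio_bounds[OF small M0 this]
  have E: "EF.E Rb 0 = E0 R" unfolding E0_EF[OF has_grad_imp_cts[OF gR(1)]] Rb_eq ..
  have pos: "0 < Zw 1 / Zw 0" using Zw0 Zw_pos[of 1] by simp
  have "E0 R \<le> ln (Zw 1 / Zw 0)" using bnd(1) pos unfolding E by (simp add: ln_ge_iff)
  moreover have "ln (Zw 1 / Zw 0) \<le> E0 R + (8 / \<kappa>^2 * (real q * \<gamma>1^2) + 8 / \<kappa> * (\<tau> + \<beta> * err)^2)"
    using bnd(2) pos unfolding E by (metis exp_le_cancel_iff exp_ln)
  moreover have "0 \<le> 8 / \<kappa>^2 * (real q * \<gamma>1^2)" "0 \<le> 8 / \<kappa> * (\<tau> + \<beta> * err)^2"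
    using \<kappa> by (auto intro!: mult_nonneg_nonneg)
  ultimately show ?thesis using E0_R_bound by (simp add: abs_le_iff)
qed

end

subsection \<open>Gaussian integrals and determinants\<close>

text \<open>Block elimination of the last row: the matrix is a block upper triangular matrix, with
  the Schur complement and H q q on its diagonal, times a unit lower triangular one.\<close>

lemma det_schur_last:
  fixes H :: "nat \<Rightarrow> nat \<Rightarrow> real"
  assumes c: "H q q \<noteq> 0"
  shows "Determinant.det (mat (Suc q) (Suc q) (\<lambda>(i, j). H i j))
    = H q q * Determinant.det (mat q q (\<lambda>(i, j). H i j - H i q * H q j / H q q))"
proof -
  let ?A = "mat (Suc q) (Suc q) (\<lambda>(i, j). H i j)"
  let ?S = "mat q q (\<lambda>(i, j). H i j - H i q * H q j / H q q)"
  let ?T = "four_block_mat ?S (mat q 1 (\<lambda>(i, j). H i q)) (0\<^sub>m 1 q) (mat 1 1 (\<lambda>_. H q q))"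
  let ?L = "mat (Suc q) (Suc q) (\<lambda>(i, j). if i = j then 1 else if i = q then H q j / H q q else 0)"
  have T: "?T \<in> carrier_mat (Suc q) (Suc q)" by (auto simp: four_block_mat_def)
  have Tij: "?T $$ (i, k) = (if i < q then (if k < q then H i k - H i q * H q k / H q q else H i q) else (if k < q then 0 else H q q))"
    if "i < Suc q" "k < Suc q" for i k using that by (auto simp: four_block_mat_def)
  have "?A = ?T * ?L"
  proof (rule eq_matI)
    fix i j assume "i < dim_row (?T * ?L)" "j < dim_col (?T * ?L)"
    then have ij: "i < Suc q" "j < Suc q" by (auto simp: four_block_mat_def)
    have "(?T * ?L) $$ (i, j) = (\<Sum>k\<in>{0..<Suc q}. ?T $$ (i, k) * ?L $$ (k, j))"
      using ij T by (simp add: scalar_prod_def four_block_mat_def)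
    also have "\<dots> = (\<Sum>k<q. ?T $$ (i, k) * ?L $$ (k, j)) + ?T $$ (i, q) * ?L $$ (q, j)"
      by (simp add: atLeast0LessThan)
    also have "(\<Sum>k<q. ?T $$ (i, k) * ?L $$ (k, j)) = (\<Sum>k<q. if k = j then ?T $$ (i, j) else 0)"
      using ij by (intro sum.cong refl) auto
    also have "\<dots> = (if j < q then ?T $$ (i, j) else 0)" by simp
    finally show "?A $$ (i, j) = (?T * ?L) $$ (i, j)"
      using ij c unfolding Tij[OF ij] Tij[OF ij(1) lessI] by (auto simp: less_Suc_eq)
  qed (auto simp: four_block_mat_def)
  then have "Determinant.det ?A = Determinant.det (?T * ?L)" by (rule arg_cong)
  also have "\<dots> = Determinant.det ?T * Determinant.det ?L"
    by (rule Determinant.det_mult[OF T]) simp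
  also have "Determinant.det ?L = 1"
  proof -
    have "Determinant.det ?L = prod_list (diag_mat ?L)"
      by (rule det_lower_triangular[of "Suc q"]) auto
    then show ?thesis unfolding prod_list_diag_prod by simp
  qed
  also have "Determinant.det ?T = Determinant.det ?S * Determinant.det (mat 1 1 (\<lambda>_. H q q))"
    by (rule det_four_block_mat_lower_left_zero) auto
  also have "Determinant.det (mat 1 1 (\<lambda>_. H q q)) = H q q"
    by (subst det_single) auto
  finally show ?thesis by simp
qed

lemma nn_integral_gaussian_affine:
  assumes c: "0 < (c::real)"
  shows "(\<integral>\<^sup>+t. ennreal (exp (- (c * t^2 + 2 * b * t) / 2)) \<partial>lborel) = ennreal (sqrt (2 * pi / c) * exp (b^2 / (2 * c)))"
proof -
  have "(\<integral>\<^sup>+t. ennreal (exp (- (c * t^2 + 2 * b * t) / 2)) \<partial>lborel)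
     = ennreal \<bar>1\<bar> * (\<integral>\<^sup>+t. ennreal (exp (- (c * (- (b/c) + 1 * t)^2 + 2 * b * (- (b/c) + 1 * t)) / 2)) \<partial>lborel)"
    by (rule nn_integral_real_affine) auto
  also have "\<dots> = (\<integral>\<^sup>+t. ennreal (exp (b^2 / (2 * c)) * exp (- (c/2 * t^2))) \<partial>lborel)"
  proof -
    have "exp (- (c * (- (b/c) + 1 * t)^2 + 2 * b * (- (b/c) + 1 * t)) / 2) = exp (b^2 / (2 * c)) * exp (- (c/2 * t^2))" for t
      unfolding exp_add[symmetric] using c by (simp add: field_simps power2_eq_square)
    then show ?thesis by simp
  qed
  also have "\<dots> = ennreal (\<integral>t. exp (b^2 / (2 * c)) * exp (- (c/2 * t^2)) \<partial>lborel)"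
    using c by (intro nn_integral_eq_integral integrable_mult_right integral_gaussian_real) auto
  also have "(\<integral>t. exp (b^2 / (2 * c)) * exp (- (c/2 * t^2)) \<partial>lborel) = exp (b^2 / (2 * c)) * sqrt (pi / (c/2))"
    using c by (simp only: integral_mult_right_zero integral_gaussian_real(2)[of "c/2"])
  finally show ?thesis by (simp add: mult.commute)
qed

text \<open>Integrating out the last coordinate by completing the square leaves the Gaussian of the
  Schur complement in one dimension less, and the determinant factors in the same way.\<close>

theorem nn_integral_gaussian_det:
  fixes H :: "nat \<Rightarrow> nat \<Rightarrow> real"
  assumes "0 < \<kappa>" "\<And>i j. i < q \<Longrightarrow> j < q \<Longrightarrow> H i j = H j i"
    and "\<And>v. \<kappa> * (nrm q v)^2 \<le> (\<Sum>i<q. \<Sum>j<q. H i j * v i * v j)"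
  shows "0 < Determinant.det (mat q q (\<lambda>(i, j). H i j)) \<and>
     (\<integral>\<^sup>+x. ennreal (exp (- (\<Sum>i<q. \<Sum>j<q. H i j * x i * x j) / 2)) \<partial>leb q)
       = ennreal (sqrt (2 * pi) ^ q / sqrt (Determinant.det (mat q q (\<lambda>(i, j). H i j))))"
  using assms(2,3)
proof (induction q arbitrary: H)
  case 0
  have "Determinant.det (mat 0 0 (\<lambda>(i, j). H i j)) = 1" by (intro det_dim_zero) auto
  moreover have "(\<integral>\<^sup>+x. ennreal (exp (- (\<Sum>i<0. \<Sum>j<0. H i j * x i * x j) / 2)) \<partial>leb 0)
      = ennreal (exp (- (\<Sum>i<0. \<Sum>j<0. H i j * undefined * undefined) / 2))"
    unfolding leb_def lessThan_0 by (subst lborel_prod.nn_integral_empty) auto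
  ultimately show ?case by simp
next
  case (Suc q)
  let ?c = "H q q"
  let ?H = "\<lambda>i j. H i j - H i q * H q j / ?c"
  have sym: "H q i = H i q" if "i < q" for i using Suc.prems(1)[of q i] that by simp
  have split: "(\<Sum>i<Suc q. \<Sum>j<Suc q. H i j * v i * v j)
     = (\<Sum>i<q. \<Sum>j<q. H i j * v i * v j) + 2 * (\<Sum>i<q. H i q * v i) * v q + ?c * (v q)^2" for v :: point
  proof -
    have "(\<Sum>i<Suc q. \<Sum>j<Suc q. H i j * v i * v j)
      = (\<Sum>i<q. (\<Sum>j<q. H i j * v i * v j) + H i q * v i * v q) + ((\<Sum>j<q. H q j * v q * v j) + ?c * v q * v q)" by simp
    also have "(\<Sum>j<q. H q j * v q * v j) = (\<Sum>i<q. H i q * v i) * v q"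
      unfolding sum_distrib_right by (intro sum.cong refl) (simp add: sym)
    finally show ?thesis by (simp add: sum.distrib sum_distrib_right power2_eq_square mult.assoc sum_distrib_left)
  qed
  have c: "0 < ?c"
  proof -
    let ?e = "\<lambda>i. if i = q then 1 else (0::real)"
    have "\<kappa> * (nrm (Suc q) ?e)^2 \<le> ?c" using Suc.prems(2)[of ?e] unfolding split by simp
    moreover have "(nrm (Suc q) ?e)^2 = 1" by (simp add: L2_set_sq)
    ultimately show ?thesis using assms(1) by simp
  qed
  have H': "(\<Sum>i<q. \<Sum>j<q. ?H i j * v i * v j) = (\<Sum>i<q. \<Sum>j<q. H i j * v i * v j) - (\<Sum>i<q. H i q * v i)^2 / ?c" for v :: point
  proof -
    have "(\<Sum>i<q. H i q * v i)^2 / ?c = (\<Sum>i<q. \<Sum>j<q. H i q * H q j / ?c * v i * v j)"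
      unfolding power2_eq_square sum_product sum_divide_distrib
      by (intro sum.cong refl) (simp add: sym)
    then show ?thesis by (simp add: left_diff_distrib sum_subtractf)
  qed
  have IH: "0 < Determinant.det (mat q q (\<lambda>(i, j). ?H i j)) \<and>
     (\<integral>\<^sup>+x. ennreal (exp (- (\<Sum>i<q. \<Sum>j<q. ?H i j * x i * x j) / 2)) \<partial>leb q)
       = ennreal (sqrt (2 * pi) ^ q / sqrt (Determinant.det (mat q q (\<lambda>(i, j). ?H i j))))"
  proof (rule Suc.IH)
    show "?H i j = ?H j i" if "i < q" "j < q" for i j
      using that Suc.prems(1)[of i j] by (simp add: sym)
    fix v :: point
    \<comment> \<open>The last coordinate is chosen to minimize the full form, whose value is then
      the form of the Schur complement. The lower bound \<kappa> is thereby inherited.\<close>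
    let ?v = "v(q := - (\<Sum>i<q. H i q * v i) / ?c)"
    have "\<kappa> * (nrm q v)^2 \<le> \<kappa> * (nrm (Suc q) ?v)^2"
      using assms(1) by (intro mult_left_mono) (auto simp: L2_set_sq)
    also have "\<dots> \<le> (\<Sum>i<Suc q. \<Sum>j<Suc q. H i j * ?v i * ?v j)" by (rule Suc.prems(2))
    also have "\<dots> = (\<Sum>i<q. \<Sum>j<q. ?H i j * v i * v j)"
    proof -
      have s: "(\<Sum>i<q. H i q * ?v i) = (\<Sum>i<q. H i q * v i)" by (intro sum.cong refl) auto
      have s2: "(\<Sum>i<q. \<Sum>j<q. H i j * ?v i * ?v j) = (\<Sum>i<q. \<Sum>j<q. H i j * v i * v j)" by (intro sum.cong refl) auto
      show ?thesis unfolding split H' s s2 using c by (simp add: power2_eq_square field_simps)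
    qed
    finally show "\<kappa> * (nrm q v)^2 \<le> (\<Sum>i<q. \<Sum>j<q. ?H i j * v i * v j)" .
  qed
  have det: "Determinant.det (mat (Suc q) (Suc q) (\<lambda>(i, j). H i j)) = ?c * Determinant.det (mat q q (\<lambda>(i, j). ?H i j))"
    using det_schur_last[of H q] c by simp
  have fm: "(\<lambda>x. ennreal (exp (- (\<Sum>i<Suc q. \<Sum>j<Suc q. H i j * x i * x j) / 2))) \<in> borel_measurable (leb (Suc q))"
    unfolding leb_def by measurable
  have "(\<integral>\<^sup>+x. ennreal (exp (- (\<Sum>i<Suc q. \<Sum>j<Suc q. H i j * x i * x j) / 2)) \<partial>leb (Suc q))
    = (\<integral>\<^sup>+x. (\<integral>\<^sup>+t. ennreal (exp (- (\<Sum>i<Suc q. \<Sum>j<Suc q. H i j * (x(q := t)) i * (x(q := t)) j) / 2)) \<partial>lborel) \<partial>leb q)"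
    using fm unfolding leb_def lessThan_Suc by (intro lborel_prod.product_nn_integral_insert) auto
  also have "\<dots> = (\<integral>\<^sup>+x. ennreal (sqrt (2 * pi / ?c)) * ennreal (exp (- (\<Sum>i<q. \<Sum>j<q. ?H i j * x i * x j) / 2)) \<partial>leb q)"
  proof (intro nn_integral_cong)
    fix x :: point
    let ?b = "\<Sum>i<q. H i q * x i" and ?Q = "\<Sum>i<q. \<Sum>j<q. H i j * x i * x j"
    have eq: "(\<Sum>i<Suc q. \<Sum>j<Suc q. H i j * (x(q := t)) i * (x(q := t)) j) = ?Q + (?c * t^2 + 2 * ?b * t)" for t
    proof -
      have s: "(\<Sum>i<q. H i q * (x(q := t)) i) = ?b" by (intro sum.cong refl) auto
      have s2: "(\<Sum>i<q. \<Sum>j<q. H i j * (x(q := t)) i * (x(q := t)) j) = ?Q" by (intro sum.cong refl) auto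
      show ?thesis unfolding split s s2 by simp
    qed
    have ex: "exp (- (Q + A) / 2) = exp (- Q / 2) * exp (- A / 2)" for Q A :: real
      unfolding exp_add[symmetric] by (simp add: field_simps)
    have "(\<integral>\<^sup>+t. ennreal (exp (- (\<Sum>i<Suc q. \<Sum>j<Suc q. H i j * (x(q := t)) i * (x(q := t)) j) / 2)) \<partial>lborel)
       = (\<integral>\<^sup>+t. ennreal (exp (- ?Q / 2)) * ennreal (exp (- (?c * t^2 + 2 * ?b * t) / 2)) \<partial>lborel)"
      unfolding eq ex by (intro nn_integral_cong ennreal_mult) auto
    also have "\<dots> = ennreal (exp (- ?Q / 2)) * ennreal (sqrt (2 * pi / ?c) * exp (?b^2 / (2 * ?c)))"
      unfolding nn_integral_gaussian_affine[OF c, symmetric] by (rule nn_integral_cmult) simp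
    also have "\<dots> = ennreal (sqrt (2 * pi / ?c)) * ennreal (exp (- ?Q / 2) * exp (?b^2 / (2 * ?c)))"
      using c by (simp add: ennreal_mult[symmetric] mult_ac)
    also have "exp (- ?Q / 2) * exp (?b^2 / (2 * ?c)) = exp (- (\<Sum>i<q. \<Sum>j<q. ?H i j * x i * x j) / 2)"
      unfolding exp_add[symmetric] H' by (simp add: field_simps)
    finally show "(\<integral>\<^sup>+t. ennreal (exp (- (\<Sum>i<Suc q. \<Sum>j<Suc q. H i j * (x(q := t)) i * (x(q := t)) j) / 2)) \<partial>lborel)
       = ennreal (sqrt (2 * pi / ?c)) * ennreal (exp (- (\<Sum>i<q. \<Sum>j<q. ?H i j * x i * x j) / 2))" .
  qed
  also have "\<dots> = ennreal (sqrt (2 * pi / ?c)) * (\<integral>\<^sup>+x. ennreal (exp (- (\<Sum>i<q. \<Sum>j<q. ?H i j * x i * x j) / 2)) \<partial>leb q)"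
    by (rule nn_integral_cmult) (unfold leb_def, measurable)
  also have "\<dots> = ennreal (sqrt (2 * pi / ?c) * (sqrt (2 * pi) ^ q / sqrt (Determinant.det (mat q q (\<lambda>(i, j). ?H i j)))))"
    unfolding conjunct2[OF IH] using c conjunct1[OF IH]
    by (subst ennreal_mult[symmetric]) (auto intro!: divide_nonneg_pos)
  also have "sqrt (2 * pi / ?c) * (sqrt (2 * pi) ^ q / sqrt (Determinant.det (mat q q (\<lambda>(i, j). ?H i j))))
     = sqrt (2 * pi) ^ Suc q / sqrt (Determinant.det (mat (Suc q) (Suc q) (\<lambda>(i, j). H i j)))"
    unfolding det by (simp add: real_sqrt_mult real_sqrt_divide)
  finally show ?case using IH c det by simp
qed

subsection \<open>The Laplace approximation in fixed dimension\<close>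

text \<open>Here h is the centred log density, R minus the quadratic form. Space is split into the
  ball of radius r, where the interpolation applies, the annulus up to \<delta>, where concavity
  gives h \<le> - \<kappa> |x|^2 / 2, and the outside, whose integral is carried along.\<close>

locale laplace_fn = ball_fn +
  fixes \<delta> :: real and h :: "point \<Rightarrow> real" and h1 :: "nat \<Rightarrow> point \<Rightarrow> real" and h2 :: "nat \<Rightarrow> nat \<Rightarrow> point \<Rightarrow> real"
  assumes hR: "\<And>x. R x = h x + (\<Sum>i<q. \<Sum>j<q. H i j * x i * x j) / 2"
    and \<delta>: "\<rho> \<le> \<delta>"
    and gh: "has_grad q \<delta> h h1" "\<And>a. a < q \<Longrightarrow> has_grad q \<delta> (h1 a) (h2 a)"
    and h10: "\<And>a. a < q \<Longrightarrow> h1 a (\<lambda>_. 0) = 0"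
    and conv\<delta>: "\<And>x v. nrm q x < \<delta> \<Longrightarrow> (\<Sum>a<q. \<Sum>b<q. h2 a b x * v a * v b) \<le> - (\<kappa> * (nrm q v)^2)"
    and out: "integrable (leb q) (\<lambda>x. indicator {x. \<not> nrm q x < \<delta>} x * exp (h x))"
begin

lemma h0: "h (\<lambda>_. 0) = 0" using R0(1) hR[of "\<lambda>_. 0"] by simp

lemma h_U: "h x = - U 1 x" unfolding U_def hR Qf_def by simp

lemma h_le:
  assumes x: "nrm q x < \<delta>"
  shows "h x \<le> - (\<kappa> / 2 * (nrm q x)^2)"
proof -
  obtain \<xi> where \<xi>: "0 < \<xi>" "\<xi> < 1" "h x = h (\<lambda>_. 0) + (\<Sum>i<q. h1 i (\<lambda>_. 0) * x i) + (\<Sum>i<q. (\<Sum>j<q. h2 i j (\<lambda>i. \<xi> * x i) * x j) * x i) / 2"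
    by (rule has_grad_ray2[OF gh(1) gh(2) x])
  have "nrm q (\<lambda>i. \<xi> * x i) < \<delta>"
    using \<xi> x mult_left_le_one_le[OF L2_set_nonneg[of x "{..<q}"], of \<xi>] by (simp add: nrm_scale)
  from conv\<delta>[OF this, of x] have "(\<Sum>i<q. (\<Sum>j<q. h2 i j (\<lambda>i. \<xi> * x i) * x j) * x i) \<le> - (\<kappa> * (nrm q x)^2)"
    unfolding sum_distrib_right by (simp only: mult_ac)
  then show ?thesis using \<xi>(3) h0 h10 by simp
qed

definition Gdet :: real where
  "Gdet = sqrt (2 * pi) ^ q / sqrt (Determinant.det (mat q q (\<lambda>(i, j). H i j)))"

text \<open>Bounds both the Gaussian mass missing from the ball and the mass of exp h on the
  annulus.\<close>

definition tail :: real where "tail = exp (- (\<kappa> * r^2 / 4)) * sqrt (4 * pi / \<kappa>) ^ q"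

lemma det_pos: "0 < Determinant.det (mat q q (\<lambda>(i, j). H i j))"
  using nn_integral_gaussian_det[OF \<kappa> H_sym H_low] by simp

lemma Gdet_pos: "0 < Gdet" unfolding Gdet_def using det_pos by (intro divide_pos_pos) auto

lemma Qf_meas[measurable]: "Qf \<in> borel_measurable (leb q)"
  unfolding Qf_def[abs_def] leb_def by measurable

lemma gauss_full: "integrable (leb q) (\<lambda>x. exp (- Qf x))" "(\<integral>x. exp (- Qf x) \<partial>leb q) = Gdet"
proof -
  have nn: "(\<integral>\<^sup>+x. ennreal (exp (- Qf x)) \<partial>leb q) = ennreal Gdet"
    using nn_integral_gaussian_det[OF \<kappa> H_sym H_low] by (simp add: Qf_def Gdet_def)
  then show "integrable (leb q) (\<lambda>x. exp (- Qf x))"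
    by (intro integrableI_nonneg) auto
  show "(\<integral>x. exp (- Qf x) \<partial>leb q) = Gdet"
    using nn Gdet_pos by (subst integral_eq_nn_integral) auto
qed

lemma iso_full:
  assumes "0 < c"
  shows "integrable (leb q) (\<lambda>x. exp (- (c * (nrm q x)^2)))" "(\<integral>x. exp (- (c * (nrm q x)^2)) \<partial>leb q) = sqrt (pi / c) ^ q"
  using integral_gaussian_iso[of "{..<q}" c] assms unfolding L2_set_sq leb_def by simp_all

lemma Gdet_lower: "sqrt (2 * pi / \<kappa>2) ^ q \<le> Gdet"
proof -
  have k2: "0 < \<kappa>2 / 2" using \<kappa>2_pos \<kappa> by simp
  have "sqrt (pi / (\<kappa>2 / 2)) ^ q = (\<integral>x. exp (- (\<kappa>2 / 2 * (nrm q x)^2)) \<partial>leb q)" by (rule iso_full(2)[OF k2, symmetric])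
  also have "\<dots> \<le> (\<integral>x. exp (- Qf x) \<partial>leb q)"
    by (rule integral_mono[OF iso_full(1)[OF k2] gauss_full(1)]) (use Qf_up in auto)
  finally show ?thesis by (simp add: gauss_full mult.commute)
qed

lemma tail_integrable: "integrable (leb q) (\<lambda>x. exp (- (\<kappa> * r^2 / 4)) * exp (- (\<kappa> / 4 * (nrm q x)^2)))"
  using \<kappa> by (intro integrable_mult_right iso_full) auto

lemma tail_integral: "(\<integral>x. exp (- (\<kappa> * r^2 / 4)) * exp (- (\<kappa> / 4 * (nrm q x)^2)) \<partial>leb q) = tail"
  using \<kappa> iso_full(2)[of "\<kappa>/4"] unfolding integral_mult_right_zero tail_def by (simp add: mult.commute)

text \<open>The exponent is halved: one half is at least \<kappa> r^2 / 4 outside the ball, the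
  other keeps the integrand Gaussian.\<close>

lemma tail_pointwise:
  assumes "f \<le> - (\<kappa> / 2 * (nrm q x)^2)" "\<not> nrm q x \<le> r"
  shows "exp f \<le> exp (- (\<kappa> * r^2 / 4)) * exp (- (\<kappa> / 4 * (nrm q x)^2))"
proof -
  have "r^2 \<le> (nrm q x)^2" using assms(2) r by (intro power_mono) auto
  then have "\<kappa> / 4 * r^2 \<le> \<kappa> / 4 * (nrm q x)^2" using \<kappa> by (intro mult_left_mono) auto
  then show ?thesis unfolding exp_add[symmetric] using assms(1) by simp
qed

lemma Zw0_bounds: "Gdet - tail \<le> Zw 0" "Zw 0 \<le> Gdet"
proof -
  have i0: "integrable (leb q) (\<lambda>x. indicator B x * exp (- Qf x))" by (rule int_Q)
  have Z: "Zw 0 = (\<integral>x. indicator B x * exp (- Qf x) \<partial>leb q)" by (simp add: Zw_def U_def)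
  show "Zw 0 \<le> Gdet" unfolding Z gauss_full(2)[symmetric]
    by (rule integral_mono[OF i0 gauss_full(1)]) (auto simp: indicator_def)
  have "Gdet - Zw 0 = (\<integral>x. exp (- Qf x) - indicator B x * exp (- Qf x) \<partial>leb q)"
    unfolding Z gauss_full(2)[symmetric] by (rule Bochner_Integration.integral_diff[OF gauss_full(1) i0, symmetric])
  also have "\<dots> \<le> (\<integral>x. exp (- (\<kappa> * r^2 / 4)) * exp (- (\<kappa> / 4 * (nrm q x)^2)) \<partial>leb q)"
  proof (rule integral_mono[OF Bochner_Integration.integrable_diff[OF gauss_full(1) i0] tail_integrable])
    fix x show "exp (- Qf x) - indicator B x * exp (- Qf x) \<le> exp (- (\<kappa> * r^2 / 4)) * exp (- (\<kappa> / 4 * (nrm q x)^2))"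
      using tail_pointwise[of "- Qf x" x] Qf_low[of x] by (cases "nrm q x \<le> r") auto
  qed
  finally show "Gdet - tail \<le> Zw 0" unfolding tail_integral by simp
qed

lemma ann:
  shows "integrable (leb q) (\<lambda>x. indicator {x. nrm q x < \<delta> \<and> \<not> nrm q x \<le> r} x * exp (h x))"
    "(\<integral>x. indicator {x. nrm q x < \<delta> \<and> \<not> nrm q x \<le> r} x * exp (h x) \<partial>leb q) \<le> tail"
proof -
  let ?A = "{x::point. nrm q x < \<delta> \<and> \<not> nrm q x \<le> r}"
  note [measurable] = cts_ball_measurable[OF has_grad_imp_cts[OF gh(1)]]
  have "(\<lambda>x. indicator ?A x * exp (h x)) = (\<lambda>x. (if nrm q x < \<delta> \<and> \<not> nrm q x \<le> r then 1 else 0) * exp (indicator {x. nrm q x < \<delta>} x * h x))"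
    by (auto simp: indicator_def)
  also have "\<dots> \<in> borel_measurable (leb q)" by measurable
  finally have m: "(\<lambda>x. indicator ?A x * exp (h x)) \<in> borel_measurable (leb q)" .
  have le: "indicator ?A x * exp (h x) \<le> exp (- (\<kappa> * r^2 / 4)) * exp (- (\<kappa> / 4 * (nrm q x)^2))" for x
    using tail_pointwise[OF h_le, of x] by (auto simp: indicator_def)
  show i: "integrable (leb q) (\<lambda>x. indicator ?A x * exp (h x))"
    by (rule Bochner_Integration.integrable_bound[OF tail_integrable m]) (use le in \<open>auto intro!: AE_I2\<close>)
  show "(\<integral>x. indicator ?A x * exp (h x) \<partial>leb q) \<le> tail"
    unfolding tail_integral[symmetric] by (rule integral_mono[OF i tail_integrable le])
qed

lemma ball_integrable: "integrable (leb q) (\<lambda>x. indicator B x * exp (h x))"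
proof -
  have "integrable (leb q) (\<lambda>x. indicator B x * (exp (- U 1 x) * 1))"
    by (rule weight_integrable[OF meas_ball[OF has_grad_const], where K = 1]) auto
  then show ?thesis unfolding h_U by simp
qed

lemma total_integral:
  "(\<integral>x. exp (h x) \<partial>leb q) = Zw 1 + (\<integral>x. indicator {x. nrm q x < \<delta> \<and> \<not> nrm q x \<le> r} x * exp (h x) \<partial>leb q)
     + (\<integral>x. indicator {x. \<not> nrm q x < \<delta>} x * exp (h x) \<partial>leb q)"
proof -
  have "Zw 1 = (\<integral>x. indicator B x * exp (h x) \<partial>leb q)" unfolding Zw_def h_U ..
  moreover have "(\<integral>x. exp (h x) \<partial>leb q) = (\<integral>x. (indicator B x * exp (h x) + indicator {x. nrm q x < \<delta> \<and> \<not> nrm q x \<le> r} x * exp (h x))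
     + indicator {x. \<not> nrm q x < \<delta>} x * exp (h x) \<partial>leb q)"
    using \<delta> r by (intro Bochner_Integration.integral_cong) (auto simp: indicator_def)
  ultimately show ?thesis using ball_integrable ann(1) out by simp
qed

text \<open>\<open>tail\<close> relative to \<open>Gdet\<close>. The power of q compares isotropic
  Gaussians of precisions \<kappa> / 2 and \<kappa>2; the factor containing r has to beat
  it.\<close>

definition trel :: real where "trel = exp (- (\<kappa> * r^2 / 4)) * sqrt (2 * \<kappa>2 / \<kappa>) ^ q"

lemma tail_rel: "tail \<le> trel * Gdet"
proof -
  have "sqrt (2 * \<kappa>2 / \<kappa>) ^ q * sqrt (2 * pi / \<kappa>2) ^ q = sqrt (4 * pi / \<kappa>) ^ q"
    unfolding power_mult_distrib[symmetric] real_sqrt_mult[symmetric] using \<kappa>2_pos \<kappa> by (simp add: field_simps)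
  then have "tail = exp (- (\<kappa> * r^2 / 4)) * sqrt (2 * \<kappa>2 / \<kappa>) ^ q * sqrt (2 * pi / \<kappa>2) ^ q"
    by (simp add: tail_def mult.assoc)
  also have "\<dots> \<le> trel * Gdet" unfolding trel_def
    using \<kappa>2_pos \<kappa> by (intro mult_left_mono Gdet_lower) auto
  finally show ?thesis .
qed

text \<open>The error of exp on [-1, 1] is at most 2 |\<theta>|, whence 2 \<Theta>. The term
  \<open>trel\<close> is counted twice, once for the Gaussian mass outside the ball and once for the
  annulus.\<close>

theorem laplace_finite:
  assumes small: "16 * \<beta>^2 \<le> \<kappa>^2" and t: "trel \<le> 1/2"
    and \<Theta>: "C * (q / \<kappa>)^2 + (\<tau> + \<beta> * r) * err + 8 / \<kappa>^2 * (real q * \<gamma>1^2) + 8 / \<kappa> * (\<tau> + \<beta> * err)^2 \<le> \<Theta>" "\<Theta> \<le> 1"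
  shows "\<bar>(\<integral>x. exp (h x) \<partial>leb q) / Gdet - 1\<bar> \<le> 2 * \<Theta> + 2 * trel
     + (\<integral>x. indicator {x. \<not> nrm q x < \<delta>} x * exp (h x) \<partial>leb q) / Gdet"
proof -
  let ?out = "\<integral>x. indicator {x. \<not> nrm q x < \<delta>} x * exp (h x) \<partial>leb q"
  let ?ann = "\<integral>x. indicator {x. nrm q x < \<delta> \<and> \<not> nrm q x \<le> r} x * exp (h x) \<partial>leb q"
  define \<theta> where "\<theta> = ln (Zw 1 / Zw 0)"
  have pos: "0 < Zw 1 / Zw 0" using Zw0 Zw_pos[of 1] by simp
  have e: "exp \<theta> = Zw 1 / Zw 0" using pos by (simp add: \<theta>_def)
  have \<theta>: "\<bar>\<theta>\<bar> \<le> \<Theta>" unfolding \<theta>_def by (rule order.trans[OF Zw_ratio[OF small] \<Theta>(1)])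
  have ex: "\<bar>exp \<theta> - 1\<bar> \<le> 2 * \<bar>\<theta>\<bar>"
  proof -
    have "\<theta> \<le> 1" "-1 \<le> \<theta>" using \<theta> \<Theta>(2) by auto
    have "1 + \<theta> \<le> exp \<theta>" by (rule exp_ge_add_one_self)
    moreover have "exp \<theta> \<le> 1 + 2 * \<bar>\<theta>\<bar>"
    proof (cases "0 \<le> \<theta>")
      case True
      have "exp \<theta> \<le> 1 + \<theta> + \<theta>^2" by (rule exp_bound[OF True \<open>\<theta> \<le> 1\<close>])
      moreover have "\<theta>^2 \<le> \<theta>" using True \<open>\<theta> \<le> 1\<close> by (simp add: power2_eq_square mult_left_le_one_le)
      ultimately show ?thesis using True by simp
    next
      case False
      then have "exp \<theta> \<le> 1" by simp
      then show ?thesis by linarith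
    qed
    ultimately show ?thesis by linarith
  qed
  let ?z = "Zw 0 / Gdet"
  have z: "1 - trel \<le> ?z" "?z \<le> 1"
  proof -
    have "(1 - trel) * Gdet \<le> Zw 0" using Zw0_bounds(1) tail_rel by (simp add: algebra_simps)
    then show "1 - trel \<le> ?z" using Gdet_pos by (simp add: pos_le_divide_eq)
    show "?z \<le> 1" using Zw0_bounds(2) Gdet_pos by simp
  qed
  have z0: "0 \<le> ?z" using Zw0 Gdet_pos by simp
  have a: "0 \<le> ?ann / Gdet" "?ann / Gdet \<le> trel"
  proof -
    show "0 \<le> ?ann / Gdet" using Gdet_pos by (intro divide_nonneg_pos integral_nonneg_AE) auto
    show "?ann / Gdet \<le> trel" using ann(2) tail_rel Gdet_pos by (simp add: pos_divide_le_eq)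
  qed
  have o: "0 \<le> ?out / Gdet" using Gdet_pos by (intro divide_nonneg_pos integral_nonneg_AE) auto
  have "(\<integral>x. exp (h x) \<partial>leb q) / Gdet - 1 = (?z * exp \<theta> - 1) + ?ann / Gdet + ?out / Gdet"
    unfolding total_integral e using Zw0 by (simp add: add_divide_distrib)
  moreover have "\<bar>?z * exp \<theta> - 1\<bar> \<le> 2 * \<Theta> + trel"
  proof -
    have gen: "z * e - 1 = z * (e - 1) + (z - 1)" for z e :: real by (simp add: algebra_simps)
    have "?z * exp \<theta> - 1 = ?z * (exp \<theta> - 1) + (?z - 1)"
      by (rule gen)
    then have "\<bar>?z * exp \<theta> - 1\<bar> \<le> ?z * \<bar>exp \<theta> - 1\<bar> + \<bar>?z - 1\<bar>" using z0 by (metis abs_mult abs_of_nonneg abs_triangle_ineq)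
    also have "?z * \<bar>exp \<theta> - 1\<bar> \<le> 1 * (2 * \<Theta>)" using z ex \<theta> z0 by (intro mult_mono) auto
    finally show ?thesis using z by simp
  qed
  ultimately show ?thesis using a o by linarith
qed

lemma trel_nonneg: "0 \<le> trel"
  unfolding trel_def using \<kappa>2_pos \<kappa> by (intro mult_nonneg_nonneg zero_le_power) auto

text \<open>\<open>bdry\<close> and \<open>tail\<close> differ by one factor sqrt (4 pi / \<kappa>),
  since the boundary integral has one dimension less, and a small \<open>trel\<close> keeps
  \<open>Zw 0\<close> above half of \<open>Gdet\<close>. Boundary errors are thus as small as the
  tail.\<close>

lemma err_le:
  assumes "trel \<le> 1/2"
  shows "err \<le> 4 * trel * (sqrt q * (q / sqrt \<kappa>))"
proof -
  have Z: "Gdet / 2 \<le> Zw 0"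
  proof -
    have "tail \<le> (1/2) * Gdet" using tail_rel assms Gdet_pos by (meson less_imp_le mult_right_mono order_trans)
    then show ?thesis using Zw0_bounds(1) by simp
  qed
  have pq: "sqrt (4 * pi / \<kappa>) ^ q = sqrt (4 * pi / \<kappa>) ^ (q - 1) * sqrt (4 * pi / \<kappa>)"
    using q by (cases q) auto
  have "bdry * sqrt (4 * pi / \<kappa>) = tail" unfolding bdry_def tail_def pq by simp
  then have b: "bdry = tail * sqrt (\<kappa> / (4 * pi))" using \<kappa> by (simp add: real_sqrt_divide real_sqrt_mult field_simps)
  have "bdry \<le> trel * Gdet * sqrt \<kappa>"
    unfolding b
  proof (rule mult_mono[OF tail_rel])
    have "\<kappa> / (4 * pi) \<le> \<kappa>" using \<kappa> pi_ge_two by (simp add: pos_divide_le_eq)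
    then show "sqrt (\<kappa> / (4 * pi)) \<le> sqrt \<kappa>" by simp
  qed (use trel_nonneg Gdet_pos \<kappa> in auto)
  then have "bdry / Zw 0 \<le> (trel * Gdet * sqrt \<kappa>) / (Gdet / 2)"
    using Z Gdet_pos bdry_nonneg by (intro frac_le) auto
  also have "\<dots> = 2 * trel * sqrt \<kappa>" using Gdet_pos by simp
  finally have "err \<le> 2 * (2 * trel * sqrt \<kappa>) * (sqrt q * (q / \<kappa>))"
    unfolding err_def using \<kappa> by (intro mult_right_mono mult_left_mono) auto
  also have "\<dots> = 4 * trel * (sqrt q * (q / sqrt \<kappa>))"
    using \<kappa> by (simp add: field_simps)
  finally show ?thesis .
qed

end

subsection \<open>Symmetry of derivatives and eigenvalue bounds\<close>

text \<open>The mean value theorem in direction a reduces the second difference to an increment of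
  \<open>\<Gamma> a\<close>, which is expanded at x. The argument rests on total differentiability
  of \<open>\<Gamma> a\<close> at x and avoids continuity of second derivatives.\<close>

lemma mixed_difference:
  assumes g: "has_grad q \<rho> \<phi> \<Gamma>" and ga: "has_grad q \<rho> (\<Gamma> a) (\<Delta> a)"
    and x: "nrm q x < \<rho>" and ab: "a < q" "b < q" and e: "0 < \<epsilon>"
  obtains t0 where "0 < t0" "\<And>t. 0 < t \<Longrightarrow> t < t0 \<Longrightarrow>
    \<bar>\<phi> (\<lambda>i. x i + t * (if i = a then 1 else 0) + t * (if i = b then 1 else 0)) - \<phi> (\<lambda>i. x i + t * (if i = a then 1 else 0))
      - \<phi> (\<lambda>i. x i + t * (if i = b then 1 else 0)) + \<phi> x - t^2 * \<Delta> a b x\<bar> \<le> 3 * \<epsilon> * t^2"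
proof -
  let ?e = "\<lambda>a i. if i = a then 1 else (0::real)"
  have ne: "nrm q (?e c) = 1" if "c < q" for c
    using that by (simp add: L2_set_def if_distrib[of "\<lambda>u. u^2"] cong: if_cong)
  have se: "(\<Sum>i<q. f i * (s * ?e c i)) = s * f c" if "c < q" for c s and f :: "nat \<Rightarrow> real"
    using that by (simp add: if_distrib[of "\<lambda>u. _ * u"] cong: if_cong)
  obtain d where d: "0 < d" "\<And>y. nrm q (\<lambda>i. y i - x i) < d \<Longrightarrow>
        \<bar>\<Gamma> a y - \<Gamma> a x - (\<Sum>i<q. \<Delta> a i x * (y i - x i))\<bar> \<le> \<epsilon> * nrm q (\<lambda>i. y i - x i)"
    using has_gradD[OF ga x e] by auto
  \<comment> \<open>Half of the admissible radius, because up to two steps of length t are taken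
    from x.\<close>
  define t0 where "t0 = min d (\<rho> - nrm q x) / 2"
  have t0: "0 < t0" "2 * t0 \<le> d" "2 * t0 \<le> \<rho> - nrm q x" using d x by (auto simp: t0_def)
  show ?thesis
  proof (rule that[OF t0(1)])
    fix t :: real assume t: "0 < t" "t < t0"
    let ?p = "\<lambda>s u i. x i + s * ?e a i + u * ?e b i"
    have np: "nrm q (\<lambda>i. ?p s u i - x i) \<le> \<bar>s\<bar> + \<bar>u\<bar>" for s u
    proof -
      have "(\<lambda>i. ?p s u i - x i) = (\<lambda>i. s * ?e a i + u * ?e b i)" by (auto simp: algebra_simps)
      then have "nrm q (\<lambda>i. ?p s u i - x i) = nrm q (\<lambda>i. s * ?e a i + u * ?e b i)" by (rule arg_cong)
      also have "\<dots> \<le> nrm q (\<lambda>i. s * ?e a i) + nrm q (\<lambda>i. u * ?e b i)" by (rule nrm_add)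
      finally show ?thesis unfolding nrm_scale using ne ab by simp
    qed
    have inb: "nrm q (?p s u) < \<rho>" if "\<bar>s\<bar> \<le> t" "\<bar>u\<bar> \<le> t" for s u
    proof -
      have "?p s u = (\<lambda>i. x i + (?p s u i - x i))" by auto
      then have "nrm q (?p s u) = nrm q (\<lambda>i. x i + (?p s u i - x i))" by (rule arg_cong)
      also have "\<dots> \<le> nrm q x + nrm q (\<lambda>i. ?p s u i - x i)" by (rule nrm_add)
      also have "\<dots> \<le> nrm q x + (\<bar>s\<bar> + \<bar>u\<bar>)" using np by simp
      also have "\<dots> < \<rho>" using that t t0 by linarith
      finally show ?thesis .
    qed
    have der: "((\<lambda>s. \<phi> (?p s u)) has_real_derivative \<Gamma> a (?p s u)) (at s)" if "\<bar>s\<bar> \<le> t" "\<bar>u\<bar> \<le> t" for s u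
    proof -
      have eq: "?p s u = (\<lambda>i. (x i + u * ?e b i) + s * ?e a i)" for s by auto
      have "((\<lambda>s. \<phi> (\<lambda>i. (x i + u * ?e b i) + s * ?e a i)) has_real_derivative
          (\<Sum>i<q. \<Gamma> i (\<lambda>i. (x i + u * ?e b i) + s * ?e a i) * ?e a i)) (at s)"
        using inb[OF that] unfolding eq by (rule has_grad_line[OF g])
      moreover have "(\<Sum>i<q. f i * ?e a i) = f a" for f :: "nat \<Rightarrow> real" using se[OF ab(1), of f 1] by simp
      ultimately show ?thesis unfolding eq by simp
    qed
    have "\<exists>s>0. s < t \<and> (\<phi> (?p t t) - \<phi> (?p t 0)) - (\<phi> (?p 0 t) - \<phi> (?p 0 0)) = (t - 0) * (\<Gamma> a (?p s t) - \<Gamma> a (?p s 0))"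
      using t by (intro MVT2 DERIV_diff der) auto
    then obtain s where s: "0 < s" "s < t" "(\<phi> (?p t t) - \<phi> (?p t 0)) - (\<phi> (?p 0 t) - \<phi> (?p 0 0)) = t * (\<Gamma> a (?p s t) - \<Gamma> a (?p s 0))" by auto
    have ap: "\<bar>\<Gamma> a (?p s u) - \<Gamma> a x - (s * \<Delta> a a x + u * \<Delta> a b x)\<bar> \<le> \<epsilon> * (\<bar>s\<bar> + \<bar>u\<bar>)" if "\<bar>u\<bar> \<le> t" for u
    proof -
      have "nrm q (\<lambda>i. ?p s u i - x i) < d" using np[of s u] s t t0 that by linarith
      from d(2)[OF this] have "\<bar>\<Gamma> a (?p s u) - \<Gamma> a x - (\<Sum>i<q. \<Delta> a i x * (?p s u i - x i))\<bar> \<le> \<epsilon> * nrm q (\<lambda>i. ?p s u i - x i)" .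
      also have "(\<Sum>i<q. \<Delta> a i x * (?p s u i - x i)) = (\<Sum>i<q. \<Delta> a i x * (s * ?e a i) + \<Delta> a i x * (u * ?e b i))"
        by (intro sum.cong refl) (simp add: algebra_simps)
      also have "\<dots> = s * \<Delta> a a x + u * \<Delta> a b x" unfolding sum.distrib se[OF ab(1)] se[OF ab(2)] ..
      also have "\<epsilon> * nrm q (\<lambda>i. ?p s u i - x i) \<le> \<epsilon> * (\<bar>s\<bar> + \<bar>u\<bar>)" using np e by (intro mult_left_mono) auto
      finally show ?thesis .
    qed
    let ?D = "\<Gamma> a (?p s t) - \<Gamma> a (?p s 0) - t * \<Delta> a b x"
    have "\<bar>?D\<bar> \<le> \<epsilon> * (\<bar>s\<bar> + \<bar>t\<bar>) + \<epsilon> * (\<bar>s\<bar> + \<bar>0\<bar>)"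
      using ap[of t] ap[of 0] t by (simp add: abs_le_iff)
    also have "\<dots> = \<epsilon> * (2 * s + t)" using s t by (simp add: algebra_simps)
    also have "\<dots> \<le> \<epsilon> * (3 * t)" using s e by (intro mult_left_mono) auto
    finally have D: "t * \<bar>?D\<bar> \<le> t * (\<epsilon> * (3 * t))" using t by (intro mult_left_mono) auto
    have "\<phi> (?p t t) - \<phi> (?p t 0) - \<phi> (?p 0 t) + \<phi> (?p 0 0) - t^2 * \<Delta> a b x = t * ?D"
      using s(3) by (simp add: algebra_simps power2_eq_square)
    then have "\<bar>\<phi> (?p t t) - \<phi> (?p t 0) - \<phi> (?p 0 t) + \<phi> (?p 0 0) - t^2 * \<Delta> a b x\<bar> = t * \<bar>?D\<bar>"
      using t by (simp add: abs_mult)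
    also have "\<dots> \<le> 3 * \<epsilon> * t^2" using D by (simp add: power2_eq_square mult_ac)
    finally show "\<bar>\<phi> (\<lambda>i. x i + t * ?e a i + t * ?e b i) - \<phi> (\<lambda>i. x i + t * ?e a i) - \<phi> (\<lambda>i. x i + t * ?e b i) + \<phi> x - t^2 * \<Delta> a b x\<bar> \<le> 3 * \<epsilon> * t^2"
      by simp
  qed
qed

text \<open>The second difference is symmetric in a and b, while divided by t^2 it tends to either
  mixed derivative.\<close>

theorem has_grad_second_symmetric:
  assumes g: "has_grad q \<rho> \<phi> \<Gamma>" and g2: "\<And>a. a < q \<Longrightarrow> has_grad q \<rho> (\<Gamma> a) (\<Delta> a)"
    and x: "nrm q x < \<rho>" and ab: "a < q" "b < q"
  shows "\<Delta> a b x = \<Delta> b a x"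
proof -
  have "\<bar>\<Delta> a b x - \<Delta> b a x\<bar> \<le> 6 * \<epsilon>" if e: "0 < \<epsilon>" for \<epsilon>
  proof -
    let ?e = "\<lambda>a i. if i = a then 1 else (0::real)"
    obtain t1 where t1: "0 < t1" "\<And>t. 0 < t \<Longrightarrow> t < t1 \<Longrightarrow>
      \<bar>\<phi> (\<lambda>i. x i + t * ?e a i + t * ?e b i) - \<phi> (\<lambda>i. x i + t * ?e a i) - \<phi> (\<lambda>i. x i + t * ?e b i) + \<phi> x - t^2 * \<Delta> a b x\<bar> \<le> 3 * \<epsilon> * t^2"
      by (rule mixed_difference[where \<Delta> = \<Delta>, OF g g2[OF ab(1)] x ab e]) blast
    obtain t2 where t2: "0 < t2" "\<And>t. 0 < t \<Longrightarrow> t < t2 \<Longrightarrow>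
      \<bar>\<phi> (\<lambda>i. x i + t * ?e b i + t * ?e a i) - \<phi> (\<lambda>i. x i + t * ?e b i) - \<phi> (\<lambda>i. x i + t * ?e a i) + \<phi> x - t^2 * \<Delta> b a x\<bar> \<le> 3 * \<epsilon> * t^2"
      by (rule mixed_difference[where \<Delta> = \<Delta>, OF g g2[OF ab(2)] x ab(2,1) e]) blast
    define t where "t = min t1 t2 / 2"
    have t: "0 < t" "t < t1" "t < t2" using t1 t2 by (auto simp: t_def)
    have sw: "(\<lambda>i. x i + t * ?e b i + t * ?e a i) = (\<lambda>i. x i + t * ?e a i + t * ?e b i)" by (simp add: add_ac)
    have "\<bar>t^2 * \<Delta> a b x - t^2 * \<Delta> b a x\<bar> \<le> 6 * \<epsilon> * t^2"
      using t1(2)[OF t(1,2)] t2(2)[OF t(1,3)] unfolding sw by linarith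
    moreover have "\<bar>t^2 * \<Delta> a b x - t^2 * \<Delta> b a x\<bar> = t^2 * \<bar>\<Delta> a b x - \<Delta> b a x\<bar>"
      by (simp only: right_diff_distrib[symmetric] abs_mult abs_power2)
    ultimately have "t^2 * \<bar>\<Delta> a b x - \<Delta> b a x\<bar> \<le> t^2 * (6 * \<epsilon>)" by (simp add: mult_ac)
    then show ?thesis using t by simp
  qed
  from this[of "e / 6" for e] have "\<bar>\<Delta> a b x - \<Delta> b a x\<bar> \<le> 0 + e" if "0 < e" for e using that by simp
  then have "\<bar>\<Delta> a b x - \<Delta> b a x\<bar> \<le> 0" by (rule field_le_epsilon)
  then show ?thesis by simp
qed

text \<open>Passes an identity between functions on the open ball to their gradients; applied to
  derivatives, it carries symmetry in the older indices to the next order.\<close>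

lemma has_grad_unique:
  assumes g: "has_grad q \<rho> \<phi> \<Gamma>" and g': "has_grad q \<rho> \<psi> \<Delta>"
    and eq: "\<And>x. nrm q x < \<rho> \<Longrightarrow> \<phi> x = \<psi> x" and x: "nrm q x < \<rho>" and i: "i < q"
  shows "\<Gamma> i x = \<Delta> i x"
proof -
  let ?e = "\<lambda>j. if j = i then 1 else (0::real)"
  have se: "(\<Sum>j<q. f j * ?e j) = f i" for f :: "nat \<Rightarrow> real"
    using i by (simp add: if_distrib[of "\<lambda>u. _ * u"] cong: if_cong)
  have x0: "nrm q (\<lambda>j. x j + 0 * ?e j) < \<rho>" using x by simp
  have d1: "((\<lambda>s. \<phi> (\<lambda>j. x j + s * ?e j)) has_real_derivative \<Gamma> i x) (at 0)"
    using has_grad_line[OF g x0] unfolding se by simp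
  have d2: "((\<lambda>s. \<psi> (\<lambda>j. x j + s * ?e j)) has_real_derivative \<Delta> i x) (at 0)"
    using has_grad_line[OF g' x0] unfolding se by simp
  have ne: "nrm q ?e = 1"
    using i by (simp add: L2_set_def if_distrib[of "\<lambda>u. u^2"] cong: if_cong)
  have "((\<lambda>s. \<phi> (\<lambda>j. x j + s * ?e j)) has_real_derivative \<Delta> i x) (at 0)"
  proof (rule has_field_derivative_transform_within_open[OF d2, of "ball 0 (\<rho> - nrm q x)"])
    fix s :: real assume "s \<in> ball 0 (\<rho> - nrm q x)"
    then have s: "\<bar>s\<bar> < \<rho> - nrm q x" by (simp add: dist_real_def)
    have "nrm q (\<lambda>j. x j + s * ?e j) \<le> nrm q x + nrm q (\<lambda>j. s * ?e j)" by (rule nrm_add)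
    then have "nrm q (\<lambda>j. x j + s * ?e j) < \<rho>" using s ne unfolding nrm_scale by simp
    then show "\<psi> (\<lambda>j. x j + s * ?e j) = \<phi> (\<lambda>j. x j + s * ?e j)" by (rule eq[symmetric])
  qed (use x in auto)
  then show ?thesis by (rule DERIV_unique[OF d1])
qed

text \<open>A maximizer of the quadratic form exists on the unit sphere by compactness, and
  stationarity makes it an eigenvector.\<close>

lemma rayleigh_max:
  fixes M :: "nat \<Rightarrow> nat \<Rightarrow> real"
  assumes q: "0 < q" and sym: "\<And>i j. i < q \<Longrightarrow> j < q \<Longrightarrow> M i j = M j i"
  obtains l v where "nrm q v = 1" "\<And>i. i < q \<Longrightarrow> (\<Sum>j<q. M i j * v j) = l * v i"
    "\<And>w. (\<Sum>i<q. \<Sum>j<q. M i j * w i * w j) \<le> l * (nrm q w)^2"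
proof -
  let ?Q = "\<lambda>u w. \<Sum>i<q. \<Sum>j<q. M i j * u i * w j"
  \<comment> \<open>A cube in the first q coordinates and 0 elsewhere. It is compact in the product
    topology, and every unit vector has a representative in it.\<close>
  define K where "K = Pi\<^sub>E UNIV (\<lambda>i. if i < q then {-1..1} else {0::real})"
  have cK: "compact K"
    unfolding K_def compactin_euclidean_iff[symmetric] euclidean_product_topology[symmetric] compactin_PiE
    by (auto simp: compactin_euclidean_iff)
  have cn: "continuous_on UNIV (\<lambda>x::point. nrm q x)"
    unfolding L2_set_def by (intro continuous_intros continuous_on_product_coordinates)
  have "closed {x::point. nrm q x = 1}"
    by (rule closed_Collect_eq[OF cn]) auto
  with cK have cS: "compact (K \<inter> {x. nrm q x = 1})" by (rule compact_Int_closed)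
  have "(\<lambda>i. if i = 0 then 1 else 0) \<in> K \<inter> {x. nrm q x = 1}"
    using q by (auto simp: K_def L2_set_def if_distrib[of "\<lambda>u. u^2"] cong: if_cong)
  then have ne: "K \<inter> {x. nrm q x = 1} \<noteq> {}" by blast
  have "continuous_on (K \<inter> {x. nrm q x = 1}) (\<lambda>w. ?Q w w)"
    by (rule continuous_on_subset[OF _ subset_UNIV]) (intro continuous_intros continuous_on_product_coordinates)
  from continuous_attains_sup[OF cS ne this] obtain v where v: "v \<in> K" "nrm q v = 1"
    "\<And>w. w \<in> K \<Longrightarrow> nrm q w = 1 \<Longrightarrow> ?Q w w \<le> ?Q v v" by auto
  define l where "l = ?Q v v"
  have Qcong: "?Q w w = ?Q w' w'" if "\<And>i. i < q \<Longrightarrow> w i = w' i" for w w' :: point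
    using that by (intro sum.cong refl) auto
  have max: "?Q w w \<le> l * (nrm q w)^2" for w
  proof (cases "nrm q w = 0")
    case True
    then have "w i = 0" if "i < q" for i using abs_coord_le_nrm[OF that, of w] by simp
    then have "?Q w w = 0" by (intro sum.neutral ballI) auto
    then show ?thesis using True by simp
  next
    case False
    then have n0: "0 < nrm q w" using L2_set_nonneg[of w "{..<q}"] by linarith
    define u where "u i = (if i < q then w i / nrm q w else 0)" for i
    have nu: "nrm q u = 1"
    proof -
      have "nrm q u = nrm q (\<lambda>i. (1 / nrm q w) * w i)" by (auto simp: u_def L2_set_def intro!: sum.cong)
      then show ?thesis unfolding nrm_scale using n0 by simp
    qed
    have "u \<in> K" unfolding K_def
    proof (rule PiE_I)
      fix i
      have "\<bar>u i\<bar> \<le> 1" if "i < q" using abs_coord_le_nrm[OF that, of u] nu by simp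
      moreover have "u i = 0" if "\<not> i < q" using that by (simp add: u_def)
      ultimately show "u i \<in> (if i < q then {-1..1} else {0})" by (auto simp: abs_le_iff minus_le_iff)
    qed auto
    then have "?Q u u \<le> l" unfolding l_def using v(3) nu by blast
    moreover have "?Q u u = ?Q w w / (nrm q w)^2"
      unfolding sum_divide_distrib by (intro sum.cong refl) (auto simp: u_def power2_eq_square)
    ultimately show ?thesis using n0 by (simp add: pos_divide_le_eq)
  qed
  have stat: "(\<Sum>j<q. M i j * v j) = l * v i" if i: "i < q" for i
  proof -
    let ?e = "\<lambda>j. if j = i then 1 else (0::real)"
    \<comment> \<open>This form is nonnegative and vanishes at v. By Cauchy--Schwarz it also
      vanishes between v and each coordinate vector, which is the eigenvector equation, obtained
      without differentiation.\<close>
    let ?B = "\<lambda>u w. l * (\<Sum>i<q. u i * w i) - ?Q u w"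
    have Bpos: "0 \<le> ?B w w" for w using max[of w] unfolding L2_set_sq by (simp add: power2_eq_square)
    have Qs: "?Q u w = ?Q w u" for u w by (subst sum.swap) (auto intro!: sum.cong simp: sym)
    have "(?B v ?e)^2 \<le> ?B v v * ?B ?e ?e"
    proof (rule quadratic_form_nonneg_imp)
      fix s :: real
      have "?B (\<lambda>i. v i + s * ?e i) (\<lambda>i. v i + s * ?e i) = ?B v v + s * ?B v ?e + s * ?B ?e v + s^2 * ?B ?e ?e"
        by (simp add: algebra_simps sum.distrib sum_distrib_left power2_eq_square)
      moreover have "?B ?e v = ?B v ?e"
      proof -
        have "(\<Sum>j<q. ?e j * v j) = (\<Sum>j<q. v j * ?e j)" by (intro sum.cong refl) (rule mult.commute)
        then show ?thesis unfolding Qs[of ?e v] by simp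
      qed
      ultimately show "0 \<le> ?B v v + 2 * s * ?B v ?e + s^2 * ?B ?e ?e"
        using Bpos[of "\<lambda>i. v i + s * ?e i"] by (simp add: algebra_simps)
    qed
    also have "?B v v = 0" using v(2) by (simp add: l_def L2_set_sq[symmetric] power2_eq_square[symmetric])
    finally have "?B v ?e = 0" by simp
    moreover have "?Q v ?e = (\<Sum>j<q. M i j * v j)"
    proof -
      have "?Q v ?e = (\<Sum>j<q. M j i * v j)"
        using i by (simp add: if_distrib[of "\<lambda>u. _ * u"] cong: if_cong)
      then show ?thesis using i by (simp add: sym)
    qed
    moreover have "(\<Sum>j<q. v j * ?e j) = v i" using i by (simp add: if_distrib[of "\<lambda>u. _ * u"] cong: if_cong)
    ultimately show ?thesis by simp
  qed
  show ?thesis by (rule that[OF v(2) stat max])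
qed

lemma eigenvalue_matI:
  fixes M :: "nat \<Rightarrow> nat \<Rightarrow> real"
  assumes "nrm q v = 1" "\<And>i. i < q \<Longrightarrow> (\<Sum>j<q. M i j * v j) = l * v i"
  shows "l \<in> spectrum (mat q q (\<lambda>(i, j). M i j))"
proof -
  let ?A = "mat q q (\<lambda>(i, j). M i j)"
  have "vec q v \<noteq> 0\<^sub>v q"
  proof
    assume "vec q v = 0\<^sub>v q"
    then have "v i = 0" if "i < q" for i using that by (metis index_vec index_zero_vec(1))
    then have "nrm q v = 0" by (simp add: L2_set_def)
    then show False using assms(1) by simp
  qed
  moreover have "?A *\<^sub>v vec q v = l \<cdot>\<^sub>v vec q v"
    by (rule eq_vecI) (auto simp: scalar_prod_def assms(2) atLeast0LessThan)
  ultimately have "eigenvector ?A (vec q v) l" by (simp add: eigenvector_def)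
  then show ?thesis by (auto simp: spectrum_def eigenvalue_def)
qed

text \<open>The maximum of the Rayleigh quotient is itself an eigenvalue, hence at most the largest
  element of the spectrum. The lower bound is the same argument for - M.\<close>

theorem eigs_within_quadratic:
  fixes M :: "nat \<Rightarrow> nat \<Rightarrow> real"
  assumes q: "0 < q" and sym: "\<And>i j. i < q \<Longrightarrow> j < q \<Longrightarrow> M i j = M j i"
    and eig: "eigs_within lo (mat q q (\<lambda>(i, j). M i j)) hi"
  shows "lo * (nrm q w)^2 \<le> (\<Sum>i<q. \<Sum>j<q. M i j * w i * w j)"
    "(\<Sum>i<q. \<Sum>j<q. M i j * w i * w j) \<le> hi * (nrm q w)^2"
proof -
  let ?A = "mat q q (\<lambda>(i, j). M i j)"
  have fin: "finite (spectrum ?A)" by (rule card_finite_spectrum[of _ q]) simp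
  obtain l v where l: "nrm q v = 1" "\<And>i. i < q \<Longrightarrow> (\<Sum>j<q. M i j * v j) = l * v i"
    "\<And>w. (\<Sum>i<q. \<Sum>j<q. M i j * w i * w j) \<le> l * (nrm q w)^2"
    by (rule rayleigh_max[where M = M, OF q sym]) auto
  have "l \<le> Max (spectrum ?A)" using eigenvalue_matI[OF l(1,2)] fin by simp
  then have "l \<le> hi" using eig by (simp add: eigs_within_def max_eig_def)
  then have "l * (nrm q w)^2 \<le> hi * (nrm q w)^2" by (intro mult_right_mono) auto
  with l(3)[of w] show "(\<Sum>i<q. \<Sum>j<q. M i j * w i * w j) \<le> hi * (nrm q w)^2" by linarith
  obtain k u where k: "nrm q u = 1" "\<And>i. i < q \<Longrightarrow> (\<Sum>j<q. - M i j * u j) = k * u i"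
    "\<And>w. (\<Sum>i<q. \<Sum>j<q. - M i j * w i * w j) \<le> k * (nrm q w)^2"
    by (rule rayleigh_max[where M = "\<lambda>i j. - M i j", OF q]) (use sym in auto)
  have "(\<Sum>j<q. M i j * u j) = (- k) * u i" if "i < q" for i using k(2)[OF that] by (simp add: sum_negf)
  then have "Min (spectrum ?A) \<le> - k" using eigenvalue_matI[OF k(1)] fin by simp
  then have "lo \<le> - k" using eig by (simp add: eigs_within_def min_eig_def)
  then have "lo * (nrm q w)^2 \<le> (- k) * (nrm q w)^2" by (intro mult_right_mono) auto
  with k(3)[of w] show "lo * (nrm q w)^2 \<le> (\<Sum>i<q. \<Sum>j<q. M i j * w i * w j)"
    by (simp add: sum_negf)
qed

text \<open>Polarization on unit vectors: four times the form is a difference of quadratic forms at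
  u + w and u - w, and by the parallelogram law the squared norms of these add up to 4.\<close>

theorem eigs_within_bilinear:
  fixes M :: "nat \<Rightarrow> nat \<Rightarrow> real"
  assumes q: "0 < q" and sym: "\<And>i j. i < q \<Longrightarrow> j < q \<Longrightarrow> M i j = M j i"
    and eig: "eigs_within lo (mat q q (\<lambda>(i, j). M i j)) hi" and K: "\<bar>lo\<bar> \<le> K" "\<bar>hi\<bar> \<le> K"
  shows "\<bar>\<Sum>i<q. \<Sum>j<q. M i j * u i * v j\<bar> \<le> K * nrm q u * nrm q v"
proof -
  let ?Q = "\<lambda>u w. \<Sum>i<q. \<Sum>j<q. M i j * u i * w j"
  have Qb: "\<bar>?Q w w\<bar> \<le> K * (nrm q w)^2" for w
  proof -
    have "- (K * (nrm q w)^2) \<le> lo * (nrm q w)^2" "hi * (nrm q w)^2 \<le> K * (nrm q w)^2"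
      using K mult_right_mono[of "- K" lo "(nrm q w)^2"] by (auto intro!: mult_right_mono)
    then show ?thesis using eigs_within_quadratic[where M = M, OF q sym eig, of w] by linarith
  qed
  have K0: "0 \<le> K" using K(1) by linarith
  have Qs: "?Q u w = ?Q w u" for u w by (subst sum.swap) (auto intro!: sum.cong simp: sym)
  have Qsc: "?Q (\<lambda>i. c * u i) (\<lambda>i. d * w i) = c * d * ?Q u w" for c d u w
    by (simp add: sum_distrib_left mult_ac)
  have unit: "\<bar>?Q u w\<bar> \<le> K" if "nrm q u = 1" "nrm q w = 1" for u w
  proof -
    let ?p = "\<lambda>i. u i + w i" and ?m = "\<lambda>i. u i + (- 1) * w i"
    have "?Q ?p ?p = ?Q u u + ?Q u w + ?Q w u + ?Q w w" by (simp add: algebra_simps sum.distrib)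
    moreover have "?Q ?m ?m = ?Q u u - ?Q u w - ?Q w u + ?Q w w" by (simp add: algebra_simps sum.distrib sum_subtractf)
    ultimately have "4 * ?Q u w = ?Q ?p ?p - ?Q ?m ?m" using Qs[of u w] by simp
    then have "4 * \<bar>?Q u w\<bar> \<le> \<bar>?Q ?p ?p\<bar> + \<bar>?Q ?m ?m\<bar>" by linarith
    also have "\<dots> \<le> K * (nrm q ?p)^2 + K * (nrm q ?m)^2" by (intro add_mono Qb)
    also have "\<dots> = K * ((nrm q ?p)^2 + (nrm q ?m)^2)" by (simp add: algebra_simps)
    also have "(nrm q ?p)^2 + (nrm q ?m)^2 = 2 * (nrm q u)^2 + 2 * (nrm q w)^2"
      unfolding L2_set_sq sum_distrib_left sum.distrib[symmetric]
      by (intro sum.cong refl) (simp add: power2_eq_square algebra_simps)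
    finally show ?thesis using that by simp
  qed
  show ?thesis
  proof (cases "nrm q u = 0 \<or> nrm q v = 0")
    case True
    then have "?Q u v = 0"
    proof
      assume "nrm q u = 0"
      then have "u i = 0" if "i < q" for i using abs_coord_le_nrm[OF that, of u] by simp
      then show ?thesis by (intro sum.neutral ballI) auto
    next
      assume "nrm q v = 0"
      then have "v i = 0" if "i < q" for i using abs_coord_le_nrm[OF that, of v] by simp
      then show ?thesis by (intro sum.neutral ballI) auto
    qed
    then show ?thesis using K0 by (simp add: L2_set_nonneg)
  next
    case False
    then have n: "0 < nrm q u" "0 < nrm q v" by (simp_all add: less_le L2_set_nonneg)
    have "\<bar>?Q (\<lambda>i. (1 / nrm q u) * u i) (\<lambda>i. (1 / nrm q v) * v i)\<bar> \<le> K"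
      by (rule unit) (use n in \<open>simp_all only: nrm_scale, simp_all\<close>)
    then show ?thesis unfolding Qsc using n by (simp add: abs_mult field_simps)
  qed
qed

subsection \<open>The Laplace conditions at a fixed sample size\<close>

text \<open>Recenters at c and restores extensionality, so that a function on \<open>Rn q\<close>
  becomes a function of arbitrary points that ignores the coordinates from q on.\<close>

definition translate :: "nat \<Rightarrow> point \<Rightarrow> point \<Rightarrow> point" where
  "translate q c x = (\<lambda>i\<in>{..<q}. c i + x i)"

lemma translate_Rn: "translate q c x \<in> Rn q" by (auto simp: translate_def Rn_def)

lemma edist_translate: "edist q c (translate q c x) = nrm q x"
  by (auto simp: edist_def translate_def L2_set_def)

lemma edist_translate_translate: "edist q (translate q c x) (translate q c y) = nrm q (\<lambda>i. y i - x i)"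
  by (auto simp: edist_def translate_def L2_set_def power2_commute)

lemma translate_eball: "nrm q x < \<rho> \<Longrightarrow> translate q c x \<in> eball q c \<rho>"
  by (simp add: eball_def translate_Rn edist_translate)

lemma translate_0: "c \<in> Rn q \<Longrightarrow> translate q c (\<lambda>_. 0) = c"
  by (auto simp: translate_def Rn_def PiE_def extensional_def fun_eq_iff)

lemma partial_of_total:
  assumes z: "z \<in> Rn q" and i: "i < q"
    and D: "\<And>e. 0 < e \<Longrightarrow> \<exists>r>0. \<forall>w\<in>eball q z r. \<bar>h w - h z - (\<Sum>i<q. D i * (w i - z i))\<bar> \<le> e * edist q z w"
  shows "((\<lambda>t. h (z(i := t))) has_real_derivative D i) (at (z i))" "partial i h z = D i"
proof -
  show d: "((\<lambda>t. h (z(i := t))) has_real_derivative D i) (at (z i))"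
    unfolding has_field_derivative_def has_derivative_at_alt
  proof (intro conjI allI impI)
    show "bounded_linear ((*) (D i))" by (rule bounded_linear_mult_right)
    fix e :: real assume "0 < e"
    from D[OF this] obtain r where r: "0 < r" "\<And>w. w \<in> eball q z r \<Longrightarrow> \<bar>h w - h z - (\<Sum>i<q. D i * (w i - z i))\<bar> \<le> e * edist q z w" by auto
    show "\<exists>d>0. \<forall>y. norm (y - z i) < d \<longrightarrow> norm (h (z(i := y)) - h (z(i := z i)) - D i * (y - z i)) \<le> e * norm (y - z i)"
    proof (intro exI[of _ r] conjI allI impI)
      fix y assume y: "norm (y - z i) < r"
      have ed: "edist q z (z(i := y)) = \<bar>y - z i\<bar>"
      proof -
        have "(\<Sum>j<q. (z j - (z(i := y)) j)^2) = (\<Sum>j<q. if j = i then (y - z i)^2 else 0)"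
          by (intro sum.cong refl) (auto simp: power2_commute)
        then show ?thesis using i by (simp add: edist_def L2_set_def)
      qed
      have "z(i := y) \<in> Rn q" using z i by (auto simp: Rn_def PiE_def extensional_def)
      then have "z(i := y) \<in> eball q z r" using y ed by (simp add: eball_def)
      from r(2)[OF this] have "\<bar>h (z(i := y)) - h z - (\<Sum>j<q. D j * ((z(i := y)) j - z j))\<bar> \<le> e * \<bar>y - z i\<bar>"
        unfolding ed .
      moreover have "(\<Sum>j<q. D j * ((z(i := y)) j - z j)) = (\<Sum>j<q. if j = i then D i * (y - z i) else 0)"
        by (intro sum.cong refl) auto
      ultimately show "norm (h (z(i := y)) - h (z(i := z i)) - D i * (y - z i)) \<le> e * norm (y - z i)"
        using i by simp
    qed (rule r(1))
  qed
  show "partial i h z = D i" unfolding partial_def by (rule DERIV_imp_deriv[OF d])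
qed

lemma has_grad_of_differentiable:
  assumes d: "\<And>z. z \<in> eball q c \<rho> \<Longrightarrow> differentiable_pt q \<phi> z"
  shows "has_grad q \<rho> (\<lambda>x. \<phi> (translate q c x)) (\<lambda>i x. partial i \<phi> (translate q c x))"
  unfolding has_grad_def
proof (intro allI impI)
  fix x and e :: real assume x: "nrm q x < \<rho>" and e: "0 < e"
  let ?z = "translate q c x"
  from d[OF translate_eball[OF x]] obtain D where D: "\<And>e. 0 < e \<Longrightarrow> \<exists>r>0. \<forall>w\<in>eball q ?z r. \<bar>\<phi> w - \<phi> ?z - (\<Sum>i<q. D i * (w i - ?z i))\<bar> \<le> e * edist q ?z w"
    unfolding differentiable_pt_def by blast
  have pD: "partial i \<phi> ?z = D i" if "i < q" for i by (rule partial_of_total(2)[OF translate_Rn that D])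
  obtain r where r: "0 < r" "\<And>w. w \<in> eball q ?z r \<Longrightarrow> \<bar>\<phi> w - \<phi> ?z - (\<Sum>i<q. D i * (w i - ?z i))\<bar> \<le> e * edist q ?z w"
    using D[OF e] by blast
  show "\<exists>d>0. \<forall>y. nrm q (\<lambda>i. y i - x i) < d \<longrightarrow>
      \<bar>\<phi> (translate q c y) - \<phi> ?z - (\<Sum>i<q. partial i \<phi> ?z * (y i - x i))\<bar> \<le> e * nrm q (\<lambda>i. y i - x i)"
  proof (intro exI[of _ r] conjI allI impI)
    fix y assume y: "nrm q (\<lambda>i. y i - x i) < r"
    have "translate q c y \<in> eball q ?z r" using y by (simp add: eball_def translate_Rn edist_translate_translate)
    from r(2)[OF this] have "\<bar>\<phi> (translate q c y) - \<phi> ?z - (\<Sum>i<q. D i * (translate q c y i - ?z i))\<bar> \<le> e * nrm q (\<lambda>i. y i - x i)"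
      unfolding edist_translate_translate .
    moreover have "(\<Sum>i<q. D i * (translate q c y i - ?z i)) = (\<Sum>i<q. partial i \<phi> ?z * (y i - x i))"
      by (intro sum.cong refl) (simp add: pD, simp add: translate_def)
    ultimately show "\<bar>\<phi> (translate q c y) - \<phi> ?z - (\<Sum>i<q. partial i \<phi> ?z * (y i - x i))\<bar> \<le> e * nrm q (\<lambda>i. y i - x i)" by simp
  qed (rule r(1))
qed

lemma has_grad_partials:
  assumes t: "times_differentiable_on k q g (eball q c \<rho>)" and js: "set js \<subseteq> {..<q}" "length js < k"
  shows "has_grad q \<rho> (\<lambda>x. partials js g (translate q c x)) (\<lambda>i x. partials (i # js) g (translate q c x))"
proof -
  have "partials (i # js) g = partial i (partials js g)" for i by (simp add: partials_def)
  then show ?thesis using t js unfolding times_differentiable_on_def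
    by (simp only:) (rule has_grad_of_differentiable, blast)
qed

lemma symmetric_inverse_exists:
  fixes H :: "nat \<Rightarrow> nat \<Rightarrow> real"
  assumes det: "Determinant.det (mat q q (\<lambda>(i, j). H i j)) \<noteq> 0"
    and sym: "\<And>i j. i < q \<Longrightarrow> j < q \<Longrightarrow> H i j = H j i"
  obtains S where "\<And>i j. i < q \<Longrightarrow> j < q \<Longrightarrow> S i j = S j i"
    "\<And>i k. i < q \<Longrightarrow> k < q \<Longrightarrow> (\<Sum>j<q. H i j * S j k) = (if i = k then 1 else (0::real))"
proof -
  let ?A = "mat q q (\<lambda>(i, j). H i j)"
  have A: "?A \<in> carrier_mat q q" by simp
  from det_non_zero_imp_unit[OF A det, of undefined]
  obtain B where B: "B \<in> carrier_mat q q" "B * ?A = 1\<^sub>m q" "?A * B = 1\<^sub>m q"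
    unfolding Units_def ring_mat_def by auto
  have At: "transpose_mat ?A = ?A" by (rule eq_matI) (auto simp: sym)
  have "transpose_mat B * ?A = 1\<^sub>m q"
  proof -
    have "transpose_mat B * transpose_mat ?A = transpose_mat (?A * B)"
      by (rule transpose_mult[symmetric, OF A B(1)])
    then show ?thesis unfolding At B(3) by simp
  qed
  then have Bt: "transpose_mat B = B"
    using assoc_mult_mat[OF transpose_carrier_mat[THEN iffD2, OF B(1)] A B(1)] B
    by simp
  show ?thesis
  proof (rule that[of "\<lambda>i j. B $$ (i, j)"])
    fix i j assume ij: "i < q" "j < q"
    have "B $$ (i, j) = transpose_mat B $$ (i, j)" using Bt by simp
    also have "\<dots> = B $$ (j, i)" using ij B(1) by simp
    finally show "B $$ (i, j) = B $$ (j, i)" .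
    have "(?A * B) $$ (i, j) = (\<Sum>k<q. H i k * B $$ (k, j))"
      using ij B(1) by (simp add: scalar_prod_def atLeast0LessThan)
    then show "(\<Sum>k<q. H i k * B $$ (k, j)) = (if i = j then 1 else 0)"
      using ij unfolding B(3) by simp
  qed
qed

text \<open>Centering at the maximizer makes the gradient vanish at 0; adding the quadratic form of
  H removes the Hessian there as well. The two radii follow the hypotheses: a definite Hessian on
  the larger ball, higher derivatives on the smaller one.\<close>

theorem laplace_fn_of_conditions:
  fixes g :: "point \<Rightarrow> real" and \<zeta> :: nat
  assumes q: "0 < q" and r: "0 < r" "r < \<rho>" "\<rho> \<le> \<delta>" and \<kappa>: "0 < \<kappa>"
    and C: "\<bar>lo3\<bar> \<le> C" "\<bar>hi3\<bar> \<le> C" "\<bar>lo4\<bar> \<le> C" "\<bar>hi4\<bar> \<le> C"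
    and max: "is_arg_max g (\<lambda>z. z \<in> Rn q) c"
    and T2: "times_differentiable_on 2 q g (eball q c \<delta>)"
    and T5: "times_differentiable_on \<zeta> q g (eball q c \<rho>)" "4 < \<zeta>"
    and hess: "\<And>z. z \<in> eball q c \<delta> \<Longrightarrow> eigs_within \<kappa> (- hessian q g z) \<kappa>2"
    and d3: "\<And>l. l < q \<Longrightarrow> eigs_within lo3 (deriv_mat q g [l] c) hi3"
    and d4: "\<And>z l m. z \<in> eball q c \<rho> \<Longrightarrow> l < q \<Longrightarrow> m < q \<Longrightarrow> eigs_within lo4 (deriv_mat q g [l, m] z) hi4"
    and out: "integrable (leb q) (\<lambda>x. indicator {x. \<not> nrm q x < \<delta>} x * exp (g (translate q c x) - g c))"
  obtains S R R1 R2 R3 R4 h1 h2 where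
    "laplace_fn q r \<rho> \<kappa> \<kappa>2 C (\<lambda>a b. - partials [a, b] g c) S R R1 R2 R3 R4 \<delta> (\<lambda>x. g (translate q c x) - g c) h1 h2"
proof -
  have cR: "c \<in> Rn q" using max by (simp add: is_arg_max_def)
  note c0 = translate_0[OF cR]
  let ?H = "\<lambda>a b. - partials [a, b] g c"
  define h1 where "h1 a x = partials [a] g (translate q c x)" for a x
  \<comment> \<open>The head of a list in \<open>partials\<close> is the derivative taken last, so
    lists are reversed: the newest index becomes the last argument, as \<open>has_grad\<close>
    expects.\<close>
  define h2 where "h2 a b x = partials [b, a] g (translate q c x)" for a b x
  define R3 where "R3 a b d x = partials [d, b, a] g (translate q c x)" for a b d x
  define R4 where "R4 a b d e x = partials [e, d, b, a] g (translate q c x)" for a b d e x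
  have \<delta>0: "nrm q (\<lambda>_. 0) < \<delta>" using r by (simp add: nrm_zero)
  have \<rho>0: "nrm q (\<lambda>_. 0) < \<rho>" using r by (simp add: nrm_zero)
  have g0: "has_grad q \<delta> (\<lambda>x. g (translate q c x)) h1"
    using has_grad_partials[OF T2, of "[]"] unfolding h1_def partials_def by simp
  have g1: "has_grad q \<delta> (h1 a) (h2 a)" if "a < q" for a
    using has_grad_partials[OF T2, of "[a]"] that unfolding h1_def[abs_def] h2_def[abs_def] by simp
  have gh: "has_grad q \<delta> (\<lambda>x. g (translate q c x) - g c) h1"
    using has_grad_add[OF g0 has_grad_const[of _ _ "- g c"]] by simp
  have sub: "has_grad q \<rho> \<phi> \<Gamma>" if "has_grad q \<delta> \<phi> \<Gamma>" for \<phi> \<Gamma>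
    using that r(3) unfolding has_grad_def by (meson less_le_trans)
  have g2: "has_grad q \<rho> (h2 a b) (R3 a b)" if "a < q" "b < q" for a b
    using has_grad_partials[OF T5(1), of "[b, a]"] that T5(2) unfolding h2_def[abs_def] R3_def[abs_def] by simp
  have g3: "has_grad q \<rho> (R3 a b d) (R4 a b d)" if "a < q" "b < q" "d < q" for a b d
    using has_grad_partials[OF T5(1), of "[d, b, a]"] that T5(2) unfolding R4_def[abs_def] R3_def[abs_def] by simp
  \<comment> \<open>Here \<zeta> > 4 enters: fourth partial derivatives are still differentiable,
    hence continuous.\<close>
  have g4: "cts_ball q \<rho> (R4 a b d e)" if "a < q" "b < q" "d < q" "e < q" for a b d e
    using has_grad_imp_cts[OF has_grad_partials[OF T5(1), of "[e, d, b, a]"]] that T5(2) unfolding R4_def[abs_def] by simp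
  have s2: "h2 a b x = h2 b a x" if "a < q" "b < q" "nrm q x < \<delta>" for a b x
    by (rule has_grad_second_symmetric[OF g0 g1 that(3,1,2)])
  \<comment> \<open>At each order, symmetry in the older indices follows from uniqueness of
    gradients and symmetry in the two newest ones from the theorem on second derivatives.\<close>
  have s3a: "R3 a b d x = R3 b a d x" if "a < q" "b < q" "d < q" "nrm q x < \<rho>" for a b d x
    by (rule has_grad_unique[OF g2 g2]) (use that s2 r in auto)
  have s3b: "R3 a b d x = R3 a d b x" if "a < q" "b < q" "d < q" "nrm q x < \<rho>" for a b d x
    by (rule has_grad_second_symmetric[OF sub[OF g1[OF that(1)]] g2[OF that(1)] that(4,2,3)])
  have s4a: "R4 a b d e x = R4 b a d e x" if "a < q" "b < q" "d < q" "e < q" "nrm q x < \<rho>" for a b d e x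
    by (rule has_grad_unique[OF g3 g3]) (use that s3a in auto)
  have s4b: "R4 a b d e x = R4 a d b e x" if "a < q" "b < q" "d < q" "e < q" "nrm q x < \<rho>" for a b d e x
    by (rule has_grad_unique[OF g3 g3]) (use that s3b in auto)
  have s4c: "R4 a b d e x = R4 a b e d x" if "a < q" "b < q" "d < q" "e < q" "nrm q x < \<rho>" for a b d e x
    by (rule has_grad_second_symmetric[OF g2[OF that(1,2)] g3[OF that(1,2)] that(5,3,4)])
  have H0: "?H a b = - h2 b a (\<lambda>_. 0)" for a b by (simp add: h2_def c0)
  have H0': "?H a b = - h2 a b (\<lambda>_. 0)" if "a < q" "b < q" for a b
    using s2[OF that \<delta>0] by (simp add: H0)
  have Hsym: "?H a b = ?H b a" if "a < q" "b < q" for a b using H0[of b a] H0'[OF that] by simp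
  have hq: "\<kappa> * (nrm q v)^2 \<le> (\<Sum>i<q. \<Sum>j<q. - h2 j i x * v i * v j)"
    "(\<Sum>i<q. \<Sum>j<q. - h2 j i x * v i * v j) \<le> \<kappa>2 * (nrm q v)^2" if x: "nrm q x < \<delta>" for x v
  proof -
    have eq: "- hessian q g (translate q c x) = mat q q (\<lambda>(i, j). - h2 j i x)"
      by (rule eq_matI) (auto simp: deriv_mat_def h2_def)
    have e: "eigs_within \<kappa> (mat q q (\<lambda>(i, j). - h2 j i x)) \<kappa>2"
      using hess[OF translate_eball[OF x]] unfolding eq .
    have s: "- h2 j i x = - h2 i j x" if "i < q" "j < q" for i j using s2[OF that x] by simp
    show "\<kappa> * (nrm q v)^2 \<le> (\<Sum>i<q. \<Sum>j<q. - h2 j i x * v i * v j)"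
      by (rule eigs_within_quadratic(1)[where M = "\<lambda>i j. - h2 j i x", OF q s e])
    show "(\<Sum>i<q. \<Sum>j<q. - h2 j i x * v i * v j) \<le> \<kappa>2 * (nrm q v)^2"
      by (rule eigs_within_quadratic(2)[where M = "\<lambda>i j. - h2 j i x", OF q s e])
  qed
  have hconv: "(\<Sum>a<q. \<Sum>b<q. h2 a b x * v a * v b) \<le> - (\<kappa> * (nrm q v)^2)" if x: "nrm q x < \<delta>" for x v
  proof -
    have "(\<Sum>a<q. \<Sum>b<q. - h2 b a x * v a * v b) = - (\<Sum>a<q. \<Sum>b<q. h2 a b x * v a * v b)"
      unfolding sum_negf[symmetric] using s2[OF _ _ x] by (intro sum.cong refl) simp
    then show ?thesis using hq(1)[OF x, of v] by linarith
  qed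
  have Hlow: "\<kappa> * (nrm q v)^2 \<le> (\<Sum>i<q. \<Sum>j<q. ?H i j * v i * v j)" for v
    using hq(1)[OF \<delta>0, of v] unfolding H0 .
  have Hup: "(\<Sum>i<q. \<Sum>j<q. ?H i j * v i * v j) \<le> \<kappa>2 * (nrm q v)^2" for v
    using hq(2)[OF \<delta>0, of v] unfolding H0 .
  have det: "Determinant.det (mat q q (\<lambda>(i, j). ?H i j)) \<noteq> 0"
    using nn_integral_gaussian_det[OF \<kappa>, of q ?H, OF Hsym Hlow] by simp
  obtain S where S: "\<And>i j. i < q \<Longrightarrow> j < q \<Longrightarrow> S i j = S j i"
    "\<And>i k. i < q \<Longrightarrow> k < q \<Longrightarrow> (\<Sum>j<q. ?H i j * S j k) = (if i = k then 1 else (0::real))"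
    by (rule symmetric_inverse_exists[OF det Hsym]) auto
  \<comment> \<open>The maximum is over all of \<open>Rn q\<close>, so each coordinate line through
    c has a local maximum there.\<close>
  have h10: "h1 a (\<lambda>_. 0) = 0" if a: "a < q" for a
  proof -
    let ?e = "\<lambda>j. if j = a then 1 else (0::real)"
    have "((\<lambda>s. g (translate q c (\<lambda>j. 0 + s * ?e j))) has_real_derivative (\<Sum>i<q. h1 i (\<lambda>j. 0 + 0 * ?e j) * ?e i)) (at 0)"
      by (rule has_grad_line[OF g0]) (use \<delta>0 in simp)
    moreover have "(\<Sum>i<q. h1 i (\<lambda>j. 0 + 0 * ?e j) * ?e i) = h1 a (\<lambda>_. 0)"
      using a by (simp add: if_distrib[of "\<lambda>u. _ * u"] cong: if_cong)
    ultimately have "((\<lambda>s. g (translate q c (\<lambda>j. 0 + s * ?e j))) has_real_derivative h1 a (\<lambda>_. 0)) (at 0)" by simp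
    then show ?thesis
    proof (rule DERIV_local_max[of _ _ _ 1])
      have "g z \<le> g c" if "z \<in> Rn q" for z using max that by (auto simp: is_arg_max_def not_less)
      then show "\<forall>y. \<bar>0 - y\<bar> < 1 \<longrightarrow> g (translate q c (\<lambda>j. 0 + y * ?e j)) \<le> g (translate q c (\<lambda>j. 0 + 0 * ?e j))"
        using translate_Rn c0 by simp
    qed simp
  qed
  have C0: "0 \<le> C" using C(1) by linarith
  let ?R = "\<lambda>x. (g (translate q c x) - g c) + (\<Sum>i<q. \<Sum>j<q. ?H i j * x i * x j) / 2"
  let ?R1 = "\<lambda>a x. h1 a x + (\<Sum>j<q. ?H a j * x j)"
  let ?R2 = "\<lambda>a b x. h2 a b x + ?H a b"
  have Hbd: "\<bar>\<Sum>i<q. \<Sum>j<q. ?H i j * v i * v j\<bar> \<le> \<kappa>2 * (nrm q v)^2" for v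
  proof -
    have "0 \<le> \<kappa> * (nrm q v)^2" using \<kappa> by simp
    then show ?thesis using Hlow[of v] Hup[of v] by linarith
  qed
  have T3: "\<bar>\<Sum>a<q. \<Sum>b<q. R3 a b l (\<lambda>_. 0) * u a * v b\<bar> \<le> C * nrm q u * nrm q v" if l: "l < q" for l u v
  proof -
    \<comment> \<open>\<open>deriv_mat\<close> lists the indices in the order opposite to
      \<open>R3\<close>; the chain of transpositions below reverses it.\<close>
    have eq: "deriv_mat q g [l] c = mat q q (\<lambda>(a, b). R3 a b l (\<lambda>_. 0))"
    proof (rule eq_matI)
      fix a b assume "a < dim_row (mat q q (\<lambda>(a, b). R3 a b l (\<lambda>_. 0)))" "b < dim_col (mat q q (\<lambda>(a, b). R3 a b l (\<lambda>_. 0)))"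
      then have ab: "a < q" "b < q" by auto
      have "deriv_mat q g [l] c $$ (a, b) = R3 l b a (\<lambda>_. 0)" using ab by (simp add: deriv_mat_def R3_def c0)
      also have "\<dots> = R3 b l a (\<lambda>_. 0)" using s3a ab l \<rho>0 by blast
      also have "\<dots> = R3 b a l (\<lambda>_. 0)" using s3b ab l \<rho>0 by blast
      also have "\<dots> = R3 a b l (\<lambda>_. 0)" using s3a ab l \<rho>0 by blast
      finally show "deriv_mat q g [l] c $$ (a, b) = mat q q (\<lambda>(a, b). R3 a b l (\<lambda>_. 0)) $$ (a, b)" using ab by simp
    qed (auto simp: deriv_mat_def)
    show ?thesis
      by (rule eigs_within_bilinear[where M = "\<lambda>a b. R3 a b l (\<lambda>_. 0)", OF q _ d3[OF l, unfolded eq] C(1,2)])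
        (use s3a l \<rho>0 in blast)
  qed
  have T4: "\<bar>\<Sum>a<q. \<Sum>b<q. R4 a b l m x * u a * v b\<bar> \<le> C * nrm q u * nrm q v"
    if lm: "l < q" "m < q" and x: "nrm q x < \<rho>" for l m x u v
  proof -
    have eq: "deriv_mat q g [l, m] (translate q c x) = mat q q (\<lambda>(a, b). R4 a b l m x)"
    proof (rule eq_matI)
      fix a b assume "a < dim_row (mat q q (\<lambda>(a, b). R4 a b l m x))" "b < dim_col (mat q q (\<lambda>(a, b). R4 a b l m x))"
      then have ab: "a < q" "b < q" by auto
      have "deriv_mat q g [l, m] (translate q c x) $$ (a, b) = R4 m l b a x" using ab by (simp add: deriv_mat_def R4_def)
      also have "\<dots> = R4 m b l a x" using s4b ab lm x by blast
      also have "\<dots> = R4 m b a l x" using s4c ab lm x by blast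
      also have "\<dots> = R4 b m a l x" using s4a ab lm x by blast
      also have "\<dots> = R4 b a m l x" using s4b ab lm x by blast
      also have "\<dots> = R4 b a l m x" using s4c ab lm x by blast
      also have "\<dots> = R4 a b l m x" using s4a ab lm x by blast
      finally show "deriv_mat q g [l, m] (translate q c x) $$ (a, b) = mat q q (\<lambda>(a, b). R4 a b l m x) $$ (a, b)" using ab by simp
    qed (auto simp: deriv_mat_def)
    show ?thesis
      by (rule eigs_within_bilinear[where M = "\<lambda>a b. R4 a b l m x", OF q _ d4[OF translate_eball[OF x] lm, unfolded eq] C(3,4)])
        (use s4a lm x in blast)
  qed
  have "laplace_fn q r \<rho> \<kappa> \<kappa>2 C ?H S ?R ?R1 ?R2 R3 R4 \<delta> (\<lambda>x. g (translate q c x) - g c) h1 h2"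
  proof (intro laplace_fn.intro ball_fn.intro laplace_fn_axioms.intro)
    show "has_grad q \<rho> ?R ?R1"
      by (intro has_grad_add sub[OF gh] has_grad_quadratic[OF Hsym Hbd])
    show "has_grad q \<rho> (?R1 a) (?R2 a)" if "a < q" for a
      using that by (intro has_grad_add sub[OF g1] has_grad_linear)
    show "has_grad q \<rho> (?R2 a b) (R3 a b)" if "a < q" "b < q" for a b
      using has_grad_add[OF g2[OF that] has_grad_const[of _ _ "?H a b"]] by simp
    show "?R (\<lambda>_. 0) = 0" by (simp add: c0)
    show "?R1 a (\<lambda>_. 0) = 0" if "a < q" for a using h10[OF that] by simp
    show "?R2 a b (\<lambda>_. 0) = 0" if "a < q" "b < q" for a b using H0'[OF that] by simp
    show "?R2 a b x = ?R2 b a x" if "a < q" "b < q" "nrm q x < \<rho>" for a b x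
      using s2[OF that(1,2)] that(3) r(3) Hsym[OF that(1,2)] by simp
    show "R3 a b d x = R3 b a d x \<and> R3 a b d x = R3 a d b x" if "a < q" "b < q" "d < q" "nrm q x < \<rho>" for a b d x
      using s3a[OF that] s3b[OF that] by blast
    show "R4 a b d e x = R4 b a d e x \<and> R4 a b d e x = R4 a d b e x \<and> R4 a b d e x = R4 a b e d x"
      if "a < q" "b < q" "d < q" "e < q" "nrm q x < \<rho>" for a b d e x
      using s4a[OF that] s4b[OF that] s4c[OF that] by blast
    show "\<kappa> * (nrm q v)^2 \<le> (\<Sum>a<q. \<Sum>b<q. (?H a b - ?R2 a b x) * v a * v b)" if x: "nrm q x < \<rho>" for x v
    proof -
      have "(\<Sum>a<q. \<Sum>b<q. (?H a b - ?R2 a b x) * v a * v b) = - (\<Sum>a<q. \<Sum>b<q. h2 a b x * v a * v b)"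
        by (simp add: sum_negf)
      then show ?thesis using hconv[of x v] x r(3) by simp
    qed
  qed (fact q r(1,2,3) \<kappa> C0 Hsym Hlow Hup S g3 g4 T3 T4 gh g1 h10 hconv out refl)+
  then show ?thesis by (rule that)
qed

section \<open>Explicit error rates and the passage to the limit\<close>

context laplace_fn begin

lemma exp_h_integrable: "integrable (leb q) (\<lambda>x. exp (h x))"
proof -
  have "(\<lambda>x. exp (h x)) = (\<lambda>x. (indicator B x * exp (h x) + indicator {x. nrm q x < \<delta> \<and> \<not> nrm q x \<le> r} x * exp (h x))
     + indicator {x. \<not> nrm q x < \<delta>} x * exp (h x))"
    using \<delta> r by (intro ext) (auto simp: indicator_def)
  then show ?thesis using ball_integrable ann(1) out by simp
qed

lemma laplace_finite_rate:
  fixes N P c \<eta> \<epsilon> K :: real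
  assumes k: "\<kappa> = \<eta> * N" "C = c * N" "r = sqrt (P * ln N / N)"
    and pos: "0 < \<eta>" "0 \<le> c" "1 \<le> N" "1 \<le> ln N" "real q \<le> P"
    and \<epsilon>: "\<epsilon> = P * ln N / sqrt N" "\<epsilon> \<le> 1" "8 * c * \<epsilon> \<le> \<eta>"
    and t: "trel \<le> 1 / N^5"  "trel \<le> 1/2"
    and K: "K = c / \<eta>^2 + (2 * c / \<eta> + 2 * c) * (4 / sqrt \<eta>) + 32 * c^2 / \<eta>^2 + 8 / \<eta> * (2 * c / \<eta> + 8 * c / sqrt \<eta>)^2"
      "K * \<epsilon>^2 \<le> 1"
  shows "\<bar>(\<integral>x. exp (h x) \<partial>leb q) / Gdet - 1\<bar> \<le> (2 * K + 2) * \<epsilon>^2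
     + (\<integral>x. indicator {x. \<not> nrm q x < \<delta>} x * exp (h x) \<partial>leb q) / Gdet"
proof -
  have N: "0 < N" using pos by linarith
  have q1: "1 \<le> real q" using q by linarith
  have P: "1 \<le> P" using q1 pos by linarith
  have L0: "0 \<le> ln N" using pos by linarith
  have \<epsilon>0: "0 \<le> \<epsilon>" using P L0 N by (simp add: \<epsilon>)
  have \<epsilon>2: "\<epsilon>^2 = P^2 * (ln N)^2 / N" using N by (simp add: \<epsilon>(1) power_divide power_mult_distrib)
  have PL: "1 \<le> P * ln N" using mult_mono[of 1 P 1 "ln N"] P pos by simp
  have N1: "1 / N \<le> \<epsilon>^2"
  proof -
    have "1 \<le> (P * ln N)^2" using PL by simp
    then show ?thesis unfolding \<epsilon>2 power_mult_distrib[symmetric] using N by (intro divide_right_mono) auto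
  qed
  have P2: "P^2 / N \<le> \<epsilon>^2"
  proof -
    have "1 \<le> (ln N)^2" using pos by simp
    then have "P^2 * 1 \<le> P^2 * (ln N)^2" by (intro mult_left_mono) auto
    then show ?thesis unfolding \<epsilon>2 using N by (intro divide_right_mono) auto
  qed
  have PN: "P^2 \<le> N"
  proof -
    have "\<epsilon>^2 \<le> 1" using \<epsilon>(2) \<epsilon>0 by (simp add: abs_square_le_1)
    then have "P^2 / N \<le> 1" using P2 by linarith
    then show ?thesis using N by (simp add: divide_le_eq)
  qed
  have Ps: "P \<le> sqrt N" using PN real_le_rsqrt by blast
  have r2: "r^2 = P * ln N / N" unfolding k using P L0 N by simp
  have qr2: "real q * r^2 \<le> \<epsilon>^2"
  proof -
    have "real q * r^2 \<le> P * (P * ln N / N)" unfolding r2 using pos(5) P L0 N by (intro mult_right_mono) auto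
    also have "\<dots> = P^2 * (ln N * 1) / N" by (simp add: power2_eq_square)
    also have "\<dots> \<le> P^2 * (ln N * ln N) / N"
      using N L0 pos by (intro divide_right_mono mult_left_mono) auto
    finally show ?thesis unfolding \<epsilon>2 by (simp only: power2_eq_square)
  qed
  have sqr: "sqrt q * r \<le> \<epsilon>"
  proof (rule power2_le_imp_le)
    show "(sqrt q * r)^2 \<le> \<epsilon>^2" using qr2 by (simp add: power_mult_distrib)
  qed (fact \<epsilon>0)
  have rle: "r \<le> 1"
  proof -
    have "1 * r \<le> sqrt q * r" using q1 r by (intro mult_right_mono) auto
    then show ?thesis using sqr \<epsilon>(2) by linarith
  qed
  have cN: "0 \<le> c * N" "0 \<le> 2 * c * N" "0 \<le> 2 * c * N * \<epsilon>" using pos N \<epsilon>0 by auto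
  have \<beta>: "\<beta> \<le> 2 * c * N * \<epsilon>"
  proof -
    have "\<epsilon>^2 \<le> \<epsilon>" using \<epsilon>0 \<epsilon>(2) by (simp add: power2_eq_square mult_left_le_one_le)
    then have "sqrt q * r + real q * r^2 / 2 \<le> 2 * \<epsilon>" using sqr qr2 \<epsilon>0 by linarith
    then have "\<beta> \<le> C * (2 * \<epsilon>)" unfolding \<beta>_def by (rule mult_left_mono) (fact C)
    then show ?thesis by (simp add: k(2))
  qed
  have \<beta>sq: "\<beta>^2 \<le> (2 * c * N * \<epsilon>)^2" by (intro power_mono \<beta> \<beta>_nonneg)
  \<comment> \<open>The factor sqrt q saved in each row is returned by summing over q rows, so the
    Frobenius and the operator bound coincide.\<close>
  have q\<gamma>: "real q * \<gamma>1^2 = \<beta>^2"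
  proof -
    have "\<beta> = sqrt q * \<gamma>1" unfolding \<beta>_def \<gamma>1_def by (simp add: algebra_simps)
    then show ?thesis by (simp add: power_mult_distrib)
  qed
  have \<tau>0: "0 \<le> \<tau>" unfolding \<tau>_def using r \<kappa> C by (intro mult_nonneg_nonneg add_nonneg_nonneg) auto
  have \<tau>: "\<tau> \<le> 2 * c / \<eta> * P"
  proof -
    have e: "C * (q / \<kappa>) = c / \<eta> * q" unfolding k using N pos by simp
    have "c / \<eta> * q * (1 + sqrt q * r) \<le> c / \<eta> * P * 2"
      using sqr \<epsilon>(2) pos r by (intro mult_mono) auto
    then show ?thesis unfolding \<tau>_def e by (simp add: mult_ac)
  qed
  define s where "s = 4 / sqrt \<eta>"
  have s0: "0 < s" using pos by (simp add: s_def)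
  have err0: "0 \<le> err" unfolding err_def using bdry_nonneg Zw0 \<kappa> by simp
  \<comment> \<open>The factor q^(3/2) is at most P^2 \<le> N and uses up one of the five powers of
    N supplied by \<open>trel\<close>.\<close>
  have err: "err \<le> s / N^4"
  proof -
    have "sqrt q * (q / sqrt \<kappa>) \<le> P * (P / sqrt \<kappa>)"
    proof (intro mult_mono divide_right_mono)
      have "sqrt q \<le> sqrt (q * q)" using q1 by (intro real_sqrt_le_mono) simp
      then show "sqrt q \<le> P" using pos(5) by simp
    qed (use pos P \<kappa> in auto)
    also have "\<dots> = P^2 / sqrt \<eta> * (1 / sqrt N)" unfolding k by (simp add: power2_eq_square real_sqrt_mult)
    also have "\<dots> \<le> N / sqrt \<eta> * 1"
      using PN pos by (intro mult_mono divide_right_mono) auto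
    finally have "4 * trel * (sqrt q * (q / sqrt \<kappa>)) \<le> 4 * (1 / N^5) * (N / sqrt \<eta>)"
      using t(1) trel_nonneg N pos \<kappa> by (intro mult_mono) auto
    also have "\<dots> = s / N^4" using N by (simp add: s_def field_simps eval_nat_numeral)
    finally show ?thesis using err_le[OF t(2)] by linarith
  qed
  have N4: "s / N^4 \<le> s / N^2" "s / N^4 \<le> s / N"
    using pos s0 by (auto intro!: divide_left_mono self_le_power power_increasing)
  have T1: "C * (q / \<kappa>)^2 \<le> c / \<eta>^2 * \<epsilon>^2"
  proof -
    have "C * (q / \<kappa>)^2 = c / \<eta>^2 * (q^2 / N)" unfolding k using N pos by (simp add: field_simps power2_eq_square)
    also have "\<dots> \<le> c / \<eta>^2 * (P^2 / N)"
      using pos N by (intro mult_left_mono divide_right_mono power_mono) auto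
    also have "\<dots> \<le> c / \<eta>^2 * \<epsilon>^2" using P2 pos by (intro mult_left_mono) auto
    finally show ?thesis .
  qed
  have T2: "(\<tau> + \<beta> * r) * err \<le> (2 * c / \<eta> + 2 * c) * s * \<epsilon>^2"
  proof -
    have "P \<le> N" using self_le_power[OF P, of 2] PN by simp
    have a: "\<tau> \<le> 2 * c / \<eta> * N" using \<tau> mult_left_mono[OF \<open>P \<le> N\<close>, of "2 * c / \<eta>"] pos by simp
    have "\<beta> * r \<le> 2 * c * N * \<epsilon> * 1" using \<beta> rle r \<beta>_nonneg cN(3) by (intro mult_mono) (auto simp: mult_ac)
    also have "\<dots> \<le> 2 * c * N * 1" using mult_left_mono[OF \<epsilon>(2) cN(2)] by simp
    finally have "\<tau> + \<beta> * r \<le> (2 * c / \<eta> + 2 * c) * N" using a by (simp add: algebra_simps)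
    then have "(\<tau> + \<beta> * r) * err \<le> ((2 * c / \<eta> + 2 * c) * N) * (s / N^2)"
      using err N4 err0 pos N by (intro mult_mono) auto
    also have "\<dots> = (2 * c / \<eta> + 2 * c) * s * (1 / N)" using N by (simp add: power2_eq_square)
    also have "\<dots> \<le> (2 * c / \<eta> + 2 * c) * s * \<epsilon>^2" using N1 pos s0 by (intro mult_left_mono) auto
    finally show ?thesis .
  qed
  have T3: "8 / \<kappa>^2 * (real q * \<gamma>1^2) \<le> 32 * c^2 / \<eta>^2 * \<epsilon>^2"
  proof -
    have "8 / \<kappa>^2 * (real q * \<gamma>1^2) \<le> 8 / \<kappa>^2 * (2 * c * N * \<epsilon>)^2"
      unfolding q\<gamma> by (intro mult_left_mono \<beta>sq) auto
    also have "\<dots> = 32 * c^2 / \<eta>^2 * \<epsilon>^2" unfolding k using N pos by (simp add: field_simps)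
    finally show ?thesis .
  qed
  have T4: "8 / \<kappa> * (\<tau> + \<beta> * err)^2 \<le> 8 / \<eta> * (2 * c / \<eta> + 8 * c / sqrt \<eta>)^2 * \<epsilon>^2"
  proof -
    have "\<beta> * err \<le> 2 * c * N * \<epsilon> * (s / N)" using \<beta> err N4 err0 \<beta>_nonneg cN(3) by (intro mult_mono) (auto simp: mult_ac)
    also have "\<dots> = 2 * c * s * \<epsilon>" using N by simp
    also have "\<dots> \<le> 2 * c * s * P" using \<epsilon>(2) P pos s0 by (intro mult_left_mono) auto
    finally have "\<tau> + \<beta> * err \<le> (2 * c / \<eta> + 8 * c / sqrt \<eta>) * P" using \<tau> by (simp add: s_def algebra_simps)
    then have "(\<tau> + \<beta> * err)^2 \<le> ((2 * c / \<eta> + 8 * c / sqrt \<eta>) * P)^2"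
      using \<tau>0 \<beta>_nonneg err0 by (intro power_mono add_nonneg_nonneg mult_nonneg_nonneg)
    then have "8 / \<kappa> * (\<tau> + \<beta> * err)^2 \<le> 8 / \<kappa> * ((2 * c / \<eta> + 8 * c / sqrt \<eta>) * P)^2"
      using \<kappa> by (intro mult_left_mono) auto
    also have "\<dots> = 8 / \<eta> * (2 * c / \<eta> + 8 * c / sqrt \<eta>)^2 * (P^2 / N)" unfolding k by (simp add: power_mult_distrib)
    also have "\<dots> \<le> 8 / \<eta> * (2 * c / \<eta> + 8 * c / sqrt \<eta>)^2 * \<epsilon>^2" using P2 pos(1) by (intro mult_left_mono) auto
    finally show ?thesis .
  qed
  have small: "16 * \<beta>^2 \<le> \<kappa>^2"
  proof -
    have "8 * c * \<epsilon> * N \<le> \<kappa>" unfolding k using \<epsilon>(3) N by (intro mult_right_mono) auto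
    then have "4 * \<beta> \<le> \<kappa>" using \<beta> by (simp add: mult_ac)
    then have "(4 * \<beta>)^2 \<le> \<kappa>^2" using \<beta>_nonneg by (intro power_mono) auto
    then show ?thesis by (simp add: power_mult_distrib)
  qed
  have \<Theta>: "C * (q / \<kappa>)^2 + (\<tau> + \<beta> * r) * err + 8 / \<kappa>^2 * (real q * \<gamma>1^2) + 8 / \<kappa> * (\<tau> + \<beta> * err)^2 \<le> K * \<epsilon>^2"
    using T1 T2 T3 T4 unfolding K(1) s_def distrib_right by linarith
  have "trel \<le> \<epsilon>^2"
  proof -
    have "1 / N^5 \<le> 1 / N" using pos by (intro divide_left_mono self_le_power) auto
    then show ?thesis using t(1) N1 by linarith
  qed
  then show ?thesis using laplace_finite[OF small t(2) \<Theta> K(2)] by (simp add: algebra_simps)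
qed

text \<open>Half of the exponent \<eta> P ln N / 4 compensates for the constant to the power q, by
  the condition on ln N. The other half is at least 5 ln N because \<eta> P >= 40.\<close>

lemma trel_le:
  fixes N P \<eta> :: real
  assumes k: "\<kappa> = \<eta> * N" "\<kappa>2 = \<eta>2 * N" "r = sqrt (P * ln N / N)"
    and pos: "0 < \<eta>" "1 \<le> N" "real q \<le> P"
    and L: "8 * ln (sqrt (2 * \<eta>2 / \<eta>)) \<le> \<eta> * ln N" and P: "40 \<le> \<eta> * P"
  shows "trel \<le> 1 / N^5"
proof -
  let ?D = "sqrt (2 * \<eta>2 / \<eta>)"
  have N: "0 < N" using pos by linarith
  have P0: "0 \<le> P" using pos by linarith
  have L0: "0 \<le> ln N" using pos by simp
  have "\<eta> \<le> \<eta>2" using \<kappa>2_pos N unfolding k by simp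
  then have D: "1 \<le> ?D" using pos by (simp add: le_divide_eq)
  have eq: "2 * \<kappa>2 / \<kappa> = 2 * \<eta>2 / \<eta>" unfolding k using N by simp
  have r2: "\<kappa> * r^2 / 4 = \<eta> * P * ln N / 4" unfolding k using P0 L0 N by simp
  have "?D ^ q = exp (ln ?D * q)" using D by (simp add: exp_of_nat2_mult)
  also have "\<dots> \<le> exp (ln ?D * P)" using D pos by (simp add: mult_left_mono)
  finally have "trel \<le> exp (- (\<eta> * P * ln N / 4)) * exp (ln ?D * P)"
    unfolding trel_def eq r2 by (intro mult_left_mono) auto
  also have "\<dots> = exp (ln ?D * P - \<eta> * P * ln N / 4)" by (simp add: exp_add[symmetric])
  also have "\<dots> \<le> exp (- (5 * ln N))"
  proof -
    have "8 * ln ?D * P \<le> \<eta> * ln N * P" by (rule mult_right_mono[OF L P0])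
    moreover have "40 * ln N \<le> \<eta> * P * ln N" by (rule mult_right_mono[OF P L0])
    ultimately show ?thesis by (simp add: mult_ac)
  qed
  also have "\<dots> = 1 / N^5"
  proof -
    have "exp (5 * ln N) = exp (ln N) ^ 5" using exp_of_nat_mult[of 5 "ln N"] by simp
    then show ?thesis using N by (simp add: exp_minus divide_inverse)
  qed
  finally show ?thesis .
qed

end

lemma integral_leb_translate:
  fixes F F' :: "point \<Rightarrow> real"
  assumes F: "integrable (leb q) (\<lambda>x. F (translate q c x))"
    and FR: "\<And>z. z \<in> Rn q \<Longrightarrow> F' z = F z"
  shows "(\<integral>z. F' z \<partial>leb q) = (\<integral>x. F (translate q c x) \<partial>leb q)"
proof -
  let ?T = "translate q (\<lambda>i. - c i)"
  have eq: "leb q = distr (leb q) (leb q) ?T"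
    using nn_integral_leb_translateanslate(2)[of "\<lambda>_. 0" q "\<lambda>i. - c i"] by (simp add: translate_def[abs_def])
  have T: "?T \<in> measurable (leb q) (leb q)" unfolding translate_def[abs_def] leb_def by measurable
  have "(\<integral>x. F (translate q c x) \<partial>leb q) = (\<integral>x. F (translate q c x) \<partial>distr (leb q) (leb q) ?T)"
    by (simp only: eq[symmetric])
  also have "\<dots> = (\<integral>z. F (translate q c (?T z)) \<partial>leb q)"
    by (rule integral_distr[OF T]) (rule borel_measurable_integrable[OF F])
  also have "\<dots> = (\<integral>z. F' z \<partial>leb q)"
  proof (rule Bochner_Integration.integral_cong[OF refl])
    fix z assume "z \<in> space (leb q)"
    then have z: "z \<in> Rn q" by (simp add: space_leb)
    then have "translate q c (?T z) = z" by (auto simp: translate_def Rn_def PiE_def extensional_def fun_eq_iff)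
    then show "F (translate q c (?T z)) = F' z" using FR[OF z] by simp
  qed
  finally show ?thesis by simp
qed

lemma two_pi_powr: "(2 * pi) powr (- real q / 2) = 1 / sqrt (2 * pi) ^ q"
proof -
  have "(2 * pi) powr (real q / 2) = sqrt (2 * pi) ^ q"
    by (simp add: powr_half_sqrt[symmetric] powr_realpow[symmetric] powr_powr)
  then show ?thesis by (simp add: powr_minus_divide)
qed

text \<open>The summands stand, in this order, for the Gaussian mean of R, its boundary terms, the
  summed variances of the partial derivatives and the squared mean gradient.\<close>

definition rate_const :: "real \<Rightarrow> real \<Rightarrow> real" where
  "rate_const \<eta> c = c / \<eta>^2 + (2 * c / \<eta> + 2 * c) * (4 / sqrt \<eta>) + 32 * c^2 / \<eta>^2
     + 8 / \<eta> * (2 * c / \<eta> + 8 * c / sqrt \<eta>)^2"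

text \<open>All requirements on the size of n are explicit inequalities, so that the constant in
  front of \<epsilon>^2 depends on \<open>\<eta>1\<close> and c alone and is uniform in n.\<close>

lemma laplace_integral_bound:
  fixes g :: "point \<Rightarrow> real" and \<zeta> p q n :: nat and \<delta> \<eta>1 \<eta>2 \<eta>3 \<eta>4 \<eta>5 \<eta>6 c3 c4 :: real
  defines "\<epsilon> \<equiv> real p * ln (real n) / sqrt (real n)"
    and "c \<equiv> \<bar>\<eta>3\<bar> + \<bar>\<eta>4\<bar> + \<bar>\<eta>5\<bar> + \<bar>\<eta>6\<bar>"
  assumes qp: "0 < q" "q \<le> p" and n: "3 \<le> n" and \<eta>: "0 < \<eta>1" and c34: "c3 \<le> 1" "c4 \<le> 1"
    and \<epsilon>: "\<epsilon> \<le> 1" "8 * c * \<epsilon> \<le> \<eta>1" "rate_const \<eta>1 c * \<epsilon>^2 \<le> 1" "2 * \<epsilon> \<le> \<delta>"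
    and big: "8 * ln (sqrt (2 * \<eta>2 / \<eta>1)) \<le> \<eta>1 * ln (real n)" "40 \<le> \<eta>1 * real p"
    and max: "is_arg_max g (\<lambda>z. z \<in> Rn q) z0"
    and int: "set_integrable (leb q) (Rn q - eball q z0 \<delta>) (\<lambda>z. exp (g z - g z0))"
    and T2: "times_differentiable_on 2 q g (eball q z0 \<delta>)"
    and hess: "\<And>z. z \<in> eball q z0 \<delta> \<Longrightarrow> eigs_within (\<eta>1 * real n) (- hessian q g z) (\<eta>2 * real n)"
    and T5: "times_differentiable_on \<zeta> q g (eball q z0 (sqrt 2 * gamma_rate p n))" "4 < \<zeta>"
    and d3: "\<And>l. l < q \<Longrightarrow> eigs_within (\<eta>3 * real n powr c3) (deriv_mat q g [l] z0) (\<eta>4 * real n powr c3)"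
    and d4: "\<And>z l m. z \<in> eball q z0 (sqrt 2 * gamma_rate p n) \<Longrightarrow> l < q \<Longrightarrow> m < q \<Longrightarrow>
        eigs_within (\<eta>5 * real n powr c4) (deriv_mat q g [l, m] z) (\<eta>6 * real n powr c4)"
  shows "0 < Determinant.det (- hessian q g z0)"
    and "\<bar>(\<integral>z. exp (g z - g z0) \<partial>leb q) * sqrt (Determinant.det (- hessian q g z0)) / sqrt (2 * pi) ^ q - 1\<bar>
      \<le> (2 * rate_const \<eta>1 c + 2) * \<epsilon>^2
        + (2 * pi) powr (- real q / 2) * sqrt (Determinant.det (- hessian q g z0))
          * (LINT z : Rn q - eball q z0 \<delta> | leb q. exp (g z - g z0))"
proof -
  let ?N = "real n" and ?P = "real p"
  let ?r = "gamma_rate p n"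
  let ?d = "Determinant.det (- hessian q g z0)"
  have N: "3 \<le> ?N" "0 < ?N" "1 \<le> ?N" using n by auto
  have L1: "1 \<le> ln ?N"
  proof -
    have "exp 1 \<le> ?N" using exp_le N by linarith
    then show ?thesis using N by (simp add: ln_ge_iff)
  qed
  have P: "1 \<le> ?P" using qp by simp
  have PL: "1 \<le> ?P * ln ?N" using mult_mono[of 1 ?P 1 "ln ?N"] P L1 by simp
  have r0: "0 < ?r" unfolding gamma_rate_def using PL N by simp
  have r\<rho>: "?r < sqrt 2 * ?r" using r0 by simp
  \<comment> \<open>As p ln n >= 1, the radius is at most \<epsilon>; the ball carrying the higher
    derivatives therefore lies in the \<delta>-ball.\<close>
  have \<rho>\<delta>: "sqrt 2 * ?r \<le> \<delta>"
  proof -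
    have "?P * ln ?N / ?N \<le> (?P * ln ?N)^2 / ?N"
      using PL N self_le_power[OF PL, of 2] by (intro divide_right_mono) auto
    then have "?r \<le> sqrt ((?P * ln ?N)^2 / ?N)" unfolding gamma_rate_def by (rule real_sqrt_le_mono)
    also have "\<dots> = \<epsilon>" using PL N by (simp add: real_sqrt_divide \<epsilon>_def)
    finally have "sqrt 2 * ?r \<le> 2 * \<epsilon>" using r0 sqrt2_less_2 by (intro mult_mono) auto
    then show ?thesis using \<epsilon>(4) by linarith
  qed
  \<comment> \<open>Exponents up to 1 make the third and fourth derivatives at most of order n, so
    one constant C = c n serves both.\<close>
  have C: "\<bar>a * ?N powr b\<bar> \<le> c * ?N" if "\<bar>a\<bar> \<le> c" "b \<le> 1" for a b
  proof -
    have "?N powr b \<le> ?N" using powr_mono[OF that(2) N(3)] N by simp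
    then have "\<bar>a\<bar> * ?N powr b \<le> c * ?N" using that by (intro mult_mono) auto
    then show ?thesis by (simp add: abs_mult)
  qed
  have c: "\<bar>\<eta>3\<bar> \<le> c" "\<bar>\<eta>4\<bar> \<le> c" "\<bar>\<eta>5\<bar> \<le> c" "\<bar>\<eta>6\<bar> \<le> c" "0 \<le> c" unfolding c_def by auto
  define G where "G z = indicator (Rn q - eball q z0 \<delta>) z * exp (g z - g z0)" for z
  have Gi: "integrable (leb q) G" using int unfolding set_integrable_def G_def by simp
  have T: "translate q z0 \<in> measurable (leb q) (leb q)" unfolding translate_def[abs_def] leb_def by measurable
  have eq: "leb q = distr (leb q) (leb q) (translate q z0)"
    using nn_integral_leb_translateanslate(2)[of "\<lambda>_. 0" q z0] by (simp add: translate_def[abs_def])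
  have GT: "G (translate q z0 x) = indicator {x. \<not> nrm q x < \<delta>} x * exp (g (translate q z0 x) - g z0)" for x
    unfolding G_def using translate_Rn[of q z0 x] edist_translate[of q z0 x] by (simp add: indicator_def eball_def)
  have GTi: "integrable (leb q) (\<lambda>x. G (translate q z0 x))"
  proof -
    have "integrable (distr (leb q) (leb q) (translate q z0)) G" using Gi by (simp only: eq[symmetric])
    then show ?thesis by (rule integrable_distr[OF T])
  qed
  obtain S R R1 R2 R3 R4 h1 h2 where
    "laplace_fn q ?r (sqrt 2 * ?r) (\<eta>1 * ?N) (\<eta>2 * ?N) (c * ?N) (\<lambda>a b. - partials [a, b] g z0) S R R1 R2 R3 R4 \<delta>
      (\<lambda>x. g (translate q z0 x) - g z0) h1 h2"
    by (rule laplace_fn_of_conditions[OF qp(1) r0 r\<rho> \<rho>\<delta> _ C[OF c(1) c34(1)] C[OF c(2) c34(1)] C[OF c(3) c34(2)] C[OF c(4) c34(2)]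
        max T2 T5 hess d3 d4 GTi[unfolded GT]]) (use N \<eta> in auto)
  then interpret laplace_fn q ?r "sqrt 2 * ?r" "\<eta>1 * ?N" "\<eta>2 * ?N" "c * ?N" "\<lambda>a b. - partials [a, b] g z0" S R R1 R2 R3 R4 \<delta>
      "\<lambda>x. g (translate q z0 x) - g z0" h1 h2 .
  have H: "- hessian q g z0 = mat q q (\<lambda>(a, b). - partials [a, b] g z0)"
    by (rule eq_matI) (auto simp: deriv_mat_def)
  show d0: "0 < ?d" using det_pos unfolding H .
  have Gd: "x / Gdet = x * sqrt ?d / sqrt (2 * pi) ^ q" for x unfolding Gdet_def H by simp
  have I: "(\<integral>z. exp (g z - g z0) \<partial>leb q) = (\<integral>x. exp (g (translate q z0 x) - g z0) \<partial>leb q)"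
    by (rule integral_leb_translate[OF exp_h_integrable]) simp
  have O: "(LINT z : Rn q - eball q z0 \<delta> | leb q. exp (g z - g z0))
      = (\<integral>x. indicator {x. \<not> nrm q x < \<delta>} x * exp (g (translate q z0 x) - g z0) \<partial>leb q)"
    unfolding GT[symmetric] set_lebesgue_integral_def using integral_leb_translate[OF GTi] by (simp add: G_def)
  have t: "trel \<le> 1 / ?N^5"
    by (rule trel_le[where P = ?P]) (use \<eta> N qp big in \<open>auto simp: gamma_rate_def\<close>)
  have t2: "trel \<le> 1 / 2"
  proof -
    have "2 \<le> ?N^5" using self_le_power[OF N(3), of 5] N(1) by linarith
    then have "1 / ?N^5 \<le> 1 / 2" using N by (intro divide_left_mono) auto
    then show ?thesis using t by linarith
  qed
  have "\<bar>(\<integral>x. exp (g (translate q z0 x) - g z0) \<partial>leb q) / Gdet - 1\<bar> \<le> (2 * rate_const \<eta>1 c + 2) * \<epsilon>^2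
     + (\<integral>x. indicator {x. \<not> nrm q x < \<delta>} x * exp (g (translate q z0 x) - g z0) \<partial>leb q) / Gdet"
    by (rule laplace_finite_rate[OF refl refl _ \<eta> c(5) N(3) L1 _ \<epsilon>_def[THEN meta_eq_to_obj_eq] \<epsilon>(1,2) t t2 rate_const_def \<epsilon>(3)])
      (use qp in \<open>auto simp: gamma_rate_def\<close>)
  then show "\<bar>(\<integral>z. exp (g z - g z0) \<partial>leb q) * sqrt ?d / sqrt (2 * pi) ^ q - 1\<bar>
      \<le> (2 * rate_const \<eta>1 c + 2) * \<epsilon>^2 + (2 * pi) powr (- real q / 2) * sqrt ?d
          * (LINT z : Rn q - eball q z0 \<delta> | leb q. exp (g z - g z0))"
    unfolding Gd I O two_pi_powr by (simp add: mult_ac)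
qed

text \<open>The dimension q is kept apart from p, in which the rate is measured, to cover the full
  parameter and the nuisance parameter alike. As \<epsilon>^2 \<le> e and e tends to 0, every
  smallness requirement at fixed n holds eventually.\<close>

theorem laplace_asymptotics:
  assumes lc: "laplace_conditions p q h zhat c3 c4 cinf \<zeta> e"
    and \<zeta>: "4 < \<zeta>" and c34: "c3 \<le> 1" "c4 \<le> 1"
    and q: "\<And>n. 0 < q n" "\<And>n. q n \<le> p n"
    and pinf: "filterlim (\<lambda>n. real (p n)) at_top sequentially"
    and e: "\<And>n. real (p n) ^ 2 * ln (real n) ^ 2 / real n \<le> e n"
  shows "\<forall>\<^sub>F n in sequentially. 0 < Determinant.det (- hessian (q n) (h n) (zhat n))"
    and "(\<lambda>n. (\<integral>z. exp (h n z - h n (zhat n)) \<partial>leb (q n)) * sqrt (Determinant.det (- hessian (q n) (h n) (zhat n)))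
        / sqrt (2 * pi) ^ q n - 1) \<in> O(e)"
proof -
  let ?det = "\<lambda>n. Determinant.det (- hessian (q n) (h n) (zhat n))"
  from lc obtain \<delta> \<eta>1 \<eta>2 \<eta>3 \<eta>4 \<eta>5 \<eta>6 :: real where
    pos: "0 < \<delta>" "0 < \<eta>1" "0 < \<eta>2" and e0: "e \<longlonglongrightarrow> 0"
    and max: "\<forall>\<^sub>F n in sequentially. is_arg_max (h n) (\<lambda>z. z \<in> Rn (q n)) (zhat n)"
    and int: "\<forall>\<^sub>F n in sequentially.
         set_integrable (leb (q n)) (Rn (q n) - eball (q n) (zhat n) \<delta>)
           (\<lambda>z. exp (h n z - h n (zhat n)))"
    and out: "(\<lambda>n. (2 * pi) powr (- real (q n) / 2) * sqrt (?det n)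
           * (LINT z : Rn (q n) - eball (q n) (zhat n) \<delta> | leb (q n).
                exp (h n z - h n (zhat n)))) \<in> O(e)"
    and hess: "\<forall>\<^sub>F n in sequentially.
         times_differentiable_on 2 (q n) (h n) (eball (q n) (zhat n) \<delta>) \<and>
         (\<forall>z\<in>eball (q n) (zhat n) \<delta>.
            eigs_within (\<eta>1 * real n) (- hessian (q n) (h n) z) (\<eta>2 * real n))"
    and T5: "\<forall>\<^sub>F n in sequentially.
         times_differentiable_on \<zeta> (q n) (h n)
           (eball (q n) (zhat n) (sqrt 2 * gamma_rate (p n) n))"
    and d3: "\<forall>\<^sub>F n in sequentially. \<forall>l<q n.
         eigs_within (\<eta>3 * real n powr c3) (deriv_mat (q n) (h n) [l] (zhat n))
           (\<eta>4 * real n powr c3)"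
    and d4: "\<forall>\<^sub>F n in sequentially. \<forall>z\<in>eball (q n) (zhat n) (sqrt 2 * gamma_rate (p n) n).
         \<forall>l<q n. \<forall>m<q n.
           eigs_within (\<eta>5 * real n powr c4) (deriv_mat (q n) (h n) [l, m] z)
             (\<eta>6 * real n powr c4)"
    unfolding laplace_conditions_def by blast
  define c where "c = \<bar>\<eta>3\<bar> + \<bar>\<eta>4\<bar> + \<bar>\<eta>5\<bar> + \<bar>\<eta>6\<bar>"
  define K where "K = rate_const \<eta>1 c"
  define \<epsilon> where "\<epsilon> n = real (p n) * ln (real n) / sqrt (real n)" for n
  have \<epsilon>e: "\<epsilon> n ^ 2 \<le> e n" for n
    using e[of n] by (simp add: \<epsilon>_def power_divide power_mult_distrib)
  have \<epsilon>0: "\<epsilon> \<longlonglongrightarrow> 0"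
  proof -
    have "\<bar>\<epsilon> n\<bar> \<le> sqrt (e n)" for n using real_sqrt_le_mono[OF \<epsilon>e[of n]] by simp
    then have "\<forall>\<^sub>F n in sequentially. norm (\<epsilon> n) \<le> sqrt (e n)" by simp
    moreover have "(\<lambda>n. sqrt (e n)) \<longlonglongrightarrow> 0" using tendsto_real_sqrt[OF e0] by simp
    ultimately show ?thesis by (rule Lim_null_comparison)
  qed
  have small: "\<forall>\<^sub>F n in sequentially. a * \<epsilon> n < b" "\<forall>\<^sub>F n in sequentially. a * \<epsilon> n ^ 2 < b" if "0 < b" for a b
  proof -
    have "(\<lambda>n. a * \<epsilon> n) \<longlonglongrightarrow> 0" "(\<lambda>n. a * \<epsilon> n ^ 2) \<longlonglongrightarrow> 0"
      using tendsto_mult_left[OF \<epsilon>0, of a] tendsto_mult_left[OF tendsto_power[OF \<epsilon>0, of 2], of a] by simp_all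
    then show "\<forall>\<^sub>F n in sequentially. a * \<epsilon> n < b" "\<forall>\<^sub>F n in sequentially. a * \<epsilon> n ^ 2 < b"
      using that by (auto intro: order_tendstoD(2))
  qed
  have lninf: "\<forall>\<^sub>F n in sequentially. b / \<eta>1 \<le> ln (real n)" for b
    using filterlim_compose[OF ln_at_top filterlim_real_sequentially] by (simp add: filterlim_at_top)
  have pbig: "\<forall>\<^sub>F n in sequentially. 40 / \<eta>1 \<le> real (p n)" using pinf by (simp add: filterlim_at_top)
  have small': "\<forall>\<^sub>F n in sequentially. \<epsilon> n < 1" "\<forall>\<^sub>F n in sequentially. 8 * c * \<epsilon> n < \<eta>1"
    "\<forall>\<^sub>F n in sequentially. 2 * \<epsilon> n < \<delta>" "\<forall>\<^sub>F n in sequentially. K * \<epsilon> n ^ 2 < 1"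
    using small(1)[where a = 1 and b = 1] small(1)[where a = "8 * c" and b = \<eta>1] small(1)[where a = 2 and b = \<delta>]
      small(2)[where a = K and b = 1] pos by simp_all
  have main: "\<forall>\<^sub>F n in sequentially. 0 < ?det n \<and>
    \<bar>(\<integral>z. exp (h n z - h n (zhat n)) \<partial>leb (q n)) * sqrt (?det n) / sqrt (2 * pi) ^ q n - 1\<bar>
      \<le> (2 * K + 2) * \<epsilon> n ^ 2 + (2 * pi) powr (- real (q n) / 2) * sqrt (?det n)
           * (LINT z : Rn (q n) - eball (q n) (zhat n) \<delta> | leb (q n). exp (h n z - h n (zhat n)))"
    using max int hess T5 d3 d4 small' lninf[of "8 * ln (sqrt (2 * \<eta>2 / \<eta>1))"] pbig eventually_ge_at_top[of 3]
  proof eventually_elim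
    case (elim n)
    have b: "8 * ln (sqrt (2 * \<eta>2 / \<eta>1)) \<le> \<eta>1 * ln (real n)" "40 \<le> \<eta>1 * real (p n)"
      using elim pos(2) by (simp_all add: divide_le_eq mult.commute)
    show ?case unfolding K_def c_def \<epsilon>_def
      by (intro conjI laplace_integral_bound[where p = "p n" and \<delta> = \<delta> and \<zeta> = \<zeta> and ?c3.0 = c3 and ?c4.0 = c4 and ?\<eta>2.0 = \<eta>2,
          OF q(1) q(2) _ pos(2) c34 _ _ _ _ b])
        (use elim \<zeta> in \<open>auto simp: K_def c_def \<epsilon>_def\<close>)
  qed
  then show "\<forall>\<^sub>F n in sequentially. 0 < ?det n" by eventually_elim auto
  have "(\<lambda>n. (2 * K + 2) * \<epsilon> n ^ 2) \<in> O(e)"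
  proof (rule bigoI[where c = "\<bar>2 * K + 2\<bar>"])
    show "\<forall>\<^sub>F n in sequentially. norm ((2 * K + 2) * \<epsilon> n ^ 2) \<le> \<bar>2 * K + 2\<bar> * norm (e n)"
    proof (rule always_eventually, rule allI)
      fix n
      have "\<epsilon> n ^ 2 \<le> \<bar>e n\<bar>" using \<epsilon>e[of n] by linarith
      then show "norm ((2 * K + 2) * \<epsilon> n ^ 2) \<le> \<bar>2 * K + 2\<bar> * norm (e n)"
        by (simp add: abs_mult mult_left_mono)
    qed
  qed
  from sum_in_bigo(1)[OF this out]
  show "(\<lambda>n. (\<integral>z. exp (h n z - h n (zhat n)) \<partial>leb (q n)) * sqrt (?det n) / sqrt (2 * pi) ^ q n - 1) \<in> O(e)"
    by (rule landau_o.big_trans[rotated], intro bigoI[where c = 1]) (use main in \<open>eventually_elim, auto\<close>)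
qed

subsection \<open>The marginal posterior density\<close>

text \<open>Fixing the interest parameter shifts coordinate indices by one. This identifies the
  Hessian of the restricted function with the nuisance block.\<close>

lemma partials_case_nat:
  "partials js (\<lambda>l. g (case_nat \<psi> l)) l = partials (map Suc js) g (case_nat \<psi> l)"
proof (induction js arbitrary: l)
  case (Cons a js)
  have upd: "case_nat \<psi> (l(a := t)) = (case_nat \<psi> l)(Suc a := t)" for t
    by (auto simp: fun_eq_iff split: nat.split)
  have "partials (a # js) (\<lambda>l. g (case_nat \<psi> l)) l
      = deriv (\<lambda>t. partials js (\<lambda>l. g (case_nat \<psi> l)) (l(a := t))) (l a)"
    by (simp add: partials_def partial_def)
  also have "\<dots> = deriv (\<lambda>t. partials (map Suc js) g ((case_nat \<psi> l)(Suc a := t))) (l a)"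
    by (simp only: Cons.IH upd)
  finally show ?case by (simp add: partials_def partial_def)
qed (simp add: partials_def)

lemma hessian_case_nat:
  "hessian (q - 1) (\<lambda>l. g (case_nat \<psi> l)) l = nuisance_hessian q g (case_nat \<psi> l)"
  by (simp add: deriv_mat_def nuisance_hessian_def partials_case_nat)

lemma coordinate_le_edist: "i < q \<Longrightarrow> \<bar>x i - y i\<bar> \<le> edist q x y"
  using member_le_L2_set[of "{..<q}" i "\<lambda>i. \<bar>x i - y i\<bar>"] by (simp add: edist_def L2_set_def)

text \<open>Shifting the interest parameter by the largest order allowed moves the parameter by at least
  that much, so the bound on the constrained maximizer forces the dimension to grow at least
  like \<open>ln n\<close>.\<close>

lemma dimension_at_top:
  assumes dim: "\<And>n. 0 < p n"
    and c: "\<And>\<psi>. near (\<lambda>n. \<theta>hat n 0) \<psi> \<Longrightarrow>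
        (\<lambda>n. edist (p n) (\<theta>hat n) (case_nat (\<psi> n) (lhat n (\<psi> n)))) \<in> O(\<lambda>n. sqrt (real (p n) / real n))"
  shows "filterlim (\<lambda>n. real (p n)) at_top sequentially"
proof -
  define \<psi> where "\<psi> n = \<theta>hat n 0 + sqrt (ln (real n)) / sqrt (real n)" for n
  have "near (\<lambda>n. \<theta>hat n 0) \<psi>" unfolding near_def \<psi>_def
    by (intro bigoI[where c = 1] always_eventually) simp
  from c[OF this] obtain K where K: "0 < K"
    "\<forall>\<^sub>F n in sequentially. norm (edist (p n) (\<theta>hat n) (case_nat (\<psi> n) (lhat n (\<psi> n)))) \<le> K * norm (sqrt (real (p n) / real n))"
    by (rule landau_o.bigE)
  have "\<forall>\<^sub>F n in sequentially. ln (real n) / K^2 \<le> real (p n)"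
    using K(2) eventually_gt_at_top[of 0]
  proof eventually_elim
    case (elim n)
    have l0: "0 \<le> ln (real n)" using elim by simp
    have "\<bar>\<theta>hat n 0 - case_nat (\<psi> n) (lhat n (\<psi> n)) 0\<bar> = sqrt (ln (real n) / real n)"
      using l0 by (simp add: \<psi>_def real_sqrt_divide)
    then have "sqrt (ln (real n) / real n) \<le> K * sqrt (real (p n) / real n)"
      using coordinate_le_edist[OF dim, of "\<theta>hat n" "case_nat (\<psi> n) (lhat n (\<psi> n))" n] elim by simp
    then have "(sqrt (ln (real n) / real n))^2 \<le> (K * sqrt (real (p n) / real n))^2"
      using l0 by (intro power_mono) auto
    then have "ln (real n) / real n \<le> K^2 * real (p n) / real n"
      using l0 by (simp add: power_mult_distrib)
    then have "ln (real n) \<le> K^2 * real (p n)" using elim by (simp add: divide_le_cancel)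
    then show ?case using K(1) by (simp add: divide_le_eq mult.commute)
  qed
  moreover have "filterlim (\<lambda>n. ln (real n) / K^2) at_top sequentially"
  proof -
    have "filterlim (\<lambda>n. 1 / K^2 * ln (real n)) at_top sequentially"
      using filterlim_compose[OF ln_at_top filterlim_real_sequentially] K(1)
      by (intro filterlim_tendsto_pos_mult_at_top[OF tendsto_const]) auto
    then show ?thesis by simp
  qed
  ultimately show ?thesis by (rule filterlim_at_top_mono[rotated])
qed

text \<open>Since e tends to 0, eventually v >= 1/2, and the division costs a factor 2.\<close>

lemma ratio_in_bigo:
  fixes u v e :: "nat \<Rightarrow> real"
  assumes u: "(\<lambda>n. u n - 1) \<in> O(e)" and v: "(\<lambda>n. v n - 1) \<in> O(e)" and e: "e \<longlonglongrightarrow> 0"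
  shows "(\<lambda>n. u n / v n - 1) \<in> O(e)"
proof -
  have "(\<lambda>n. v n - 1) \<longlonglongrightarrow> 0"
    using smalloD_tendsto[OF landau_o.big_small_trans[OF v smalloI_tendsto[of e "\<lambda>_. 1"]]] e by simp
  then have "\<forall>\<^sub>F n in sequentially. \<bar>v n - 1\<bar> < 1 / 2"
    using tendstoD[of "\<lambda>n. v n - 1" 0 sequentially "1/2"] by (simp only: dist_real_def diff_0_right)
  then have "\<forall>\<^sub>F n in sequentially. norm (u n / v n - 1) \<le> 2 * norm ((u n - 1) - (v n - 1))"
  proof eventually_elim
    case (elim n)
    then have v: "1 / 2 \<le> v n" by linarith
    then have "u n / v n - 1 = (u n - v n) / v n" by (simp add: diff_divide_distrib)
    moreover have "\<bar>u n - v n\<bar> / v n \<le> \<bar>u n - v n\<bar> / (1 / 2)" using v by (intro divide_left_mono) auto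
    ultimately show ?case using v by simp
  qed
  then have "(\<lambda>n. u n / v n - 1) \<in> O(\<lambda>n. (u n - 1) - (v n - 1))" by (rule bigoI)
  then show ?thesis using sum_in_bigo(2)[OF u v] by (rule landau_o.big_trans)
qed

text \<open>The values of g at the two maximizers and the determinants cancel against those in the
  Laplace formula; the two powers of sqrt (2 pi) differ by the one factor in its
  denominator.\<close>

lemma marginal_ratio:
  fixes g :: "point \<Rightarrow> real" and t l :: point and \<psi> :: real and p :: nat
  defines "d \<equiv> Determinant.det (- hessian p g t)"
    and "d' \<equiv> Determinant.det (- nuisance_hessian p g (case_nat \<psi> l))"
  assumes p: "0 < p" and d: "0 < d" "0 < d'"
  shows "marginal_post p g \<psi> / laplace_marginal_post p g t l \<psi> =
    ((\<integral>z. exp (g (case_nat \<psi> z) - g (case_nat \<psi> l)) \<partial>leb (p - 1)) * sqrt d' / sqrt (2 * pi) ^ (p - 1))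
      / ((\<integral>z. exp (g z - g t) \<partial>leb p) * sqrt d / sqrt (2 * pi) ^ p)"
proof -
  have e: "exp (x - y) = exp x * exp (- y)" for x y :: real by (simp add: exp_diff exp_minus divide_inverse)
  have s: "sqrt (2 * pi) ^ p = sqrt (2 * pi) * sqrt (2 * pi) ^ (p - 1)"
    using p by (simp add: power_eq_if)
  define N where "N = (\<integral>z. exp (g (case_nat \<psi> z)) \<partial>leb (p - 1))"
  define Z where "Z = (\<integral>z. exp (g z) \<partial>leb p)"
  define w where "w = sqrt (2 * pi) ^ (p - 1)"
  have w: "0 < w" by (simp add: w_def)
  show ?thesis
    unfolding marginal_post_def laplace_marginal_post_def e s d_def[symmetric] d'_def[symmetric]
    using d w by (simp add: N_def[symmetric] Z_def[symmetric] w_def[symmetric] exp_minus field_simps)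
qed

theorem theorem4p1:
  fixes p :: "nat \<Rightarrow> nat" and \<zeta> :: nat and c3 c4 cinf \<alpha> :: real
    and N :: "'x measure" and I :: "nat \<Rightarrow> nat set"
    and \<Omega> :: "'w measure" and Y :: "nat \<Rightarrow> 'w \<Rightarrow> 'x" and \<omega> :: 'w
    and \<mu> :: "nat \<Rightarrow> (nat \<Rightarrow> 'x) measure"
    and f :: "nat \<Rightarrow> point \<Rightarrow> (nat \<Rightarrow> 'x) \<Rightarrow> real"
    and \<pi> :: "nat \<Rightarrow> point \<Rightarrow> real"
    and X :: "nat \<Rightarrow> nat \<Rightarrow> 'x" and g :: "nat \<Rightarrow> point \<Rightarrow> real"
    and \<theta>0 :: "nat \<Rightarrow> point" and \<theta>hat :: "nat \<Rightarrow> point" and lhat :: "nat \<Rightarrow> real \<Rightarrow> point"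
  assumes dim: "\<And>n. 2 \<le> p n"
    and model: "\<And>n. sets (\<mu> n) = sets (\<Pi>\<^sub>M i\<in>I n. N)"
      "\<And>n. dominated_model (p n) (\<mu> n) (f n)"
    and orthogonal: "\<And>n. orthogonal_parametrization (p n) (\<mu> n) (f n)"
      "\<And>n. independent_prior (p n) (\<pi> n)"
    and truth: "prob_space \<Omega>" "\<And>i. Y i \<in> measurable \<Omega> N" "\<And>n. \<theta>0 n \<in> Rn (p n)"
      "\<And>n. distr \<Omega> (\<Pi>\<^sub>M i\<in>I n. N) (\<lambda>w. \<lambda>i\<in>I n. Y i w) = sampling_dist (\<mu> n) (f n) (\<theta>0 n)"
    and data: "\<omega> \<in> space \<Omega>" "X = (\<lambda>n. \<lambda>i\<in>I n. Y i \<omega>)"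
      "\<And>n \<theta>. \<theta> \<in> Rn (p n) \<Longrightarrow> 0 < f n \<theta> (X n)"
    and g: "g = (\<lambda>n. log_post (\<pi> n) (f n) (X n))"
    and constants: "4 < \<zeta>" "c3 \<le> 1" "c4 \<le> 1" "0 \<le> cinf" "cinf \<le> 1 / 2"
    and growth: "(\<lambda>n. real (p n)) \<in> O(\<lambda>n. real n powr \<alpha>)" "\<alpha> < 1 / 2 - 1 / (2 * real \<zeta> - 2)"
    and a: "laplace_conditions p p g \<theta>hat c3 c4 cinf \<zeta> (error_rate p c3 \<zeta>)"
    and b: "\<And>\<psi>. near (\<lambda>n. \<theta>hat n 0) \<psi> \<Longrightarrow>
        laplace_conditions p (\<lambda>n. p n - 1) (\<lambda>n l. g n (case_nat (\<psi> n) l))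
          (\<lambda>n. lhat n (\<psi> n)) c3 c4 cinf \<zeta> (error_rate p c3 \<zeta>)"
    and c: "(\<lambda>n. edist (p n) (\<theta>hat n) (\<theta>0 n)) \<in> O(\<lambda>n. sqrt (real (p n) / real n))"
      "\<And>\<psi>. near (\<lambda>n. \<theta>hat n 0) \<psi> \<Longrightarrow>
        (\<lambda>n. edist (p n) (\<theta>hat n) (case_nat (\<psi> n) (lhat n (\<psi> n))))
          \<in> O(\<lambda>n. sqrt (real (p n) / real n))"
      "\<exists>K. \<forall>\<^sub>F n in sequentially. \<forall>j\<in>{1..<p n}.
        \<bar>partials [0, j] (g n) (\<theta>0 n)\<bar> \<le> K * sqrt (real n)"
  shows "\<And>\<psi>. near (\<lambda>n. \<theta>hat n 0) \<psi> \<Longrightarrow>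
    (\<lambda>n. marginal_post (p n) (g n) (\<psi> n)
          / laplace_marginal_post (p n) (g n) (\<theta>hat n) (lhat n (\<psi> n)) (\<psi> n) - 1)
      \<in> O(error_rate p c3 \<zeta>)"
proof -
  fix \<psi> assume \<psi>: "near (\<lambda>n. \<theta>hat n 0) \<psi>"
  have p: "0 < p n" "0 < p n - 1" "p n - 1 \<le> p n" for n using dim[of n] by auto
  have pinf: "filterlim (\<lambda>n. real (p n)) at_top sequentially" by (rule dimension_at_top[OF p(1) c(2)])
  \<comment> \<open>The first of the three terms in the maximum.\<close>
  have e: "real (p n) ^ 2 * ln (real n) ^ 2 / real n \<le> error_rate p c3 \<zeta> n" for n
    unfolding error_rate_def by (rule Max_ge) auto
  have e0: "error_rate p c3 \<zeta> \<longlonglongrightarrow> 0" using a unfolding laplace_conditions_def by blast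
  note full = laplace_asymptotics[OF a constants(1-3) p(1) order_refl pinf e]
  note nuis = laplace_asymptotics[OF b[OF \<psi>] constants(1-3) p(2,3) pinf e, unfolded hessian_case_nat]
  have "\<forall>\<^sub>F n in sequentially. marginal_post (p n) (g n) (\<psi> n)
          / laplace_marginal_post (p n) (g n) (\<theta>hat n) (lhat n (\<psi> n)) (\<psi> n) - 1 =
      ((\<integral>z. exp (g n (case_nat (\<psi> n) z) - g n (case_nat (\<psi> n) (lhat n (\<psi> n)))) \<partial>leb (p n - 1))
          * sqrt (Determinant.det (- nuisance_hessian (p n) (g n) (case_nat (\<psi> n) (lhat n (\<psi> n))))) / sqrt (2 * pi) ^ (p n - 1))
      / ((\<integral>z. exp (g n z - g n (\<theta>hat n)) \<partial>leb (p n)) * sqrt (Determinant.det (- hessian (p n) (g n) (\<theta>hat n))) / sqrt (2 * pi) ^ p n) - 1"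
    using full(1) nuis(1) by eventually_elim (simp only: marginal_ratio[OF p(1)])
  then show "(\<lambda>n. marginal_post (p n) (g n) (\<psi> n)
          / laplace_marginal_post (p n) (g n) (\<theta>hat n) (lhat n (\<psi> n)) (\<psi> n) - 1)
      \<in> O(error_rate p c3 \<zeta>)"
    by (rule landau_o.big.in_cong[THEN iffD2]) (rule ratio_in_bigo[OF nuis(2) full(2) e0])
qed

end
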